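(* Let $\Omega\subset\mathbb{R}^n$ be a bounded, smooth, uniformly (strictly) convex domain with diameter $d$, let $V:\bar\Omega\to\mathbb{R}$ be a smooth convex function, and let $\tilde V\in C^1([-\tfrac d2,\tfrac d2])$ be an even function satisfying $$\big[\nabla V(y)-\nabla V(x)\big]\cdot\frac{y-x}{|y-x|}\ \ge\ 2\tilde V'\Big(\frac{|y-x|}{2}\Big)\qquad\text{for all }x\neq y\in\Omega.$$ Then $\lambda_2-\lambda_1\ \ge\ \tilde\lambda_2-\tilde\lambda_1$.
   Context: $\lambda_1<\lambda_2$ are the first two Dirichlet eigenvalues of $-\Delta+V$ on $\Omega$ (i.e. of $-\Delta u+Vu=\lambda u$ in $\Omega$, $u=0$ on $\partial\Omega$). $\tilde\lambda_1<\tilde\lambda_2$ are the first two eigenvalues of the one-dimensional problem $-\tilde u''+\tilde V\tilde u=\tilde\lambda\tilde u$ on $(-\tfrac d2,\tfrac d2)$, $\tilde u(\pm\tfrac d2)=0$. *)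

theory Defs
  imports "HOL-Analysis.Analysis"
begin

fun iter_dd :: "'a::real_normed_vector list \<Rightarrow> ('a \<Rightarrow> real) \<Rightarrow> 'a \<Rightarrow> real" where
  "iter_dd [] f = f"
| "iter_dd (v # vs) f = (\<lambda>x. deriv (\<lambda>t. iter_dd vs f (x + t *\<^sub>R v)) 0)"

definition Ck_on :: "nat \<Rightarrow> 'a::real_normed_vector set \<Rightarrow> ('a \<Rightarrow> real) \<Rightarrow> bool" where
  "Ck_on k S f \<longleftrightarrow> open S \<and>
     (\<forall>vs. length vs \<le> k \<longrightarrow> continuous_on S (iter_dd vs f) \<and>
        (length vs < k \<longrightarrow> (\<forall>v. \<forall>x\<in>S. (\<lambda>t. iter_dd vs f (x + t *\<^sub>R v)) differentiable (at 0))))"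

definition C_inf_on :: "'a::real_normed_vector set \<Rightarrow> ('a \<Rightarrow> real) \<Rightarrow> bool" where
  "C_inf_on S f \<longleftrightarrow> (\<forall>k. Ck_on k S f)"

definition smooth_on_closed :: "'a::real_normed_vector set \<Rightarrow> ('a \<Rightarrow> real) \<Rightarrow> bool" where
  "smooth_on_closed K f \<longleftrightarrow> (\<exists>U. open U \<and> K \<subseteq> U \<and> C_inf_on U f)"

definition grad :: "('a::euclidean_space \<Rightarrow> real) \<Rightarrow> 'a \<Rightarrow> 'a" where
  "grad f x = (\<Sum>b\<in>Basis. iter_dd [b] f x *\<^sub>R b)"

definition laplacian :: "('a::euclidean_space \<Rightarrow> real) \<Rightarrow> 'a \<Rightarrow> real" where
  "laplacian u x = (\<Sum>b\<in>Basis. iter_dd [b, b] u x)"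

text \<open>Bounded smooth uniformly (strictly) convex domain: given by a smooth defining function
  rho with nonvanishing gradient on the boundary whose Hessian is positive definite on the
  tangent space at every boundary point (boundary compact, hence uniformly).\<close>
definition smooth_uniformly_convex_domain :: "'a::euclidean_space set \<Rightarrow> bool" where
  "smooth_uniformly_convex_domain \<Omega> \<longleftrightarrow>
     open \<Omega> \<and> bounded \<Omega> \<and> \<Omega> \<noteq> {} \<and> convex \<Omega> \<and>
     (\<exists>\<rho> U. open U \<and> closure \<Omega> \<subseteq> U \<and> C_inf_on U \<rho> \<and>
        \<Omega> = {x\<in>U. \<rho> x < 0} \<and> frontier \<Omega> = {x\<in>U. \<rho> x = 0} \<and>
        (\<forall>x\<in>frontier \<Omega>. grad \<rho> x \<noteq> 0 \<and>
           (\<forall>\<xi>. \<xi> \<noteq> 0 \<and> grad \<rho> x \<bullet> \<xi> = 0 \<longrightarrow> iter_dd [\<xi>, \<xi>] \<rho> x > 0)))"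

definition dirichlet_eigenvalue :: "'a::euclidean_space set \<Rightarrow> ('a \<Rightarrow> real) \<Rightarrow> real \<Rightarrow> bool" where
  "dirichlet_eigenvalue \<Omega> V lam \<longleftrightarrow>
     (\<exists>u. Ck_on 2 \<Omega> u \<and> continuous_on (closure \<Omega>) u \<and>
          (\<forall>x\<in>frontier \<Omega>. u x = 0) \<and> (\<exists>x\<in>\<Omega>. u x \<noteq> 0) \<and>
          (\<forall>x\<in>\<Omega>. - laplacian u x + V x * u x = lam * u x))"

definition first_two_dirichlet_eigenvalues ::
  "'a::euclidean_space set \<Rightarrow> ('a \<Rightarrow> real) \<Rightarrow> real \<Rightarrow> real \<Rightarrow> bool" where
  "first_two_dirichlet_eigenvalues \<Omega> V l1 l2 \<longleftrightarrow>
     dirichlet_eigenvalue \<Omega> V l1 \<and> (\<forall>\<mu>. dirichlet_eigenvalue \<Omega> V \<mu> \<longrightarrow> l1 \<le> \<mu>) \<and>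
     l1 < l2 \<and> dirichlet_eigenvalue \<Omega> V l2 \<and>
     (\<forall>\<mu>. dirichlet_eigenvalue \<Omega> V \<mu> \<and> l1 < \<mu> \<longrightarrow> l2 \<le> \<mu>)"

end

theory Submission
  imports Defs "HOL-Library.Diagonal_Subsequence"
begin

text \<open>
  The argument follows Andrews and Clutterbuck, with elliptic maximum principles in place of
  parabolic ones. Perturb \<open>V\<close> to \<open>V + \<delta> |x|\<^sup>2\<close>, let \<open>u\<close> be the positive ground state and \<open>f = ln u\<close>.
  Korevaar's argument shows that \<open>f\<close> is concave, and a four-point maximum principle sharpens this to
  \<open>(\<nabla>f(y) - \<nabla>f(x)) \<bullet> (y - x) \<le> 2 (ln \<phi>)'(|y - x|/2) |y - x|\<close>, where \<open>\<phi>\<close> is the even solution of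
  the one-dimensional equation at an energy slightly below its first eigenvalue. If \<open>u\<^sub>2\<close> is an
  eigenfunction for the second eigenvalue, then \<open>v = u\<^sub>2 / u\<close> satisfies
  \<open>\<Delta>v + 2 \<nabla>f \<bullet> \<nabla>v = - \<gamma> v\<close> with \<open>\<gamma>\<close> tending to the gap as \<open>\<delta> \<rightarrow> 0\<close>; comparing \<open>v(y) - v(x)\<close> with
  \<open>C w(|y - x|/2)\<close>, where \<open>w\<close> is a quotient of one-dimensional solutions, bounds \<open>\<gamma>\<close> from below.

  Regularity up to the boundary is never used. Maxima are kept inside by the penalty \<open>\<epsilon> ln u\<close>, and
  \<open>v\<close> is bounded by barriers built from the defining function. The ground state itself is a
  limit of ground states of finite-difference operators, compactness coming from a
  discrete gradient estimate of Brandt.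
\<close>

section \<open>Second-order calculus and maxima\<close>

text \<open>Three obstacles shape the details. First, every maximum principle here ends in a
  contradiction between a second-order inequality and the potential, so convexity and the modulus of
  the potential must be strict; the quadratic perturbation supplies this and moves the lowest
  eigenvalue by at most \<open>delta R^2\<close>. Second, the one-dimensional ground state vanishes
  at the ends, where its logarithmic derivative is infinite. Taking both one-dimensional solutions
  at energies slightly below the eigenvalues, and adding a small even part to the odd one, keeps
  \<open>phi\<close> and \<open>w\<close> positive up to the ends, at the price of an error that is
  sent to zero. Third, an eigenvalue is defined only by a classical eigenfunction, without
  orthogonality or sign. A positive ground state is therefore constructed, its eigenvalue is located
  by comparison of quotients, and the change of sign of \<open>u2 / u\<close> is replaced by a
  maximum principle. The eigenfunction \<open>u2\<close> belongs to the unperturbed operator, so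
  only the ground state of the perturbed operator enters.\<close>

lemma has_derivative_of_continuous_partials:
 fixes f :: "'a::euclidean_space \<Rightarrow> real"
 assumes S: "open S" "x \<in> S"
  and p: "\<And>b y. b \<in> Basis ==> y \<in> S ==> ((\<lambda>t. f (y + t *\<^sub>R b)) has_real_derivative p b y) (at 0)"
  and c: "\<And>b. b \<in> Basis ==> isCont (p b) x"
 shows "(f has_derivative (\<lambda>v. \<Sum>b\<in>Basis. p b x * (v \<bullet> b))) (at x)"
proof -
 have sum_le: "norm (\<Sum>b\<in>B. q b *\<^sub>R b) <= real DIM('a) * norm v"
  if "B \<subseteq> Basis" "\<And>b. b \<in> B ==> \<bar>q b\<bar> <= norm v" for B and q :: "'a \<Rightarrow> real" and v :: 'a
 proof -
  have "norm (\<Sum>b\<in>B. q b *\<^sub>R b) <= (\<Sum>b\<in>B. norm (q b *\<^sub>R b))" by (rule norm_sum)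
  also have "\<dots> <= (\<Sum>b\<in>B. norm v)" using that by (intro sum_mono) (auto simp: subset_iff)
  also have "\<dots> <= real DIM('a) * norm v" using that(1)
   by (simp add: card_mono mult_right_mono)
  finally show ?thesis .
 qed
 \<comment> \<open>The set \<open>B\<close> holds the coordinates already moved. Adding one
   coordinate costs a mean value estimate on a segment parallel to a basis vector, where the partial
   derivative is close to its value at \<open>x\<close>.\<close>
 have "\<forall>e>0. \<exists>d>0. \<forall>v. norm v < d -->
   \<bar>f (x + (\<Sum>b\<in>B. (v \<bullet> b) *\<^sub>R b)) - f x - (\<Sum>b\<in>B. p b x * (v \<bullet> b))\<bar> <= e * norm v"
  if "B \<subseteq> Basis" for B
  using finite_subset[OF that finite_Basis] that
 proof (induction B rule: finite_induct)
  case empty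
  show ?case by (auto intro: exI[of _ 1])
 next
  case (insert a B)
  show ?case
  proof (intro allI impI)
   fix e :: real assume e: "e > 0"
   obtain d1 where d1: "d1 > 0" "\<And>v. norm v < d1 ==>
    \<bar>f (x + (\<Sum>b\<in>B. (v \<bullet> b) *\<^sub>R b)) - f x - (\<Sum>b\<in>B. p b x * (v \<bullet> b))\<bar> <= (e/2) * norm v"
    using insert.IH insert.prems e by (meson half_gt_zero insert_subset)
   have aB: "a \<in> Basis" using insert.prems by auto
   obtain r where r: "r > 0" "ball x r \<subseteq> S" using S open_contains_ball by blast
   obtain s where s: "s > 0" "\<And>y. dist y x < s ==> dist (p a y) (p a x) < e/2"
    using c[OF aB] e unfolding continuous_at_eps_delta by (meson half_gt_zero)
   \<comment> \<open>A vector that keeps only some coordinates of \<open>v\<close> is bounded,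
     crudely, by \<open>DIM\<close> times \<open>norm v\<close>, so this radius keeps the whole
     segment inside \<open>S\<close> and inside the continuity radius of \<open>p a\<close>.\<close>
   define d where "d = min d1 (min r s / (real DIM('a)))"
   have d0: "d > 0" using d1 r s by (auto simp: d_def)
   show "\<exists>d>0. \<forall>v. norm v < d -->
     \<bar>f (x + (\<Sum>b\<in>insert a B. (v \<bullet> b) *\<^sub>R b)) - f x - (\<Sum>b\<in>insert a B. p b x * (v \<bullet> b))\<bar> <= e * norm v"
   proof (intro exI[of _ d] conjI allI impI)
    fix v :: 'a assume v: "norm v < d"
    define y where "y = x + (\<Sum>b\<in>B. (v \<bullet> b) *\<^sub>R b)"
    define k where "k = (\<lambda>t. f (y + t *\<^sub>R a) - t * p a x)"
    have near: "dist (y + t *\<^sub>R a) x < min r s" if "\<bar>t\<bar> <= \<bar>v \<bullet> a\<bar>" for t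
    proof -
     have "y + t *\<^sub>R a - x = (\<Sum>b\<in>insert a B. (if b = a then t else v \<bullet> b) *\<^sub>R b)"
      using insert.hyps by (simp add: y_def) (intro sum.cong, auto)
     moreover have "norm (\<Sum>b\<in>insert a B. (if b = a then t else v \<bullet> b) *\<^sub>R b) <= real DIM('a) * norm v"
     proof (rule sum_le)
      show "insert a B \<subseteq> Basis" using insert.prems .
      fix b assume "b \<in> insert a B"
      then show "\<bar>if b = a then t else v \<bullet> b\<bar> <= norm v"
       using that insert.prems Basis_le_norm[of a v] Basis_le_norm[of b v] aB by auto
     qed
     moreover have "real DIM('a) * norm v < min r s"
      using v by (simp add: d_def field_simps)
     ultimately show ?thesis by (simp add: dist_norm)
    qed
    have seg: "\<bar>t\<bar> <= \<bar>v \<bullet> a\<bar>" if "t \<in> closed_segment 0 (v \<bullet> a)" for t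
     using that by (auto simp: closed_segment_eq_real_ivl split: if_splits)
    have "norm (k (v \<bullet> a) - k 0) <= (e/2) * norm (v \<bullet> a - 0)"
    proof (rule field_differentiable_bound[where S = "closed_segment 0 (v \<bullet> a)" and f' = "\<lambda>t. p a (y + t *\<^sub>R a) - p a x"])
     fix t assume t: "t \<in> closed_segment 0 (v \<bullet> a)"
     have "y + t *\<^sub>R a \<in> S" using near[OF seg[OF t]] r by (auto simp: dist_commute subset_iff)
     from p[OF aB this] have "((\<lambda>s. f (y + (s + t) *\<^sub>R a)) has_real_derivative p a (y + t *\<^sub>R a)) (at 0)"
      by (simp add: algebra_simps)
     then have "((\<lambda>s. f (y + s *\<^sub>R a)) has_real_derivative p a (y + t *\<^sub>R a)) (at t)"
      using DERIV_shift[of "\<lambda>s. f (y + s *\<^sub>R a)" _ 0 t] by simp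
     then show "(k has_field_derivative p a (y + t *\<^sub>R a) - p a x) (at t within closed_segment 0 (v \<bullet> a))"
      unfolding k_def by (auto intro!: derivative_eq_intros dest: has_field_derivative_at_within)
     show "norm (p a (y + t *\<^sub>R a) - p a x) <= e/2"
      using s(2)[of "y + t *\<^sub>R a"] near[OF seg[OF t]] by (simp add: dist_norm)
    qed auto
    also have "\<dots> <= (e/2) * norm v" using Basis_le_norm[OF aB, of v] e by (simp add: mult_left_mono)
    finally have k: "\<bar>f (y + (v \<bullet> a) *\<^sub>R a) - f y - (v \<bullet> a) * p a x\<bar> <= (e/2) * norm v"
     by (simp add: k_def algebra_simps)
    have "\<bar>f y - f x - (\<Sum>b\<in>B. p b x * (v \<bullet> b))\<bar> <= (e/2) * norm v"
     using d1(2)[of v] v by (simp add: y_def d_def)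
    moreover have "x + (\<Sum>b\<in>insert a B. (v \<bullet> b) *\<^sub>R b) = y + (v \<bullet> a) *\<^sub>R a"
     using insert.hyps by (simp add: y_def algebra_simps)
    moreover have "(\<Sum>b\<in>insert a B. p b x * (v \<bullet> b)) = (v \<bullet> a) * p a x + (\<Sum>b\<in>B. p b x * (v \<bullet> b))"
     using insert.hyps by simp
    ultimately show "\<bar>f (x + (\<Sum>b\<in>insert a B. (v \<bullet> b) *\<^sub>R b)) - f x - (\<Sum>b\<in>insert a B. p b x * (v \<bullet> b))\<bar> <= e * norm v"
     using k field_sum_of_halves[of "e * norm v"] by (simp add: abs_le_iff, intro conjI; linarith)
   qed (use d0 in auto)
  qed
 qed
 from this[of Basis] have main: "\<forall>e>0. \<exists>d>0. \<forall>v. norm v < d -->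
   \<bar>f (x + v) - f x - (\<Sum>b\<in>Basis. p b x * (v \<bullet> b))\<bar> <= e * norm v"
  by (simp add: euclidean_representation)
 show ?thesis
  unfolding has_derivative_at_alt
 proof (intro conjI allI impI)
  show "bounded_linear (\<lambda>v. \<Sum>b\<in>Basis. p b x * (v \<bullet> b))"
   by (intro bounded_linear_sum bounded_linear_const_mult bounded_linear_inner_left)
  fix e :: real assume "e > 0"
  then obtain d where d: "d > 0" "\<And>v. norm v < d ==> \<bar>f (x + v) - f x - (\<Sum>b\<in>Basis. p b x * (v \<bullet> b))\<bar> <= e * norm v"
   using main by blast
  show "\<exists>d>0. \<forall>y. norm (y - x) < d -->
      norm (f y - f x - (\<Sum>b\<in>Basis. p b x * ((y - x) \<bullet> b))) <= e * norm (y - x)"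
   using d(1) d(2)[of "y - x" for y] by (intro exI[of _ d]) auto
 qed
qed

text \<open>Gradient and Hessian are explicit arguments, so that the rules below produce them as
  terms. The Hessian is the Frechet derivative of the gradient field and thus linear by
  construction; its continuity is stated separately, where membership in C^2 has to be
  shown.\<close>

definition has_hessian_on ::
 "'a::euclidean_space set \<Rightarrow> ('a \<Rightarrow> real) \<Rightarrow> ('a \<Rightarrow> 'a) \<Rightarrow> ('a \<Rightarrow> 'a \<Rightarrow> 'a) \<Rightarrow> bool" where
 "has_hessian_on S u g H \<longleftrightarrow>
   (\<forall>x\<in>S. (u has_derivative (\<lambda>v. g x \<bullet> v)) (at x) \<and> (g has_derivative H x) (at x))"

definition trace_op :: "('a::euclidean_space \<Rightarrow> 'a) \<Rightarrow> real" where
 "trace_op A = (\<Sum>b\<in>Basis. A b \<bullet> b)"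

lemma has_derivative_line:
 fixes u :: "'a::euclidean_space \<Rightarrow> real"
 assumes "(u has_derivative (\<lambda>v. g \<bullet> v)) (at (x + t *\<^sub>R a))"
 shows "((\<lambda>t. u (x + t *\<^sub>R a)) has_real_derivative g \<bullet> a) (at t)"
proof -
 have "((\<lambda>t. x + t *\<^sub>R a) has_derivative (\<lambda>s. s *\<^sub>R a)) (at t)"
  by (auto intro!: derivative_eq_intros)
 from has_derivative_compose[OF this assms] show ?thesis
  by (simp add: has_field_derivative_def mult_commute_abs)
qed

text \<open>\<open>Ck_on\<close> speaks only of derivatives along fixed directions. Continuity of
  the partial derivatives upgrades \<open>u\<close> and each partial derivative to Frechet
  differentiability, and then the iterated directional derivatives become linear in their
  directions.\<close>

lemma Ck2_has_hessian:
 assumes "Ck_on 2 S u"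
 obtains g H where "has_hessian_on S u g H" "\<And>b c. continuous_on S (\<lambda>x. H x b \<bullet> c)"
  "\<And>x. x \<in> S ==> laplacian u x = trace_op (H x)" "\<And>x. grad u x = g x"
  "\<And>x v. x \<in> S ==> iter_dd [v] u x = g x \<bullet> v"
  "\<And>x v w. x \<in> S ==> iter_dd [v, w] u x = H x v \<bullet> w"
proof -
 have S: "open S" using assms by (auto simp: Ck_on_def)
 have cont: "continuous_on S (iter_dd vs u)" if "length vs <= 2" for vs
  using assms that by (auto simp: Ck_on_def)
 have dd: "((\<lambda>t. iter_dd vs u (x + t *\<^sub>R v)) has_real_derivative iter_dd (v # vs) u x) (at 0)"
  if "length vs < 2" "x \<in> S" for vs v x
 proof -
  have "(\<lambda>t. iter_dd vs u (x + t *\<^sub>R v)) differentiable (at 0)"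
   using assms that by (auto simp: Ck_on_def)
  then show ?thesis
   by (simp add: DERIV_deriv_iff_real_differentiable)
 qed
 have D: "(iter_dd vs u has_derivative (\<lambda>v. \<Sum>b\<in>Basis. iter_dd (b # vs) u x * (v \<bullet> b))) (at x)"
  if "length vs < 2" "x \<in> S" for vs x
  using S that(2)
 proof (rule has_derivative_of_continuous_partials)
  show "isCont (iter_dd (b # vs) u) x" for b
   using cont[of "b # vs"] that S by (simp add: continuous_on_eq_continuous_at)
 qed (use dd that in auto)
 define g where "g = grad u"
 define H where "H = (\<lambda>x v. \<Sum>b\<in>Basis. (\<Sum>c\<in>Basis. iter_dd [c, b] u x * (v \<bullet> c)) *\<^sub>R b)"
 have g_inner: "g x \<bullet> v = (\<Sum>b\<in>Basis. iter_dd [b] u x * (v \<bullet> b))" for x v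
  by (simp add: g_def grad_def inner_sum_left inner_sum_right inner_commute[of _ v] del: iter_dd.simps)
 have hg: "(g has_derivative H x) (at x)" if "x \<in> S" for x
  unfolding g_def grad_def H_def
  by (intro has_derivative_sum has_derivative_scaleR_left D) (use that in auto)
 have hu: "(u has_derivative (\<lambda>v. g x \<bullet> v)) (at x)" if "x \<in> S" for x
  using D[of "[]" x] that by (simp add: g_inner del: iter_dd.simps) (simp only: iter_dd.simps(1))
 have lin: "iter_dd (v # vs) u x = (\<Sum>b\<in>Basis. iter_dd (b # vs) u x * (v \<bullet> b))" if "length vs < 2" "x \<in> S" for v vs x
 proof -
  have "((\<lambda>t. iter_dd vs u (x + t *\<^sub>R v)) has_real_derivative (\<Sum>b\<in>Basis. iter_dd (b # vs) u x *\<^sub>R b) \<bullet> v) (at 0)"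
  proof (rule has_derivative_line)
   have "(\<lambda>w. (\<Sum>b\<in>Basis. iter_dd (b # vs) u x *\<^sub>R b) \<bullet> w) = (\<lambda>w. \<Sum>b\<in>Basis. iter_dd (b # vs) u x * (w \<bullet> b))"
    by (auto simp: inner_sum_left inner_sum_right inner_commute simp del: iter_dd.simps intro!: ext sum.cong)
   then show "(iter_dd vs u has_derivative (\<lambda>w. (\<Sum>b\<in>Basis. iter_dd (b # vs) u x *\<^sub>R b) \<bullet> w)) (at (x + 0 *\<^sub>R v))"
    using D[OF that] by (simp del: iter_dd.simps)
  qed
  with dd[OF that] have "iter_dd (v # vs) u x = (\<Sum>b\<in>Basis. iter_dd (b # vs) u x *\<^sub>R b) \<bullet> v"
   using DERIV_unique by blast
  then show ?thesis by (simp add: inner_sum_left inner_sum_right inner_commute[of _ v] del: iter_dd.simps)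
 qed
 have i2: "iter_dd [v, w] u x = H x v \<bullet> w" if x: "x \<in> S" for x v w
 proof -
  have e: "iter_dd [w] u y = g y \<bullet> w" if "y \<in> S" for y
   using lin[of "[]" y w] that by (simp add: g_inner del: iter_dd.simps)
  have "((\<lambda>t. iter_dd [w] u (x + t *\<^sub>R v)) has_real_derivative iter_dd [v, w] u x) (at 0)"
   using dd[of "[w]" x v] x by (simp del: iter_dd.simps)
  moreover have "((\<lambda>t. g (x + t *\<^sub>R v) \<bullet> w) has_real_derivative H x v \<bullet> w) (at 0)"
  proof -
   have "((\<lambda>t. x + t *\<^sub>R v) has_derivative (\<lambda>s. s *\<^sub>R v)) (at 0)"
    by (auto intro!: derivative_eq_intros)
   from has_derivative_compose[OF this, of g "H x"] hg[OF x]
   have "((\<lambda>t. g (x + t *\<^sub>R v)) has_derivative (\<lambda>s. H x (s *\<^sub>R v))) (at 0)" by simp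
   then have "((\<lambda>t. g (x + t *\<^sub>R v) \<bullet> w) has_derivative (\<lambda>s. H x (s *\<^sub>R v) \<bullet> w)) (at 0)"
    by (auto intro!: derivative_eq_intros)
   moreover have "H x (s *\<^sub>R v) \<bullet> w = (H x v \<bullet> w) * s" for s
    using linear_scale[OF has_derivative_linear[OF hg[OF x]]] by simp
   ultimately show ?thesis by (simp add: has_field_derivative_def)
  qed
  moreover have "eventually (\<lambda>t. iter_dd [w] u (x + t *\<^sub>R v) = g (x + t *\<^sub>R v) \<bullet> w) (nhds 0)"
  proof -
   have "((\<lambda>t. x + t *\<^sub>R v) \<longlongrightarrow> x + 0 *\<^sub>R v) (nhds (0::real))"
    by (intro tendsto_intros filterlim_ident)
   then have "eventually (\<lambda>t. x + t *\<^sub>R v \<in> S) (nhds 0)"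
    using S x by (simp add: topological_tendstoD)
   then show ?thesis by eventually_elim (rule e)
  qed
  ultimately show ?thesis
   using DERIV_cong_ev[of 0 0 "\<lambda>t. iter_dd [w] u (x + t *\<^sub>R v)" "\<lambda>t. g (x + t *\<^sub>R v) \<bullet> w" "H x v \<bullet> w" "H x v \<bullet> w"]
    DERIV_unique[of "\<lambda>t. iter_dd [w] u (x + t *\<^sub>R v)" "iter_dd [v, w] u x" 0 "H x v \<bullet> w"]
   by (simp del: iter_dd.simps)
 qed
 show ?thesis
 proof (rule that[of g H])
  show "has_hessian_on S u g H" using hu hg by (auto simp: has_hessian_on_def)
  fix b c
  show "continuous_on S (\<lambda>x. H x b \<bullet> c)"
   by (rule continuous_on_eq[OF cont[of "[b, c]"]]) (use i2 in \<open>auto simp del: iter_dd.simps\<close>)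
 next
  fix x v assume x: "x \<in> S"
  show "laplacian u x = trace_op (H x)"
   using x by (simp add: laplacian_def trace_op_def i2 del: iter_dd.simps)
  show "iter_dd [v] u x = g x \<bullet> v" using lin[of "[]" x v] x by (simp add: g_inner del: iter_dd.simps)
 qed (use i2 in \<open>auto simp: g_def simp del: iter_dd.simps\<close>)
qed

lemma Ck2_of_hessian:
 assumes S: "open S" and h: "has_hessian_on S u g H"
  and c: "\<And>b c. continuous_on S (\<lambda>x. H x b \<bullet> c)"
 shows "Ck_on 2 S u" "x \<in> S ==> laplacian u x = trace_op (H x)"
proof -
 have inS: "eventually (\<lambda>t. x + t *\<^sub>R v \<in> S) (nhds (0::real))" if "x \<in> S" for x v
 proof -
  have "((\<lambda>t. x + t *\<^sub>R v) \<longlongrightarrow> x + 0 *\<^sub>R v) (nhds (0::real))"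
   by (intro tendsto_intros filterlim_ident)
  then show ?thesis using S that by (simp add: topological_tendstoD)
 qed
 have d1: "((\<lambda>t. u (x + t *\<^sub>R v)) has_real_derivative g x \<bullet> v) (at 0)" if "x \<in> S" for x v
  using h that has_derivative_line[of u "g x" x 0 v] by (auto simp: has_hessian_on_def)
 have i1: "iter_dd [v] u x = g x \<bullet> v" if "x \<in> S" for x v
  using DERIV_imp_deriv[OF d1[OF that]] by simp
 have d2: "((\<lambda>t. iter_dd [w] u (x + t *\<^sub>R v)) has_real_derivative H x v \<bullet> w) (at 0)" if x: "x \<in> S" for x v w
 proof -
  have hg: "(g has_derivative H x) (at x)" using h x by (auto simp: has_hessian_on_def)
  have "((\<lambda>t. x + t *\<^sub>R v) has_derivative (\<lambda>s. s *\<^sub>R v)) (at 0)"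
   by (auto intro!: derivative_eq_intros)
  from has_derivative_compose[OF this, of g "H x"] hg
  have "((\<lambda>t. g (x + t *\<^sub>R v)) has_derivative (\<lambda>s. H x (s *\<^sub>R v))) (at 0)" by simp
  then have "((\<lambda>t. g (x + t *\<^sub>R v) \<bullet> w) has_derivative (\<lambda>s. H x (s *\<^sub>R v) \<bullet> w)) (at 0)"
   by (auto intro!: derivative_eq_intros)
  moreover have "H x (s *\<^sub>R v) \<bullet> w = (H x v \<bullet> w) * s" for s
   using linear_scale[OF has_derivative_linear[OF hg]] by simp
  ultimately have "((\<lambda>t. g (x + t *\<^sub>R v) \<bullet> w) has_real_derivative H x v \<bullet> w) (at 0)"
   by (simp add: has_field_derivative_def)
  moreover have "eventually (\<lambda>t. iter_dd [w] u (x + t *\<^sub>R v) = g (x + t *\<^sub>R v) \<bullet> w) (nhds 0)"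
   using inS[OF x, of v] by eventually_elim (rule i1)
  ultimately show ?thesis
   using DERIV_cong_ev[of 0 0 "\<lambda>t. iter_dd [w] u (x + t *\<^sub>R v)" "\<lambda>t. g (x + t *\<^sub>R v) \<bullet> w" "H x v \<bullet> w" "H x v \<bullet> w"]
   by (simp del: iter_dd.simps)
 qed
 have i2: "iter_dd [v, w] u x = H x v \<bullet> w" if "x \<in> S" for x v w
  using DERIV_imp_deriv[OF d2[OF that]] by simp
 show "x \<in> S ==> laplacian u x = trace_op (H x)"
  by (simp add: laplacian_def trace_op_def i2 del: iter_dd.simps)
 have cu: "continuous_on S u" and cg: "continuous_on S g"
  using h by (auto simp: has_hessian_on_def continuous_on_eq_continuous_at S intro: has_derivative_continuous)
 show "Ck_on 2 S u"
  unfolding Ck_on_def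
 proof (intro conjI allI impI ballI)
  show "open S" by (rule S)
  fix vs :: "'a list" assume l: "length vs <= 2"
  then consider "vs = []" | v where "vs = [v]" | v w where "vs = [v, w]"
   by (cases vs; cases "tl vs") auto
  then show "continuous_on S (iter_dd vs u)"
  proof cases
   case 1 then show ?thesis using cu by (simp only: iter_dd.simps(1))
  next
   case (2 v)
   show ?thesis unfolding 2
    by (rule continuous_on_eq[of _ "\<lambda>x. g x \<bullet> v"]) (use i1 cg in \<open>auto intro!: continuous_intros simp del: iter_dd.simps\<close>)
  next
   case (3 v w)
   show ?thesis unfolding 3
    by (rule continuous_on_eq[OF c[of v w]]) (use i2 in \<open>auto simp del: iter_dd.simps\<close>)
  qed
  fix v x assume l: "length vs < 2" and x: "x \<in> S"
  then consider "vs = []" | w where "vs = [w]"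
   by (cases vs; cases "tl vs") auto
  then show "(\<lambda>t. iter_dd vs u (x + t *\<^sub>R v)) differentiable (at 0)"
  proof cases
   case 1 then show ?thesis using d1[OF x, of v] by (auto simp: real_differentiable_def)
  next
   case (2 w)
   show ?thesis using d2[OF x, of w v] unfolding 2 real_differentiable_def by blast
  qed
 qed
qed

text \<open>First and second derivative at \<open>0\<close> of a function that is differentiable
  near \<open>0\<close>. A test function of several points moved along lines is a sum of such
  one-variable functions, so its first and second variations follow by adding jets.\<close>

definition jet2 :: "(real \<Rightarrow> real) \<Rightarrow> real \<Rightarrow> real \<Rightarrow> bool" where
 "jet2 F a c \<longleftrightarrow> (\<exists>F1. (\<forall>\<^sub>F t in nhds 0. (F has_real_derivative F1 t) (at t)) \<and> F1 0 = a \<and>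
   (F1 has_real_derivative c) (at 0))"

lemma jet2_add:
 assumes "jet2 F a c" "jet2 G b d" shows "jet2 (\<lambda>t. F t + G t) (a + b) (c + d)"
proof -
 from assms obtain F1 G1 where "\<forall>\<^sub>F t in nhds 0. (F has_real_derivative F1 t) (at t)" "F1 0 = a"
   "(F1 has_real_derivative c) (at 0)" "\<forall>\<^sub>F t in nhds 0. (G has_real_derivative G1 t) (at t)" "G1 0 = b"
   "(G1 has_real_derivative d) (at 0)" unfolding jet2_def by blast
 then show ?thesis unfolding jet2_def
  by (intro exI[of _ "\<lambda>t. F1 t + G1 t"]) (auto intro!: derivative_eq_intros elim: eventually_elim2)
qed

lemma jet2_cmult:
 assumes "jet2 F a c" shows "jet2 (\<lambda>t. k * F t) (k * a) (k * c)"
proof -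
 from assms obtain F1 where "\<forall>\<^sub>F t in nhds 0. (F has_real_derivative F1 t) (at t)" "F1 0 = a"
   "(F1 has_real_derivative c) (at 0)" unfolding jet2_def by blast
 then show ?thesis unfolding jet2_def
  by (intro exI[of _ "\<lambda>t. k * F1 t"]) (auto intro!: derivative_eq_intros elim: eventually_mono)
qed

lemma jet2_minus: "jet2 F a c ==> jet2 (\<lambda>t. - F t) (- a) (- c)"
 using jet2_cmult[of F a c "-1"] by simp

lemma jet2_diff:
 assumes "jet2 F a c" "jet2 G b d" shows "jet2 (\<lambda>t. F t - G t) (a - b) (c - d)"
 using jet2_add[OF assms(1) jet2_minus[OF assms(2)]] by simp

lemma jet2_line:
 fixes u :: "'a::euclidean_space \<Rightarrow> real"
 assumes h: "has_hessian_on S u g H" and S: "open S" "x \<in> S"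
 shows "jet2 (\<lambda>t. u (x + t *\<^sub>R v)) (g x \<bullet> v) (H x v \<bullet> v)"
proof -
 have "((\<lambda>t. x + t *\<^sub>R v) \<longlongrightarrow> x + 0 *\<^sub>R v) (nhds (0::real))"
  by (intro tendsto_intros filterlim_ident)
 then have "eventually (\<lambda>t. x + t *\<^sub>R v \<in> S) (nhds 0)" using S by (simp add: topological_tendstoD)
 then have "\<forall>\<^sub>F t in nhds 0. ((\<lambda>t. u (x + t *\<^sub>R v)) has_real_derivative g (x + t *\<^sub>R v) \<bullet> v) (at t)"
  by eventually_elim (use h in \<open>auto intro: has_derivative_line simp: has_hessian_on_def\<close>)
 moreover have "((\<lambda>t. g (x + t *\<^sub>R v) \<bullet> v) has_real_derivative H x v \<bullet> v) (at 0)"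
 proof -
  have hg: "(g has_derivative H x) (at x)" using h S by (auto simp: has_hessian_on_def)
  have "((\<lambda>t. x + t *\<^sub>R v) has_derivative (\<lambda>s. s *\<^sub>R v)) (at 0)"
   by (auto intro!: derivative_eq_intros)
  from has_derivative_compose[OF this, of g "H x"] hg
  have "((\<lambda>t. g (x + t *\<^sub>R v)) has_derivative (\<lambda>s. H x (s *\<^sub>R v))) (at 0)" by simp
  then have "((\<lambda>t. g (x + t *\<^sub>R v) \<bullet> v) has_derivative (\<lambda>s. H x (s *\<^sub>R v) \<bullet> v)) (at 0)"
   by (auto intro!: derivative_eq_intros)
  moreover have "H x (s *\<^sub>R v) \<bullet> v = (H x v \<bullet> v) * s" for s
   using linear_scale[OF has_derivative_linear[OF hg]] by simp
  ultimately show ?thesis by (simp add: has_field_derivative_def)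
 qed
 ultimately show ?thesis unfolding jet2_def by (intro exI[of _ "\<lambda>t. g (x + t *\<^sub>R v) \<bullet> v"]) auto
qed

lemma jet2_max:
 assumes j: "jet2 F a c" and m: "\<forall>\<^sub>F t in nhds 0. F t <= F 0"
 shows "a = 0" "c <= 0"
proof -
 obtain F1 where F1: "\<forall>\<^sub>F t in nhds 0. (F has_real_derivative F1 t) (at t)" "F1 0 = a"
   "(F1 has_real_derivative c) (at 0)" using j unfolding jet2_def by blast
 obtain r where r: "r > 0" "\<And>t. \<bar>t\<bar> < r ==> (F has_real_derivative F1 t) (at t)"
   "\<And>t. \<bar>t\<bar> < r ==> F t <= F 0"
  using eventually_conj[OF F1(1) m] unfolding eventually_nhds_metric by (auto simp: dist_real_def)
 show a: "a = 0"
  using DERIV_local_max[of F "F1 0" 0 r] r(1) r(2)[of 0] r(3) F1(2) by (simp add: abs_minus_commute)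
 show "c <= 0"
 proof (rule ccontr)
  assume "\<not> c <= 0"
  then obtain d where d: "d > 0" "\<And>h. 0 < h ==> h < d ==> F1 0 < F1 (0 + h)"
   using DERIV_pos_inc_right[OF F1(3)] by force
  define h where "h = min d r / 2"
  have h: "0 < h" "h < d" "h < r" using d r by (auto simp: h_def)
  have "F 0 < F h"
  proof (rule DERIV_pos_imp_increasing_open[of 0 h F])
   show "\<And>x. 0 < x ==> x < h ==> \<exists>y. DERIV F x :> y \<and> 0 < y"
    using r(2) d(2) h a F1(2) by (metis abs_of_pos add_0 less_trans)
   show "continuous_on {0..h} F"
    by (rule continuous_at_imp_continuous_on)
      (use r(2) h in \<open>auto intro!: DERIV_isCont[of F "F1 x" x for x]\<close>)
  qed (use h in auto)
  moreover have "F h <= F 0" using r(3)[of h] h by simp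
  ultimately show False by simp
 qed
qed

lemma hessian_at_max:
 fixes u :: "'a::euclidean_space \<Rightarrow> real"
 assumes h: "has_hessian_on S u g H" and S: "open S" "x \<in> S" and m: "\<forall>\<^sub>F y in nhds x. u y <= u x"
 shows "g x = 0" "trace_op (H x) <= 0"
proof -
 have ev: "\<forall>\<^sub>F t in nhds 0. u (x + t *\<^sub>R v) <= u (x + 0 *\<^sub>R v)" for v
 proof -
  have "((\<lambda>t. x + t *\<^sub>R v) \<longlongrightarrow> x + 0 *\<^sub>R v) (nhds (0::real))"
   by (intro tendsto_intros filterlim_ident)
  then show ?thesis using m by (auto simp: filterlim_iff)
 qed
 note J = jet2_max[OF jet2_line[OF h S] ev]
 show "g x = 0" using J(1)[of "g x"] by simp
 show "trace_op (H x) <= 0" unfolding trace_op_def using J(2) by (intro sum_nonpos) auto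
qed

section \<open>Sum, product and chain rules for Hessians, and traces\<close>

lemma hessian_add:
 "has_hessian_on S u g H ==> has_hessian_on S v k K ==>
  has_hessian_on S (\<lambda>x. u x + v x) (\<lambda>x. g x + k x) (\<lambda>x a. H x a + K x a)"
 unfolding has_hessian_on_def by (auto intro!: derivative_eq_intros simp: inner_add_left)

lemma hessian_cmult:
 "has_hessian_on S u g H ==>
  has_hessian_on S (\<lambda>x. c * u x) (\<lambda>x. c *\<^sub>R g x) (\<lambda>x a. c *\<^sub>R H x a)"
 unfolding has_hessian_on_def by (auto intro!: derivative_eq_intros)

lemma hessian_const: "has_hessian_on S (\<lambda>x. c) (\<lambda>x. 0) (\<lambda>x a. 0)"
proof -
 have "(\<bullet>) (0::'a) = (\<lambda>v. 0)" by auto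
 then show ?thesis unfolding has_hessian_on_def by auto
qed

lemma hessian_mult:
 "has_hessian_on S u g H ==> has_hessian_on S v k K ==>
  has_hessian_on S (\<lambda>x. u x * v x) (\<lambda>x. u x *\<^sub>R k x + v x *\<^sub>R g x)
   (\<lambda>x a. u x *\<^sub>R K x a + (g x \<bullet> a) *\<^sub>R k x + (v x *\<^sub>R H x a + (k x \<bullet> a) *\<^sub>R g x))"
 unfolding has_hessian_on_def
 by (auto intro!: derivative_eq_intros ext simp: inner_add_left algebra_simps)

lemma hessian_compose:
 assumes "has_hessian_on S u g H"
  and "\<And>x. x \<in> S ==> (F has_real_derivative F1 (u x)) (at (u x))"
  and "\<And>x. x \<in> S ==> (F1 has_real_derivative F2 (u x)) (at (u x))"
 shows "has_hessian_on S (\<lambda>x. F (u x)) (\<lambda>x. F1 (u x) *\<^sub>R g x)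
   (\<lambda>x a. F1 (u x) *\<^sub>R H x a + (F2 (u x) * (g x \<bullet> a)) *\<^sub>R g x)"
 unfolding has_hessian_on_def
proof (intro ballI conjI)
 fix x assume x: "x \<in> S"
 have u: "(u has_derivative (\<lambda>v. g x \<bullet> v)) (at x)" and g: "(g has_derivative H x) (at x)"
  using assms(1) x by (auto simp: has_hessian_on_def)
 have 1: "((\<lambda>x. F (u x)) has_derivative (\<lambda>v. F1 (u x) * (g x \<bullet> v))) (at x)"
  using has_derivative_compose[OF u] assms(2)[OF x] by (simp add: has_field_derivative_def)
 then show "((\<lambda>x. F (u x)) has_derivative (\<lambda>v. (F1 (u x) *\<^sub>R g x) \<bullet> v)) (at x)" by simp
 have 2: "((\<lambda>x. F1 (u x)) has_derivative (\<lambda>v. F2 (u x) * (g x \<bullet> v))) (at x)"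
  using has_derivative_compose[OF u] assms(3)[OF x] by (simp add: has_field_derivative_def)
 show "((\<lambda>x. F1 (u x) *\<^sub>R g x) has_derivative (\<lambda>a. F1 (u x) *\<^sub>R H x a + (F2 (u x) * (g x \<bullet> a)) *\<^sub>R g x)) (at x)"
  by (rule has_derivative_scaleR[OF 2 g])
qed

lemma hessian_subset: "has_hessian_on S u g H ==> T \<subseteq> S ==> has_hessian_on T u g H"
 by (auto simp: has_hessian_on_def)

lemma trace_op_simps:
 "trace_op (\<lambda>a. A a + B a) = trace_op A + trace_op B"
 "trace_op (\<lambda>a. c *\<^sub>R A a) = c * trace_op A"
 "trace_op (\<lambda>a. (p \<bullet> a) *\<^sub>R q) = p \<bullet> q"
 "trace_op (\<lambda>a. (k * (p \<bullet> a)) *\<^sub>R q) = k * (p \<bullet> q)"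
 "trace_op (\<lambda>a. 0) = 0"
 by (simp_all add: trace_op_def inner_add_left sum.distrib sum_distrib_left euclidean_inner[of p q] mult.assoc)

lemma hessian_continuous_on:
 assumes "has_hessian_on S u g H" shows "continuous_on S u" "continuous_on S g"
 using assms by (auto simp: has_hessian_on_def intro!: continuous_at_imp_continuous_on intro: has_derivative_continuous)

lemma hessian_linear: "has_hessian_on S u g H ==> x \<in> S ==> linear (H x)"
 by (auto simp: has_hessian_on_def intro: has_derivative_linear)

text \<open>In the two-point and four-point arguments the points separate along one unit vector
  \<open>e\<close> and are translated together in the orthogonal directions; the trace has to be
  split accordingly.\<close>

lemma trace_op_orthonormal:
 fixes e :: "'a::euclidean_space"
 assumes e: "norm e = 1"
 obtains B where "finite B" "e \<in> B" "\<And>b. b \<in> B ==> norm b = 1" "\<And>b. b \<in> B ==> b \<noteq> e ==> e \<bullet> b = 0"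
  "\<And>A. linear A ==> trace_op A = (\<Sum>b\<in>B. A b \<bullet> b)"
proof -
 obtain B where B: "e \<in> B" "pairwise orthogonal B" "\<And>x. x \<in> B ==> norm x = 1"
   "independent B" "card B = DIM('a)" "span B = UNIV"
  using vector_in_orthonormal_basis[OF e] by metis
 have fin: "finite B" using B(4) independent_imp_finite by blast
 have expand: "v = (\<Sum>b\<in>B. (v \<bullet> b) *\<^sub>R b)" for v
  using orthonormal_basis_expand[OF B(2) B(3), of v] fin B(6) by simp
 show ?thesis
 proof (rule that[of B])
  fix A :: "'a \<Rightarrow> 'a" assume A: "linear A"
  have "trace_op A = (\<Sum>c\<in>Basis. \<Sum>b\<in>B. (A c \<bullet> b) * (b \<bullet> c))"
   unfolding trace_op_def
  proof (rule sum.cong[OF refl])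
   fix c :: 'a
   have "A c \<bullet> c = (\<Sum>b\<in>B. (A c \<bullet> b) *\<^sub>R b) \<bullet> c" using expand[of "A c"] by simp
   then show "A c \<bullet> c = (\<Sum>b\<in>B. (A c \<bullet> b) * (b \<bullet> c))" by (simp add: inner_sum_left)
  qed
  also have "\<dots> = (\<Sum>b\<in>B. \<Sum>c\<in>Basis. (A c \<bullet> b) * (b \<bullet> c))" by (rule sum.swap)
  also have "\<dots> = (\<Sum>b\<in>B. A b \<bullet> b)"
  proof (rule sum.cong[OF refl])
   fix b
   have "A b = A (\<Sum>c\<in>Basis. (b \<bullet> c) *\<^sub>R c)" by (simp add: euclidean_representation)
   also have "\<dots> = (\<Sum>c\<in>Basis. (b \<bullet> c) *\<^sub>R A c)" using A by (simp add: linear_sum linear_scale)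
   finally show "(\<Sum>c\<in>Basis. (A c \<bullet> b) * (b \<bullet> c)) = A b \<bullet> b" 
    by (simp add: inner_sum_left mult.commute)
  qed
  finally show "trace_op A = (\<Sum>b\<in>B. A b \<bullet> b)" .
 qed (use B fin in \<open>auto simp: pairwise_def orthogonal_def\<close>)
qed

lemma compact_bound:
 fixes h :: "'a::euclidean_space \<Rightarrow> 'b::real_normed_vector"
 assumes "compact S" "continuous_on S h" obtains K where "K >= 0" "\<And>x. x \<in> S ==> norm (h x) <= K"
proof -
 have "bounded (h ` S)" by (rule compact_imp_bounded[OF compact_continuous_image[OF assms(2,1)]])
 then obtain K where "K > 0" "\<forall>y\<in>h ` S. norm y <= K" unfolding bounded_pos by blast
 then show ?thesis using that[of K] by auto
qed

section \<open>Discrete ground states and gradient estimates\<close>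

lemma linear_term_zero:
 fixes p q :: real assumes "\<And>t. 0 <= 2 * t * p + t\<^sup>2 * q" shows "p = 0"
proof (rule ccontr)
 assume p: "p \<noteq> 0"
 \<comment> \<open>The optimal \<open>t\<close> would be \<open>- p / q\<close>; replacing
   \<open>q\<close> by a larger positive \<open>k\<close> keeps the test value negative and avoids a
   case distinction on \<open>q\<close>.\<close>
 define k where "k = \<bar>q\<bar> + 1"
 have k: "k > 0" "q < k" by (auto simp: k_def)
 have "2 * (- p / k) * p + (- p / k)\<^sup>2 * q = (p\<^sup>2 / k\<^sup>2) * (q - 2 * k)"
  using k by (simp add: field_simps power2_eq_square)
 moreover have "\<dots> < 0" using p k by (intro mult_pos_neg) auto
 ultimately show False using assms[of "- p / k"] by simp
qed

text \<open>Minimiser of the quadratic form on the unit sphere. Since off-diagonal entries are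
  nonpositive, passing to absolute values does not increase the form, so a nonnegative minimiser
  exists. Strict positivity would require a connected index graph; it is recovered after the limit,
  by the strong maximum principle.\<close>

lemma finite_ground_state:
 fixes a :: "'i \<Rightarrow> 'i \<Rightarrow> real"
 assumes fin: "finite A" "A \<noteq> {}"
  and sym: "\<And>x y. x \<in> A ==> y \<in> A ==> a x y = a y x"
  and off: "\<And>x y. x \<in> A ==> y \<in> A ==> x \<noteq> y ==> a x y <= 0"
 obtains u l where "\<And>x. 0 <= u x" "\<And>x. x \<notin> A ==> u x = 0" "\<exists>x\<in>A. u x \<noteq> 0"
  "\<And>x. x \<in> A ==> (\<Sum>y\<in>A. a x y * u y) = l * u x"
  "\<And>w. l * (\<Sum>x\<in>A. (w x)\<^sup>2) <= (\<Sum>x\<in>A. w x * (\<Sum>y\<in>A. a x y * w y))"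
proof -
 define B where "B = (\<lambda>f g. \<Sum>x\<in>A. f x * (\<Sum>y\<in>A. a x y * g y))"
 define N where "N = (\<lambda>f. \<Sum>x\<in>A. (f x :: real)\<^sup>2)"
 define F where "F = (\<lambda>x. if x \<in> A then {-1..1::real} else {0})"
 have ev: "continuous_on T (\<lambda>f. f x)" for x :: 'i and T :: "('i \<Rightarrow> real) set"
  by (rule continuous_on_subset[OF continuous_on_product_coordinates]) simp
 \<comment> \<open>Functions on \<open>A\<close> are extended by zero and live in the full product
   space; the factors are compact intervals, or \<open>{0}\<close> outside \<open>A\<close>, so
   compactness is Tychonoff's theorem.\<close>
 define S where "S = PiE UNIV F \<inter> {f. N f = 1}"
 have "compactin (product_topology (\<lambda>_. euclidean) UNIV) (PiE UNIV F)"
  unfolding compactin_PiE by (auto simp: F_def)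
 then have "compact (PiE UNIV F)" by (simp add: euclidean_product_topology)
 moreover have "closed {f. N f = 1}"
  unfolding N_def by (intro closed_Collect_eq continuous_on_sum continuous_on_power continuous_on_const ev)
 ultimately have S: "compact S" unfolding S_def by (rule compact_Int_closed)
 obtain a0 where a0: "a0 \<in> A" using fin by auto
 have "(\<lambda>x. if x = a0 then 1 else 0) \<in> S"
  using a0 fin by (auto simp: S_def F_def N_def if_distrib[where f = "\<lambda>z. z\<^sup>2"] cong: if_cong split: if_splits)
 then have ne: "S \<noteq> {}" by blast
 have cB: "continuous_on S (\<lambda>f. B f f)"
  unfolding B_def by (intro continuous_on_sum continuous_on_mult continuous_on_const ev)
 obtain u0 where u0: "u0 \<in> S" "\<And>w. w \<in> S ==> B u0 u0 <= B w w"
  using continuous_attains_inf[OF S ne cB] by blast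
 define l where "l = B u0 u0"
 have inS: "w \<in> S" if w: "\<And>x. x \<notin> A ==> w x = 0" "N w = 1" for w
 proof -
  have "\<bar>w x\<bar> <= 1" if "x \<in> A" for x
  proof -
   have "(w x)\<^sup>2 <= N w" unfolding N_def using fin that by (intro member_le_sum) auto
   then show ?thesis using w(2) abs_le_square_iff[of "w x" 1] by simp
  qed
  then show ?thesis using w by (auto simp: S_def F_def abs_le_iff)
 qed
 have N0: "N w >= 0" for w unfolding N_def by (intro sum_nonneg) auto
 have min: "l * N w <= B w w" for w
 proof (cases "N w = 0")
  case True
  then have "w x = 0" if "x \<in> A" for x using that fin by (simp add: N_def sum_nonneg_eq_0_iff)
  then show ?thesis using True by (simp add: B_def)
 next
  case False
  then have Np: "N w > 0" using N0[of w] by simp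
  define c where "c = 1 / sqrt (N w)"
  have c2: "c * c = 1 / N w" using Np by (simp add: c_def)
  define w' where "w' = (\<lambda>x. if x \<in> A then c * w x else 0)"
  have "N w' = (\<Sum>x\<in>A. (c * c) * (w x)\<^sup>2)" unfolding N_def
   by (rule sum.cong[OF refl]) (simp add: w'_def power2_eq_square)
  also have "\<dots> = 1" using Np unfolding sum_distrib_left[symmetric] c2 by (simp add: N_def)
  finally have "w' \<in> S" by (intro inS) (auto simp: w'_def)
  then have "l <= B w' w'" using u0 l_def by auto
  also have "B w' w' = (\<Sum>x\<in>A. (c * c) * (w x * (\<Sum>y\<in>A. a x y * w y)))"
   unfolding B_def
  proof (rule sum.cong[OF refl])
   fix x assume x: "x \<in> A"
   have "(\<Sum>y\<in>A. a x y * w' y) = c * (\<Sum>y\<in>A. a x y * w y)"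
    unfolding sum_distrib_left by (rule sum.cong[OF refl]) (simp add: w'_def)
   then show "w' x * (\<Sum>y\<in>A. a x y * w' y) = (c * c) * (w x * (\<Sum>y\<in>A. a x y * w y))"
    using x by (simp add: w'_def)
  qed
  also have "\<dots> = B w w / N w" unfolding sum_distrib_left[symmetric] c2 by (simp add: B_def)
  finally show ?thesis using Np by (simp add: field_simps)
 qed
 define u where "u = (\<lambda>x. \<bar>u0 x\<bar>)"
 have Nu: "N u = 1" using u0 by (auto simp: S_def N_def u_def)
 have "B u u <= B u0 u0"
  unfolding B_def sum_distrib_left
 proof (intro sum_mono)
  fix x y assume "x \<in> A" "y \<in> A"
  then show "u x * (a x y * u y) <= u0 x * (a x y * u0 y)"
  proof (cases "x = y")
   case True
   have "\<bar>p\<bar> * (k * \<bar>p\<bar>) = p * (k * p)" for p k :: real by (cases "p >= 0") auto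
   then show ?thesis using True by (simp add: u_def)
  next
   case False
   then have "a x y <= 0" using off \<open>x \<in> A\<close> \<open>y \<in> A\<close> by auto
   moreover have "u0 x * u0 y <= u x * u y" by (simp add: u_def abs_mult[symmetric])
   ultimately have "a x y * (u x * u y) <= a x y * (u0 x * u0 y)" by (intro mult_left_mono_neg)
   then show ?thesis by (simp add: mult.left_commute)
  qed
 qed
 then have Bu: "B u u = l" using min[of u] Nu l_def by simp
 have eq: "(\<Sum>y\<in>A. a x y * u y) = l * u x" if x: "x \<in> A" for x
 proof -
  define d where "d = (\<lambda>y. if y = x then 1 else 0 :: real)"
  have Bd: "B d g = (\<Sum>y\<in>A. a x y * g y)" for g
   using x fin by (simp add: B_def d_def if_distrib[where f = "\<lambda>c. c * _"] cong: if_cong)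
  have Bs: "B f g = B g f" for f g
  proof -
   have "B f g = (\<Sum>x\<in>A. \<Sum>y\<in>A. f x * (a x y * g y))" by (simp add: B_def sum_distrib_left)
   also have "\<dots> = (\<Sum>y\<in>A. \<Sum>x\<in>A. f x * (a x y * g y))" by (rule sum.swap)
   also have "\<dots> = (\<Sum>y\<in>A. \<Sum>x\<in>A. g y * (a y x * f x))"
    by (intro sum.cong refl) (auto simp: sym)
   finally show ?thesis by (simp add: B_def sum_distrib_left)
  qed
  have Badd: "B (\<lambda>y. f y + t * k y) g = B f g + t * B k g" for f k g t
   by (simp add: B_def algebra_simps sum.distrib sum_distrib_left)
  \<comment> \<open>First variation: minimality along \<open>u + t d\<close>, with \<open>d\<close>
    the indicator of \<open>x\<close>, is a quadratic inequality in \<open>t\<close>.\<close>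
  have "0 <= 2 * t * ((\<Sum>y\<in>A. a x y * u y) - l * u x) + t\<^sup>2 * (a x x - l)" for t
  proof -
   have "B (\<lambda>y. u y + t * d y) (\<lambda>y. u y + t * d y) = B u u + t * B d u + t * (B d u + t * B d d)"
    using Badd[of u t d] Bs by metis
   moreover have "B d d = a x x" using x fin by (simp add: Bd) (simp add: d_def if_distrib cong: if_cong)
   moreover have "N (\<lambda>y. u y + t * d y) = 1 + 2 * t * u x + t\<^sup>2"
   proof -
    have "N (\<lambda>y. u y + t * d y) = (\<Sum>y\<in>A. (u y)\<^sup>2 + (if y = x then 2 * t * u x + t\<^sup>2 else 0))"
     unfolding N_def d_def by (intro sum.cong) (auto simp: power2_eq_square algebra_simps)
    also have "\<dots> = N u + (2 * t * u x + t\<^sup>2)" using x fin by (simp add: sum.distrib N_def)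
    finally show ?thesis using Nu by simp
   qed
   ultimately show ?thesis using min[of "\<lambda>y. u y + t * d y"] Bu Bd[of u]
    by (simp add: algebra_simps power2_eq_square)
  qed
  from linear_term_zero[OF this] show ?thesis by simp
 qed
 show ?thesis
 proof (rule that[of u l])
  fix x assume "x \<notin> A"
  moreover have "u0 x \<in> F x" using u0(1) unfolding S_def by blast
  ultimately show "u x = 0" by (simp add: F_def u_def)
 next
  show "\<exists>x\<in>A. u x \<noteq> 0" using Nu by (auto simp: N_def intro: ccontr)
  show "\<And>w. l * (\<Sum>x\<in>A. (w x)\<^sup>2) <= (\<Sum>x\<in>A. w x * (\<Sum>y\<in>A. a x y * w y))"
   using min by (simp add: N_def B_def)
 qed (use eq in \<open>auto simp: u_def\<close>)
qed

lemma finite_max_obtain: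
 fixes f :: "'i \<Rightarrow> real"
 assumes "finite A" "A \<noteq> {}" obtains x where "x \<in> A" "\<And>y. y \<in> A ==> f y <= f x"
proof -
 have "Max (f ` A) \<in> f ` A" using assms by (intro Max_in) auto
 then obtain x where "x \<in> A" "f x = Max (f ` A)" by auto
 then show ?thesis using that[of x] assms by (metis Max_ge finite_imageI imageI)
qed

section \<open>Grids and finite differences\<close>

definition grid :: "real \<Rightarrow> 'a::euclidean_space set" where
 "grid h = {x. \<forall>b\<in>Basis. \<exists>j::int. x \<bullet> b = h * of_int j}"

definition dlap :: "real \<Rightarrow> ('a::euclidean_space \<Rightarrow> real) \<Rightarrow> 'a \<Rightarrow> real" where
 "dlap h u x = (\<Sum>b\<in>Basis. (u (x + h *\<^sub>R b) + u (x - h *\<^sub>R b) - 2 * u x) / h\<^sup>2)"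

definition fdiff :: "real \<Rightarrow> 'a::euclidean_space \<Rightarrow> ('a \<Rightarrow> real) \<Rightarrow> 'a \<Rightarrow> real" where
 "fdiff h b u x = (u (x + h *\<^sub>R b) - u x) / h"

lemma grid_add: "x \<in> grid h ==> y \<in> grid h ==> x + y \<in> grid h"
 unfolding grid_def by (auto simp: inner_add_left) (metis distrib_left of_int_add)

lemma grid_diff: "x \<in> grid h ==> y \<in> grid h ==> x - y \<in> grid h"
 unfolding grid_def by (auto simp: inner_diff_left) (metis right_diff_distrib of_int_diff)

lemma grid_basis: "b \<in> Basis ==> (h * of_int j) *\<^sub>R b \<in> grid h"
 unfolding grid_def by (auto simp: inner_Basis intro: exI[of _ 0])

lemma grid_basis1: "b \<in> Basis ==> h *\<^sub>R b \<in> grid h"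
 using grid_basis[of b h 1] by simp

lemma finite_grid_bounded:
 assumes h: "h > 0" and B: "bounded (B :: 'a::euclidean_space set)" shows "finite (B \<inter> grid h)"
proof -
 obtain R where R: "\<And>x. x \<in> B ==> norm x <= R" using B bounded_iff by blast
 define J where "J = {- \<lceil>R / h\<rceil> .. \<lceil>R / h\<rceil>}"
 define G where "G = (\<lambda>j::'a \<Rightarrow> int. \<Sum>b\<in>Basis. (h * of_int (j b)) *\<^sub>R b)"
 have "B \<inter> grid h \<subseteq> G ` (PiE Basis (\<lambda>_. J))"
 proof
  fix x assume x: "x \<in> B \<inter> grid h"
  then obtain j where j: "\<And>b. b \<in> Basis ==> x \<bullet> b = h * of_int (j b)"
   unfolding grid_def by (auto, metis)
  have "j b \<in> J" if b: "b \<in> Basis" for b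
  proof -
   have "\<bar>h * of_int (j b)\<bar> <= R" using j[OF b] R[of x] x Basis_le_norm[OF b, of x] by auto
   then have "\<bar>of_int (j b)\<bar> <= R / h" using h by (simp add: abs_mult field_simps)
   then have "\<bar>real_of_int (j b)\<bar> <= of_int \<lceil>R / h\<rceil>" by linarith
   then have "\<bar>j b\<bar> <= \<lceil>R / h\<rceil>" by linarith
   then show ?thesis by (auto simp: J_def)
  qed
  then have "restrict j Basis \<in> PiE Basis (\<lambda>_. J)" by auto
  moreover have "x = G (restrict j Basis)"
   unfolding G_def using j euclidean_representation[of x] by (simp cong: sum.cong)
  ultimately show "x \<in> G ` (PiE Basis (\<lambda>_. J))" by blast
 qed
 moreover have "finite (PiE (Basis::'a set) (\<lambda>_. J))" by (intro finite_PiE) (auto simp: J_def)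
 ultimately show ?thesis using finite_surj by blast
qed

text \<open>The barrier of the gradient estimate is a sum of functions of one coordinate each, so
  each second difference sees a single summand and can be evaluated exactly.\<close>

lemma separable_second_difference:
 fixes q :: "'a::euclidean_space \<Rightarrow> real \<Rightarrow> real" and x0 :: 'a
 assumes c: "c \<in> Basis"
 defines "f \<equiv> \<lambda>y. \<Sum>d\<in>Basis. q d ((y - x0) \<bullet> d)"
 shows "f (y + h *\<^sub>R c) + f (y - h *\<^sub>R c) - 2 * f y =
  q c ((y - x0) \<bullet> c + h) + q c ((y - x0) \<bullet> c - h) - 2 * q c ((y - x0) \<bullet> c)"
proof -
 have *: "f (y + t *\<^sub>R c) = q c ((y - x0) \<bullet> c + t) + (\<Sum>d\<in>Basis - {c}. q d ((y - x0) \<bullet> d))" for t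
 proof -
  have "f (y + t *\<^sub>R c) = q c ((y + t *\<^sub>R c - x0) \<bullet> c) + (\<Sum>d\<in>Basis - {c}. q d ((y + t *\<^sub>R c - x0) \<bullet> d))"
   unfolding f_def using c by (intro sum.remove) auto
  also have "(y + t *\<^sub>R c - x0) \<bullet> c = (y - x0) \<bullet> c + t" using c by (simp add: algebra_simps inner_Basis)
  also have "(\<Sum>d\<in>Basis - {c}. q d ((y + t *\<^sub>R c - x0) \<bullet> d)) = (\<Sum>d\<in>Basis - {c}. q d ((y - x0) \<bullet> d))"
   using c by (intro sum.cong) (auto simp: algebra_simps inner_Basis)
  finally show ?thesis .
 qed
 from *[of h] *[of "-h"] *[of 0] show ?thesis by simp
qed

text \<open>Brandt's interior gradient estimate: the odd part of \<open>u\<close> in direction \<open>b\<close> is compared with a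
 quadratic function on a half box, on which the discrete Laplacian acts exactly.\<close>

lemma discrete_gradient_estimate_upper:
 fixes u :: "'a::euclidean_space \<Rightarrow> real"
 assumes h: "h > 0" and N: "N >= (1::nat)" and r: "r = real N * h" and b: "b \<in> Basis"
  and x0: "x0 \<in> grid h" and M: "M > 0" and F: "F >= 0"
  and bd: "\<And>y. y \<in> grid h ==> (\<And>c. c \<in> Basis ==> \<bar>(y - x0) \<bullet> c\<bar> <= r + h) ==> \<bar>u y\<bar> <= M"
  and lap: "\<And>y. y \<in> grid h ==> (\<And>c. c \<in> Basis ==> \<bar>(y - x0) \<bullet> c\<bar> <= r + h) ==> \<bar>dlap h u y\<bar> <= F"
 shows "u (x0 + h *\<^sub>R b) - u x0 <= h * (M / r * (1 + 3/2 * real DIM('a)) + 3/4 * F * r)"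
proof -
 have r0: "r > 0" using r N h by simp
 have hr: "h <= r" using r N h by simp
 define n where "n = real DIM('a)"
 have n1: "n >= 1" by (simp add: n_def DIM_positive Suc_leI)
 \<comment> \<open>The constants \<open>B\<close> and \<open>al\<close> are dictated by the barrier:
   \<open>B\<close> makes its discrete Laplacian equal to \<open>- F - 2 M / r^2\<close>, strictly
   below that of \<open>ph\<close>, and \<open>al\<close> makes it at least \<open>M\<close> on the
   top face, where the distance to the mirror is at most \<open>3 r / 2\<close>.\<close>
 define B where "B = F/2 + n * M / r\<^sup>2"
 define al where "al = M / r + 3/2 * B * r"
 have B0: "B > 0" using F M n1 r0 by (auto simp: B_def intro!: add_nonneg_pos divide_pos_pos mult_pos_pos)
 define X where "X = (\<lambda>y c. (y - x0) \<bullet> c)"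
 define R where "R = {y \<in> grid h. (\<forall>c\<in>Basis - {b}. \<bar>X y c\<bar> <= r) \<and> h <= X y b \<and> X y b <= r + h}"
 \<comment> \<open>Reflection in the hyperplane at height \<open>h / 2\<close>, half a step below
   the lowest layer of \<open>R\<close>. It maps the grid to itself and exchanges \<open>x0\<close>
   with \<open>x0 + h b\<close>, so the odd part \<open>ph\<close> at that neighbour is half the
   increment sought.\<close>
 define sg where "sg = (\<lambda>y. y - (2 * X y b - h) *\<^sub>R b)"
 define ph where "ph = (\<lambda>y. (u y - u (sg y)) / 2)"
 \<comment> \<open>The constant \<open>B * h^2 / 4\<close> makes the values at heights
   \<open>0\<close> and \<open>h\<close> opposite, namely \<open>- al * h / 2\<close> and
   \<open>al * h / 2\<close>, so in direction \<open>b\<close> the barrier is odd across the two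
   layers next to the mirror.\<close>
 define q where "q = (\<lambda>c t. if c = b then al * (t - h/2) - B * (t - h/2)\<^sup>2 + B * h\<^sup>2 / 4 else M / r\<^sup>2 * t\<^sup>2)"
 define ps where "ps = (\<lambda>y. \<Sum>c\<in>Basis. q c ((y - x0) \<bullet> c))"
 have ps2: "ps (y + h *\<^sub>R c) + ps (y - h *\<^sub>R c) - 2 * ps y = (if c = b then - 2 * B * h\<^sup>2 else 2 * M / r\<^sup>2 * h\<^sup>2)"
  if "c \<in> Basis" for y c
  unfolding ps_def separable_second_difference[OF that]
  using r0 by (simp add: q_def power2_eq_square field_simps)
 have psR: "ps y = q b (X y b) + (\<Sum>c\<in>Basis - {b}. M / r\<^sup>2 * (X y c)\<^sup>2)" for y
  unfolding ps_def X_def using b by (subst sum.remove[of _ b]) (auto simp: q_def)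
 have Rfin: "finite R"
 proof -
  define C where "C = {y. \<forall>c\<in>Basis. \<bar>X y c\<bar> <= r + h}"
  have "C \<subseteq> cball x0 (\<Sum>c\<in>(Basis::'a set). r + h)"
  proof
   fix y assume "y \<in> C"
   then have "norm (y - x0) <= (\<Sum>c\<in>(Basis::'a set). r + h)"
    using order_trans[OF norm_le_l1[of "y - x0"] sum_mono[of Basis "\<lambda>c. \<bar>(y - x0) \<bullet> c\<bar>" "\<lambda>_. r + h"]]
    by (auto simp: C_def X_def)
   then show "y \<in> cball x0 (\<Sum>c\<in>(Basis::'a set). r + h)" by (simp add: dist_norm norm_minus_commute)
  qed
  then have "bounded C" using bounded_subset bounded_cball by blast
  have "R \<subseteq> C \<inter> grid h"
  proof
   fix y assume y: "y \<in> R"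
   have "\<bar>X y c\<bar> <= r + h" if "c \<in> Basis" for c
   proof (cases "c = b")
    case True then show ?thesis using y h by (simp add: R_def)
   next
    case False
    then have "\<bar>X y c\<bar> <= r" using y that by (simp add: R_def)
    then show ?thesis using h by simp
   qed
   then show "y \<in> C \<inter> grid h" using y by (simp add: C_def R_def)
  qed
  then show ?thesis using finite_grid_bounded[OF h \<open>bounded C\<close>] finite_subset by blast
 qed
 have Xgrid: "\<exists>j::int. X y c = h * of_int j" if "y \<in> grid h" "c \<in> Basis" for y c
  using grid_diff[OF that(1) x0] that(2) by (auto simp: X_def grid_def)
 have Xsh: "X (y + t *\<^sub>R c) d = X y d + (if c = d then t else 0)" if "c \<in> Basis" "d \<in> Basis" for y t c d
  using that by (simp add: X_def algebra_simps inner_Basis)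
 have Xlt: "\<bar>X y c\<bar> + h <= r" if yc: "y \<in> grid h" "c \<in> Basis" "\<bar>X y c\<bar> < r" for y c
 proof -
  obtain j where j: "X y c = h * of_int j" using Xgrid yc by blast
  have "\<bar>real_of_int j\<bar> < real N" using yc(3) h r j by (simp add: abs_mult)
  then have "\<bar>j\<bar> + 1 <= int N" by linarith
  then have "\<bar>real_of_int j\<bar> + 1 <= real N" by linarith
  then have "h * (\<bar>real_of_int j\<bar> + 1) <= h * real N" using h by (intro mult_left_mono) auto
  then show ?thesis using j h r by (simp add: abs_mult algebra_simps)
 qed
 have Xltb: "X y b + h <= r + h" if yc: "y \<in> grid h" "X y b < r + h" for y
 proof -
  obtain j where j: "X y b = h * of_int j" using Xgrid yc b by blast
  have "h * real_of_int j < h * (real N + 1)" using yc(2) h r j by (simp add: algebra_simps)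
  then have "real_of_int j < real N + 1" using h by simp
  then have "j <= int N" by linarith
  then have "real_of_int j <= real N" by linarith
  then have "h * real_of_int j <= h * real N" using h by (intro mult_left_mono) auto
  then show ?thesis using j h r by (simp add: algebra_simps)
 qed
 have Xgeb: "X y b = h \<or> 2 * h <= X y b" if yc: "y \<in> grid h" "h <= X y b" for y
 proof -
  obtain j where j: "X y b = h * of_int j" using Xgrid yc b by blast
  have "j >= 1" using yc(2) h j by (simp)
  then have "j = 1 \<or> 2 <= real_of_int j" by linarith
  then show ?thesis using j h by (auto simp: mult.commute)
 qed
 have sgrid: "sg y \<in> grid h" if y: "y \<in> grid h" for y
 proof -
  obtain j where j: "X y b = h * of_int j" using Xgrid y b by blast
  have "sg y = y - (h * of_int (2 * j - 1)) *\<^sub>R b" by (simp add: sg_def j algebra_simps)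
  then show ?thesis using grid_diff[OF y grid_basis[OF b, of h "2 * j - 1"]] by simp
 qed
 have sgX: "X (sg y) c = (if c = b then h - X y b else X y c)" if "c \<in> Basis" for y c
 proof -
  have "sg y = y + (h - 2 * X y b) *\<^sub>R b" by (simp add: sg_def algebra_simps)
  then show ?thesis using Xsh[OF b that, of y "h - 2 * X y b"] by auto
 qed
 have sgsh: "sg (y + t *\<^sub>R c) = sg y + (if c = b then - t else t) *\<^sub>R c" if "c \<in> Basis" for y t c
  using Xsh[OF that b] by (auto simp: sg_def algebra_simps) (simp flip: scaleR_add_left)
 have inbd: "\<bar>(y - x0) \<bullet> c\<bar> <= r + h" "\<bar>(sg y - x0) \<bullet> c\<bar> <= r + h" if y: "y \<in> R" and c: "c \<in> Basis" for y c
 proof -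
  have *: "\<bar>X y c\<bar> <= r + h \<and> \<bar>X (sg y) c\<bar> <= r + h"
  proof (cases "c = b")
   case True then show ?thesis using y h r0 sgX[OF c, of y] by (simp add: R_def)
  next
   case False
   then have "\<bar>X y c\<bar> <= r" using y c by (simp add: R_def)
   then show ?thesis using h sgX[OF c, of y] False by simp
  qed
  show "\<bar>(y - x0) \<bullet> c\<bar> <= r + h" using * by (simp add: X_def)
  show "\<bar>(sg y - x0) \<bullet> c\<bar> <= r + h" using * by (simp add: X_def)
 qed
 have phM: "ph y <= M" if "y \<in> R" for y
 proof -
  have "\<bar>u y\<bar> <= M" using that by (intro bd inbd) (auto simp: R_def)
  moreover have "\<bar>u (sg y)\<bar> <= M" using that sgrid by (intro bd inbd) (auto simp: R_def)
  ultimately show ?thesis by (simp add: ph_def)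
 qed
 have phlap: "dlap h ph y >= - F" if "y \<in> R" for y
 proof -
  have "dlap h (\<lambda>y. u (sg y)) y = dlap h u (sg y)"
   unfolding dlap_def
  proof (rule sum.cong[OF refl])
   fix c :: 'a assume c: "c \<in> Basis"
   show "(u (sg (y + h *\<^sub>R c)) + u (sg (y - h *\<^sub>R c)) - 2 * u (sg y)) / h\<^sup>2 =
     (u (sg y + h *\<^sub>R c) + u (sg y - h *\<^sub>R c) - 2 * u (sg y)) / h\<^sup>2"
    using sgsh[OF c, of y h] sgsh[OF c, of y "-h"] by (cases "c = b") auto
  qed
  moreover have "dlap h ph y = (dlap h u y - dlap h (\<lambda>y. u (sg y)) y) / 2"
   unfolding dlap_def ph_def sum_subtractf[symmetric] sum_divide_distrib
   by (rule sum.cong[OF refl]) (simp add: diff_divide_distrib add_divide_distrib)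
  moreover have "\<bar>dlap h u y\<bar> <= F" using that by (intro lap inbd) (auto simp: R_def)
  moreover have "\<bar>dlap h u (sg y)\<bar> <= F" using that sgrid by (intro lap inbd) (auto simp: R_def)
  ultimately show ?thesis by simp
 qed
 have qb: "q b (X y b) >= 0" if "y \<in> R" for y
 proof -
  define T where "T = X y b - h/2"
  have T: "0 <= T" "T <= 3/2 * r" using that h hr by (auto simp: T_def R_def)
  have "B * T * T <= B * (3/2 * r) * T" using T B0 by (intro mult_right_mono mult_left_mono) auto
  moreover have "0 <= M / r * T" using T M r0 by simp
  moreover have "0 <= B * h\<^sup>2 / 4" using B0 by simp
  ultimately have "0 <= al * T - B * T * T + B * h\<^sup>2 / 4" by (simp add: al_def algebra_simps)
  then show ?thesis by (simp add: q_def T_def power2_eq_square)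
 qed
 have top: "ps y >= M" if y: "y \<in> R" "X y b = r + h" for y
 proof -
  define T where "T = X y b - h/2"
  have T: "r <= T" "T <= 3/2 * r" using y h hr by (auto simp: T_def)
  have "M = r * (M / r)" using r0 by simp
  also have "\<dots> <= T * (al - B * T)"
  proof (rule mult_mono)
   have "B * T <= B * (3/2 * r)" using T B0 by (intro mult_left_mono) auto
   then show "M / r <= al - B * T" by (simp add: al_def algebra_simps)
  qed (use T r0 M in auto)
  also have "\<dots> <= q b (X y b)" using B0 by (simp add: q_def T_def power2_eq_square algebra_simps)
  also have "\<dots> <= ps y" unfolding psR using M by (auto intro!: sum_nonneg)
  finally show ?thesis .
 qed
 have side: "ps y >= M" if y: "y \<in> R" "c \<in> Basis" "c \<noteq> b" "\<bar>X y c\<bar> = r" for y c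
 proof -
  have "(X y c)\<^sup>2 = r\<^sup>2" using y(4) by (metis power2_abs)
  then have "M = M / r\<^sup>2 * (X y c)\<^sup>2" using r0 by simp
  also have "\<dots> <= (\<Sum>c\<in>Basis - {b}. M / r\<^sup>2 * (X y c)\<^sup>2)"
   using y M by (intro member_le_sum) auto
  also have "\<dots> <= ps y" unfolding psR using qb[OF y(1)] by simp
  finally show ?thesis .
 qed
 have start: "x0 + h *\<^sub>R b \<in> R"
  using grid_add[OF x0 grid_basis1[OF b]] b h r0 hr by (auto simp: R_def X_def inner_Basis)
 then obtain y where y: "y \<in> R" "\<And>z. z \<in> R ==> ph z - ps z <= ph y - ps y"
  using finite_max_obtain[OF Rfin, of "\<lambda>z. ph z - ps z"] by blast
 have "ph y - ps y <= 0"
 proof (rule ccontr)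
  assume "\<not> ph y - ps y <= 0"
  then have pos: "ph y - ps y > 0" by simp
  have yg: "y \<in> grid h" using y by (simp add: R_def)
  have xb: "X y b + h <= r + h"
  proof (cases "X y b = r + h")
   case True
   then show ?thesis using top[OF y(1)] phM[OF y(1)] pos by simp
  next
   case False
   then have "X y b < r + h" using y(1) by (simp add: R_def)
   then show ?thesis by (rule Xltb[OF yg])
  qed
  have xc: "\<bar>X y c\<bar> + h <= r" if "c \<in> Basis" "c \<noteq> b" for c
  proof (cases "\<bar>X y c\<bar> = r")
   case True
   then show ?thesis using side[OF y(1) that] phM[OF y(1)] pos by simp
  next
   case False
   then have "\<bar>X y c\<bar> < r" using y(1) that by (auto simp: R_def less_le)
   then show ?thesis by (rule Xlt[OF yg that(1)])
  qed
  have D: "(ph (y + h *\<^sub>R c) - ps (y + h *\<^sub>R c)) + (ph (y - h *\<^sub>R c) - ps (y - h *\<^sub>R c)) - 2 * (ph y - ps y) <= 0"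
   if c: "c \<in> Basis" for c
  proof -
   have g: "y + h *\<^sub>R c \<in> grid h" "y - h *\<^sub>R c \<in> grid h"
    using grid_add[OF yg grid_basis1[OF c]] grid_diff[OF yg grid_basis1[OF c]] by auto
   have mem: "y + t *\<^sub>R c \<in> R" if t: "\<bar>t\<bar> = h" "y + t *\<^sub>R c \<in> grid h" "c = b ==> h <= X y b + t" for t
   proof -
    have "\<bar>X (y + t *\<^sub>R c) d\<bar> <= r" if d: "d \<in> Basis - {b}" for d
    proof (cases "c = d")
     case True
     have "\<bar>X y c\<bar> + h <= r" using xc True d by auto
     then show ?thesis using True t(1) Xsh[of c d y t] c d by auto
    next
     case False
     then show ?thesis using Xsh[of c d y t] c d y(1) by (auto simp: R_def)
    qed
    moreover have "h <= X (y + t *\<^sub>R c) b \<and> X (y + t *\<^sub>R c) b <= r + h"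
    proof (cases "c = b")
     case True then show ?thesis using t Xsh[OF c b, of y t] xb by auto
    next
     case False then show ?thesis using Xsh[OF c b, of y t] y(1) by (auto simp: R_def)
    qed
    ultimately show ?thesis using t(2) by (simp add: R_def)
   qed
   have hb: "h <= X y b" using y(1) by (simp add: R_def)
   have up: "y + h *\<^sub>R c \<in> R" using mem[of h] g h hb by simp
   \<comment> \<open>The lower neighbour can leave \<open>R\<close> only from the layer at height
     \<open>h\<close>. It is then the mirror image of \<open>y\<close>, so \<open>ph\<close> changes
     sign there while the two barrier values have nonnegative sum.\<close>
   have dn: "ph (y - h *\<^sub>R c) - ps (y - h *\<^sub>R c) <= ph y - ps y"
   proof (cases "c = b \<and> X y b = h")
    case False
    then have "c = b ==> h <= X y b + (- h)" using Xgeb[OF yg hb] by auto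
    then have "y - h *\<^sub>R c \<in> R" using mem[of "- h"] g h by simp
    then show ?thesis by (rule y(2))
   next
    case True
    have "sg y = y - h *\<^sub>R c" "sg (y - h *\<^sub>R c) = y"
     using True sgsh[OF b, of y "-h"] by (auto simp: sg_def)
    then have "ph (y - h *\<^sub>R c) = - ph y" unfolding ph_def by (simp only:) argo
    moreover have "ps (y - h *\<^sub>R c) + ps y >= 0"
    proof -
     have "ps (y - h *\<^sub>R c) + ps y >= q b (X (y - h *\<^sub>R c) b) + q b (X y b)"
     proof -
      have "(\<Sum>c\<in>Basis - {b}. M / r\<^sup>2 * (X z c)\<^sup>2) >= 0" for z
       using M by (intro sum_nonneg) auto
      from this[of "y - h *\<^sub>R c"] this[of y] show ?thesis unfolding psR by linarith
     qed
     moreover have "X (y - h *\<^sub>R c) b = 0" using True Xsh[OF b b, of y "-h"] by simp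
     ultimately show ?thesis using True by (simp add: q_def power2_eq_square field_simps)
    qed
    ultimately show ?thesis using pos by simp
   qed
   show ?thesis using y(2)[OF up] dn by simp
  qed
  have "dlap h ph y - (\<Sum>c\<in>Basis. (if c = b then - 2 * B else 2 * M / r\<^sup>2)) = 
   (\<Sum>c\<in>Basis. ((ph (y + h *\<^sub>R c) - ps (y + h *\<^sub>R c)) + (ph (y - h *\<^sub>R c) - ps (y - h *\<^sub>R c)) - 2 * (ph y - ps y)) / h\<^sup>2)"
   unfolding dlap_def sum_subtractf[symmetric]
  proof (rule sum.cong[OF refl])
   fix c :: 'a assume c: "c \<in> Basis"
   have "(if c = b then - 2 * B else 2 * M / r\<^sup>2) = (ps (y + h *\<^sub>R c) + ps (y - h *\<^sub>R c) - 2 * ps y) / h\<^sup>2"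
    unfolding ps2[OF c] using h by auto
   then show "(ph (y + h *\<^sub>R c) + ph (y - h *\<^sub>R c) - 2 * ph y) / h\<^sup>2 - (if c = b then - 2 * B else 2 * M / r\<^sup>2) =
     ((ph (y + h *\<^sub>R c) - ps (y + h *\<^sub>R c)) + (ph (y - h *\<^sub>R c) - ps (y - h *\<^sub>R c)) - 2 * (ph y - ps y)) / h\<^sup>2"
    by (simp add: diff_divide_distrib add_divide_distrib)
  qed
  also have "\<dots> <= 0" using D h by (intro sum_nonpos divide_nonpos_nonneg) auto
  finally have "dlap h ph y <= (\<Sum>c\<in>Basis. (if c = b then - 2 * B else 2 * M / r\<^sup>2))" by simp
  also have "\<dots> = - 2 * B + (\<Sum>c\<in>Basis - {b}. 2 * M / r\<^sup>2)"
   using b by (subst sum.remove[of _ b]) (auto intro!: sum.cong)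
  also have "\<dots> = - 2 * B + (n - 1) * (2 * M / r\<^sup>2)"
   using b by (simp add: n_def card_Diff_singleton of_nat_diff DIM_positive Suc_leI)
  also have "\<dots> = - F - 2 * M / r\<^sup>2" by (simp add: B_def algebra_simps add_divide_distrib diff_divide_distrib)
  finally have "2 * M / r\<^sup>2 <= 0" using phlap[OF y(1)] by simp
  then show False using M r0 by (simp add: field_simps)
 qed
 then have "ph (x0 + h *\<^sub>R b) <= ps (x0 + h *\<^sub>R b)" using y(2)[OF start] by simp
 also have "ps (x0 + h *\<^sub>R b) = al * h / 2"
 proof -
  have "X (x0 + h *\<^sub>R b) c = (if c = b then h else 0)" if "c \<in> Basis" for c
   using Xsh[OF b that, of x0 h] by (auto simp: X_def)
  then show ?thesis unfolding psR using b by (simp add: q_def power2_eq_square field_simps)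
 qed
 finally have "u (x0 + h *\<^sub>R b) - u (sg (x0 + h *\<^sub>R b)) <= al * h" by (simp add: ph_def)
 moreover have "sg (x0 + h *\<^sub>R b) = x0" using b by (simp add: sg_def X_def inner_Basis)
 moreover have "al = M / r * (1 + 3/2 * n) + 3/4 * F * r"
  using r0 by (simp add: al_def B_def field_simps power2_eq_square)
 ultimately show ?thesis by (simp add: n_def mult.commute)
qed

lemma discrete_gradient_estimate:
 fixes u :: "'a::euclidean_space \<Rightarrow> real"
 assumes h: "h > 0" and N: "N >= (1::nat)" and r: "r = real N * h" and b: "b \<in> Basis"
  and x0: "x0 \<in> grid h" and M: "M > 0" and F: "F >= 0"
  and bd: "\<And>y. y \<in> grid h ==> (\<And>c. c \<in> Basis ==> \<bar>(y - x0) \<bullet> c\<bar> <= r + h) ==> \<bar>u y\<bar> <= M"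
  and lap: "\<And>y. y \<in> grid h ==> (\<And>c. c \<in> Basis ==> \<bar>(y - x0) \<bullet> c\<bar> <= r + h) ==> \<bar>dlap h u y\<bar> <= F"
 shows "\<bar>fdiff h b u x0\<bar> <= M / r * (1 + 3/2 * real DIM('a)) + 3/4 * F * r"
proof -
 define K where "K = M / r * (1 + 3/2 * real DIM('a)) + 3/4 * F * r"
 have 1: "u (x0 + h *\<^sub>R b) - u x0 <= h * K"
  unfolding K_def by (rule discrete_gradient_estimate_upper[OF h N r b x0 M F bd lap])
 have "dlap h (\<lambda>y. - u y) y = - dlap h u y" for y
  unfolding dlap_def sum_negf[symmetric] using h by (intro sum.cong) (auto simp: field_simps)
 then have 2: "- u (x0 + h *\<^sub>R b) - (- u x0) <= h * K"
  unfolding K_def by (intro discrete_gradient_estimate_upper[OF h N r b x0 M F]) (use bd lap in auto)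
 have "\<bar>u (x0 + h *\<^sub>R b) - u x0\<bar> <= h * K" using 1 2 by simp
 then show ?thesis unfolding fdiff_def K_def[symmetric] abs_divide using h by (simp add: pos_divide_le_eq mult.commute)
qed

section \<open>Product rules for differences, and rounding to the grid\<close>

lemma dlap_eq_sum_fdiff:
 assumes "h \<noteq> 0" shows "dlap h u x = (\<Sum>b\<in>Basis. fdiff h b (fdiff h b u) (x - h *\<^sub>R b))"
 unfolding dlap_def fdiff_def using assms
 by (intro sum.cong) (auto simp: power2_eq_square diff_divide_distrib add_divide_distrib)

lemma dlap_fdiff: "dlap h (fdiff h b u) x = fdiff h b (dlap h u) x"
proof -
 have "fdiff h b (dlap h u) x = (\<Sum>c\<in>Basis. ((u (x + h *\<^sub>R b + h *\<^sub>R c) + u (x + h *\<^sub>R b - h *\<^sub>R c) - 2 * u (x + h *\<^sub>R b)) / h\<^sup>2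
   - (u (x + h *\<^sub>R c) + u (x - h *\<^sub>R c) - 2 * u x) / h\<^sup>2) / h)"
  unfolding fdiff_def dlap_def sum_divide_distrib sum_subtractf[symmetric] diff_divide_distrib[symmetric] by simp
 also have "\<dots> = dlap h (fdiff h b u) x"
  unfolding dlap_def fdiff_def
  by (rule sum.cong[OF refl]) (simp add: diff_divide_distrib add_divide_distrib algebra_simps)
 finally show ?thesis ..
qed

lemma fdiff_mult:
 "fdiff h b (\<lambda>x. p x * q x) = (\<lambda>x. p (x + h *\<^sub>R b) * fdiff h b q x + fdiff h b p x * q x)"
 by (rule ext) (simp add: fdiff_def diff_divide_distrib algebra_simps)

lemma fdiff_add: "fdiff h b (\<lambda>x. p x + q x) = (\<lambda>x. fdiff h b p x + fdiff h b q x)"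
 by (rule ext) (simp add: fdiff_def diff_divide_distrib add_divide_distrib)

lemma fdiff_shift: "fdiff h b (\<lambda>x. p (x + h *\<^sub>R c)) = (\<lambda>x. fdiff h b p (x + h *\<^sub>R c))"
 by (rule ext) (simp add: fdiff_def algebra_simps)

text \<open>Rounds down to the grid, coordinate by coordinate. Functions on grids of different mesh
  thus become step functions on the whole space and can be compared at a fixed point.\<close>

definition gfloor :: "real \<Rightarrow> 'a::euclidean_space \<Rightarrow> 'a" where
 "gfloor h x = (\<Sum>b\<in>Basis. (h * of_int \<lfloor>(x \<bullet> b) / h\<rfloor>) *\<^sub>R b)"

lemma gfloor_inner: "b \<in> Basis ==> gfloor h x \<bullet> b = h * of_int \<lfloor>(x \<bullet> b) / h\<rfloor>"
 unfolding gfloor_def by (simp add: inner_sum_left inner_Basis if_distrib cong: if_cong)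

lemma gfloor_grid: "gfloor h x \<in> grid h"
 unfolding grid_def by (auto simp: gfloor_inner)

lemma gfloor_close:
 assumes "h > 0" "b \<in> Basis"
 shows "gfloor h x \<bullet> b <= x \<bullet> b" "x \<bullet> b < gfloor h x \<bullet> b + h" "\<bar>(gfloor h x - x) \<bullet> b\<bar> <= h"
proof -
 have f: "of_int \<lfloor>(x \<bullet> b) / h\<rfloor> <= (x \<bullet> b) / h" "(x \<bullet> b) / h < of_int \<lfloor>(x \<bullet> b) / h\<rfloor> + 1" by linarith+
 show 1: "gfloor h x \<bullet> b <= x \<bullet> b" using mult_left_mono[OF f(1), of h] assms by (simp add: gfloor_inner)
 show 2: "x \<bullet> b < gfloor h x \<bullet> b + h" using mult_strict_left_mono[OF f(2), of h] assms by (simp add: gfloor_inner distrib_left)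
 show "\<bar>(gfloor h x - x) \<bullet> b\<bar> <= h" using 1 2 by (simp add: inner_diff_left)
qed

section \<open>Discrete Schroedinger operators on a convex domain\<close>

locale schroedinger_domain =
 fixes Om :: "'a::euclidean_space set" and V :: "'a \<Rightarrow> real" and gV :: "'a \<Rightarrow> 'a" and M :: real
 assumes open_Om: "open Om" and convex_Om: "convex Om" and bounded_Om: "bounded Om" and Om_ne: "Om \<noteq> {}"
  and V_deriv: "\<And>x. x \<in> Om ==> (V has_derivative (\<lambda>v. gV x \<bullet> v)) (at x)"
  and V_bound: "\<And>x. x \<in> Om ==> \<bar>V x\<bar> <= M"
  and gV_bound: "\<And>x. x \<in> Om ==> norm (gV x) <= M"
  and gV_lip: "\<And>x y. x \<in> Om ==> y \<in> Om ==> norm (gV x - gV y) <= M * norm (x - y)"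
begin

definition box_nbd :: "'a \<Rightarrow> real \<Rightarrow> 'a \<Rightarrow> bool" where
 "box_nbd p r x \<longleftrightarrow> (\<forall>b\<in>Basis. \<bar>(x - p) \<bullet> b\<bar> <= r)"

lemma M_nonneg: "M >= 0" using V_bound Om_ne by force

lemma box_nbd_Om:
 assumes "p \<in> Om" obtains r where "r > 0" "\<And>x. box_nbd p r x ==> x \<in> Om"
proof -
 obtain e where e: "e > 0" "ball p e \<subseteq> Om" using open_Om assms open_contains_ball by blast
 define r where "r = e / (2 * real DIM('a))"
 have "x \<in> Om" if "box_nbd p r x" for x
 proof -
  have "norm (x - p) <= (\<Sum>b\<in>Basis. \<bar>(x - p) \<bullet> b\<bar>)" by (rule norm_le_l1)
  also have "\<dots> <= (\<Sum>b\<in>(Basis::'a set). r)" using that by (intro sum_mono) (auto simp: box_nbd_def)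
  also have "\<dots> < e" using e by (simp add: r_def)
  finally show ?thesis using e by (auto simp: dist_norm norm_minus_commute subset_iff)
 qed
 then show ?thesis using that[of r] e by (simp add: r_def)
qed

text \<open>The variational half of being a lowest eigenvalue. A single test function then bounds
  \<open>l\<close> from above uniformly in \<open>h\<close>.\<close>

definition rayleigh_bound :: "real \<Rightarrow> real \<Rightarrow> bool" where
 "rayleigh_bound h l \<longleftrightarrow> (\<forall>w. (\<forall>x. x \<notin> Om \<inter> grid h --> w x = 0) -->
   l * (\<Sum>x\<in>Om \<inter> grid h. (w x)\<^sup>2) <= (\<Sum>x\<in>Om \<inter> grid h. w x * (V x * w x - dlap h w x)))"

lemma discrete_ground_state:
 assumes h: "h > 0" and ne: "Om \<inter> grid h \<noteq> {}"
 obtains u l where "\<And>x. 0 <= u x" "\<And>x. u x <= 1" "\<And>x. x \<notin> Om \<inter> grid h ==> u x = 0"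
  "\<exists>x\<in>Om \<inter> grid h. u x = 1"
  "\<And>x. x \<in> Om \<inter> grid h ==> dlap h u x = (V x - l) * u x"
  "rayleigh_bound h l"
proof -
 define A where "A = Om \<inter> grid h"
 have fin: "finite A" unfolding A_def by (rule finite_grid_bounded[OF h bounded_Om])
 \<comment> \<open>Matrix of \<open>V - dlap h\<close> on \<open>A\<close>. Neighbours outside
   \<open>A\<close> are simply dropped, which is the Dirichlet condition.\<close>
 define a where "a = (\<lambda>x y. (if y = x then V x else 0) +
  (\<Sum>b\<in>Basis. (2 * (if y = x then 1 else 0) - (if y = x + h *\<^sub>R b then 1 else 0) - (if y = x - h *\<^sub>R b then 1 else 0)) / h\<^sup>2))"
 have asym: "a x y = a y x" if "x \<in> A" "y \<in> A" for x y
 proof -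
  have "(\<Sum>b\<in>Basis. (2 * (if y = x then 1 else 0) - (if y = x + h *\<^sub>R b then 1 else 0) - (if y = x - h *\<^sub>R b then 1 else 0)) / h\<^sup>2)
   = (\<Sum>b\<in>Basis. (2 * (if x = y then 1 else 0) - (if x = y + h *\<^sub>R b then 1 else 0) - (if x = y - h *\<^sub>R b then 1 else 0)) / h\<^sup>2)"
  proof (rule sum.cong[OF refl])
   fix b
   have "(y = x + h *\<^sub>R b) = (x = y - h *\<^sub>R b)" "(y = x - h *\<^sub>R b) = (x = y + h *\<^sub>R b)" "(y = x) = (x = y)"
    by (auto simp: algebra_simps)
   then show "(2 * (if y = x then 1 else 0) - (if y = x + h *\<^sub>R b then 1 else 0) - (if y = x - h *\<^sub>R b then 1 else 0)) / h\<^sup>2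
    = (2 * (if x = y then 1 else 0) - (if x = y + h *\<^sub>R b then 1 else 0) - (if x = y - h *\<^sub>R b then 1 else 0)) / h\<^sup>2"
    by simp
  qed
  then show ?thesis by (simp add: a_def)
 qed
 have aoff: "a x y <= 0" if "x \<in> A" "y \<in> A" "x \<noteq> y" for x y
  unfolding a_def using that by (auto intro!: sum_nonpos divide_nonpos_nonneg)
 have aw: "(\<Sum>y\<in>A. a x y * w y) = V x * w x - dlap h w x"
  if x: "x \<in> A" and w: "\<And>y. y \<notin> A ==> w y = 0" for x w
 proof -
  have delta: "(\<Sum>y\<in>A. (if y = z then 1 else 0) * w y) = w z" for z
   using fin w[of z] by (simp add: if_distrib[where f = "\<lambda>t. t * _"] cong: if_cong)
  have "(\<Sum>y\<in>A. a x y * w y) = (\<Sum>y\<in>A. (if y = x then V x else 0) * w y) +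
    (\<Sum>y\<in>A. \<Sum>b\<in>Basis. (2 * ((if y = x then 1 else 0) * w y) - (if y = x + h *\<^sub>R b then 1 else 0) * w y - (if y = x - h *\<^sub>R b then 1 else 0) * w y) / h\<^sup>2)"
   unfolding a_def distrib_right sum.distrib sum_distrib_right
   by (intro arg_cong2[where f = "(+)"] sum.cong refl) (auto simp: algebra_simps diff_divide_distrib)
  also have "(\<Sum>y\<in>A. (if y = x then V x else 0) * w y) = V x * w x"
   using fin x by (simp add: if_distrib[where f = "\<lambda>t. t * _"] cong: if_cong)
  also have "(\<Sum>y\<in>A. \<Sum>b\<in>Basis. (2 * ((if y = x then 1 else 0) * w y) - (if y = x + h *\<^sub>R b then 1 else 0) * w y - (if y = x - h *\<^sub>R b then 1 else 0) * w y) / h\<^sup>2)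
   = (\<Sum>b\<in>Basis. \<Sum>y\<in>A. (2 * ((if y = x then 1 else 0) * w y) - (if y = x + h *\<^sub>R b then 1 else 0) * w y - (if y = x - h *\<^sub>R b then 1 else 0) * w y) / h\<^sup>2)"
   by (rule sum.swap)
  also have "\<dots> = (\<Sum>b\<in>Basis. (2 * w x - w (x + h *\<^sub>R b) - w (x - h *\<^sub>R b)) / h\<^sup>2)"
   unfolding sum_divide_distrib[symmetric] sum_subtractf sum_distrib_left[symmetric] delta ..
  also have "\<dots> = - dlap h w x"
   unfolding dlap_def sum_negf[symmetric] using h by (intro sum.cong) (auto simp: field_simps)
  finally show ?thesis by simp
 qed
 obtain u l where u: "\<And>x. 0 <= u x" "\<And>x. x \<notin> A ==> u x = 0" "\<exists>x\<in>A. u x \<noteq> 0"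
  "\<And>x. x \<in> A ==> (\<Sum>y\<in>A. a x y * u y) = l * u x"
  "\<And>w. l * (\<Sum>x\<in>A. (w x)\<^sup>2) <= (\<Sum>x\<in>A. w x * (\<Sum>y\<in>A. a x y * w y))"
  by (rule finite_ground_state[OF fin ne[folded A_def], of a, OF asym aoff]) (assumption | rule that)+
 obtain m where m: "m \<in> A" "\<And>x. x \<in> A ==> u x <= u m"
  using finite_max_obtain[OF fin, of u] ne unfolding A_def by blast
 have um: "u m > 0"
  using u(1,3) m(2) by (metis less_eq_real_def less_le_trans)
 \<comment> \<open>Normalising the maximum to \<open>1\<close>, rather than the Euclidean norm,
   gives a supremum bound uniform in the mesh and a point that keeps the limit away from
   zero.\<close>
 define v where "v = (\<lambda>x. u x / u m)"
 have dv: "dlap h v x = dlap h u x / u m" for x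
  unfolding dlap_def v_def sum_divide_distrib using um h by (intro sum.cong) (auto simp: field_simps)
 show ?thesis
 proof (rule that[of v l])
  show "0 <= v x" for x using u(1) um by (simp add: v_def)
  show "v x <= 1" for x using u(2)[of x] m(2)[of x] um by (cases "x \<in> A") (auto simp: v_def)
  show "x \<notin> Om \<inter> grid h ==> v x = 0" for x using u(2) by (simp add: v_def A_def)
  show "\<exists>x\<in>Om \<inter> grid h. v x = 1" using m(1) um by (auto simp: v_def A_def)
  show "dlap h v x = (V x - l) * v x" if "x \<in> Om \<inter> grid h" for x
  proof -
   have "x \<in> A" using that A_def by simp
   from u(4)[OF this] aw[OF this, of u] u(2) have "dlap h u x = (V x - l) * u x" by (simp add: algebra_simps)
   then show ?thesis unfolding dv by (simp add: v_def)
  qed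
  show "rayleigh_bound h l" unfolding rayleigh_bound_def
  proof (intro allI impI)
  fix w assume w: "\<forall>x. x \<notin> Om \<inter> grid h --> w x = (0::real)"
  have "(\<Sum>x\<in>A. w x * (\<Sum>y\<in>A. a x y * w y)) = (\<Sum>x\<in>A. w x * (V x * w x - dlap h w x))"
   by (rule sum.cong[OF refl]) (use aw[of _ w] w A_def in auto)
  then show "l * (\<Sum>x\<in>Om \<inter> grid h. (w x)\<^sup>2) <= (\<Sum>x\<in>Om \<inter> grid h. w x * (V x * w x - dlap h w x))"
   using u(5)[of w] by (simp add: A_def)
  qed
 qed
qed

text \<open>The test function is a product of cosines supported in a grid cube, an exact eigenfunction
 of the discrete Laplacian there.\<close>

lemma discrete_eigenvalue_upper:
 obtains h0 C where "h0 > 0" "\<And>h. 0 < h ==> h <= h0 ==> Om \<inter> grid h \<noteq> {}"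
  "\<And>h l. 0 < h ==> h <= h0 ==> rayleigh_bound h l ==> l <= C"
proof -
 obtain p where p: "p \<in> Om" using Om_ne by auto
 obtain r where r: "r > 0" "\<And>x. box_nbd p r x ==> x \<in> Om" using box_nbd_Om[OF p] by blast
 define C where "C = real DIM('a) * (2 * pi / r)\<^sup>2 + M"
 have c_box: "box_nbd p r (gfloor h p)" if "0 < h" "h <= r / 4" for h
  unfolding box_nbd_def
 proof
  fix b :: 'a assume "b \<in> Basis"
  from gfloor_close(3)[OF that(1) this, of p] show "\<bar>(gfloor h p - p) \<bullet> b\<bar> <= r" using that r by linarith
 qed
 show ?thesis
 proof (rule that[of "r / 4" C])
  show "Om \<inter> grid h \<noteq> {}" if "0 < h" "h <= r / 4" for h
   using r(2)[OF c_box[OF that]] gfloor_grid by blast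
  fix h l assume h: "0 < h" "h <= r / 4" and min: "rayleigh_bound h l"
  define A where "A = Om \<inter> grid h"
  have fin: "finite A" unfolding A_def by (rule finite_grid_bounded[OF h(1) bounded_Om])
  define c where "c = gfloor h p"
  have cg: "c \<in> grid h" unfolding c_def by (rule gfloor_grid)
  \<comment> \<open>The cube has half side \<open>L\<close>, a multiple of the mesh between
    \<open>r / 4\<close> and \<open>r / 2\<close>; with the rounding error of its centre it stays in
    the box of radius \<open>r\<close>.\<close>
  define N where "N = nat \<lfloor>r / (2 * h)\<rfloor>"
  define L where "L = h * real N"
  have "2 <= r / (2 * h)" using h by (simp add: field_simps)
  then have N: "real N <= r / (2 * h)" "r / (2 * h) - 1 <= real N" "1 <= N" 
   unfolding N_def by linarith+
  have L: "r / 4 <= L" "L <= r / 2" "0 < L"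
  proof -
   have "h * real N <= h * (r / (2 * h))" using N(1) h by (intro mult_left_mono) auto
   then show "L <= r / 2" using h by (simp add: L_def)
   have "h * (r / (2 * h) - 1) <= h * real N" using N(2) h by (intro mult_left_mono) auto
   then have "r / 2 - h <= L" using h by (simp add: L_def algebra_simps)
   then show "r / 4 <= L" using h by simp
   then show "0 < L" using r by simp
  qed
  define s where "s = (\<lambda>t. if \<bar>t\<bar> < L then cos (pi * t / (2 * L)) else 0)"
  define w where "w = (\<lambda>x. if x \<in> grid h then (\<Prod>b\<in>Basis. s ((x - c) \<bullet> b)) else 0)"
  have supp: "w x = 0" if "x \<notin> A" for x
  proof (rule ccontr)
   assume "w x \<noteq> 0"
   then have g: "x \<in> grid h" and s0: "\<And>b. b \<in> Basis ==> s ((x - c) \<bullet> b) \<noteq> 0" by (auto simp: w_def split: if_splits)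
   have "box_nbd p r x"
    unfolding box_nbd_def
   proof
    fix b :: 'a assume b: "b \<in> Basis"
    have "\<bar>(x - c) \<bullet> b\<bar> < L" using s0[OF b] by (auto simp: s_def split: if_splits)
    moreover have "\<bar>(c - p) \<bullet> b\<bar> <= h" unfolding c_def by (rule gfloor_close(3)[OF h(1) b])
    ultimately show "\<bar>(x - p) \<bullet> b\<bar> <= r" using L h by (simp add: inner_diff_left)
   qed
   then show False using r(2) g that by (auto simp: A_def)
  qed
  have wc: "w c = 1" using cg L by (simp add: w_def s_def)
  then have cA: "c \<in> A" using supp[of c] by auto
  have key: "w x * (V x * w x - dlap h w x) <= C * (w x)\<^sup>2" if x: "x \<in> A" for x
  proof (cases "w x = 0")
   case False
   have g: "x \<in> grid h" using x by (simp add: A_def)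
   have s0: "s ((x - c) \<bullet> b) \<noteq> 0" if "b \<in> Basis" for b using False that by (auto simp: w_def split: if_splits)
   define th where "th = pi * h / (2 * L)"
   have dir: "w (x + h *\<^sub>R b) + w (x - h *\<^sub>R b) = 2 * cos th * w x" if b: "b \<in> Basis" for b
   proof -
    define t where "t = (x - c) \<bullet> b"
    have tL: "\<bar>t\<bar> < L" using s0[OF b] by (auto simp: s_def t_def split: if_splits)
    obtain j :: int where j: "t = h * of_int j" using grid_diff[OF g cg] b by (auto simp: grid_def t_def)
    have "h * \<bar>real_of_int j\<bar> < h * real N" using tL h by (simp add: j abs_mult L_def)
    then have "\<bar>real_of_int j\<bar> < real N" using h by simp
    then have "\<bar>j\<bar> + 1 <= int N" by linarith
    then have "\<bar>real_of_int j\<bar> + 1 <= real N" by linarith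
    then have "h * (\<bar>real_of_int j\<bar> + 1) <= h * real N" using h by (intro mult_left_mono) auto
    then have tL': "\<bar>t\<bar> + h <= L" using h by (simp add: j abs_mult L_def algebra_simps)
    \<comment> \<open>Since \<open>L\<close> is a multiple of \<open>h\<close>, the neighbours of an
      interior point reach at most \<open>L\<close> or \<open>- L\<close>, where the cosine
      vanishes. Truncation therefore does not disturb the eigenfunction identity.\<close>
    have sh: "s (t + e) = cos (pi * (t + e) / (2 * L))" if "\<bar>e\<bar> = h" for e
    proof (cases "\<bar>t + e\<bar> < L")
     case False
     then have "\<bar>t + e\<bar> = L" using tL' that by linarith
     then consider "t + e = L" | "t + e = - L" by linarith
     then have "cos (pi * (t + e) / (2 * L)) = 0" using L by cases auto
     then show ?thesis using False by (simp add: s_def)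
    qed (simp add: s_def)
    have "s (t + h) + s (t - h) = 2 * cos th * s t"
    proof -
     have "pi * (t + h) / (2 * L) = pi * t / (2 * L) + th" "pi * (t + - h) / (2 * L) = pi * t / (2 * L) - th"
      by (auto simp: th_def add_divide_distrib diff_divide_distrib algebra_simps)
     then show ?thesis using sh[of h] sh[of "- h"] h tL by (simp add: cos_add cos_diff s_def)
    qed
    moreover have "w (x + e *\<^sub>R b) = s (t + e) * (\<Prod>d\<in>Basis - {b}. s ((x - c) \<bullet> d))"
     if "x + e *\<^sub>R b \<in> grid h" for e
    proof -
     have "w (x + e *\<^sub>R b) = s ((x + e *\<^sub>R b - c) \<bullet> b) * (\<Prod>d\<in>Basis - {b}. s ((x + e *\<^sub>R b - c) \<bullet> d))"
      using that b by (simp add: w_def prod.remove)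
     also have "(x + e *\<^sub>R b - c) \<bullet> b = t + e" using b by (simp add: t_def algebra_simps)
     also have "(\<Prod>d\<in>Basis - {b}. s ((x + e *\<^sub>R b - c) \<bullet> d)) = (\<Prod>d\<in>Basis - {b}. s ((x - c) \<bullet> d))"
      using b by (intro prod.cong) (auto simp: algebra_simps inner_Basis)
     finally show ?thesis .
    qed
    from this[of h] this[of "- h"] this[of 0]
    have "w (x + h *\<^sub>R b) = s (t + h) * (\<Prod>d\<in>Basis - {b}. s ((x - c) \<bullet> d))"
     "w (x - h *\<^sub>R b) = s (t - h) * (\<Prod>d\<in>Basis - {b}. s ((x - c) \<bullet> d))"
     "w x = s t * (\<Prod>d\<in>Basis - {b}. s ((x - c) \<bullet> d))"
     using grid_add[OF g grid_basis1[OF b]] grid_diff[OF g grid_basis1[OF b]] g by auto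
    ultimately show ?thesis by (simp add: distrib_right[symmetric])
   qed
   have "dlap h w x = (\<Sum>b\<in>(Basis::'a set). (2 * cos th - 2) * w x / h\<^sup>2)"
    unfolding dlap_def by (rule sum.cong[OF refl]) (simp only: dir left_diff_distrib)
   then have dl: "dlap h w x = real DIM('a) * ((2 * cos th - 2) / h\<^sup>2) * w x" by simp
   have "cos th >= 1 - th\<^sup>2 / 2"
   proof -
    have "cos th = 1 - 2 * (sin (th / 2))\<^sup>2" using cos_double_sin[of "th / 2"] by simp
    moreover have "(sin (th / 2))\<^sup>2 <= (th / 2)\<^sup>2" using abs_sin_x_le_abs_x[of "th / 2"] abs_le_square_iff by blast
    ultimately show ?thesis by (simp add: power_divide)
   qed
   then have "(2 - 2 * cos th) / h\<^sup>2 <= th\<^sup>2 / h\<^sup>2" by (intro divide_right_mono) auto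
   also have "th\<^sup>2 / h\<^sup>2 = (pi / (2 * L))\<^sup>2" using h by (simp add: th_def power_divide power_mult_distrib)
   also have "\<dots> <= (2 * pi / r)\<^sup>2"
    using L r by (intro power_mono) (auto simp: field_simps)
   finally have "real DIM('a) * ((2 - 2 * cos th) / h\<^sup>2) <= real DIM('a) * (2 * pi / r)\<^sup>2" by (intro mult_left_mono) auto
   moreover have "V x <= M" using V_bound[of x] x by (simp add: A_def)
   ultimately have "V x + real DIM('a) * ((2 - 2 * cos th) / h\<^sup>2) <= C" by (simp add: C_def)
   then have "(V x + real DIM('a) * ((2 - 2 * cos th) / h\<^sup>2)) * (w x)\<^sup>2 <= C * (w x)\<^sup>2" by (intro mult_right_mono) auto
   moreover have "w x * (V x * w x - dlap h w x) = (V x + real DIM('a) * ((2 - 2 * cos th) / h\<^sup>2)) * (w x)\<^sup>2"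
    unfolding dl by (simp add: power2_eq_square algebra_simps diff_divide_distrib)
   ultimately show ?thesis by simp
  qed simp
  have "l * (\<Sum>x\<in>A. (w x)\<^sup>2) <= (\<Sum>x\<in>A. w x * (V x * w x - dlap h w x))"
   using min[unfolded rayleigh_bound_def, rule_format, of w] supp unfolding A_def by blast
  also have "\<dots> <= (\<Sum>x\<in>A. C * (w x)\<^sup>2)" by (intro sum_mono key)
  also have "\<dots> = C * (\<Sum>x\<in>A. (w x)\<^sup>2)" by (simp add: sum_distrib_left)
  finally have "l * (\<Sum>x\<in>A. (w x)\<^sup>2) <= C * (\<Sum>x\<in>A. (w x)\<^sup>2)" .
  moreover have "(\<Sum>x\<in>A. (w x)\<^sup>2) > 0"
   using fin cA wc by (intro sum_pos2[of A c]) auto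
  ultimately show "l <= C" by simp
 qed (use r in auto)
qed

text \<open>At a maximum the discrete Laplacian is nonpositive, so the equation forces
  \<open>V x <= l\<close> there.\<close>

lemma discrete_eigenvalue_lower:
 assumes h: "h > 0" and u: "\<And>x. u x <= 1" "x \<in> Om" "u x = 1" "dlap h u x = (V x - l) * u x"
 shows "- M <= l"
proof -
 have "dlap h u x <= 0" unfolding dlap_def using u h
  by (intro sum_nonpos divide_nonpos_nonneg) (auto simp: add_mono intro!: order_trans[OF add_mono[OF u(1) u(1)]])
 then show ?thesis using u V_bound[of x] by simp
qed

text \<open>Comparison with the quadratic \<open>W\<close> in the distance \<open>s\<close> to a
  supporting hyperplane, on which the discrete Laplacian is exactly \<open>- 2 K\<close>. The
  resulting decay at the boundary is linear and uniform in the mesh, and rests on supporting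
  hyperplanes alone; the term \<open>h\<close> pays for neighbours that overshoot the hyperplane by
  up to one step.\<close>

lemma discrete_half_space_barrier:
 fixes nu :: 'a
 assumes h: "h > 0" "h <= D" and nu: "norm nu = 1" and half: "\<And>x. x \<in> Om ==> 0 < t - x \<bullet> nu \<and> t - x \<bullet> nu <= D"
  and u: "\<And>x. u x <= 1" "\<And>x. 0 <= u x" "\<And>x. x \<notin> Om \<inter> grid h ==> u x = 0"
  "\<And>x. x \<in> Om \<inter> grid h ==> dlap h u x = (V x - l) * u x" and l: "l <= C" and C: "C >= 0"
  and x: "x \<in> Om"
 shows "u x <= 3 * (C + M + 1) * D * (t - x \<bullet> nu + h)"
proof -
 define A where "A = Om \<inter> grid h"
 define K where "K = C + M + 1"
 have K: "K > 0" using C M_nonneg by (simp add: K_def)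
 have D: "D > 0" using h by simp
 define s where "s = (\<lambda>x. t - x \<bullet> nu)"
 define W where "W = (\<lambda>x. K * (2 * D * s x - (s x)\<^sup>2))"
 have rhs: "0 <= 3 * K * D * (s x + h)" using half[OF x] K D h by (auto simp: s_def)
 show ?thesis
 proof (cases "x \<in> A")
  case False
  then show ?thesis using rhs u(3)[of x] by (auto simp: A_def K_def s_def)
 next
  case True
  have fin: "finite A" unfolding A_def by (rule finite_grid_bounded[OF h(1) bounded_Om])
  obtain y where y: "y \<in> A" "\<And>z. z \<in> A ==> u z - W z <= u y - W y"
   using finite_max_obtain[OF fin, of "\<lambda>z. u z - W z"] True by blast
  have W2: "W (y + h *\<^sub>R b) + W (y - h *\<^sub>R b) - 2 * W y = - 2 * K * h\<^sup>2 * (nu \<bullet> b)\<^sup>2" for b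
   by (simp add: W_def s_def power2_eq_square algebra_simps inner_commute)
  have dW: "dlap h W y = - 2 * K"
  proof -
   have "dlap h W y = (\<Sum>b\<in>Basis. - 2 * K * (nu \<bullet> b)\<^sup>2)"
    unfolding dlap_def W2 using h by (intro sum.cong) auto
   also have "\<dots> = - 2 * K * (\<Sum>b\<in>Basis. (nu \<bullet> b)\<^sup>2)" by (simp add: sum_distrib_left)
   also have "(\<Sum>b\<in>Basis. (nu \<bullet> b)\<^sup>2) = nu \<bullet> nu" by (simp add: euclidean_inner[of nu nu] power2_eq_square)
   also have "nu \<bullet> nu = 1" using nu by (simp add: norm_eq_1)
   finally show ?thesis by simp
  qed
  have du: "dlap h u y >= - (C + M)"
  proof -
   have yO: "y \<in> Om" using y by (simp add: A_def)
   have "(V y - l) * u y >= - (C + M)"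
   proof (cases "V y - l >= 0")
    case True
    then have "0 <= (V y - l) * u y" using u(2) by simp
    then show ?thesis using C M_nonneg by linarith
   next
    case False
    then have "(V y - l) * u y >= V y - l" using mult_left_mono_neg[OF u(1)[of y], of "V y - l"] by simp
    then show ?thesis using V_bound[OF yO] l by linarith
   qed
   then show ?thesis using u(4)[of y] y by (simp add: A_def)
  qed
  \<comment> \<open>At the maximum of \<open>u - W\<close> over \<open>A\<close> some neighbour must
    carry a larger value; otherwise the discrete Laplacian of \<open>u - W\<close> would be
    nonpositive, whereas it is at least \<open>2 K - (C + M) > 0\<close>. That neighbour lies
    outside \<open>A\<close>, where \<open>u\<close> vanishes.\<close>
  have "\<exists>b\<in>Basis. \<exists>e. \<bar>e\<bar> = h \<and> u (y + e *\<^sub>R b) - W (y + e *\<^sub>R b) > u y - W y"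
  proof (rule ccontr)
   assume "\<not> ?thesis"
   then have le: "u (y + e *\<^sub>R b) - W (y + e *\<^sub>R b) <= u y - W y" if "b \<in> Basis" "\<bar>e\<bar> = h" for b e
    using that by force
   have "dlap h u y - dlap h W y <= 0"
    unfolding dlap_def sum_subtractf[symmetric]
   proof (rule sum_nonpos)
    fix b :: 'a assume b: "b \<in> Basis"
    have "u (y + h *\<^sub>R b) + u (y - h *\<^sub>R b) - 2 * u y - (W (y + h *\<^sub>R b) + W (y - h *\<^sub>R b) - 2 * W y) <= 0"
     using le[OF b, of h] le[OF b, of "- h"] h by simp
    then show "(u (y + h *\<^sub>R b) + u (y - h *\<^sub>R b) - 2 * u y) / h\<^sup>2 - (W (y + h *\<^sub>R b) + W (y - h *\<^sub>R b) - 2 * W y) / h\<^sup>2 <= 0"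
     unfolding diff_divide_distrib[symmetric] by (rule divide_nonpos_nonneg) simp
   qed
   then show False using du dW K K_def C M_nonneg by simp
  qed
  then obtain b e where be: "b \<in> Basis" "\<bar>e\<bar> = h" "u (y + e *\<^sub>R b) - W (y + e *\<^sub>R b) > u y - W y" by blast
  define z where "z = y + e *\<^sub>R b"
  have "z \<notin> A" using y(2)[of z] be by (auto simp: z_def)
  then have uz: "u z = 0" using u(3) by (simp add: A_def)
  have sy: "0 < s y" "s y <= D" using half[of y] y by (auto simp: s_def A_def)
  have sz: "\<bar>s z - s y\<bar> <= h"
  proof -
   have "\<bar>b \<bullet> nu\<bar> <= 1" using Basis_le_norm[OF be(1), of nu] nu by (simp add: inner_commute)
   moreover have "s z - s y = - (e * (b \<bullet> nu))" by (simp add: s_def z_def algebra_simps)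
   then have "\<bar>s z - s y\<bar> = h * \<bar>b \<bullet> nu\<bar>" using be(2) by (simp add: abs_mult)
   ultimately show ?thesis using h by (simp add: mult_left_le)
  qed
  have Wz: "- W z <= 3 * K * D * h"
  proof -
   have "- (s z * (2 * D - s z)) <= 3 * D * h"
   proof (cases "s z >= 0")
    case True
    then have "0 <= s z * (2 * D - s z)" using sz sy h by (intro mult_nonneg_nonneg) auto
    then show ?thesis using D h by (smt (verit) mult_nonneg_nonneg)
   next
    case False
    have "(- s z) * (2 * D - s z) <= h * (3 * D)" using False sz sy h by (intro mult_mono) auto
    then show ?thesis by (simp add: mult.commute)
   qed
   then have "K * (- (s z * (2 * D - s z))) <= K * (3 * D * h)" using K by (intro mult_left_mono) auto
   then show ?thesis by (simp add: W_def power2_eq_square algebra_simps)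
  qed
  have "u x - W x <= - W z" using y(2)[OF True] be(3) uz by (simp add: z_def)
  moreover have "W x <= 3 * K * D * s x"
  proof -
   have "s x * (2 * D - s x) <= s x * (3 * D)" using half[OF x] D by (intro mult_left_mono) (auto simp: s_def)
   then have "K * (s x * (2 * D - s x)) <= K * (s x * (3 * D))" by (rule mult_left_mono) (use K in simp)
   then show ?thesis by (simp add: W_def power2_eq_square algebra_simps)
  qed
  ultimately show ?thesis using Wz by (simp add: K_def s_def algebra_simps)
 qed
qed

end

section \<open>Interior bounds uniform in the mesh size\<close>

definition hk :: "nat \<Rightarrow> real" where "hk k = inverse (real (Suc k))"

lemma hk_pos: "hk k > 0" and hk_le_1: "hk k <= 1" by (auto simp: hk_def field_simps)

lemma hk_tendsto: "hk \<longlonglongrightarrow> 0" unfolding hk_def by (rule LIMSEQ_inverse_real_of_nat)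

lemma eventually_hk_le: "e > 0 ==> \<forall>\<^sub>F k in sequentially. hk k <= e"
 using order_tendstoD(2)[OF hk_tendsto, of e] by (auto elim: eventually_mono)

lemma grid_line_bound:
 assumes h: "h > 0" and "\<And>i. i < j ==> \<bar>fdiff h b w (x + (real i * h) *\<^sub>R b)\<bar> <= C"
 shows "\<bar>w (x + (real j * h) *\<^sub>R b) - w x\<bar> <= C * (real j * h)"
 using assms(2)
proof (induction j)
 case (Suc j)
 have e: "x + (real (Suc j) * h) *\<^sub>R b = x + (real j * h) *\<^sub>R b + h *\<^sub>R b" by (simp add: algebra_simps)
 have "\<bar>fdiff h b w (x + (real j * h) *\<^sub>R b)\<bar> * h <= C * h" using Suc.prems[of j] h by (intro mult_right_mono) auto
 then have "\<bar>w (x + (real (Suc j) * h) *\<^sub>R b) - w (x + (real j * h) *\<^sub>R b)\<bar> <= C * h"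
  unfolding e fdiff_def using h by (simp add: abs_divide)
 moreover have "\<bar>w (x + (real j * h) *\<^sub>R b) - w x\<bar> <= C * (real j * h)" using Suc by auto
 ultimately show ?case by (simp add: algebra_simps)
qed simp

lemma grid_line_taylor:
 assumes h: "h > 0" and C: "C >= 0" and d2: "\<And>i. i < j ==> \<bar>fdiff h b (fdiff h b w) (x + (real i * h) *\<^sub>R b)\<bar> <= C"
 shows "\<bar>w (x + (real j * h) *\<^sub>R b) - w x - (real j * h) * fdiff h b w x\<bar> <= C * (real j * h)\<^sup>2"
 using d2
proof (induction j)
 case (Suc j)
 have e: "x + (real (Suc j) * h) *\<^sub>R b = x + (real j * h) *\<^sub>R b + h *\<^sub>R b" by (simp add: algebra_simps)
 define q where "q = fdiff h b w (x + (real j * h) *\<^sub>R b)"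
 have 1: "w (x + (real (Suc j) * h) *\<^sub>R b) = w (x + (real j * h) *\<^sub>R b) + h * q"
  unfolding e q_def fdiff_def using h by simp
 have 2: "\<bar>q - fdiff h b w x\<bar> <= C * (real j * h)"
  unfolding q_def by (rule grid_line_bound[OF h]) (use Suc.prems in auto)
 then have "h * \<bar>q - fdiff h b w x\<bar> <= h * (C * (real j * h))" using h by (intro mult_left_mono) auto
 then have 3: "\<bar>h * (q - fdiff h b w x)\<bar> <= C * (real j * h * h)" unfolding abs_mult using h by (simp add: algebra_simps)
 have 4: "\<bar>w (x + (real j * h) *\<^sub>R b) - w x - (real j * h) * fdiff h b w x\<bar> <= C * (real j * h)\<^sup>2" using Suc by auto
 have "w (x + (real (Suc j) * h) *\<^sub>R b) - w x - (real (Suc j) * h) * fdiff h b w x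
   = (w (x + (real j * h) *\<^sub>R b) - w x - (real j * h) * fdiff h b w x) + h * (q - fdiff h b w x)"
  unfolding 1 by (simp add: algebra_simps)
 also have "\<bar>\<dots>\<bar> <= C * (real j * h)\<^sup>2 + C * (real j * h * h)" using 3 4 by linarith
 also have "\<dots> <= C * (real (Suc j) * h)\<^sup>2"
 proof -
  have "(real j * h)\<^sup>2 + real j * h * h <= (real (Suc j) * h)\<^sup>2"
   using h by (simp add: power2_eq_square algebra_simps)
  then show ?thesis using C by (simp add: distrib_left[symmetric] mult_left_mono)
 qed
 finally show ?case .
qed simp

context schroedinger_domain
begin

lemma box_nbd_mono: "box_nbd p r x ==> r <= r' ==> box_nbd p r' x"
 unfolding box_nbd_def by force

lemma box_nbd_shift:
 assumes "box_nbd p r x" "\<And>b. b \<in> Basis ==> \<bar>(y - x) \<bullet> b\<bar> <= e" shows "box_nbd p (r + e) y"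
 unfolding box_nbd_def
proof
 fix b :: 'a assume b: "b \<in> Basis"
 have "\<bar>(x - p) \<bullet> b\<bar> <= r" using assms(1) b by (simp add: box_nbd_def)
 then show "\<bar>(y - p) \<bullet> b\<bar> <= r + e" using assms(2)[OF b] by (simp add: inner_diff_left)
qed

lemma box_nbd_basis:
 assumes "box_nbd p r x" "b \<in> Basis" "\<bar>t\<bar> <= e" shows "box_nbd p (r + e) (x + t *\<^sub>R b)"
 by (rule box_nbd_shift[OF assms(1)]) (use assms in \<open>auto simp: inner_Basis\<close>)

lemma grid_box_lipschitz:
 assumes h: "h > 0" and C: "\<And>z b. b \<in> Basis ==> z \<in> grid h ==> box_nbd p r z ==> \<bar>fdiff h b w z\<bar> <= C"
  and x: "x \<in> grid h" "box_nbd p r x" and y: "y \<in> grid h" "box_nbd p r y"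
 shows "\<bar>w y - w x\<bar> <= C * (\<Sum>b\<in>Basis. \<bar>(y - x) \<bullet> b\<bar>)"
proof -
 have line0: "\<bar>w (z + (h * of_int j) *\<^sub>R b) - w z\<bar> <= C * \<bar>h * of_int j\<bar>"
  if b: "b \<in> Basis" and z: "z \<in> grid h" "box_nbd p r z" "box_nbd p r (z + (h * of_int j) *\<^sub>R b)" and j: "j >= 0" for z b j
 proof -
  obtain n where n: "j = int n" using j nonneg_int_cases by blast
  have "\<bar>w (z + (real n * h) *\<^sub>R b) - w z\<bar> <= C * (real n * h)"
  proof (rule grid_line_bound[OF h])
   fix i assume i: "i < n"
   show "\<bar>fdiff h b w (z + (real i * h) *\<^sub>R b)\<bar> <= C"
   proof (rule C[OF b])
    show "z + (real i * h) *\<^sub>R b \<in> grid h"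
     using grid_add[OF z(1) grid_basis[OF b, of h "int i"]] by (simp add: mult.commute)
    have "0 <= real i * h" "real i * h <= real n * h" using i h by (auto intro: mult_right_mono)
    then show "box_nbd p r (z + (real i * h) *\<^sub>R b)"
     unfolding box_nbd_def
    proof (intro ballI)
     fix c :: 'a assume c: "c \<in> Basis"
     have "\<bar>(z - p) \<bullet> c\<bar> <= r" "\<bar>(z + (real n * h) *\<^sub>R b - p) \<bullet> c\<bar> <= r"
      using z c by (auto simp: box_nbd_def n mult.commute)
     then show "\<bar>(z + (real i * h) *\<^sub>R b - p) \<bullet> c\<bar> <= r"
      using \<open>0 <= real i * h\<close> \<open>real i * h <= real n * h\<close> b c
      by (cases "b = c") (auto simp: inner_diff_left inner_add_left inner_Basis)
    qed
   qed
  qed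
  then show ?thesis using h by (simp add: n mult.commute abs_mult)
 qed
 have line: "\<bar>w (z + t *\<^sub>R b) - w z\<bar> <= C * \<bar>t\<bar>"
  if b: "b \<in> Basis" and z: "z \<in> grid h" "box_nbd p r z" "box_nbd p r (z + t *\<^sub>R b)" and t: "t = h * of_int j" for z b t j
 proof (cases "j >= 0")
  case True then show ?thesis using line0[OF b z(1,2), of j] z(3) t by simp
 next
  case False
  define z' where "z' = z + t *\<^sub>R b"
  have zz: "z = z' + (h * of_int (- j)) *\<^sub>R b" by (simp add: z'_def t)
  have g: "z' \<in> grid h" unfolding z'_def t using grid_add[OF z(1) grid_basis[OF b]] .
  have "\<bar>w (z' + (h * of_int (- j)) *\<^sub>R b) - w z'\<bar> <= C * \<bar>h * of_int (- j)\<bar>"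
  proof (rule line0[OF b g])
   show "box_nbd p r z'" unfolding z'_def by (rule z(3))
   show "box_nbd p r (z' + (h * of_int (- j)) *\<^sub>R b)" unfolding zz[symmetric] by (rule z(2))
  qed (use False in simp)
  then have "\<bar>w z - w z'\<bar> <= C * \<bar>h * of_int (- j)\<bar>" unfolding zz[symmetric] .
  then show ?thesis by (simp add: z'_def t abs_minus_commute)
 qed
 \<comment> \<open>Replaces the coordinates of \<open>x\<close> by those of \<open>y\<close> one at
   a time. Each intermediate point takes every coordinate from \<open>x\<close> or from
   \<open>y\<close>, so it stays in the box and on the grid.\<close>
 define Z where "Z = (\<lambda>B. x + (\<Sum>b\<in>B. ((y - x) \<bullet> b) *\<^sub>R b))"
 have Zc: "Z B \<bullet> c = (if c \<in> B then y \<bullet> c else x \<bullet> c)" if "B \<subseteq> Basis" "c \<in> Basis" for B c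
 proof -
  have "(\<Sum>b\<in>B. ((y - x) \<bullet> b) *\<^sub>R b) \<bullet> c = (\<Sum>b\<in>B. if b = c then (y - x) \<bullet> b else 0)"
   unfolding inner_sum_left using that by (intro sum.cong) (auto simp: inner_Basis)
  also have "\<dots> = (if c \<in> B then (y - x) \<bullet> c else 0)"
   using finite_subset[OF that(1) finite_Basis] by simp
  finally show ?thesis by (simp add: Z_def inner_add_left inner_diff_left)
 qed
 have Zg: "Z B \<in> grid h" if "B \<subseteq> Basis" for B
  unfolding grid_def
 proof (intro CollectI ballI)
  fix c :: 'a assume c: "c \<in> Basis"
  show "\<exists>j::int. Z B \<bullet> c = h * of_int j"
   using x(1) y(1) c unfolding Zc[OF that c] grid_def by (cases "c \<in> B") auto
 qed
 have Zb: "box_nbd p r (Z B)" if "B \<subseteq> Basis" for B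
  unfolding box_nbd_def
 proof
  fix c :: 'a assume c: "c \<in> Basis"
  show "\<bar>(Z B - p) \<bullet> c\<bar> <= r"
   using x(2) y(2) c unfolding inner_diff_left Zc[OF that c] box_nbd_def by (cases "c \<in> B") auto
 qed
 have "\<bar>w (Z B) - w x\<bar> <= C * (\<Sum>b\<in>B. \<bar>(y - x) \<bullet> b\<bar>)" if "B \<subseteq> Basis" for B
  using finite_subset[OF that finite_Basis] that
 proof (induction B rule: finite_induct)
  case empty then show ?case by (simp add: Z_def)
 next
  case (insert a B)
  have a: "a \<in> Basis" "B \<subseteq> Basis" using insert.prems by auto
  have e: "Z (insert a B) = Z B + ((y - x) \<bullet> a) *\<^sub>R a" using insert.hyps by (simp add: Z_def algebra_simps)
  obtain j :: int where j: "(y - x) \<bullet> a = h * of_int j" using grid_diff[OF y(1) x(1)] a by (auto simp: grid_def)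
  have "\<bar>w (Z (insert a B)) - w (Z B)\<bar> <= C * \<bar>(y - x) \<bullet> a\<bar>"
   unfolding e by (rule line[OF a(1) Zg[OF a(2)] Zb[OF a(2)] _ j]) (use Zb[OF insert.prems] e in simp)
  then show ?case using insert.IH[OF a(2)] insert.hyps by (simp add: distrib_left)
 qed
 from this[of Basis] show ?thesis by (simp add: Z_def euclidean_representation)
qed

text \<open>Validity near \<open>p\<close> on all sufficiently fine grids. The radius is fixed
  before the mesh, so a shift by one mesh step is absorbed by halving the radius.\<close>

definition locat :: "'a \<Rightarrow> (nat \<Rightarrow> 'a \<Rightarrow> bool) \<Rightarrow> bool" where
 "locat p P \<longleftrightarrow> (\<exists>r>0. \<forall>\<^sub>F k in sequentially. \<forall>x\<in>grid (hk k). box_nbd p r x --> P k x)"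

text \<open>Local boundedness uniform in the mesh. The class is closed under sums, products, shifts
  and local modification, so a bootstrap reduces to following the syntax of the difference
  quotients.\<close>

definition locb :: "(nat \<Rightarrow> 'a \<Rightarrow> real) \<Rightarrow> bool" where
 "locb w \<longleftrightarrow> (\<forall>p\<in>Om. \<exists>C. locat p (\<lambda>k x. \<bar>w k x\<bar> <= C))"

lemma locat_mono: "locat p P ==> (\<And>k x. P k x ==> Q k x) ==> locat p Q"
 unfolding locat_def
proof (elim exE conjE)
 fix r :: real assume r: "\<And>k x. P k x ==> Q k x" "0 < r"
  "\<forall>\<^sub>F k in sequentially. \<forall>x\<in>grid (hk k). box_nbd p r x --> P k x"
 from r(3) have "\<forall>\<^sub>F k in sequentially. \<forall>x\<in>grid (hk k). box_nbd p r x --> Q k x"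
  by (rule eventually_mono) (use r(1) in blast)
 then show "\<exists>r>0. \<forall>\<^sub>F k in sequentially. \<forall>x\<in>grid (hk k). box_nbd p r x --> Q k x"
  using r(2) by blast
qed

lemma locat_conj:
 assumes "locat p P" "locat p Q" shows "locat p (\<lambda>k x. P k x \<and> Q k x)"
proof -
 obtain r s where r: "r > 0" "\<forall>\<^sub>F k in sequentially. \<forall>x\<in>grid (hk k). box_nbd p r x --> P k x"
  and s: "s > 0" "\<forall>\<^sub>F k in sequentially. \<forall>x\<in>grid (hk k). box_nbd p s x --> Q k x"
  using assms unfolding locat_def by blast
 show ?thesis unfolding locat_def
 proof (intro exI[of _ "min r s"] conjI)
  show "\<forall>\<^sub>F k in sequentially. \<forall>x\<in>grid (hk k). box_nbd p (min r s) x --> P k x \<and> Q k x"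
   using r(2) s(2)
   by eventually_elim (meson box_nbd_mono min.cobounded1 min.cobounded2)
 qed (use r s in auto)
qed

lemma locat_shift:
 assumes "locat p P" "b \<in> Basis" shows "locat p (\<lambda>k x. P k (x + hk k *\<^sub>R b))"
proof -
 obtain r where r: "r > 0" "\<forall>\<^sub>F k in sequentially. \<forall>x\<in>grid (hk k). box_nbd p r x --> P k x"
  using assms unfolding locat_def by blast
 have h: "\<forall>\<^sub>F k in sequentially. hk k <= r / 2" using r by (intro eventually_hk_le) auto
 show ?thesis unfolding locat_def
 proof (intro exI[of _ "r / 2"] conjI)
  show "\<forall>\<^sub>F k in sequentially. \<forall>x\<in>grid (hk k). box_nbd p (r / 2) x --> P k (x + hk k *\<^sub>R b)"
   using r(2) h
  proof eventually_elim
   case (elim k)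
   show ?case
   proof (intro ballI impI)
    fix x assume x: "x \<in> grid (hk k)" "box_nbd p (r / 2) x"
    have "box_nbd p (r / 2 + r / 2) (x + hk k *\<^sub>R b)"
     using x assms(2) elim(2) hk_pos[of k] by (intro box_nbd_basis) auto
    then show "P k (x + hk k *\<^sub>R b)" using elim(1) grid_add[OF x(1) grid_basis1[OF assms(2)]] by simp
   qed
  qed
 qed (use r in auto)
qed

lemma locat_Om: assumes "p \<in> Om" shows "locat p (\<lambda>k x. x \<in> Om \<and> x \<in> grid (hk k))"
proof -
 obtain r where "r > 0" "\<And>x. box_nbd p r x ==> x \<in> Om" using box_nbd_Om[OF assms] by blast
 then show ?thesis unfolding locat_def by (intro exI[of _ r]) auto
qed

lemma locat_eventually: "\<forall>\<^sub>F k in sequentially. \<forall>x. P k x ==> locat p P"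
 unfolding locat_def by (rule exI[of _ 1]) (auto elim: eventually_mono)

lemma locbD: "locb w ==> p \<in> Om ==> \<exists>C. locat p (\<lambda>k x. \<bar>w k x\<bar> <= C)"
 unfolding locb_def by blast

lemma locb_cong:
 assumes "locb w'" "\<And>p. p \<in> Om ==> locat p (\<lambda>k x. w k x = w' k x)" shows "locb w"
 unfolding locb_def
proof
 fix p assume p: "p \<in> Om"
 obtain C where "locat p (\<lambda>k x. \<bar>w' k x\<bar> <= C)" using locbD[OF assms(1) p] by blast
 from locat_conj[OF this assms(2)[OF p]] show "\<exists>C. locat p (\<lambda>k x. \<bar>w k x\<bar> <= C)"
  by (intro exI[of _ C]) (erule locat_mono, auto)
qed

lemma locb_add:
 assumes "locb w" "locb v" shows "locb (\<lambda>k x. w k x + v k x)"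
 unfolding locb_def
proof
 fix p assume p: "p \<in> Om"
 obtain C D where "locat p (\<lambda>k x. \<bar>w k x\<bar> <= C)" "locat p (\<lambda>k x. \<bar>v k x\<bar> <= D)"
  using locbD[OF assms(1) p] locbD[OF assms(2) p] by blast
 from locat_conj[OF this] show "\<exists>C. locat p (\<lambda>k x. \<bar>w k x + v k x\<bar> <= C)"
  by (intro exI[of _ "C + D"]) (erule locat_mono, auto)
qed

lemma locb_mult:
 assumes "locb w" "locb v" shows "locb (\<lambda>k x. w k x * v k x)"
 unfolding locb_def
proof
 fix p assume p: "p \<in> Om"
 obtain C D where "locat p (\<lambda>k x. \<bar>w k x\<bar> <= C)" "locat p (\<lambda>k x. \<bar>v k x\<bar> <= D)"
  using locbD[OF assms(1) p] locbD[OF assms(2) p] by blast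
 from locat_conj[OF this] have "locat p (\<lambda>k x. \<bar>w k x * v k x\<bar> <= C * D)"
 proof (rule locat_mono)
  fix k x assume "\<bar>w k x\<bar> <= C \<and> \<bar>v k x\<bar> <= D"
  then show "\<bar>w k x * v k x\<bar> <= C * D" unfolding abs_mult
   by (meson abs_ge_zero mult_mono order_trans)
 qed
 then show "\<exists>C. locat p (\<lambda>k x. \<bar>w k x * v k x\<bar> <= C)" ..
qed

lemma locb_shift: "locb w ==> b \<in> Basis ==> locb (\<lambda>k x. w k (x + hk k *\<^sub>R b))"
 unfolding locb_def using locat_shift by blast

lemma locb_bounded: "(\<And>k x. \<bar>w k x\<bar> <= C) ==> locb w"
 unfolding locb_def by (blast intro: locat_eventually always_eventually)

lemma locb_Om_bounded: "(\<And>k x. x \<in> Om ==> \<bar>w k x\<bar> <= C) ==> locb w"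
 unfolding locb_def by (blast intro: locat_mono[OF locat_Om])

text \<open>The discrete gradient estimate in this language: a bound on the discrete Laplacian gains
  one difference. This is the engine of the bootstrap.\<close>

lemma locb_fdiff:
 assumes w: "locb w" "locb (\<lambda>k. dlap (hk k) (w k))" and b: "b \<in> Basis"
 shows "locb (\<lambda>k. fdiff (hk k) b (w k))"
 unfolding locb_def
proof
 fix p assume p: "p \<in> Om"
 obtain C D where "locat p (\<lambda>k x. \<bar>w k x\<bar> <= C)" "locat p (\<lambda>k x. \<bar>dlap (hk k) (w k) x\<bar> <= D)"
  using locbD[OF w(1) p] locbD[OF w(2) p] by blast
 from locat_conj[OF this] obtain r where r: "r > 0"
  "\<forall>\<^sub>F k in sequentially. \<forall>x\<in>grid (hk k). box_nbd p r x --> \<bar>w k x\<bar> <= C \<and> \<bar>dlap (hk k) (w k) x\<bar> <= D"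
  unfolding locat_def by blast
 define C' D' where "C' = \<bar>C\<bar> + 1" and "D' = \<bar>D\<bar>"
 define E where "E = C' / (r / 8) * (1 + 3/2 * real DIM('a)) + 3/4 * D' * (r / 4)"
 have h: "\<forall>\<^sub>F k in sequentially. hk k <= r / 8" using r by (intro eventually_hk_le) auto
 have "\<forall>\<^sub>F k in sequentially. \<forall>x\<in>grid (hk k). box_nbd p (r / 4) x --> \<bar>fdiff (hk k) b (w k) x\<bar> <= E"
  using r(2) h
 proof eventually_elim
  case (elim k)
  show ?case
  proof (intro ballI impI)
   fix x assume x: "x \<in> grid (hk k)" "box_nbd p (r / 4) x"
   define h where "h = hk k"
   have h: "h > 0" "h <= r / 8" using hk_pos[of k] elim by (auto simp: h_def)
   \<comment> \<open>Half side of the estimation box: the largest multiple of the mesh below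
     \<open>r / 4\<close>, hence at least \<open>r / 8\<close>, which makes the bound
     \<open>E\<close> independent of \<open>k\<close>.\<close>
   define N where "N = nat \<lfloor>r / (4 * h)\<rfloor>"
   have "2 <= r / (4 * h)" using h by (simp add: field_simps)
   then have N: "real N <= r / (4 * h)" "r / (4 * h) - 1 <= real N" "1 <= N"
    unfolding N_def by linarith+
   define rr where "rr = real N * h"
   have "rr <= r / (4 * h) * h" unfolding rr_def using N h by (intro mult_right_mono) auto
   then have rr1: "rr <= r / 4" using h by simp
   have "(r / (4 * h) - 1) * h <= rr" unfolding rr_def using N h by (intro mult_right_mono) auto
   then have "r / 4 - h <= rr" using h by (simp add: left_diff_distrib)
   then have rr2: "r / 8 <= rr" using h by simp
   have inbox: "box_nbd p r y" if "\<And>c. c \<in> Basis ==> \<bar>(y - x) \<bullet> c\<bar> <= rr + h" for y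
    using box_nbd_mono[OF box_nbd_shift[OF x(2) that], of r] rr1 h r by simp
   have "\<bar>fdiff h b (w k) x\<bar> <= C' / rr * (1 + 3/2 * real DIM('a)) + 3/4 * D' * rr"
   proof (rule discrete_gradient_estimate[OF h(1) N(3) rr_def b])
    show "x \<in> grid h" using x by (simp add: h_def)
    show "C' > 0" "D' >= 0" by (auto simp: C'_def D'_def)
    fix y :: 'a assume y: "y \<in> grid h" "\<And>c. c \<in> Basis ==> \<bar>(y - x) \<bullet> c\<bar> <= rr + h"
    have "\<bar>w k y\<bar> <= C \<and> \<bar>dlap h (w k) y\<bar> <= D" using elim(1) y(1) inbox[OF y(2)] by (simp add: h_def)
    then show "\<bar>w k y\<bar> <= C'" "\<bar>dlap h (w k) y\<bar> <= D'" by (auto simp: C'_def D'_def)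
   qed
   also have "\<dots> <= E" unfolding E_def
    using rr1 rr2 r by (intro add_mono mult_right_mono mult_left_mono divide_left_mono) (auto simp: C'_def D'_def)
   finally show "\<bar>fdiff (hk k) b (w k) x\<bar> <= E" by (simp add: h_def)
  qed
 qed
 then show "\<exists>C. locat p (\<lambda>k x. \<bar>fdiff (hk k) b (w k) x\<bar> <= C)"
  unfolding locat_def using r by (intro exI[of _ E] exI[of _ "r / 4"]) auto
qed

lemma onorm_inner_le: "onorm (\<lambda>v. a \<bullet> v) <= norm a"
proof (rule onorm_bound)
 show "norm (a \<bullet> v) <= norm a * norm v" for v using Cauchy_Schwarz_ineq2[of a v] by simp
qed simp

lemma V_lipschitz: "x \<in> Om ==> y \<in> Om ==> \<bar>V x - V y\<bar> <= M * norm (x - y)"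
proof -
 assume "x \<in> Om" "y \<in> Om"
 then have "norm (V x - V y) <= M * norm (x - y)"
 proof (intro differentiable_bound[OF convex_Om, of V "\<lambda>x v. gV x \<bullet> v" M x y])
  fix z assume z: "z \<in> Om"
  show "(V has_derivative (\<lambda>v. gV z \<bullet> v)) (at z within Om)" by (rule has_derivative_at_withinI[OF V_deriv[OF z]])
  show "onorm (\<lambda>v. gV z \<bullet> v) <= M" by (rule order_trans[OF onorm_inner_le gV_bound[OF z]])
 qed
 then show ?thesis by simp
qed

lemma locb_V1: assumes "b \<in> Basis" shows "locb (\<lambda>k. fdiff (hk k) b V)"
 unfolding locb_def
proof
 fix p assume p: "p \<in> Om"
 show "\<exists>C. locat p (\<lambda>k x. \<bar>fdiff (hk k) b V x\<bar> <= C)"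
 proof (intro exI[of _ M], rule locat_mono[OF locat_conj[OF locat_Om[OF p] locat_shift[OF locat_Om[OF p] assms]]])
  fix k x assume "(x \<in> Om \<and> x \<in> grid (hk k)) \<and> (x + hk k *\<^sub>R b \<in> Om \<and> x + hk k *\<^sub>R b \<in> grid (hk k))"
  then have "\<bar>V (x + hk k *\<^sub>R b) - V x\<bar> <= M * hk k"
   using V_lipschitz[of "x + hk k *\<^sub>R b" x] hk_pos[of k] assms by simp
  then show "\<bar>fdiff (hk k) b V x\<bar> <= M" using hk_pos[of k] by (simp add: fdiff_def abs_divide field_simps)
 qed
qed

text \<open>Only a Lipschitz bound for the gradient is at hand, so the mixed second difference is
  estimated by the mean value inequality for \<open>V (z + h c) - V z\<close>, whose gradient is at
  most \<open>M h\<close>. The convex set \<open>T\<close> is where both points lie in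
  \<open>Om\<close>.\<close>

lemma locb_V2: assumes b: "b \<in> Basis" and c: "c \<in> Basis" shows "locb (\<lambda>k. fdiff (hk k) c (fdiff (hk k) b V))"
 unfolding locb_def
proof
 fix p assume p: "p \<in> Om"
 note L = locat_conj[OF locat_Om[OF p] locat_shift[OF locat_Om[OF p] c]]
 show "\<exists>C. locat p (\<lambda>k x. \<bar>fdiff (hk k) c (fdiff (hk k) b V) x\<bar> <= C)"
 proof (intro exI[of _ M], rule locat_mono[OF locat_conj[OF L locat_shift[OF L b]]])
  fix k x
  assume A: "((x \<in> Om \<and> x \<in> grid (hk k)) \<and> x + hk k *\<^sub>R c \<in> Om \<and> x + hk k *\<^sub>R c \<in> grid (hk k)) \<and>
    (x + hk k *\<^sub>R b \<in> Om \<and> x + hk k *\<^sub>R b \<in> grid (hk k)) \<and>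
    x + hk k *\<^sub>R b + hk k *\<^sub>R c \<in> Om \<and> x + hk k *\<^sub>R b + hk k *\<^sub>R c \<in> grid (hk k)"
  define h where "h = hk k"
  have h: "h > 0" using hk_pos h_def by simp
  define T where "T = Om \<inter> {z. z + h *\<^sub>R c \<in> Om}"
  have cT: "convex T"
  proof -
   have "convex {z. z + h *\<^sub>R c \<in> Om}"
   proof (rule convexI)
    fix y z :: 'a and a b :: real
    assume A: "y \<in> {z. z + h *\<^sub>R c \<in> Om}" "z \<in> {z. z + h *\<^sub>R c \<in> Om}" "0 <= a" "0 <= b" "a + b = 1"
    have "a *\<^sub>R (y + h *\<^sub>R c) + b *\<^sub>R (z + h *\<^sub>R c) \<in> Om"
     using A by (intro convexD[OF convex_Om]) auto
    moreover have "a *\<^sub>R (y + h *\<^sub>R c) + b *\<^sub>R (z + h *\<^sub>R c) = a *\<^sub>R y + b *\<^sub>R z + (a + b) *\<^sub>R (h *\<^sub>R c)"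
     by (simp add: algebra_simps)
    ultimately show "a *\<^sub>R y + b *\<^sub>R z \<in> {z. z + h *\<^sub>R c \<in> Om}" using A by simp
   qed
   then show ?thesis unfolding T_def using convex_Om by (simp add: convex_Int)
  qed
  have "norm ((V (x + h *\<^sub>R b + h *\<^sub>R c) - V (x + h *\<^sub>R b)) - (V (x + h *\<^sub>R c) - V x)) <= (M * h) * norm (x + h *\<^sub>R b - x)"
  proof (rule differentiable_bound[OF cT, of "\<lambda>z. V (z + h *\<^sub>R c) - V z" "\<lambda>z v. gV (z + h *\<^sub>R c) \<bullet> v - gV z \<bullet> v"])
   fix z assume z: "z \<in> T"
   have "((\<lambda>z. z + h *\<^sub>R c) has_derivative (\<lambda>v. v)) (at z)" by (auto intro!: derivative_eq_intros)
   from has_derivative_compose[OF this, of V] V_deriv[of "z + h *\<^sub>R c"] z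
   have "((\<lambda>z. V (z + h *\<^sub>R c)) has_derivative (\<lambda>v. gV (z + h *\<^sub>R c) \<bullet> v)) (at z)" by (auto simp: T_def)
   then show "((\<lambda>z. V (z + h *\<^sub>R c) - V z) has_derivative (\<lambda>v. gV (z + h *\<^sub>R c) \<bullet> v - gV z \<bullet> v)) (at z within T)"
    using has_derivative_at_withinI[OF has_derivative_diff[OF _ V_deriv[of z]]] z by (simp add: T_def)
   have "onorm (\<lambda>v. gV (z + h *\<^sub>R c) \<bullet> v - gV z \<bullet> v) <= norm (gV (z + h *\<^sub>R c) - gV z)"
    using onorm_inner_le[of "gV (z + h *\<^sub>R c) - gV z"] by (simp add: inner_diff_left)
   also have "\<dots> <= M * norm (z + h *\<^sub>R c - z)" using z by (intro gV_lip) (auto simp: T_def)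
   finally show "onorm (\<lambda>v. gV (z + h *\<^sub>R c) \<bullet> v - gV z \<bullet> v) <= M * h" using h c by simp
  next
   show "x + h *\<^sub>R b \<in> T" "x \<in> T" using A unfolding T_def h_def by blast+
  qed
  then have "\<bar>(V (x + h *\<^sub>R b + h *\<^sub>R c) - V (x + h *\<^sub>R b)) - (V (x + h *\<^sub>R c) - V x)\<bar> <= M * h * h" using h b by simp
  moreover have "fdiff h c (fdiff h b V) x = ((V (x + h *\<^sub>R b + h *\<^sub>R c) - V (x + h *\<^sub>R b)) - (V (x + h *\<^sub>R c) - V x)) / (h * h)"
  proof -
   have e: "x + h *\<^sub>R c + h *\<^sub>R b = x + h *\<^sub>R b + h *\<^sub>R c" by simp
   show ?thesis unfolding fdiff_def e by (simp add: diff_divide_distrib)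
  qed
  ultimately have "\<bar>fdiff h c (fdiff h b V) x\<bar> <= M" using h by (simp add: abs_divide pos_divide_le_eq)
  then show "\<bar>fdiff (hk k) c (fdiff (hk k) b V) x\<bar> <= M" by (simp add: h_def)
 qed
qed

lemma locat_eq_fdiff:
 assumes "locat p (\<lambda>k x. w k x = v k x)" "b \<in> Basis"
 shows "locat p (\<lambda>k x. fdiff (hk k) b (w k) x = fdiff (hk k) b (v k) x)"
 by (rule locat_mono[OF locat_conj[OF assms(1) locat_shift[OF assms]]]) (simp add: fdiff_def)

text \<open>Differences commute with the discrete Laplacian, so each differenced equation bounds the
  Laplacian of the next difference. Third differences are reached because second differences must be
  equicontinuous for the limit to be C^2; this takes two differences of \<open>V\<close>, which the
  Lipschitz bound on its gradient controls.\<close>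

lemma discrete_regularity:
 assumes u1: "\<And>k x. \<bar>u k x\<bar> <= 1" and l: "\<And>k. \<bar>l k\<bar> <= C"
  and eq: "\<forall>\<^sub>F k in sequentially. \<forall>x\<in>Om \<inter> grid (hk k). dlap (hk k) (u k) x = (V x - l k) * u k x"
 shows "locb u" "b \<in> Basis ==> locb (\<lambda>k. fdiff (hk k) b (u k))"
  "b \<in> Basis ==> c \<in> Basis ==> locb (\<lambda>k. fdiff (hk k) c (fdiff (hk k) b (u k)))"
  "b \<in> Basis ==> c \<in> Basis ==> a \<in> Basis ==> locb (\<lambda>k. fdiff (hk k) a (fdiff (hk k) c (fdiff (hk k) b (u k))))"
proof -
 define P where "P = (\<lambda>k x. V x + (- l k))"
 define f where "f = (\<lambda>k x. P k x * u k x)"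
 have P0: "locb P" unfolding P_def
  by (intro locb_add locb_Om_bounded[of "\<lambda>k. V" M] locb_bounded[of "\<lambda>k x. - l k" C]) (use V_bound l in auto)
 have Pd: "fdiff h b (P k) = fdiff h b V" for h k b by (rule ext) (simp add: fdiff_def P_def)
 have E0: "locat p (\<lambda>k x. dlap (hk k) (u k) x = f k x)" if p: "p \<in> Om" for p
 proof -
  have "\<forall>\<^sub>F k in sequentially. \<forall>x. x \<in> Om \<inter> grid (hk k) --> dlap (hk k) (u k) x = f k x"
   using eq by eventually_elim (simp add: f_def P_def)
  from locat_conj[OF locat_eventually[OF this] locat_Om[OF p]] show ?thesis
   by (rule locat_mono) auto
 qed
 show 0: "locb u" by (rule locb_bounded[OF u1])
 have 1: "locb (\<lambda>k. fdiff (hk k) b (u k))" if "b \<in> Basis" for b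
 proof (rule locb_fdiff[OF 0 _ that])
  show "locb (\<lambda>k. dlap (hk k) (u k))"
   by (rule locb_cong[OF locb_mult[OF P0 0]]) (use E0 in \<open>auto simp: f_def\<close>)
 qed
 have 2: "locb (\<lambda>k. fdiff (hk k) c (fdiff (hk k) b (u k)))" if b: "b \<in> Basis" and c: "c \<in> Basis" for b c
 proof (rule locb_fdiff[OF 1[OF b] _ c])
  have "locb (\<lambda>k. fdiff (hk k) b (f k))"
   unfolding f_def fdiff_mult Pd by (intro locb_add locb_mult locb_shift P0 1 0 locb_V1 b)
  then show "locb (\<lambda>k. dlap (hk k) (fdiff (hk k) b (u k)))"
   by (rule locb_cong) (use locat_eq_fdiff[OF E0 b] in \<open>auto simp: dlap_fdiff\<close>)
 qed
 have 3: "locb (\<lambda>k. fdiff (hk k) a (fdiff (hk k) c (fdiff (hk k) b (u k))))" if b: "b \<in> Basis" and c: "c \<in> Basis" and a: "a \<in> Basis" for a b c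
 proof (rule locb_fdiff[OF 2[OF b c] _ a])
  have A: "locb (\<lambda>k. fdiff (hk k) c (fdiff (hk k) b (f k)))"
   unfolding f_def fdiff_mult fdiff_add fdiff_shift Pd
   by (intro locb_add locb_mult locb_shift P0 1 0 2 locb_V1 locb_V2 b c)
  have B: "locat p (\<lambda>k x. fdiff (hk k) c (fdiff (hk k) b (dlap (hk k) (u k))) x = fdiff (hk k) c (fdiff (hk k) b (f k)) x)"
   if "p \<in> Om" for p
   by (rule locat_eq_fdiff[OF locat_eq_fdiff[OF E0[OF that] b] c])
  have D: "dlap (hk k) (fdiff (hk k) c (fdiff (hk k) b (u k))) x = fdiff (hk k) c (fdiff (hk k) b (dlap (hk k) (u k))) x" for k x
  proof -
   have "dlap (hk k) (fdiff (hk k) b (u k)) = fdiff (hk k) b (dlap (hk k) (u k))"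
    by (rule ext) (rule dlap_fdiff)
   then show ?thesis unfolding dlap_fdiff by simp
  qed
  show "locb (\<lambda>k. dlap (hk k) (fdiff (hk k) c (fdiff (hk k) b (u k))))"
   unfolding D by (rule locb_cong[OF A B])
 qed
 show "b \<in> Basis ==> locb (\<lambda>k. fdiff (hk k) b (u k))" by (rule 1)
 show "b \<in> Basis ==> c \<in> Basis ==> locb (\<lambda>k. fdiff (hk k) c (fdiff (hk k) b (u k)))" by (rule 2)
 show "b \<in> Basis ==> c \<in> Basis ==> a \<in> Basis ==> locb (\<lambda>k. fdiff (hk k) a (fdiff (hk k) c (fdiff (hk k) b (u k))))" by (rule 3)
qed

end

section \<open>The ground state of a Schroedinger operator\<close>

lemma diagonal_convergent_subsequence:
 fixes f :: "nat \<Rightarrow> 'i \<Rightarrow> real"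
 assumes S: "countable S" and bd: "\<And>x. x \<in> S ==> Bseq (\<lambda>n. f n x)"
 obtains s where "strict_mono (s::nat\<Rightarrow>nat)" "\<And>x. x \<in> S ==> convergent (\<lambda>n. f (s n) x)"
proof (cases "S = {}")
 case True
 then show ?thesis using that[of id] by (simp add: strict_mono_def)
next
 case False
 define y where "y = from_nat_into S"
 have y: "range y = S" using False S by (simp add: y_def)
 define P where "P = (\<lambda>n s. convergent (\<lambda>k::nat. f (s k :: nat) (y n)))"
 interpret subseqs P
 proof
  fix n and s :: "nat \<Rightarrow> nat" assume s: "strict_mono s"
  have "y n \<in> S" using y by blast
  from bd[OF this] have "bounded (range (\<lambda>k. f (s k) (y n)))"
   unfolding Bseq_def bounded_iff by blast
  then obtain l r where r: "strict_mono (r::nat\<Rightarrow>nat)" "((\<lambda>k. f (s k) (y n)) \<circ> r) \<longlonglongrightarrow> l"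
   using bounded_imp_convergent_subsequence by blast
  then show "\<exists>r'. strict_mono r' \<and> P n (s \<circ> r')"
   unfolding P_def convergent_def by (auto simp: o_def)
 qed
 show ?thesis
 proof (rule that[of diagseq])
  show "strict_mono diagseq" by (rule subseq_diagseq)
  fix x assume "x \<in> S"
  then obtain n where n: "x = y n" using y by blast
  have "P n (diagseq \<circ> ((+) (Suc n)))"
  proof (rule diagseq_holds)
   fix k and r s :: "nat \<Rightarrow> nat" assume "strict_mono r" "P k s"
   then show "P k (s \<circ> r)" unfolding P_def convergent_def
    using LIMSEQ_subseq_LIMSEQ[of "\<lambda>i. f (s i) (y k)" _ r] by (auto simp: o_def)
  qed
  then have "convergent (\<lambda>k. f (diagseq (k + Suc n)) (y n))"
   unfolding P_def by (simp add: o_def add.commute)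
  then show "convergent (\<lambda>k. f (diagseq k) x)"
   using convergent_ignore_initial_segment[of "\<lambda>k. f (diagseq k) (y n)" "Suc n"] n by simp
 qed
qed

text \<open>Equicontinuity is required only up to \<open>e\<close> for late \<open>k\<close>,
  because it is applied to step functions on finer and finer grids. The index set \<open>I\<close>
  gathers the eigenvalue and all difference quotients, so that one subsequence serves them
  all.\<close>

lemma asymptotic_ascoli:
 fixes F :: "nat \<Rightarrow> 'i \<Rightarrow> 'a::euclidean_space \<Rightarrow> real"
 assumes I: "countable I" and bd: "\<And>i x. i \<in> I ==> x \<in> S ==> Bseq (\<lambda>k. F k i x)"
  and eq: "\<And>i x e. i \<in> I ==> x \<in> S ==> e > 0 ==>
   \<exists>r>0. \<forall>\<^sub>F k in sequentially. \<forall>y\<in>S. dist y x < r --> \<bar>F k i y - F k i x\<bar> <= e"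
 obtains s where "strict_mono (s::nat\<Rightarrow>nat)" "\<And>i x. i \<in> I ==> x \<in> S ==> convergent (\<lambda>k. F (s k) i x)"
proof -
 obtain Q where Q: "countable Q" "Q \<subseteq> S" "S \<subseteq> closure Q" using separable by blast
 have cIQ: "countable (I \<times> Q)" using I Q by simp
 have B: "Bseq (\<lambda>n. F n (fst z) (snd z))" if "z \<in> I \<times> Q" for z using bd that Q(2) by auto
 obtain s where s: "strict_mono (s::nat\<Rightarrow>nat)" "\<And>z. z \<in> I \<times> Q ==> convergent (\<lambda>n. F (s n) (fst z) (snd z))"
  by (rule diagonal_convergent_subsequence[OF cIQ, of "\<lambda>n z. F n (fst z) (snd z)", OF B]) (assumption | rule that)+
 show ?thesis
 proof (rule that[OF s(1)])
  fix i x assume i: "i \<in> I" and x: "x \<in> S"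
  have "Cauchy (\<lambda>k. F (s k) i x)"
   unfolding Cauchy_def
  proof (intro allI impI)
   fix e :: real assume e: "e > 0"
   obtain r where r: "r > 0" "\<forall>\<^sub>F k in sequentially. \<forall>y\<in>S. dist y x < r --> \<bar>F k i y - F k i x\<bar> <= e / 4"
    using eq[OF i x, of "e / 4"] e by auto
   obtain q where q: "q \<in> Q" "dist q x < r" using Q(3) x r(1) unfolding closure_approachable subset_iff by blast
   have "\<forall>\<^sub>F k in sequentially. \<bar>F (s k) i q - F (s k) i x\<bar> <= e / 4"
    using eventually_subseq[OF s(1) r(2)] by (rule eventually_mono) (use q Q(2) in blast)
   then obtain N1 where N1: "\<And>k. k >= N1 ==> \<bar>F (s k) i q - F (s k) i x\<bar> <= e / 4"
    unfolding eventually_sequentially by blast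
   have "Cauchy (\<lambda>k. F (s k) i q)" using s(2)[of "(i, q)"] i q by (simp add: convergent_Cauchy)
   then obtain N2 where N2: "\<And>m n. m >= N2 ==> n >= N2 ==> dist (F (s m) i q) (F (s n) i q) < e / 4"
    unfolding Cauchy_def using e by (meson divide_pos_pos zero_less_numeral)
   show "\<exists>N. \<forall>m\<ge>N. \<forall>n\<ge>N. dist (F (s m) i x) (F (s n) i x) < e"
   proof (intro exI[of _ "max N1 N2"] allI impI)
    fix m n assume "m >= max N1 N2" "n >= max N1 N2"
    then show "dist (F (s m) i x) (F (s n) i x) < e"
     using N1[of m] N1[of n] N2[of m n] unfolding dist_real_def by linarith
   qed
  qed
  then show "convergent (\<lambda>k. F (s k) i x)" by (simp add: Cauchy_convergent_iff)
 qed
qed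

lemma DERIV_of_quadratic_error:
 fixes F :: "real \<Rightarrow> real"
 assumes r: "r > 0" and F: "\<And>t. \<bar>t\<bar> <= r ==> \<bar>F t - F 0 - t * D\<bar> <= C * t\<^sup>2"
 shows "(F has_real_derivative D) (at 0)"
proof -
 have "((\<lambda>t. (F t - F 0) / t - D) \<longlongrightarrow> 0) (at 0)"
 proof (rule Lim_null_comparison)
  show "\<forall>\<^sub>F t in at 0. norm ((F t - F 0) / t - D) <= C * \<bar>t\<bar>"
   unfolding eventually_at
  proof (intro exI[of _ r] conjI ballI impI)
   fix t :: real assume t: "t \<noteq> 0 \<and> dist t 0 < r"
   have e: "(F t - F 0) / t - D = (F t - F 0 - t * D) / t" using t by (simp add: field_simps)
   have "\<bar>F t - F 0 - t * D\<bar> / \<bar>t\<bar> <= C * t\<^sup>2 / \<bar>t\<bar>" using F[of t] t by (intro divide_right_mono) auto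
   also have "C * t\<^sup>2 / \<bar>t\<bar> = C * \<bar>t\<bar>" using t by (simp add: power2_eq_square abs_if)
   finally show "norm ((F t - F 0) / t - D) <= C * \<bar>t\<bar>" unfolding e by (simp add: abs_divide)
  qed (rule r)
  show "((\<lambda>t. C * \<bar>t\<bar>) \<longlongrightarrow> 0) (at 0)" by (auto intro!: tendsto_eq_intros)
 qed
 then have "((\<lambda>t. (F t - F 0) / t) \<longlongrightarrow> D) (at 0)" by (rule LIM_zero_cancel)
 then show ?thesis by (simp add: has_field_derivative_iff)
qed

section \<open>Step functions obtained by rounding\<close>

lemma gfloor_shift:
 assumes h: "h > 0" and b: "b \<in> Basis"
 shows "gfloor h (x + (h * of_int j) *\<^sub>R b) = gfloor h x + (h * of_int j) *\<^sub>R b"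
proof (rule euclidean_eqI)
 fix c :: 'a assume c: "c \<in> Basis"
 have "(x \<bullet> c + h * of_int j) / h = x \<bullet> c / h + of_int j" using h by (simp add: field_simps)
 then show "gfloor h (x + (h * of_int j) *\<^sub>R b) \<bullet> c = (gfloor h x + (h * of_int j) *\<^sub>R b) \<bullet> c"
  using b c by (cases "b = c") (simp_all add: gfloor_inner inner_add_left inner_Basis distrib_left)
qed

lemma gfloor_line:
 assumes b: "b \<in> Basis"
 shows "gfloor h (x + t *\<^sub>R b) = gfloor h x + (h * of_int (\<lfloor>(x \<bullet> b + t) / h\<rfloor> - \<lfloor>x \<bullet> b / h\<rfloor>)) *\<^sub>R b"
proof (rule euclidean_eqI)
 fix c :: 'a assume c: "c \<in> Basis"
 show "gfloor h (x + t *\<^sub>R b) \<bullet> c = (gfloor h x + (h * of_int (\<lfloor>(x \<bullet> b + t) / h\<rfloor> - \<lfloor>x \<bullet> b / h\<rfloor>)) *\<^sub>R b) \<bullet> c"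
  using b c by (cases "b = c") (simp_all add: gfloor_inner inner_add_left inner_Basis right_diff_distrib)
qed

lemma gfloor_id: assumes "h > 0" "x \<in> grid h" shows "gfloor h x = x"
proof (rule euclidean_eqI)
 fix c :: 'a assume c: "c \<in> Basis"
 then obtain j :: int where j: "x \<bullet> c = h * of_int j" using assms by (auto simp: grid_def)
 then show "gfloor h x \<bullet> c = x \<bullet> c" using assms c by (simp add: gfloor_inner)
qed

lemma norm_gfloor_diff:
 fixes x :: "'a::euclidean_space"
 assumes "h > 0" shows "norm (gfloor h x - x) <= real DIM('a) * h"
proof -
 have "norm (gfloor h x - x) <= (\<Sum>b\<in>Basis. \<bar>(gfloor h x - x) \<bullet> b\<bar>)" by (rule norm_le_l1)
 also have "\<dots> <= (\<Sum>b\<in>(Basis::'a set). h)" using assms by (intro sum_mono gfloor_close)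
 finally show ?thesis by simp
qed

lemma supporting_direction:
 fixes S :: "'a::euclidean_space set"
 assumes "open S" "convex S" "S \<noteq> {}" "p \<notin> S"
 obtains nu where "norm nu = 1" "\<And>x. x \<in> S ==> 0 < (p - x) \<bullet> nu"
proof -
 obtain a b where a: "a \<noteq> 0" "\<forall>x\<in>S. a \<bullet> x <= b" "\<forall>x\<in>{p}. b <= a \<bullet> x"
  using separating_hyperplane_sets[of S "{p}"] assms by auto
 have "0 < (p - x) \<bullet> (a /\<^sub>R norm a)" if x: "x \<in> S" for x
 proof -
  obtain e where e: "e > 0" "ball x e \<subseteq> S" using assms(1) x open_contains_ball by blast
  define d where "d = e / (2 * norm a)"
  have d: "d > 0" using e a by (simp add: d_def)
  have "dist x (x + d *\<^sub>R a) < e" using e a by (simp add: d_def dist_norm)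
  then have "a \<bullet> (x + d *\<^sub>R a) <= b" using a(2) e(2) by (auto simp: subset_iff)
  then have "a \<bullet> x + d * (a \<bullet> a) <= b" by (simp add: inner_add_right)
  moreover have "d * (a \<bullet> a) > 0" using d a by simp
  ultimately have "a \<bullet> x < a \<bullet> p" using a(3) by simp
  then have "0 < (p - x) \<bullet> a" by (simp add: inner_commute[of _ a] inner_diff_right)
  then have "0 < inverse (norm a) * ((p - x) \<bullet> a)" using a(1) by simp
  then show ?thesis by simp
 qed
 then show ?thesis using that[of "a /\<^sub>R norm a"] a by simp
qed

context schroedinger_domain
begin

lemma locat_finite:
 assumes "finite B" "\<And>b. b \<in> B ==> locat p (P b)" shows "locat p (\<lambda>k x. \<forall>b\<in>B. P b k x)"
 using assms
proof (induction B rule: finite_induct)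
 case empty show ?case by (rule locat_eventually) simp
next
 case (insert a B)
 have "locat p (\<lambda>k x. P a k x \<and> (\<forall>b\<in>B. P b k x))" using insert by (intro locat_conj) auto
 then show ?case by (rule locat_mono) auto
qed

lemma gfloor_box: assumes "box_nbd p r x" "hk k <= e" shows "box_nbd p (r + e) (gfloor (hk k) x)"
proof (rule box_nbd_shift[OF assms(1)])
 fix b :: 'a assume "b \<in> Basis"
 from gfloor_close(3)[OF hk_pos this] assms(2) show "\<bar>(gfloor (hk k) x - x) \<bullet> b\<bar> <= e" by (meson order_trans)
qed

lemma box_nbd_refl: "r >= 0 ==> box_nbd p r p" by (simp add: box_nbd_def)

lemma box_nbd_dist: "dist x p <= r ==> box_nbd p r x"
 unfolding box_nbd_def by (auto simp: dist_norm intro: order_trans[OF Basis_le_norm])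

lemma locb_gfloor_Bseq:
 assumes "locb w" "x \<in> Om" shows "Bseq (\<lambda>k. w k (gfloor (hk k) x))"
proof -
 obtain C r where r: "r > 0" "\<forall>\<^sub>F k in sequentially. \<forall>z\<in>grid (hk k). box_nbd x r z --> \<bar>w k z\<bar> <= C"
  using locbD[OF assms] unfolding locat_def by blast
 have "\<forall>\<^sub>F k in sequentially. norm (w k (gfloor (hk k) x)) <= C"
  using r(2) eventually_hk_le[OF r(1)]
 proof eventually_elim
  case (elim k)
  have "box_nbd x (0 + r) (gfloor (hk k) x)" by (rule gfloor_box[OF box_nbd_refl elim(2)]) simp
  then show ?case using elim(1) gfloor_grid[of "hk k" x] by simp
 qed
 then show ?thesis by (rule BfunI)
qed

text \<open>A step function is Lipschitz only up to one mesh width; the summand \<open>hk k\<close>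
  accounts for the rounding of both points and disappears in the limit.\<close>

lemma locb_gfloor_lipschitz:
 assumes w: "\<And>b. b \<in> Basis ==> locb (\<lambda>k. fdiff (hk k) b (w k))" and p: "p \<in> Om"
 obtains r C where "r > 0" "C >= 0" "\<forall>\<^sub>F k in sequentially. \<forall>x y. box_nbd p r x --> box_nbd p r y -->
  \<bar>w k (gfloor (hk k) y) - w k (gfloor (hk k) x)\<bar> <= C * (norm (y - x) + hk k)"
proof -
 have "\<forall>b\<in>Basis. \<exists>C. locat p (\<lambda>k x. \<bar>fdiff (hk k) b (w k) x\<bar> <= C)" using locbD[OF w p] by blast
 from bchoice[OF this] obtain C0 where "\<forall>b\<in>Basis. locat p (\<lambda>k x. \<bar>fdiff (hk k) b (w k) x\<bar> <= C0 b)" ..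
 then have C0: "\<And>b. b \<in> Basis ==> locat p (\<lambda>k x. \<bar>fdiff (hk k) b (w k) x\<bar> <= C0 b)" by (rule bspec)
 define D where "D = (\<Sum>b\<in>Basis. \<bar>C0 b\<bar>)"
 have D: "\<bar>C0 b\<bar> <= D" if "b \<in> Basis" for b unfolding D_def using that by (intro member_le_sum) auto
 have D0: "D >= 0" unfolding D_def by (intro sum_nonneg) auto
 have "locat p (\<lambda>k x. \<forall>b\<in>Basis. \<bar>fdiff (hk k) b (w k) x\<bar> <= C0 b)" by (rule locat_finite[OF finite_Basis C0])
 then obtain r where r: "r > 0" "\<forall>\<^sub>F k in sequentially. \<forall>x\<in>grid (hk k). box_nbd p r x --> (\<forall>b\<in>Basis. \<bar>fdiff (hk k) b (w k) x\<bar> <= C0 b)"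
  unfolding locat_def by blast
 define n where "n = real DIM('a)"
 have r2: "r / 2 > 0" using r by simp
 show ?thesis
 proof (rule that[of "r / 2" "D * (2 * n)"])
  show "r / 2 > 0" by (rule r2)
  show "D * (2 * n) >= 0" using D0 by (simp add: n_def)
  show "\<forall>\<^sub>F k in sequentially. \<forall>x y. box_nbd p (r / 2) x --> box_nbd p (r / 2) y -->
   \<bar>w k (gfloor (hk k) y) - w k (gfloor (hk k) x)\<bar> <= D * (2 * n) * (norm (y - x) + hk k)"
   using r(2) eventually_hk_le[OF r2]
  proof eventually_elim
   case (elim k)
   show ?case
   proof (intro allI impI)
    fix x y assume x: "box_nbd p (r / 2) x" and y: "box_nbd p (r / 2) y"
    define h where "h = hk k"
    have h: "h > 0" using hk_pos h_def by simp
    have gx: "box_nbd p r (gfloor h x)" "box_nbd p r (gfloor h y)"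
     using gfloor_box[OF x elim(2)] gfloor_box[OF y elim(2)] by (auto simp: h_def)
    have "\<bar>w k (gfloor h y) - w k (gfloor h x)\<bar> <= D * (\<Sum>b\<in>Basis. \<bar>(gfloor h y - gfloor h x) \<bullet> b\<bar>)"
    proof (rule grid_box_lipschitz[OF h _ gfloor_grid gx(1) gfloor_grid gx(2)])
     fix z b :: 'a assume "b \<in> Basis" "z \<in> grid h" "box_nbd p r z"
     then have "\<bar>fdiff h b (w k) z\<bar> <= C0 b" "\<bar>C0 b\<bar> <= D" using elim(1) D by (auto simp: h_def)
     then show "\<bar>fdiff h b (w k) z\<bar> <= D" by linarith
    qed
    also have "\<dots> <= D * (\<Sum>b\<in>(Basis::'a set). 2 * (norm (y - x) + h))"
    proof (intro mult_left_mono sum_mono)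
     fix b :: 'a assume b: "b \<in> Basis"
     have "\<bar>(gfloor h y - gfloor h x) \<bullet> b\<bar> <= \<bar>(y - x) \<bullet> b\<bar> + \<bar>(gfloor h y - y) \<bullet> b\<bar> + \<bar>(gfloor h x - x) \<bullet> b\<bar>"
      by (simp add: inner_diff_left)
     also have "\<dots> <= norm (y - x) + h + h"
      by (intro add_mono gfloor_close(3)[OF h b] Basis_le_norm[OF b])
     finally show "\<bar>(gfloor h y - gfloor h x) \<bullet> b\<bar> <= 2 * (norm (y - x) + h)"
      using norm_ge_zero[of "y - x"] unfolding distrib_left by linarith
    qed (rule D0)
    also have "\<dots> = D * (2 * n) * (norm (y - x) + h)" by (simp add: n_def)
    finally show "\<bar>w k (gfloor (hk k) y) - w k (gfloor (hk k) x)\<bar> <= D * (2 * n) * (norm (y - x) + hk k)"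
     by (simp add: h_def)
   qed
  qed
 qed
qed

text \<open>The limit of this expansion identifies the derivative of the limit function with the
  limit of the differences. Forward differences expand naturally towards \<open>t >= 0\<close>;
  negative increments are treated later by expanding from the other end.\<close>

lemma locb_gfloor_taylor:
 assumes b: "b \<in> Basis" and w: "locb (\<lambda>k. fdiff (hk k) b (w k))" "locb (\<lambda>k. fdiff (hk k) b (fdiff (hk k) b (w k)))"
  and p: "p \<in> Om"
 obtains r C where "r > 0" "C >= 0" "\<forall>\<^sub>F k in sequentially. \<forall>x t. 0 <= t --> box_nbd p r x --> box_nbd p r (x + t *\<^sub>R b) -->
  \<bar>w k (gfloor (hk k) (x + t *\<^sub>R b)) - w k (gfloor (hk k) x) - t * fdiff (hk k) b (w k) (gfloor (hk k) x)\<bar> <= C * (t\<^sup>2 + hk k)"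
proof -
 obtain C1 C2 where "locat p (\<lambda>k x. \<bar>fdiff (hk k) b (w k) x\<bar> <= C1)"
  "locat p (\<lambda>k x. \<bar>fdiff (hk k) b (fdiff (hk k) b (w k)) x\<bar> <= C2)"
  using locbD[OF w(1) p] locbD[OF w(2) p] by blast
 from locat_conj[OF this] obtain r where r: "r > 0"
  "\<forall>\<^sub>F k in sequentially. \<forall>x\<in>grid (hk k). box_nbd p r x -->
   \<bar>fdiff (hk k) b (w k) x\<bar> <= C1 \<and> \<bar>fdiff (hk k) b (fdiff (hk k) b (w k)) x\<bar> <= C2"
  unfolding locat_def by blast
 define C where "C = \<bar>C1\<bar> + \<bar>C2\<bar>"
 have C: "C >= 0" "C1 <= C" "C2 <= C" by (auto simp: C_def)
 have r2: "r / 2 > 0" using r by simp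
 show ?thesis
 proof (rule that[of "r / 2" "3 * C"])
  show "r / 2 > 0" by (rule r2)
  show "3 * C >= 0" using C by simp
  show "\<forall>\<^sub>F k in sequentially. \<forall>x t. 0 <= t --> box_nbd p (r / 2) x --> box_nbd p (r / 2) (x + t *\<^sub>R b) -->
   \<bar>w k (gfloor (hk k) (x + t *\<^sub>R b)) - w k (gfloor (hk k) x) - t * fdiff (hk k) b (w k) (gfloor (hk k) x)\<bar> <= 3 * C * (t\<^sup>2 + hk k)"
   using r(2) eventually_hk_le[OF r2]
  proof eventually_elim
   case (elim k)
   show ?case
   proof (intro allI impI)
    fix x t assume t: "(0::real) <= t" and x: "box_nbd p (r / 2) x" and y: "box_nbd p (r / 2) (x + t *\<^sub>R b)"
    define h where "h = hk k"
    have h: "h > 0" "h <= 1" using hk_pos hk_le_1 h_def by auto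
    define X where "X = gfloor h x"
    define j where "j = \<lfloor>(x \<bullet> b + t) / h\<rfloor> - \<lfloor>x \<bullet> b / h\<rfloor>"
    have j0: "j >= 0" unfolding j_def using t h by (simp add: floor_mono divide_right_mono)
    define N where "N = nat j"
    have jN: "of_int j = real N" using j0 by (simp add: N_def)
    have Y: "gfloor h (x + t *\<^sub>R b) = X + (real N * h) *\<^sub>R b"
     using gfloor_line[OF b, of h x t] unfolding j_def[symmetric] jN X_def by (simp add: mult.commute)
    have Xg: "X \<in> grid h" unfolding X_def by (rule gfloor_grid)
    have bx: "box_nbd p r X" "box_nbd p r (X + (real N * h) *\<^sub>R b)"
     unfolding X_def Y[unfolded X_def, symmetric] 
     using gfloor_box[OF x elim(2)] gfloor_box[OF y elim(2)] by (auto simp: h_def)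
    have tN: "\<bar>real N * h - t\<bar> <= h"
    proof -
     have "(X + (real N * h) *\<^sub>R b) \<bullet> b = X \<bullet> b + real N * h" using b by (simp add: inner_add_left)
     moreover have "(x + t *\<^sub>R b) \<bullet> b = x \<bullet> b + t" using b by (simp add: inner_add_left)
     ultimately show ?thesis
      using gfloor_close(1,2)[OF h(1) b, of x] gfloor_close(1,2)[OF h(1) b, of "x + t *\<^sub>R b"]
      unfolding Y X_def[symmetric] by linarith
    qed
    have d1: "\<bar>fdiff h b (w k) X\<bar> <= C"
     using elim(1) Xg bx(1) C by (auto simp: h_def intro: order_trans)
    have "\<bar>w k (X + (real N * h) *\<^sub>R b) - w k X - (real N * h) * fdiff h b (w k) X\<bar> <= C * (real N * h)\<^sup>2"
    proof (rule grid_line_taylor[OF h(1) C(1)])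
     fix i assume i: "i < N"
     have g: "X + (real i * h) *\<^sub>R b \<in> grid h"
      using grid_add[OF Xg grid_basis[OF b, of h "int i"]] by (simp add: mult.commute)
     have ih: "0 <= real i * h" "real i * h <= real N * h" using i h by (auto intro: mult_right_mono)
     have "box_nbd p r (X + (real i * h) *\<^sub>R b)"
      unfolding box_nbd_def
     proof (intro ballI)
      fix c :: 'a assume c: "c \<in> Basis"
      have "\<bar>(X - p) \<bullet> c\<bar> <= r" "\<bar>(X + (real N * h) *\<^sub>R b - p) \<bullet> c\<bar> <= r"
       using bx c by (auto simp: box_nbd_def)
      then show "\<bar>(X + (real i * h) *\<^sub>R b - p) \<bullet> c\<bar> <= r"
       using ih b c by (cases "b = c") (auto simp: inner_diff_left inner_add_left inner_Basis)
     qed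
     then have "\<bar>fdiff h b (fdiff h b (w k)) (X + (real i * h) *\<^sub>R b)\<bar> <= C2" using elim(1) g by (simp add: h_def)
     then show "\<bar>fdiff h b (fdiff h b (w k)) (X + (real i * h) *\<^sub>R b)\<bar> <= C" using C by simp
    qed
    moreover have "\<bar>(real N * h - t) * fdiff h b (w k) X\<bar> <= h * C"
     unfolding abs_mult using tN d1 h by (intro mult_mono) auto
    moreover have "C * (real N * h)\<^sup>2 <= C * (2 * (t\<^sup>2 + h))"
    proof (intro mult_left_mono C(1))
     have "(real N * h)\<^sup>2 <= (t + h)\<^sup>2" using tN h by (intro power_mono) auto
     also have "\<dots> <= 2 * (t\<^sup>2 + h * h)" using sum_squares_bound[of t h] by (simp add: power2_eq_square algebra_simps)
     also have "\<dots> <= 2 * (t\<^sup>2 + h)" using h by (simp add: mult_left_le)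
     finally show "(real N * h)\<^sup>2 <= 2 * (t\<^sup>2 + h)" .
    qed
    moreover have "0 <= C * t\<^sup>2" using C by simp
    ultimately have "\<bar>w k (X + (real N * h) *\<^sub>R b) - w k X - t * fdiff h b (w k) X\<bar> <= 3 * C * (t\<^sup>2 + h)"
     by (simp add: algebra_simps abs_le_iff)
    then show "\<bar>w k (gfloor (hk k) (x + t *\<^sub>R b)) - w k (gfloor (hk k) x) - t * fdiff (hk k) b (w k) (gfloor (hk k) x)\<bar> <= 3 * C * (t\<^sup>2 + hk k)"
     using Y by (simp add: h_def X_def)
   qed
  qed
 qed
qed

end

section \<open>Passage to the continuum limit\<close>

context schroedinger_domain
begin

text \<open>Bounds on differences up to order three give a C^2 limit of the normalised discrete
  ground states, solving the equation in the interior. The half-space barrier has two uses: it makes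
  the limit continuous with value zero at the boundary, and it keeps the points where the discrete
  functions equal \<open>1\<close> away from the boundary, so that the limit is not zero.\<close>

lemma ground_state_exists:
 obtains u g H lam where "has_hessian_on Om u g H" "\<And>b c. continuous_on Om (\<lambda>x. H x b \<bullet> c)"
  "\<And>x. x \<in> Om ==> trace_op (H x) = (V x - lam) * u x"
  "\<And>x. x \<in> Om ==> 0 <= u x" "\<And>x. x \<in> Om ==> u x <= 1" "\<exists>x\<in>Om. u x = 1"
  "continuous_on (closure Om) u" "\<And>x. x \<in> frontier Om ==> u x = 0"
proof -
 obtain h0 C where h0: "h0 > 0" "\<And>h. 0 < h ==> h <= h0 ==> Om \<inter> grid h \<noteq> {}"
  "\<And>h l. 0 < h ==> h <= h0 ==> rayleigh_bound h l ==> l <= C"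
  using discrete_eigenvalue_upper by blast
 define C1 where "C1 = \<bar>C\<bar> + M"
 have C1: "C1 >= 0" "C <= C1" "M <= C1" using M_nonneg by (auto simp: C1_def)
 \<comment> \<open>Meshes coarser than \<open>h0\<close> receive the zero function and
   \<open>l = 0\<close>, so that the sequence is total; the equations are claimed only for fine
   meshes, which is all that limits see.\<close>
 define good where "good = (\<lambda>k u l. (\<forall>x. 0 <= u x) \<and> (\<forall>x. u x <= 1) \<and> \<bar>l\<bar> <= C1 \<and>
   (hk k <= h0 --> (\<forall>x. x \<notin> Om \<inter> grid (hk k) --> u x = 0) \<and> (\<exists>x\<in>Om \<inter> grid (hk k). u x = (1::real)) \<and>
    (\<forall>x\<in>Om \<inter> grid (hk k). dlap (hk k) u x = (V x - l) * u x)))"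
 have "\<exists>u l. good k u l" for k
 proof (cases "hk k <= h0")
  case True
  obtain u l where u: "\<And>x. 0 <= u x" "\<And>x. u x <= 1" "\<And>x. x \<notin> Om \<inter> grid (hk k) ==> u x = 0"
   "\<exists>x\<in>Om \<inter> grid (hk k). u x = 1"
   "\<And>x. x \<in> Om \<inter> grid (hk k) ==> dlap (hk k) u x = (V x - l) * u x"
   "rayleigh_bound (hk k) l"
   using discrete_ground_state[OF hk_pos h0(2)[OF hk_pos True]] by blast
  have "l <= C" by (rule h0(3)[OF hk_pos True u(6)])
  moreover have "- M <= l"
   using u(4) discrete_eigenvalue_lower[OF hk_pos, of u _ k l] u(2,5) by blast
  ultimately have "\<bar>l\<bar> <= C1" using C1 by linarith
  then have "good k u l" unfolding good_def using u(1-5) by blast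
  then show ?thesis by blast
 next
  case False
  then have "good k (\<lambda>x. 0) 0" unfolding good_def using C1 by simp
  then show ?thesis by blast
 qed
 then have "\<forall>k. \<exists>u. \<exists>l. good k u l" by blast
 from choice[OF this] obtain u where "\<forall>k. \<exists>l. good k (u k) l" ..
 from choice[OF this] obtain l where good: "\<forall>k. good k (u k) (l k)" ..
 have u0: "0 <= u k x" "u k x <= 1" "\<bar>u k x\<bar> <= 1" for k x
  using good[rule_format, of k] unfolding good_def by (auto simp: abs_le_iff intro: order_trans[of _ 0])
 have l: "\<bar>l k\<bar> <= C1" for k using good[rule_format, of k] unfolding good_def by blast
 have evh: "\<forall>\<^sub>F k in sequentially. hk k <= h0" by (rule eventually_hk_le[OF h0(1)])
 have eq: "\<forall>\<^sub>F k in sequentially. \<forall>x\<in>Om \<inter> grid (hk k). dlap (hk k) (u k) x = (V x - l k) * u k x"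
  using evh by (rule eventually_mono) (use good in \<open>simp add: good_def\<close>)
 note reg = discrete_regularity[OF u0(3) l eq]
 define DD where "DD = (\<lambda>k vs. foldr (fdiff (hk k)) vs (u k))"
 have DDs: "DD k [] = u k" "DD k (b # vs) = fdiff (hk k) b (DD k vs)" for k b vs by (simp_all add: DD_def)
 define L where "L = (\<lambda>m. {vs :: 'a list. set vs \<subseteq> Basis \<and> length vs <= m})"
 have Lcases: "vs = [] \<or> (\<exists>b\<in>Basis. vs = [b]) \<or> (\<exists>b\<in>Basis. \<exists>c\<in>Basis. vs = [c, b]) \<or>
   (\<exists>b\<in>Basis. \<exists>c\<in>Basis. \<exists>a\<in>Basis. vs = [a, c, b])" if "vs \<in> L 3" for vs
 proof (cases vs)
  case (Cons a ws)
  show ?thesis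
  proof (cases ws)
   case C2: (Cons c xs)
   show ?thesis
   proof (cases xs)
    case C3: (Cons b ys)
    then have "ys = []" using that Cons C2 by (simp add: L_def)
    then show ?thesis using that Cons C2 C3 by (simp add: L_def)
   qed (use that Cons C2 in \<open>simp add: L_def\<close>)
  qed (use that Cons in \<open>simp add: L_def\<close>)
 qed simp
 have lb: "locb (\<lambda>k. DD k vs)" if "vs \<in> L 3" for vs
 proof -
  from Lcases[OF that] consider "vs = []" | b where "b \<in> Basis" "vs = [b]"
   | b c where "b \<in> Basis" "c \<in> Basis" "vs = [c, b]"
   | a b c where "b \<in> Basis" "c \<in> Basis" "a \<in> Basis" "vs = [a, c, b]" by blast
  then show ?thesis
  proof cases
   case 1 then show ?thesis using reg(1) by (simp add: DDs)
  next
   case 2 then show ?thesis using reg(2) by (simp add: DDs)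
  next
   case 3 then show ?thesis using reg(3) by (simp add: DDs)
  next
   case 4 then show ?thesis using reg(4) by (simp add: DDs)
  qed
 qed
 have lbs: "locb (\<lambda>k. fdiff (hk k) b (DD k vs))" if "vs \<in> L 2" "b \<in> Basis" for vs b
  using lb[of "b # vs"] that by (simp add: DDs L_def)
 have L23: "vs \<in> L 3" if "vs \<in> L 2" for vs using that by (simp add: L_def)
 \<comment> \<open>\<open>None\<close> indexes the eigenvalues, which do not depend on
   \<open>x\<close>, so that they converge along the same subsequence as the differences.\<close>
 define F where "F = (\<lambda>k i x. case i of None \<Rightarrow> l k | Some vs \<Rightarrow> DD k vs (gfloor (hk k) x))"
 define I where "I = insert None (Some ` L 2)"
 have "finite (L 2)" unfolding L_def by (rule finite_lists_length_le) simp
 then have Ic: "countable I" unfolding I_def by (simp add: countable_finite)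
 have lip: "\<exists>r>0. \<exists>C\<ge>0. \<forall>\<^sub>F k in sequentially. \<forall>x y. box_nbd p r x --> box_nbd p r y -->
   \<bar>DD k vs (gfloor (hk k) y) - DD k vs (gfloor (hk k) x)\<bar> <= C * (norm (y - x) + hk k)"
  if "vs \<in> L 2" "p \<in> Om" for vs p
  by (rule locb_gfloor_lipschitz[of "\<lambda>k. DD k vs" p, OF lbs[OF that(1)] that(2)]) blast+
 obtain s where s: "strict_mono (s::nat\<Rightarrow>nat)" "\<And>i x. i \<in> I ==> x \<in> Om ==> convergent (\<lambda>k. F (s k) i x)"
 proof (rule asymptotic_ascoli[OF Ic, of Om F])
  fix i x assume i: "i \<in> I" and x: "x \<in> Om"
  show "Bseq (\<lambda>k. F k i x)"
  proof (cases i)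
   case None
   show ?thesis by (rule BseqI'[of _ C1]) (simp add: F_def None l)
  next
   case (Some vs)
   then have "vs \<in> L 3" using i L23 by (auto simp: I_def)
   from locb_gfloor_Bseq[OF lb[OF this] x] show ?thesis by (simp add: F_def Some)
  qed
  fix e :: real assume e: "e > 0"
  show "\<exists>r>0. \<forall>\<^sub>F k in sequentially. \<forall>y\<in>Om. dist y x < r --> \<bar>F k i y - F k i x\<bar> <= e"
  proof (cases i)
   case None
   show ?thesis by (intro exI[of _ 1]) (use e in \<open>simp add: F_def None\<close>)
  next
   case (Some vs)
   then have vs: "vs \<in> L 2" using i by (auto simp: I_def)
   obtain r C where r: "r > 0" "C >= 0" "\<forall>\<^sub>F k in sequentially. \<forall>y z. box_nbd x r y --> box_nbd x r z -->
     \<bar>DD k vs (gfloor (hk k) z) - DD k vs (gfloor (hk k) y)\<bar> <= C * (norm (z - y) + hk k)"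
    using lip[OF vs x] by blast
   define d where "d = (e / (C + 1)) / 2"
   have d: "d > 0" using e r by (simp add: d_def)
   have Cd: "C * (d + d) <= e"
   proof -
    have "C * (d + d) <= (C + 1) * (d + d)" using d by (intro mult_right_mono) auto
    also have "\<dots> = e"
    proof -
     have dd: "d + d = e / (C + 1)" unfolding d_def by (rule field_sum_of_halves)
     show ?thesis unfolding dd using r(2) by simp
    qed
    finally show ?thesis .
   qed
   show ?thesis
   proof (intro exI[of _ "min r d"] conjI)
    show "\<forall>\<^sub>F k in sequentially. \<forall>y\<in>Om. dist y x < min r d --> \<bar>F k i y - F k i x\<bar> <= e"
     using r(3) eventually_hk_le[OF d]
    proof eventually_elim
     case (elim k)
     show ?case
     proof (intro ballI impI)
      fix y assume y: "dist y x < min r d"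
      have "\<bar>DD k vs (gfloor (hk k) y) - DD k vs (gfloor (hk k) x)\<bar> <= C * (norm (y - x) + hk k)"
       using elim(1) box_nbd_refl[of r x] box_nbd_dist[of y x r] y r(1) by simp
      also have "\<dots> <= C * (d + d)"
       using y elim(2) r(2) by (intro mult_left_mono add_mono) (auto simp: dist_norm)
      finally show "\<bar>F k i y - F k i x\<bar> <= e" using Cd by (simp add: F_def Some)
     qed
    qed
   qed (use r d in auto)
  qed
 qed (rule that)
 define U where "U = (\<lambda>vs x. lim (\<lambda>k. F (s k) (Some vs) x))"
 obtain x00 where x00: "x00 \<in> Om" using Om_ne by blast
 define lam where "lam = lim (\<lambda>k. F (s k) None x00)"
 have lim_l: "(\<lambda>k. l (s k)) \<longlonglongrightarrow> lam"
 proof -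
  have "convergent (\<lambda>k. F (s k) None x00)" by (rule s(2)[OF _ x00]) (simp add: I_def)
  then show ?thesis unfolding lam_def convergent_LIMSEQ_iff by (simp add: F_def)
 qed
 have lim_U: "(\<lambda>k. DD (s k) vs (gfloor (hk (s k)) x)) \<longlonglongrightarrow> U vs x" if "vs \<in> L 2" "x \<in> Om" for vs x
 proof -
  have "convergent (\<lambda>k. F (s k) (Some vs) x)" by (rule s(2)[OF _ that(2)]) (simp add: I_def that)
  then show ?thesis unfolding U_def convergent_LIMSEQ_iff by (simp add: F_def)
 qed
 have lim_h: "(\<lambda>k. hk (s k)) \<longlonglongrightarrow> 0"
  using LIMSEQ_subseq_LIMSEQ[OF hk_tendsto s(1)] by (simp add: o_def)
 have U_lip: "\<exists>r>0. \<exists>C\<ge>0. (\<forall>x. box_nbd p r x --> x \<in> Om) \<and>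
   (\<forall>x y. box_nbd p r x --> box_nbd p r y --> \<bar>U vs y - U vs x\<bar> <= C * norm (y - x))"
  if vs: "vs \<in> L 2" and p: "p \<in> Om" for vs p
 proof -
  obtain r1 where r1: "r1 > 0" "\<And>x. box_nbd p r1 x ==> x \<in> Om" using box_nbd_Om[OF p] by blast
  obtain r C where r: "r > 0" "C >= 0" "\<forall>\<^sub>F k in sequentially. \<forall>x y. box_nbd p r x --> box_nbd p r y -->
     \<bar>DD k vs (gfloor (hk k) y) - DD k vs (gfloor (hk k) x)\<bar> <= C * (norm (y - x) + hk k)"
   using lip[OF vs p] by blast
  have A: "\<forall>x. box_nbd p (min r r1) x --> x \<in> Om" using r1(2) box_nbd_mono by (metis min.cobounded2)
  have B: "\<forall>x y. box_nbd p (min r r1) x --> box_nbd p (min r r1) y --> \<bar>U vs y - U vs x\<bar> <= C * norm (y - x)"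
  proof (intro allI impI)
   fix x y assume x: "box_nbd p (min r r1) x" and y: "box_nbd p (min r r1) y"
   have xy: "x \<in> Om" "y \<in> Om" "box_nbd p r x" "box_nbd p r y"
    using r1(2) box_nbd_mono[OF x] box_nbd_mono[OF y] by simp_all
   have "(\<lambda>k. \<bar>DD (s k) vs (gfloor (hk (s k)) y) - DD (s k) vs (gfloor (hk (s k)) x)\<bar>) \<longlonglongrightarrow> \<bar>U vs y - U vs x\<bar>"
    by (intro tendsto_intros lim_U vs xy)
   moreover have "(\<lambda>k. C * (norm (y - x) + hk (s k))) \<longlonglongrightarrow> C * (norm (y - x) + 0)"
    by (intro tendsto_intros lim_h)
   moreover have "\<forall>\<^sub>F k in sequentially. \<bar>DD (s k) vs (gfloor (hk (s k)) y) - DD (s k) vs (gfloor (hk (s k)) x)\<bar> <= C * (norm (y - x) + hk (s k))"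
    using eventually_subseq[OF s(1) r(3)] by (rule eventually_mono) (use xy in blast)
   ultimately have "\<bar>U vs y - U vs x\<bar> <= C * (norm (y - x) + 0)"
    by (intro tendsto_le[OF sequentially_bot]) auto
   then show "\<bar>U vs y - U vs x\<bar> <= C * norm (y - x)" by simp
  qed
  have "min r r1 > 0" using r r1 by simp
  with A B r(2) show ?thesis by blast
 qed
 have U_cont: "isCont (U vs) p" if vs: "vs \<in> L 2" and p: "p \<in> Om" for vs p
 proof -
  obtain r C where r: "r > 0" "C >= 0" "\<And>x y. box_nbd p r x ==> box_nbd p r y ==> \<bar>U vs y - U vs x\<bar> <= C * norm (y - x)"
   using U_lip[OF vs p] by blast
  have "((\<lambda>x. U vs x - U vs p) \<longlongrightarrow> 0) (at p)"
  proof (rule Lim_null_comparison)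
   show "\<forall>\<^sub>F x in at p. norm (U vs x - U vs p) <= C * norm (x - p)"
    unfolding eventually_at
    by (intro exI[of _ r]) (use r box_nbd_refl[of r p] box_nbd_dist[of _ p r] in simp)
   show "((\<lambda>x. C * norm (x - p)) \<longlongrightarrow> 0) (at p)" by (auto intro!: tendsto_eq_intros)
  qed
  then show ?thesis unfolding isCont_def by (rule LIM_zero_cancel)
 qed
 have U_deriv: "((\<lambda>t. U vs (p + t *\<^sub>R b)) has_real_derivative U (b # vs) p) (at 0)"
  if vs: "vs \<in> L 1" and p: "p \<in> Om" and b: "b \<in> Basis" for vs p b
 proof -
  have vs2: "vs \<in> L 2" "b # vs \<in> L 2" using vs b by (simp_all add: L_def)
  obtain r C where r: "r > 0" "C >= 0" "\<And>x. box_nbd p r x ==> x \<in> Om"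
    "\<And>x y. box_nbd p r x ==> box_nbd p r y ==> \<bar>U (b # vs) y - U (b # vs) x\<bar> <= C * norm (y - x)"
   using U_lip[OF vs2(2) p] by blast
  have "locb (\<lambda>k. fdiff (hk k) b (fdiff (hk k) b (DD k vs)))"
   using lbs[OF vs2(2) b] by (simp add: DDs)
  from locb_gfloor_taylor[of b "\<lambda>k. DD k vs" p, OF b lbs[OF vs2(1) b] this p]
  obtain r' C' where r': "r' > 0" "C' >= 0" "\<forall>\<^sub>F k in sequentially. \<forall>x t. 0 <= t --> box_nbd p r' x --> box_nbd p r' (x + t *\<^sub>R b) -->
    \<bar>DD k vs (gfloor (hk k) (x + t *\<^sub>R b)) - DD k vs (gfloor (hk k) x) - t * fdiff (hk k) b (DD k vs) (gfloor (hk k) x)\<bar> <= C' * (t\<^sup>2 + hk k)"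
   by blast
  define d where "d = min r r'"
  have d: "d > 0" using r r' by (simp add: d_def)
  have T: "\<bar>U vs (x + t *\<^sub>R b) - U vs x - t * U (b # vs) x\<bar> <= C' * t\<^sup>2"
   if t: "0 <= t" and x: "box_nbd p d x" and y: "box_nbd p d (x + t *\<^sub>R b)" for x t
  proof -
   have xy: "x \<in> Om" "x + t *\<^sub>R b \<in> Om" "box_nbd p r' x" "box_nbd p r' (x + t *\<^sub>R b)"
    using r(3) box_nbd_mono[OF x] box_nbd_mono[OF y] by (simp_all add: d_def)
   have "(\<lambda>k. \<bar>DD (s k) vs (gfloor (hk (s k)) (x + t *\<^sub>R b)) - DD (s k) vs (gfloor (hk (s k)) x) - t * DD (s k) (b # vs) (gfloor (hk (s k)) x)\<bar>)
     \<longlonglongrightarrow> \<bar>U vs (x + t *\<^sub>R b) - U vs x - t * U (b # vs) x\<bar>"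
    by (intro tendsto_intros lim_U vs2 xy)
   moreover have "(\<lambda>k. C' * (t\<^sup>2 + hk (s k))) \<longlonglongrightarrow> C' * (t\<^sup>2 + 0)"
    by (intro tendsto_intros lim_h)
   moreover have "\<forall>\<^sub>F k in sequentially. \<bar>DD (s k) vs (gfloor (hk (s k)) (x + t *\<^sub>R b)) - DD (s k) vs (gfloor (hk (s k)) x) - t * DD (s k) (b # vs) (gfloor (hk (s k)) x)\<bar> <= C' * (t\<^sup>2 + hk (s k))"
    unfolding DDs using eventually_subseq[OF s(1) r'(3)] by (rule eventually_mono) (use xy t in blast)
   ultimately have "\<bar>U vs (x + t *\<^sub>R b) - U vs x - t * U (b # vs) x\<bar> <= C' * (t\<^sup>2 + 0)"
    by (intro tendsto_le[OF sequentially_bot]) auto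
   then show ?thesis by simp
  qed
  show ?thesis
  proof (rule DERIV_of_quadratic_error[OF d, where C = "C + C'"])
   fix t :: real assume t: "\<bar>t\<bar> <= d"
   define y where "y = p + t *\<^sub>R b"
   have py: "box_nbd p d p" "box_nbd p d y" using d box_nbd_refl box_nbd_dist[of y p d] t b by (simp_all add: y_def dist_norm)
   have Ct: "0 <= C * t\<^sup>2" using r by simp
   show "\<bar>U vs (p + t *\<^sub>R b) - U vs (p + 0 *\<^sub>R b) - t * U (b # vs) p\<bar> <= (C + C') * t\<^sup>2"
   proof (cases "t >= 0")
    case True
    have "\<bar>U vs (p + t *\<^sub>R b) - U vs p - t * U (b # vs) p\<bar> <= C' * t\<^sup>2"
     using T[OF True py(1)] py(2) by (simp add: y_def)
    then show ?thesis using Ct by (simp add: distrib_right)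
   next
    case False
    \<comment> \<open>For a negative increment the forward expansion starts at \<open>y\<close> and
      ends at \<open>p\<close>; the Lipschitz bound for \<open>U (b # vs)\<close> then moves the
      derivative from \<open>y\<close> to \<open>p\<close>.\<close>
    have e: "y + (- t) *\<^sub>R b = p" by (simp add: y_def)
    have "\<bar>U vs (y + (- t) *\<^sub>R b) - U vs y - (- t) * U (b # vs) y\<bar> <= C' * (- t)\<^sup>2"
     by (rule T) (use False py e in simp_all)
    then have 1: "\<bar>U vs p - U vs y + t * U (b # vs) y\<bar> <= C' * t\<^sup>2" unfolding e by simp
    have "\<bar>U (b # vs) y - U (b # vs) p\<bar> <= C * norm (y - p)"
     by (rule r(4)) (use box_nbd_mono[OF py(1)] box_nbd_mono[OF py(2)] in \<open>simp_all add: d_def\<close>)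
    also have "norm (y - p) = \<bar>t\<bar>" using b by (simp add: y_def)
    finally have "\<bar>t\<bar> * \<bar>U (b # vs) y - U (b # vs) p\<bar> <= \<bar>t\<bar> * (C * \<bar>t\<bar>)" by (intro mult_left_mono) auto
    then have 2: "\<bar>t * U (b # vs) y - t * U (b # vs) p\<bar> <= C * t\<^sup>2"
     by (simp add: abs_mult[symmetric] right_diff_distrib power2_eq_square mult.left_commute)
    have "\<bar>U vs y - U vs p - t * U (b # vs) p\<bar> <= C * t\<^sup>2 + C' * t\<^sup>2" using 1 2 by linarith
    then show ?thesis by (simp add: y_def distrib_right)
   qed
  qed
 qed
 have gf_Om: "\<forall>\<^sub>F k in sequentially. gfloor (hk (s k)) x \<in> Om" if x: "x \<in> Om" for x
 proof -
  obtain r where r: "r > 0" "\<And>y. box_nbd x r y ==> y \<in> Om" using box_nbd_Om[OF x] by blast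
  from eventually_subseq[OF s(1) eventually_hk_le[OF r(1)]] show ?thesis
  proof eventually_elim
   case (elim k)
   have "box_nbd x (0 + r) (gfloor (hk (s k)) x)" by (rule gfloor_box[OF box_nbd_refl elim]) simp
   then show ?case using r by simp
  qed
 qed
 have gf_lim: "(\<lambda>k. gfloor (hk (s k)) x) \<longlonglongrightarrow> x" for x :: 'a
 proof (rule LIM_zero_cancel[OF Lim_null_comparison])
  show "\<forall>\<^sub>F k in sequentially. norm (gfloor (hk (s k)) x - x) <= real DIM('a) * hk (s k)"
   by (rule always_eventually, rule allI, rule norm_gfloor_diff[OF hk_pos])
  show "(\<lambda>k. real DIM('a) * hk (s k)) \<longlonglongrightarrow> 0" using tendsto_mult_right_zero[OF lim_h] .
 qed
 have pde: "(\<Sum>b\<in>Basis. U [b, b] x) = (V x - lam) * U [] x" if x: "x \<in> Om" for x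
 proof (rule LIMSEQ_unique)
  have "isCont V x" using has_derivative_continuous[OF V_deriv[OF x]] .
  then have Vl: "(\<lambda>k. V (gfloor (hk (s k)) x)) \<longlonglongrightarrow> V x"
   using gf_lim isCont_tendsto_compose by blast
  have u_lim: "(\<lambda>k. u (s k) (gfloor (hk (s k)) x)) \<longlonglongrightarrow> U [] x"
   using lim_U[of "[]" x] x by (simp add: L_def DDs)
  show "(\<lambda>k. (V (gfloor (hk (s k)) x) - l (s k)) * u (s k) (gfloor (hk (s k)) x)) \<longlonglongrightarrow> (V x - lam) * U [] x"
   by (intro tendsto_intros Vl lim_l u_lim)
  \<comment> \<open>The discrete Laplacian consists of forward second differences at points shifted
    back by one step. The asymptotic Lipschitz bound shows that the shift does not change the
    limit.\<close>
  have each: "(\<lambda>k. DD (s k) [b, b] (gfloor (hk (s k)) x - hk (s k) *\<^sub>R b)) \<longlonglongrightarrow> U [b, b] x" if b: "b \<in> Basis" for b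
  proof -
   have bb: "[b, b] \<in> L 2" using b by (simp add: L_def)
   obtain r C where r: "r > 0" "C >= 0" "\<forall>\<^sub>F k in sequentially. \<forall>y z. box_nbd x r y --> box_nbd x r z -->
     \<bar>DD k [b, b] (gfloor (hk k) z) - DD k [b, b] (gfloor (hk k) y)\<bar> <= C * (norm (z - y) + hk k)"
    using lip[OF bb x] by blast
   have "(\<lambda>k. DD (s k) [b, b] (gfloor (hk (s k)) x - hk (s k) *\<^sub>R b) - DD (s k) [b, b] (gfloor (hk (s k)) x)) \<longlonglongrightarrow> 0"
   proof (rule Lim_null_comparison)
    show "\<forall>\<^sub>F k in sequentially. norm (DD (s k) [b, b] (gfloor (hk (s k)) x - hk (s k) *\<^sub>R b) - DD (s k) [b, b] (gfloor (hk (s k)) x)) <= C * (hk (s k) + hk (s k))"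
     using eventually_subseq[OF s(1) r(3)] eventually_subseq[OF s(1) eventually_hk_le[OF r(1)]]
    proof eventually_elim
     case (elim k)
     define h where "h = hk (s k)"
     have h: "h > 0" "h <= r" using hk_pos elim by (simp_all add: h_def)
     have e: "gfloor h (x + (h * of_int (-1)) *\<^sub>R b) = gfloor h x - h *\<^sub>R b"
      using gfloor_shift[OF h(1) b, of x "-1"] by simp
     have bx: "box_nbd x r (x + (h * of_int (-1)) *\<^sub>R b)"
      by (rule box_nbd_dist) (use h b in \<open>simp add: dist_norm\<close>)
     have "\<bar>DD (s k) [b, b] (gfloor h (x + (h * of_int (-1)) *\<^sub>R b)) - DD (s k) [b, b] (gfloor h x)\<bar> <= C * (norm (x + (h * of_int (-1)) *\<^sub>R b - x) + h)"
      using elim(1)[rule_format, OF box_nbd_refl bx] r(1) unfolding h_def by simp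
     then show ?case unfolding e using h b by (simp add: h_def[symmetric])
    qed
    show "(\<lambda>k. C * (hk (s k) + hk (s k))) \<longlonglongrightarrow> 0"
     using tendsto_mult_right_zero[OF tendsto_add_zero[OF lim_h lim_h]] .
   qed
   from tendsto_add[OF this lim_U[OF bb x]] show ?thesis by simp
  qed
  have "(\<lambda>k. \<Sum>b\<in>Basis. DD (s k) [b, b] (gfloor (hk (s k)) x - hk (s k) *\<^sub>R b)) \<longlonglongrightarrow> (\<Sum>b\<in>Basis. U [b, b] x)"
   by (intro tendsto_sum each)
  moreover have "\<forall>\<^sub>F k in sequentially. (\<Sum>b\<in>Basis. DD (s k) [b, b] (gfloor (hk (s k)) x - hk (s k) *\<^sub>R b)) =
    (V (gfloor (hk (s k)) x) - l (s k)) * u (s k) (gfloor (hk (s k)) x)"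
   using eventually_subseq[OF s(1) eq] gf_Om[OF x]
  proof eventually_elim
   case (elim k)
   have "hk (s k) \<noteq> 0" using hk_pos[of "s k"] by simp
   from dlap_eq_sum_fdiff[OF this, of "u (s k)" "gfloor (hk (s k)) x"]
   have "(\<Sum>b\<in>Basis. DD (s k) [b, b] (gfloor (hk (s k)) x - hk (s k) *\<^sub>R b)) = dlap (hk (s k)) (u (s k)) (gfloor (hk (s k)) x)"
    by (simp add: DDs)
   also have "\<dots> = (V (gfloor (hk (s k)) x) - l (s k)) * u (s k) (gfloor (hk (s k)) x)"
    using elim(1)[rule_format, of "gfloor (hk (s k)) x"] elim(2) gfloor_grid[of "hk (s k)" x] by blast
   finally show ?case .
  qed
  ultimately show "(\<lambda>k. (V (gfloor (hk (s k)) x) - l (s k)) * u (s k) (gfloor (hk (s k)) x)) \<longlonglongrightarrow> (\<Sum>b\<in>Basis. U [b, b] x)"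
   by (rule Lim_transform_eventually)
 qed
 have U0: "0 <= U [] x" "U [] x <= 1" if x: "x \<in> Om" for x
 proof -
  have u_lim: "(\<lambda>k. u (s k) (gfloor (hk (s k)) x)) \<longlonglongrightarrow> U [] x"
   using lim_U[of "[]" x] x by (simp add: L_def DDs)
  show "0 <= U [] x" by (rule LIMSEQ_le_const[OF u_lim]) (use u0 in blast)
  show "U [] x <= 1" by (rule LIMSEQ_le_const2[OF u_lim]) (use u0 in blast)
 qed
 obtain R where R: "R > 0" "\<And>x. x \<in> closure Om ==> norm x <= R"
  using bounded_closure[OF bounded_Om] unfolding bounded_pos by blast
 define D where "D = 2 * R + 1"
 define K where "K = 3 * (C1 + M + 1) * D"
 have K: "K >= 0" using C1 M_nonneg R by (simp add: K_def D_def)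
 \<comment> \<open>The bound is uniform in \<open>x\<close>, so it applies to points that move with
   the mesh: rounded points, and points where the maximum is attained.\<close>
 have bar: "\<forall>\<^sub>F k in sequentially. \<forall>p\<in>frontier Om. \<forall>nu x. norm nu = 1 --> (\<forall>x\<in>Om. 0 < (p - x) \<bullet> nu) --> x \<in> Om -->
   u k x <= K * ((p - x) \<bullet> nu + hk k)"
  using evh
 proof eventually_elim
  case (elim k)
  show ?case
  proof (intro ballI allI impI)
   fix p nu x assume p: "p \<in> frontier Om" and nu: "norm nu = 1" "\<forall>x\<in>Om. 0 < (p - x) \<bullet> nu" and x: "x \<in> Om"
   have half: "0 < p \<bullet> nu - y \<bullet> nu \<and> p \<bullet> nu - y \<bullet> nu <= D" if y: "y \<in> Om" for y
   proof -
    have "(p - y) \<bullet> nu <= norm (p - y) * norm nu" by (rule norm_cauchy_schwarz)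
    also have "\<dots> <= norm p + norm y" using nu norm_triangle_ineq4[of p y] by simp
    also have "\<dots> <= D" using R(2)[of p] R(2)[of y] p y closure_subset[of Om] by (auto simp: D_def frontier_def)
    finally show ?thesis using nu(2) y by (simp add: inner_diff_left)
   qed
   have gk: "good k (u k) (l k)" using good by blast
   have "u k x <= 3 * (C1 + M + 1) * D * (p \<bullet> nu - x \<bullet> nu + hk k)"
   proof (rule discrete_half_space_barrier[OF hk_pos _ nu(1) half])
    show "hk k <= D" using hk_le_1[of k] R by (simp add: D_def)
    show "l k <= C1" using l[of k] by simp
    show "y \<notin> Om \<inter> grid (hk k) ==> u k y = 0" for y using gk elim unfolding good_def by blast
    show "y \<in> Om \<inter> grid (hk k) ==> dlap (hk k) (u k) y = (V y - l k) * u k y" for y using gk elim unfolding good_def by blast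
   qed (use u0 C1 x in auto)
   then show "u k x <= K * ((p - x) \<bullet> nu + hk k)" by (simp add: K_def inner_diff_left)
  qed
 qed
 have Ubar: "U [] x <= K * ((p - x) \<bullet> nu)"
  if p: "p \<in> frontier Om" and nu: "norm nu = 1" "\<forall>x\<in>Om. 0 < (p - x) \<bullet> nu" and x: "x \<in> Om" for p nu x
 proof -
  have u_lim: "(\<lambda>k. u (s k) (gfloor (hk (s k)) x)) \<longlonglongrightarrow> U [] x"
   using lim_U[of "[]" x] x by (simp add: L_def DDs)
  have "(\<lambda>k. K * ((p - gfloor (hk (s k)) x) \<bullet> nu + hk (s k))) \<longlonglongrightarrow> K * ((p - x) \<bullet> nu + 0)"
   by (intro tendsto_intros gf_lim lim_h)
  moreover have "\<forall>\<^sub>F k in sequentially. u (s k) (gfloor (hk (s k)) x) <= K * ((p - gfloor (hk (s k)) x) \<bullet> nu + hk (s k))"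
   using eventually_subseq[OF s(1) bar] gf_Om[OF x]
  proof eventually_elim
   case (elim k)
   show ?case using elim(1)[rule_format, OF p nu(1), of "gfloor (hk (s k)) x"] nu(2) elim(2) by blast
  qed
  ultimately have "U [] x <= K * ((p - x) \<bullet> nu + 0)" by (rule tendsto_le[OF sequentially_bot _ u_lim])
  then show ?thesis by simp
 qed
 have Umax: "\<exists>x\<in>Om. U [] x = 1"
 proof -
  have "\<forall>k. \<exists>x. hk k <= h0 --> x \<in> Om \<inter> grid (hk k) \<and> u k x = 1" using good unfolding good_def by blast
  from choice[OF this] obtain m where m: "\<forall>k. hk k <= h0 --> m k \<in> Om \<inter> grid (hk k) \<and> u k (m k) = 1" ..
  define m' where "m' = (\<lambda>k. if hk k <= h0 then m k else x00)"
  have m'Om: "m' k \<in> closure Om" for k using m x00 closure_subset[of Om] unfolding m'_def by auto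
  have "compact (closure Om)" using bounded_Om by simp
  then obtain z q where z: "z \<in> closure Om" "strict_mono (q::nat\<Rightarrow>nat)" "((\<lambda>k. m' (s k)) \<circ> q) \<longlonglongrightarrow> z"
   using m'Om unfolding compact_def by (metis (no_types, lifting))
  have zl: "(\<lambda>k. m' (s (q k))) \<longlonglongrightarrow> z" using z(3) by (simp add: o_def)
  have sq: "strict_mono (\<lambda>k. s (q k))" using s(1) z(2) by (simp add: strict_mono_def)
  have hl: "(\<lambda>k. hk (s (q k))) \<longlonglongrightarrow> 0" using LIMSEQ_subseq_LIMSEQ[OF hk_tendsto sq] by (simp add: o_def)
  have mm: "\<forall>\<^sub>F k in sequentially. m' (s (q k)) \<in> Om \<inter> grid (hk (s (q k))) \<and> u (s (q k)) (m' (s (q k))) = 1"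
   using eventually_subseq[OF sq evh] by (rule eventually_mono) (use m in \<open>simp add: m'_def\<close>)
  \<comment> \<open>A boundary limit of maximum points would contradict the barrier: the values are
    \<open>1\<close> while the bound tends to \<open>0\<close>.\<close>
  have zO: "z \<in> Om"
  proof (rule ccontr)
   assume zn: "z \<notin> Om"
   then have zf: "z \<in> frontier Om" using z(1) open_Om by (simp add: frontier_def interior_open)
   obtain nu where nu: "norm nu = 1" "\<And>x. x \<in> Om ==> 0 < (z - x) \<bullet> nu"
    using supporting_direction[OF open_Om convex_Om Om_ne zn] by blast
   have "(\<lambda>k. K * ((z - m' (s (q k))) \<bullet> nu + hk (s (q k)))) \<longlonglongrightarrow> K * ((z - z) \<bullet> nu + 0)"
    by (intro tendsto_intros zl hl)
   moreover have "\<forall>\<^sub>F k in sequentially. 1 <= K * ((z - m' (s (q k))) \<bullet> nu + hk (s (q k)))"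
    using eventually_subseq[OF sq bar] mm
   proof eventually_elim
    case (elim k)
    show ?case using elim(1)[rule_format, OF zf nu(1), of "m' (s (q k))"] nu(2) elim(2) by simp
   qed
   ultimately have "1 <= K * ((z - z) \<bullet> nu + 0)" using tendsto_lowerbound sequentially_bot by blast
   then show False by simp
  qed
  have e0: "[] \<in> L 2" by (simp add: L_def)
  obtain r C where r: "r > 0" "C >= 0" "\<forall>\<^sub>F k in sequentially. \<forall>x y. box_nbd z r x --> box_nbd z r y -->
     \<bar>DD k [] (gfloor (hk k) y) - DD k [] (gfloor (hk k) x)\<bar> <= C * (norm (y - x) + hk k)"
   using lip[OF e0 zO] by blast
  have "(\<lambda>k. u (s (q k)) (gfloor (hk (s (q k))) z) - 1) \<longlonglongrightarrow> 0"
  proof (rule Lim_null_comparison)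
   have near: "\<forall>\<^sub>F k in sequentially. dist (m' (s (q k))) z < r" using tendstoD[OF zl r(1)] .
   show "\<forall>\<^sub>F k in sequentially. norm (u (s (q k)) (gfloor (hk (s (q k))) z) - 1) <= C * (norm (z - m' (s (q k))) + hk (s (q k)))"
    using eventually_subseq[OF sq r(3)] mm near
   proof eventually_elim
    case (elim k)
    have "gfloor (hk (s (q k))) (m' (s (q k))) = m' (s (q k))" by (rule gfloor_id[OF hk_pos]) (use elim(2) in blast)
    moreover have "\<bar>DD (s (q k)) [] (gfloor (hk (s (q k))) z) - DD (s (q k)) [] (gfloor (hk (s (q k))) (m' (s (q k))))\<bar> <= C * (norm (z - m' (s (q k))) + hk (s (q k)))"
     using elim(1) box_nbd_refl[of r z] box_nbd_dist[of "m' (s (q k))" z r] elim(3) r(1) by simp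
    ultimately show ?case using elim(2) by (simp add: DDs)
   qed
   have "(\<lambda>k. C * (norm (z - m' (s (q k))) + hk (s (q k)))) \<longlonglongrightarrow> C * (norm (z - z) + 0)"
    by (intro tendsto_intros zl hl)
   then show "(\<lambda>k. C * (norm (z - m' (s (q k))) + hk (s (q k)))) \<longlonglongrightarrow> 0" by simp
  qed
  then have "(\<lambda>k. u (s (q k)) (gfloor (hk (s (q k))) z)) \<longlonglongrightarrow> 1" by (rule LIM_zero_cancel)
  moreover have "(\<lambda>k. u (s (q k)) (gfloor (hk (s (q k))) z)) \<longlonglongrightarrow> U [] z"
   using LIMSEQ_subseq_LIMSEQ[OF lim_U[OF e0 zO] z(2)] by (simp add: o_def DDs)
  ultimately have "U [] z = 1" using LIMSEQ_unique by blast
  then show ?thesis using zO by blast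
 qed
 \<comment> \<open>\<open>U\<close> is meaningful on \<open>Om\<close> only; the extension by zero
   carries the boundary values.\<close>
 define v where "v = (\<lambda>x. if x \<in> Om then U [] x else 0)"
 define g where "g = (\<lambda>x. \<Sum>b\<in>Basis. U [b] x *\<^sub>R b)"
 define H where "H = (\<lambda>x a. \<Sum>b\<in>Basis. (\<Sum>c\<in>Basis. U [c, b] x * (a \<bullet> c)) *\<^sub>R b)"
 have UD: "(U vs has_derivative (\<lambda>a. \<Sum>b\<in>Basis. U (b # vs) x * (a \<bullet> b))) (at x)" if "vs \<in> L 1" "x \<in> Om" for vs x
  using open_Om that(2)
 proof (rule has_derivative_of_continuous_partials)
  show "isCont (U (b # vs)) x" if "b \<in> Basis" for b
   by (rule U_cont) (use that \<open>vs \<in> L 1\<close> \<open>x \<in> Om\<close> in \<open>simp_all add: L_def\<close>)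
  show "((\<lambda>t. U vs (y + t *\<^sub>R b)) has_real_derivative U (b # vs) y) (at 0)" if "b \<in> Basis" "y \<in> Om" for b y
   by (rule U_deriv[OF \<open>vs \<in> L 1\<close> that(2,1)])
 qed
 have gin: "g x \<bullet> a = (\<Sum>b\<in>Basis. U [b] x * (a \<bullet> b))" for x a
  unfolding g_def inner_sum_left by (intro sum.cong) (simp_all add: inner_commute)
 have hess: "has_hessian_on Om v g H"
  unfolding has_hessian_on_def
 proof (intro ballI conjI)
  fix x assume x: "x \<in> Om"
  have "(U [] has_derivative (\<lambda>a. g x \<bullet> a)) (at x)" using UD[of "[]" x] x by (simp add: L_def gin)
  then show "(v has_derivative (\<lambda>a. g x \<bullet> a)) (at x)"
   by (rule has_derivative_transform_within_open[OF _ open_Om x]) (simp add: v_def)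
  show "(g has_derivative H x) (at x)"
   unfolding g_def H_def
   by (intro has_derivative_sum has_derivative_scaleR_left UD) (use x in \<open>simp_all add: L_def\<close>)
 qed
 have Hin: "H x b \<bullet> c = (\<Sum>d\<in>Basis. (\<Sum>a\<in>Basis. U [a, d] x * (b \<bullet> a)) * (d \<bullet> c))" for x b c
  by (simp add: H_def inner_sum_left)
 show ?thesis
 proof (rule that[OF hess, of lam])
  fix b c
  show "continuous_on Om (\<lambda>x. H x b \<bullet> c)"
   unfolding Hin
  proof (intro continuous_on_sum continuous_on_mult continuous_on_const)
   fix d a :: 'a assume "d \<in> Basis" "a \<in> Basis"
   then show "continuous_on Om (U [a, d])"
    by (intro continuous_at_imp_continuous_on ballI U_cont) (simp_all add: L_def)
  qed
 next
  fix x assume x: "x \<in> Om"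
  have "H x b \<bullet> b = U [b, b] x" if b: "b \<in> Basis" for b
  proof -
   have "H x b \<bullet> b = (\<Sum>d\<in>Basis. if d = b then (\<Sum>a\<in>Basis. if a = b then U [a, d] x else 0) else 0)"
    unfolding Hin using b by (intro sum.cong refl) (auto simp: inner_Basis if_distrib cong: if_cong)
   also have "\<dots> = U [b, b] x" using b by simp
   finally show ?thesis .
  qed
  then show "trace_op (H x) = (V x - lam) * v x" using pde[OF x] x by (simp add: trace_op_def v_def)
  show "0 <= v x" "v x <= 1" using U0[OF x] x by (simp_all add: v_def)
 next
  show "\<exists>x\<in>Om. v x = 1" using Umax by (auto simp: v_def)
  show fr: "v x = 0" if "x \<in> frontier Om" for x using that open_Om by (simp add: v_def frontier_def interior_open)
  show "continuous_on (closure Om) v"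
   unfolding continuous_on_eq_continuous_within
  proof
   fix x assume x: "x \<in> closure Om"
   show "continuous (at x within closure Om) v"
   proof (cases "x \<in> Om")
    case True
    then have "(v has_derivative (\<lambda>a. g x \<bullet> a)) (at x)" using hess by (simp add: has_hessian_on_def)
    then show ?thesis using has_derivative_continuous continuous_at_imp_continuous_at_within by blast
   next
    case False
    then have xf: "x \<in> frontier Om" using x open_Om by (simp add: frontier_def interior_open)
    obtain nu where nu: "norm nu = 1" "\<And>y. y \<in> Om ==> 0 < (x - y) \<bullet> nu"
     using supporting_direction[OF open_Om convex_Om Om_ne False] by blast
    have "(v \<longlongrightarrow> 0) (at x within closure Om)"
    proof (rule Lim_null_comparison)
     show "\<forall>\<^sub>F y in at x within closure Om. norm (v y) <= K * norm (x - y)"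
     proof (intro always_eventually allI)
      fix y
      show "norm (v y) <= K * norm (x - y)"
      proof (cases "y \<in> Om")
       case True
       have "v y <= K * ((x - y) \<bullet> nu)" using Ubar[OF xf nu(1) _ True] nu(2) True by (simp add: v_def)
       also have "\<dots> <= K * (norm (x - y) * norm nu)" by (intro mult_left_mono norm_cauchy_schwarz K)
       finally show ?thesis using nu U0(1)[OF True] True by (simp add: v_def)
      qed (use K in \<open>simp add: v_def\<close>)
     qed
     have "((\<lambda>y. K * norm (x - y)) \<longlongrightarrow> K * norm (x - x)) (at x within closure Om)"
      by (intro tendsto_intros)
     then show "((\<lambda>y. K * norm (x - y)) \<longlongrightarrow> 0) (at x within closure Om)" by simp
    qed
    then show ?thesis using fr[OF xf] by (simp add: continuous_within)
   qed
  qed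
 qed
qed

end

section \<open>Boundary barriers and quotients by the ground state\<close>

lemma hessian_dist_sq: "has_hessian_on S (\<lambda>x. (x - c) \<bullet> (x - c)) (\<lambda>x. 2 *\<^sub>R (x - c)) (\<lambda>x a. 2 *\<^sub>R a)"
 unfolding has_hessian_on_def
 by (auto intro!: derivative_eq_intros simp: inner_commute algebra_simps)

lemma trace_op_id: "trace_op (\<lambda>a::'a::euclidean_space. a) = real DIM('a)"
 by (simp add: trace_op_def)

lemma hessian_exp:
 assumes "has_hessian_on S u g H"
 shows "has_hessian_on S (\<lambda>x. exp (p * u x)) (\<lambda>x. (p * exp (p * u x)) *\<^sub>R g x)
   (\<lambda>x a. (p * exp (p * u x)) *\<^sub>R H x a + ((p * p * exp (p * u x)) * (g x \<bullet> a)) *\<^sub>R g x)"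
 by (rule hessian_compose[OF assms, of "\<lambda>s. exp (p * s)" "\<lambda>s. p * exp (p * s)" "\<lambda>s. p * p * exp (p * s)"])
   (auto intro!: derivative_eq_intros)

lemma trace_exp:
 "trace_op (\<lambda>a. (p * E) *\<^sub>R H a + ((p * p * E) * (g \<bullet> a)) *\<^sub>R g) = E * (p\<^sup>2 * (g \<bullet> g) + p * trace_op H)"
 unfolding trace_op_simps(1) trace_op_simps(2) trace_op_simps(4)
 by (simp add: power2_eq_square algebra_simps)

lemma hessian_at_min:
 fixes u :: "'a::euclidean_space \<Rightarrow> real"
 assumes h: "has_hessian_on S u g H" and S: "open S" "x \<in> S" and m: "\<forall>\<^sub>F y in nhds x. u x <= u y"
 shows "g x = 0" "trace_op (H x) >= 0"
proof -
 have h': "has_hessian_on S (\<lambda>x. (-1) * u x) (\<lambda>x. (-1) *\<^sub>R g x) (\<lambda>x a. (-1) *\<^sub>R H x a)" by (rule hessian_cmult[OF h])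
 have m': "\<forall>\<^sub>F y in nhds x. (-1) * u y <= (-1) * u x" using m by (rule eventually_mono) simp
 show "g x = 0" using hessian_at_max(1)[OF h' S m'] by simp
 have "trace_op (\<lambda>a. (-1) *\<^sub>R H x a) <= 0" using hessian_at_max(2)[OF h' S m'] .
 then show "trace_op (H x) >= 0" unfolding trace_op_simps(2) by simp
qed

text \<open>Hopf's comparison argument. Positivity at the centre of a ball contained in
  \<open>S\<close> spreads to the open ball by comparison with
  \<open>exp (- al |x - c|^2) - exp (- al R^2)\<close> on an annulus, and connectedness does the
  rest.\<close>

lemma positive_of_nonneg_supersolution:
 fixes u :: "'a::euclidean_space \<Rightarrow> real"
 assumes S: "open S" "connected S" and h: "has_hessian_on S u g H" and C: "C >= 0"
  and tr: "\<And>x. x \<in> S ==> trace_op (H x) <= C * u x" and nn: "\<And>x. x \<in> S ==> 0 <= u x"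
  and ex: "\<exists>x\<in>S. u x > 0" and x: "x \<in> S"
 shows "u x > 0"
proof -
 have cont: "continuous_on S u" by (rule hessian_continuous_on(1)[OF h])
 define n where "n = real DIM('a)"
 have claim: "u z > 0" if c: "c \<in> S" "u c > 0" and R: "cball c R \<subseteq> S" and z: "dist c z < R" for c R z
 proof -
  have R0: "R > 0" using z zero_le_dist[of c z] by linarith
  have "isCont u c" using cont S(1) c(1) by (simp add: continuous_on_eq_continuous_at)
  then obtain r0 where r0: "r0 > 0" "\<And>y. dist y c < r0 ==> dist (u y) (u c) < u c / 2"
   unfolding continuous_at_eps_delta using c(2) half_gt_zero by blast
  define r where "r = min r0 R / 2"
  have r: "0 < r" "r < R" "r < r0" using r0 R0 by (auto simp: r_def)
  define m where "m = u c / 2"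
  have m: "m > 0" "\<And>y. dist c y <= r ==> m <= u y"
  proof -
   show "m > 0" using c by (simp add: m_def)
   fix y assume "dist c y <= r"
   then have "dist (u y) (u c) < u c / 2" using r by (intro r0(2)) (simp add: dist_commute)
   then show "m <= u y" unfolding m_def dist_real_def by linarith
  qed
  \<comment> \<open>Makes \<open>al * |x - c|^2\<close> at least \<open>n + C + 1\<close> outside
    the inner ball, so there the Laplacian of the barrier is at least \<open>C + 1\<close> times its
    exponential and beats the zero-order term.\<close>
  define al where "al = max 1 ((n + C + 1) / r\<^sup>2)"
  have al: "al >= 1" "al * r\<^sup>2 >= n + C + 1"
   using r by (auto simp: al_def max_def field_simps)
  define sq where "sq = (\<lambda>x. (x - c) \<bullet> (x - c))"
  have sqd: "sq y = (dist c y)\<^sup>2" for y by (simp add: sq_def dist_norm norm_minus_commute[of c y] power2_norm_eq_inner)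
  define q where "q = (\<lambda>x. exp ((- al) * sq x) + (- exp (- al * R\<^sup>2)))"
  define gq where "gq = (\<lambda>x. ((- al) * exp ((- al) * sq x)) *\<^sub>R (2 *\<^sub>R (x - c)) + 0)"
  define Hq where "Hq = (\<lambda>x a. (((- al) * exp ((- al) * sq x)) *\<^sub>R (2 *\<^sub>R a) + (((- al) * (- al) * exp ((- al) * sq x)) * ((2 *\<^sub>R (x - c)) \<bullet> a)) *\<^sub>R (2 *\<^sub>R (x - c))) + 0)"
  have hq: "has_hessian_on S q gq Hq"
   unfolding q_def gq_def Hq_def
   by (rule hessian_add[OF hessian_exp hessian_const]) (unfold sq_def, rule hessian_dist_sq)
  have trq: "trace_op (Hq x) = exp ((- al) * sq x) * (4 * al\<^sup>2 * sq x - 2 * n * al)" for x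
  proof -
   have e1: "trace_op (Hq x) = exp ((- al) * sq x) * ((- al)\<^sup>2 * ((2 *\<^sub>R (x - c)) \<bullet> (2 *\<^sub>R (x - c))) + (- al) * trace_op (\<lambda>a::'a. 2 *\<^sub>R a))"
    unfolding Hq_def by (subst trace_op_simps(1), subst trace_exp) (simp only: trace_op_simps(5) add_0_right)
   have e2: "(2 *\<^sub>R (x - c)) \<bullet> (2 *\<^sub>R (x - c)) = 4 * sq x" by (simp add: sq_def)
   have e3: "trace_op (\<lambda>a::'a. 2 *\<^sub>R a) = 2 * n" unfolding trace_op_simps(2) trace_op_id n_def ..
   show ?thesis unfolding e1 e2 e3 by (simp add: algebra_simps)
  qed
  define w where "w = (\<lambda>x. u x + (- m) * q x)"
  have hw: "has_hessian_on S w (\<lambda>x. g x + (- m) *\<^sub>R gq x) (\<lambda>x a. H x a + (- m) *\<^sub>R Hq x a)"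
   unfolding w_def by (rule hessian_add[OF h hessian_cmult[OF hq]])
  define A where "A = {y. r <= dist c y \<and> dist c y <= R}"
  have AS: "A \<subseteq> S" using R by (auto simp: A_def)
  have "A = cball c R - ball c r" by (auto simp: A_def)
  then have "compact A" by (simp add: compact_diff)
  show ?thesis
  proof (cases "dist c z <= r")
   case True then show ?thesis using m by (meson less_le_trans)
  next
   case False
   then have zA: "z \<in> A" using z by (simp add: A_def)
   have "continuous_on A w" using hessian_continuous_on(1)[OF hw] AS continuous_on_subset by metis
   then obtain y where y: "y \<in> A" "\<And>x. x \<in> A ==> w y <= w x"
    using continuous_attains_inf[OF \<open>compact A\<close>, of w] zA by blast
   have "w y >= 0"
   proof (rule ccontr)
    assume neg: "\<not> w y >= 0"
    have yS: "y \<in> S" using y AS by blast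
    have q1: "q y <= 1"
    proof -
     have "(- al) * sq y <= 0" using al by (simp add: sqd mult_nonneg_nonneg)
     then have "exp ((- al) * sq y) <= 1" by simp
     moreover have "0 < exp (- al * R\<^sup>2)" by simp
     ultimately show ?thesis unfolding q_def by linarith
    qed
    have "dist c y \<noteq> r"
    proof
     assume "dist c y = r"
     then have "m <= u y" using m(2) by simp
     moreover have "m * q y <= m * 1" using q1 m by (intro mult_left_mono) auto
     ultimately show False using neg by (simp add: w_def)
    qed
    moreover have "dist c y \<noteq> R"
    proof
     assume "dist c y = R"
     then have "q y = 0" by (simp add: q_def sqd)
     then show False using neg nn[OF yS] by (simp add: w_def)
    qed
    ultimately have yi: "r < dist c y" "dist c y < R" using y(1) by (auto simp: A_def)
    have "open ({x. r < dist c x} \<inter> ball c R)"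
     by (intro open_Int open_ball open_Collect_less continuous_intros)
    then have "\<forall>\<^sub>F x in nhds y. x \<in> {x. r < dist c x} \<inter> ball c R"
     by (rule eventually_nhds_in_open) (use yi in simp)
    then have "\<forall>\<^sub>F x in nhds y. w y <= w x"
     by (rule eventually_mono) (use y(2) in \<open>simp add: A_def\<close>)
    from hessian_at_min(2)[OF hw S(1) yS this]
    have t: "0 <= trace_op (H y) - m * trace_op (Hq y)"
     unfolding trace_op_simps(1) trace_op_simps(2) by simp
    define E where "E = exp ((- al) * sq y)"
    have E: "E > 0" by (simp add: E_def)
    have sr: "sq y >= r\<^sup>2" unfolding sqd using yi r by (intro power_mono) auto
    have "C + 1 <= 4 * al\<^sup>2 * sq y - 2 * n * al"
    proof -
     have "al * sq y >= n + C + 1" using al sr by (meson mult_left_mono order_trans zero_le_one)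
     then have "4 * (al * sq y) - 2 * n >= C + 1" using C by (simp add: n_def)
     then have "1 * (C + 1) <= al * (4 * (al * sq y) - 2 * n)" using al C by (intro mult_mono) auto
     then show ?thesis by (simp add: power2_eq_square algebra_simps)
    qed
    then have "E * (C + 1) <= trace_op (Hq y)" unfolding trq E_def[symmetric] using E by (intro mult_left_mono) auto
    then have "m * (E * (C + 1)) <= m * trace_op (Hq y)" using m by (intro mult_left_mono) auto
    moreover have "trace_op (H y) <= C * (m * q y)"
    proof -
     have "u y <= m * q y" using neg by (simp add: w_def)
     from mult_left_mono[OF this C] tr[OF yS] show ?thesis by (rule order_trans[rotated])
    qed
    moreover have "C * (m * q y) <= C * (m * E)"
     using C m by (intro mult_left_mono) (auto simp: q_def E_def)
    moreover have "m * E > 0" using m E by simp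
    ultimately have "m * (E * (C + 1)) <= C * (m * E)" using t by linarith
    then show False using \<open>m * E > 0\<close> by (simp add: algebra_simps)
   qed
   then have "w z >= 0" using y(2)[OF zA] by simp
   moreover have "q z > 0"
   proof -
    have "sq z < R\<^sup>2" unfolding sqd using z by (intro power_strict_mono) auto
    then have "al * sq z < al * R\<^sup>2" using al by (intro mult_strict_left_mono) auto
    then show ?thesis by (simp add: q_def)
   qed
   then have "m * q z > 0" using m by simp
   ultimately show ?thesis by (simp add: w_def)
  qed
 qed
 define P where "P = {x \<in> S. u x > 0}"
 define N where "N = {x \<in> S. u x <= 0}"
 have "open P" unfolding P_def
  using continuous_on_open_vimage[OF S(1), of u, THEN iffD1, OF cont, rule_format, OF open_greaterThan[of "0::real"]]
  by (simp add: vimage_def Int_def conj_commute)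
 \<comment> \<open>The claim in reverse: a point of positivity close to a zero \<open>z\<close>
   would spread positivity to a ball containing \<open>z\<close>. Hence the zero set is open as
   well.\<close>
 moreover have "open N"
  unfolding open_contains_ball
 proof
  fix z assume z: "z \<in> N"
  then have "z \<in> S" by (simp add: N_def)
  then obtain e where e: "e > 0" "cball z e \<subseteq> S" using S(1)[unfolded open_contains_cball] by blast
  have "y \<in> N" if "y \<in> ball z (e / 3)" for y
  proof -
   have yS: "y \<in> S" using e that by (auto simp: subset_iff)
   have "cball y (e / 2) \<subseteq> S"
   proof
    fix v assume "v \<in> cball y (e / 2)"
    then have "dist z v <= e" using that dist_triangle[of z v y] e by simp
    then show "v \<in> S" using e by auto
   qed
   then have "\<not> u y > 0" using claim[OF yS, of "e / 2" z] z that e by (auto simp: N_def dist_commute)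
   then show ?thesis using yS by (simp add: N_def)
  qed
  then show "\<exists>e>0. ball z e \<subseteq> N" using e by (intro exI[of _ "e / 3"]) auto
 qed
 ultimately have "P \<inter> S = {} \<or> N \<inter> S = {}"
  using S(2) by (intro connectedD) (auto simp: P_def N_def)
 then show ?thesis using ex x by (auto simp: P_def N_def)
qed

section \<open>Barriers from the defining function\<close>

locale smooth_convex_domain =
 fixes Om :: "'a::euclidean_space set" and rho :: "'a \<Rightarrow> real" and gr :: "'a \<Rightarrow> 'a" and Hr :: "'a \<Rightarrow> 'a \<Rightarrow> 'a"
  and U :: "'a set"
 assumes open_Om: "open Om" and convex_Om: "convex Om" and bounded_Om: "bounded Om" and Om_ne: "Om \<noteq> {}"
  and open_U: "open U" and cl_U: "closure Om \<subseteq> U" and hess_rho: "has_hessian_on U rho gr Hr"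
  and cont_Hr: "\<And>b c. continuous_on U (\<lambda>x. Hr x b \<bullet> c)"
  and rho_neg: "\<And>x. x \<in> Om ==> rho x < 0" and rho_zero: "\<And>x. x \<in> frontier Om ==> rho x = 0"
  and gr_nz: "\<And>x. x \<in> frontier Om ==> gr x \<noteq> 0"
  and curv: "\<And>x v. x \<in> frontier Om ==> v \<noteq> 0 ==> gr x \<bullet> v = 0 ==> Hr x v \<bullet> v > 0"

lemma smooth_convex_domain_of_def:
 assumes "smooth_uniformly_convex_domain Om"
 obtains rho gr Hr U where "smooth_convex_domain Om rho gr Hr U"
proof -
 obtain rho U where r: "open U" "closure Om \<subseteq> U" "C_inf_on U rho" "Om = {x\<in>U. rho x < 0}" "frontier Om = {x\<in>U. rho x = 0}"
   "\<forall>x\<in>frontier Om. grad rho x \<noteq> 0 \<and> (\<forall>v. v \<noteq> 0 \<and> grad rho x \<bullet> v = 0 --> iter_dd [v, v] rho x > 0)"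
  and o: "open Om" "bounded Om" "Om \<noteq> {}" "convex Om"
  using assms unfolding smooth_uniformly_convex_domain_def by blast
 have C2: "Ck_on 2 U rho" using r(3) by (simp add: C_inf_on_def)
 obtain g H where h: "has_hessian_on U rho g H" "\<And>b c. continuous_on U (\<lambda>x. H x b \<bullet> c)"
  "\<And>x. grad rho x = g x" "\<And>x v w. x \<in> U ==> iter_dd [v, w] rho x = H x v \<bullet> w"
  by (rule Ck2_has_hessian[OF C2]) (rule that)
 have "smooth_convex_domain Om rho g H U"
 proof
  fix x v assume x: "x \<in> frontier Om"
  then have xU: "x \<in> U" using r(5) by blast
  show "rho x = 0" "g x \<noteq> 0" using x r(5,6) h(3) by auto
  assume "v \<noteq> 0" "g x \<bullet> v = 0"
  then show "H x v \<bullet> v > 0" using x r(6) h(3) h(4)[OF xU, of v v] by (metis (no_types))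
 qed (use r(1,2) r(4) o h(1,2) in auto)
 then show ?thesis using that by blast
qed

context smooth_convex_domain
begin

lemma compact_closure: "compact (closure Om)" using bounded_Om by simp

lemma Om_closure: "x \<in> Om ==> x \<in> closure Om" using closure_subset by blast

lemma Om_U: "x \<in> Om ==> x \<in> U" using cl_U Om_closure by blast

lemma closure_cases: "x \<in> closure Om ==> x \<in> Om \<or> x \<in> frontier Om"
 using open_Om by (simp add: frontier_def interior_open)

lemma cont_rho: "continuous_on (closure Om) rho"
 using hessian_continuous_on(1)[OF hess_rho] cl_U continuous_on_subset by metis

text \<open>Where the gradient of \<open>rho\<close> is bounded below, the square term in the
  Laplacians of \<open>exp (k rho)\<close> and \<open>exp (- k rho)\<close> wins for large
  \<open>k\<close>. The strip shrinks like \<open>1 / k\<close>, which keeps both exponentials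
  between fixed constants.\<close>

lemma strip_laplacian_large:
 obtains k where "k > 0" "\<And>x. x \<in> Om ==> rho x > - 1 / k ==>
   exp (k * rho x) * (k\<^sup>2 * (gr x \<bullet> gr x) + k * trace_op (Hr x)) >= G \<and>
   exp ((- k) * rho x) * ((- k)\<^sup>2 * (gr x \<bullet> gr x) + (- k) * trace_op (Hr x)) >= G"
proof -
 define G' where "G' = \<bar>G\<bar>"
 have cg: "continuous_on (closure Om) (\<lambda>x. gr x \<bullet> gr x)"
  using hessian_continuous_on(2)[OF hess_rho] cl_U by (intro continuous_on_inner) (auto intro: continuous_on_subset)
 have "continuous_on (closure Om) (\<lambda>x. trace_op (Hr x))"
  unfolding trace_op_def by (intro continuous_on_sum continuous_on_subset[OF cont_Hr cl_U])
 then have "bounded ((\<lambda>x. trace_op (Hr x)) ` closure Om)"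
  by (rule compact_imp_bounded[OF compact_continuous_image[OF _ compact_closure]])
 then obtain T where T: "T > 0" "\<And>x. x \<in> closure Om ==> \<bar>trace_op (Hr x)\<bar> <= T"
  unfolding bounded_pos by auto
 \<comment> \<open>The gradient is nonzero on the compact frontier. The points of the closure where
   it is small form a compact subset of \<open>Om\<close>, on which \<open>rho\<close> has a
   negative maximum.\<close>
 have "\<exists>be>0. \<exists>d>0. \<forall>x\<in>closure Om. rho x > - d --> gr x \<bullet> gr x >= be"
 proof (cases "frontier Om = {}")
  case True
  have "Om = {}" using True frontier_eq_empty bounded_Om not_bounded_UNIV by blast
  then show ?thesis using Om_ne by simp
 next
  case False
  have cf: "compact (frontier Om)" using compact_frontier_bounded[OF bounded_Om] .
  have fc: "frontier Om \<subseteq> closure Om" by (simp add: frontier_def)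
  obtain x0 where x0: "x0 \<in> frontier Om" "\<And>x. x \<in> frontier Om ==> gr x0 \<bullet> gr x0 <= gr x \<bullet> gr x"
   using continuous_attains_inf[OF cf False continuous_on_subset[OF cg fc]] by blast
  define be where "be = (gr x0 \<bullet> gr x0) / 2"
  have be: "be > 0" using gr_nz[OF x0(1)] by (simp add: be_def)
  define Z where "Z = closure Om \<inter> {x. gr x \<bullet> gr x <= be}"
  have "closed Z" unfolding Z_def Int_def mem_Collect_eq
   by (rule continuous_on_closed_Collect_le[OF cg continuous_on_const closed_closure])
  then have cZ: "compact Z" using compact_closure unfolding Z_def by (metis Int_absorb2 Int_lower1 compact_Int_closed inf.commute)
  have Zneg: "rho x < 0" if "x \<in> Z" for x
  proof -
   have "gr x0 \<bullet> gr x0 = 2 * be" by (simp add: be_def)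
   then have "x \<notin> frontier Om" using x0(2)[of x] that be by (auto simp: Z_def)
   then show ?thesis using that closure_cases[of x] rho_neg by (auto simp: Z_def)
  qed
  show ?thesis
  proof (cases "Z = {}")
   case True
   then have "\<forall>x\<in>closure Om. rho x > - 1 --> gr x \<bullet> gr x >= be" by (auto simp: Z_def not_le)
   then show ?thesis using be zero_less_one by blast
  next
   case False
   have "continuous_on Z rho" using cont_rho continuous_on_subset Z_def by blast
   then obtain z where z: "z \<in> Z" "\<And>x. x \<in> Z ==> rho x <= rho z" using continuous_attains_sup[OF cZ False] by blast
   have "gr x \<bullet> gr x >= be" if "x \<in> closure Om" "rho x > - (- rho z)" for x
    using z(2)[of x] that by (cases "gr x \<bullet> gr x <= be") (auto simp: Z_def)
   moreover have "- rho z > 0" using Zneg[OF z(1)] by simp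
   ultimately show ?thesis using be by blast
  qed
 qed
 then obtain be d where be: "be > 0" "d > 0" "\<And>x. x \<in> closure Om ==> rho x > - d ==> gr x \<bullet> gr x >= be" by blast
 \<comment> \<open>The entry \<open>1 / d\<close> puts the strip where the gradient is bounded
   below. In the last entry the factor \<open>3\<close> pays for \<open>exp (k * rho x)\<close>,
   which is at least \<open>1 / 3\<close> in the strip.\<close>
 define k where "k = max (1 / d) (max 1 ((T + 3 * G') / be))"
 have k: "k >= 1 / d" "k >= 1" "k * be >= T + 3 * G'" 
 proof -
  show "k >= 1 / d" "k >= 1" by (simp_all add: k_def)
  have "(T + 3 * G') / be <= k" by (simp add: k_def)
  then show "k * be >= T + 3 * G'" using be by (simp add: pos_divide_le_eq)
 qed
 have k0: "k > 0" using k by simp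
 show ?thesis
 proof (rule that[OF k0])
  fix x assume x: "x \<in> Om" and rx: "rho x > - 1 / k"
  have "1 / k <= d" using k be by (simp add: field_simps)
  then have gx: "gr x \<bullet> gr x >= be" using be(3)[OF Om_closure[OF x]] rx by simp
  have tx: "\<bar>trace_op (Hr x)\<bar> <= T" using T(2)[OF Om_closure[OF x]] .
  have "k * (T + 3 * G') <= k * (k * be)" using k(3) k0 by (intro mult_left_mono) auto
  also have "\<dots> <= k * (k * (gr x \<bullet> gr x))" using gx k0 by (intro mult_left_mono) auto
  finally have A: "k * T + 3 * k * G' <= k\<^sup>2 * (gr x \<bullet> gr x)" by (simp add: power2_eq_square algebra_simps)
  have B: "\<bar>k * trace_op (Hr x)\<bar> <= k * T" unfolding abs_mult using tx k0 by (simp add: mult_left_mono)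
  have C: "G' <= k * G'" using k(2) by (simp add: G'_def mult_le_cancel_right1)
  have kr: "- 1 < k * rho x" "k * rho x < 0" using rx k0 rho_neg[OF x] by (auto simp: field_simps mult_pos_neg)
  have P1: "3 * G' <= k\<^sup>2 * (gr x \<bullet> gr x) + k * trace_op (Hr x)"
   and P2: "3 * G' <= (- k)\<^sup>2 * (gr x \<bullet> gr x) + (- k) * trace_op (Hr x)"
   using A B C by (simp_all add: abs_le_iff)
  have e1: "exp (k * rho x) >= 1 / 3"
  proof -
   have "exp (k * rho x) >= exp (- 1)" using kr by simp
   moreover have "exp (- 1 :: real) >= 1 / 3" using exp_le by (simp add: exp_minus field_simps)
   ultimately show ?thesis by linarith
  qed
  have e2: "exp ((- k) * rho x) >= 1" using kr by simp
  have G0: "G' >= 0" "G <= G'" by (auto simp: G'_def)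
  have "(1/3) * (3 * G') <= exp (k * rho x) * (k\<^sup>2 * (gr x \<bullet> gr x) + k * trace_op (Hr x))"
   using e1 P1 G0 by (intro mult_mono) auto
  moreover have "1 * (3 * G') <= exp ((- k) * rho x) * ((- k)\<^sup>2 * (gr x \<bullet> gr x) + (- k) * trace_op (Hr x))"
   using e2 P2 G0 by (intro mult_mono) auto
  ultimately show "exp (k * rho x) * (k\<^sup>2 * (gr x \<bullet> gr x) + k * trace_op (Hr x)) >= G \<and>
   exp ((- k) * rho x) * ((- k)\<^sup>2 * (gr x \<bullet> gr x) + (- k) * trace_op (Hr x)) >= G" using G0 by linarith
 qed
qed

text \<open>The sign condition on the Laplacian is asked only where \<open>q > 0\<close>; this lets
  zero-order terms be estimated from the assumed positivity of \<open>q\<close>.\<close>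

lemma strip_maximum_principle:
 assumes q: "has_hessian_on Om q gq Hq" "continuous_on (closure Om) q" and k: "k > 0"
  and fr: "\<And>x. x \<in> frontier Om ==> q x <= 0" and inner: "\<And>x. x \<in> Om ==> rho x = - 1 / k ==> q x <= 0"
  and tr: "\<And>x. x \<in> Om ==> rho x > - 1 / k ==> q x > 0 ==> trace_op (Hq x) > 0"
  and x: "x \<in> Om" "rho x >= - 1 / k"
 shows "q x <= 0"
proof (rule ccontr)
 assume pos: "\<not> q x <= 0"
 define Z where "Z = closure Om \<inter> {x. - 1 / k <= rho x}"
 have "closed Z" unfolding Z_def Int_def mem_Collect_eq
  by (rule continuous_on_closed_Collect_le[OF continuous_on_const cont_rho closed_closure])
 then have "compact Z" using compact_closure unfolding Z_def by (metis Int_absorb2 Int_lower1 compact_Int_closed inf.commute)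
 moreover have "x \<in> Z" using x Om_closure by (simp add: Z_def)
 moreover have "continuous_on Z q" using q(2) continuous_on_subset Z_def by blast
 ultimately obtain y where y: "y \<in> Z" "\<And>z. z \<in> Z ==> q z <= q y" using continuous_attains_sup[of Z q] by blast
 have qy: "q y > 0" using y(2)[OF \<open>x \<in> Z\<close>] pos by simp
 have yO: "y \<in> Om" using closure_cases[of y] y(1) fr[of y] qy by (auto simp: Z_def)
 have ry: "rho y > - 1 / k" using y(1) inner[OF yO] qy by (cases "rho y = - 1 / k") (auto simp: Z_def)
 have "isCont rho y" using hessian_continuous_on(1)[OF hess_rho] open_U Om_U[OF yO] by (simp add: continuous_on_eq_continuous_at)
 then have "\<forall>\<^sub>F z in nhds y. rho z > - 1 / k"
  using ry by (metis isCont_def order_tendstoD(1) tendsto_at_iff_tendsto_nhds)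
 moreover have "\<forall>\<^sub>F z in nhds y. z \<in> Om" by (rule eventually_nhds_in_open[OF open_Om yO])
 ultimately have "\<forall>\<^sub>F z in nhds y. q z <= q y"
  by eventually_elim (use y(2) Om_closure in \<open>simp add: Z_def\<close>)
 from hessian_at_max(2)[OF q(1) open_Om yO this] tr[OF yO ry qy] show False by simp
qed

end

section \<open>The logarithm of the ground state and the drift Laplacian\<close>

lemma hessian_ln:
 assumes "has_hessian_on S p gp Hp" "\<And>x. x \<in> S ==> p x > 0"
 obtains Hf where "has_hessian_on S (\<lambda>x. ln (p x)) (\<lambda>x. inverse (p x) *\<^sub>R gp x) Hf"
  "\<And>x. x \<in> S ==> trace_op (Hf x) + (inverse (p x) *\<^sub>R gp x) \<bullet> (inverse (p x) *\<^sub>R gp x) = trace_op (Hp x) / p x"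
proof -
 define Hf where "Hf = (\<lambda>x a. inverse (p x) *\<^sub>R Hp x a + (- (inverse (p x) * inverse (p x)) * (gp x \<bullet> a)) *\<^sub>R gp x)"
 have 1: "has_hessian_on S (\<lambda>x. ln (p x)) (\<lambda>x. inverse (p x) *\<^sub>R gp x) Hf"
  unfolding Hf_def
  by (rule hessian_compose[OF assms(1), of ln inverse "\<lambda>s. - (inverse s * inverse s)"])
    (use assms(2) in \<open>auto intro!: derivative_eq_intros simp: less_imp_neq[symmetric] power2_eq_square inverse_eq_divide\<close>)
 have 2: "trace_op (Hf x) + (inverse (p x) *\<^sub>R gp x) \<bullet> (inverse (p x) *\<^sub>R gp x) = trace_op (Hp x) / p x" for x
  unfolding Hf_def trace_op_simps(1) trace_op_simps(2) trace_op_simps(4)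
  by (simp add: divide_inverse)
 show ?thesis by (rule that[OF 1 2])
qed

text \<open>The normalisation \<open>u <= 1\<close> makes \<open>f = ln u\<close> nonpositive, so a
  positive multiple of \<open>f\<close> can be added to a test function without raising it.\<close>

locale ground_state = smooth_convex_domain Om rho gr Hr U
 for Om :: "'a::euclidean_space set" and rho gr Hr U +
 fixes V :: "'a \<Rightarrow> real" and M :: real and u :: "'a \<Rightarrow> real" and g :: "'a \<Rightarrow> 'a" and H :: "'a \<Rightarrow> 'a \<Rightarrow> 'a" and lam :: real
 assumes V_bd: "\<And>x. x \<in> Om ==> \<bar>V x\<bar> <= M"
  and hu: "has_hessian_on Om u g H" and pde: "\<And>x. x \<in> Om ==> trace_op (H x) = (V x - lam) * u x"
  and u_pos: "\<And>x. x \<in> Om ==> u x > 0" and u_le1: "\<And>x. x \<in> Om ==> u x <= 1"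
  and cont_u: "continuous_on (closure Om) u" and u_zero: "\<And>x. x \<in> frontier Om ==> u x = 0"
begin

definition f :: "'a \<Rightarrow> real" where "f = (\<lambda>x. ln (u x))"
definition gf :: "'a \<Rightarrow> 'a" where "gf = (\<lambda>x. inverse (u x) *\<^sub>R g x)"
definition Hf :: "'a \<Rightarrow> 'a \<Rightarrow> 'a" where
 "Hf = (SOME Hf. has_hessian_on Om f gf Hf \<and> (\<forall>x\<in>Om. trace_op (Hf x) + gf x \<bullet> gf x = V x - lam))"

lemma hf: "has_hessian_on Om f gf Hf" and trf: "x \<in> Om ==> trace_op (Hf x) + gf x \<bullet> gf x = V x - lam"
proof -
 obtain K where K: "has_hessian_on Om (\<lambda>x. ln (u x)) (\<lambda>x. inverse (u x) *\<^sub>R g x) K"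
  "\<And>x. x \<in> Om ==> trace_op (K x) + (inverse (u x) *\<^sub>R g x) \<bullet> (inverse (u x) *\<^sub>R g x) = trace_op (H x) / u x"
  using hessian_ln[OF hu u_pos] by blast
 have "has_hessian_on Om f gf K \<and> (\<forall>x\<in>Om. trace_op (K x) + gf x \<bullet> gf x = V x - lam)"
 proof (intro conjI ballI)
  show "has_hessian_on Om f gf K" using K(1) by (simp add: f_def gf_def)
  fix x assume x: "x \<in> Om"
  have "trace_op (K x) + gf x \<bullet> gf x = trace_op (H x) / u x" unfolding gf_def by (rule K(2)[OF x])
  then show "trace_op (K x) + gf x \<bullet> gf x = V x - lam" using pde[OF x] u_pos[OF x] by simp
 qed
 then have *: "has_hessian_on Om f gf Hf \<and> (\<forall>x\<in>Om. trace_op (Hf x) + gf x \<bullet> gf x = V x - lam)"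
  unfolding Hf_def by (rule someI[where P = "\<lambda>K. has_hessian_on Om f gf K \<and> (\<forall>x\<in>Om. trace_op (K x) + gf x \<bullet> gf x = V x - lam)"])
 from * show "has_hessian_on Om f gf Hf" by blast
 from * show "x \<in> Om ==> trace_op (Hf x) + gf x \<bullet> gf x = V x - lam" by blast
qed

lemma f_le0: "x \<in> Om ==> f x <= 0" using u_pos u_le1 by (simp add: f_def)

lemma u_nonneg: "x \<in> closure Om ==> u x >= 0"
 using closure_cases[of x] u_pos[of x] u_zero[of x] by fastforce

lemma u_pos_Om: "x \<in> closure Om ==> u x > 0 ==> x \<in> Om"
 using closure_cases[of x] u_zero[of x] by fastforce

lemma closed_sublevel:
 fixes q :: "'b::t2_space \<Rightarrow> real"
 assumes "compact A" "continuous_on A q" shows "compact {x \<in> A. q x <= c}" "compact {x \<in> A. c <= q x}"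
proof -
 have A: "closed A" using assms(1) compact_imp_closed by blast
 have "closed {x \<in> A. q x <= c}" by (rule continuous_on_closed_Collect_le[OF assms(2) continuous_on_const A])
 then have "compact (A \<inter> {x \<in> A. q x <= c})" using assms(1) by (rule compact_Int_closed[rotated])
 moreover have "A \<inter> {x \<in> A. q x <= c} = {x \<in> A. q x <= c}" by blast
 ultimately show "compact {x \<in> A. q x <= c}" by simp
 have "closed {x \<in> A. c <= q x}" by (rule continuous_on_closed_Collect_le[OF continuous_on_const assms(2) A])
 then have "compact (A \<inter> {x \<in> A. c <= q x})" using assms(1) by (rule compact_Int_closed[rotated])
 moreover have "A \<inter> {x \<in> A. c <= q x} = {x \<in> A. c <= q x}" by blast
 ultimately show "compact {x \<in> A. c <= q x}" by simp
qed

text \<open>This replaces Hopf's lemma and a gradient bound up to the boundary. In the strip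
  \<open>|w|\<close> lies below a multiple of \<open>1 - exp (k rho)\<close> and \<open>u\<close>
  above a multiple of \<open>exp (- k rho) - 1\<close>, and these are comparable; on the rest of the
  closure \<open>u\<close> is bounded below by compactness.\<close>

lemma quotient_bounded:
 assumes hw: "has_hessian_on Om w gw Hw" and cw: "continuous_on (closure Om) w"
  and zw: "\<And>x. x \<in> frontier Om ==> w x = 0" and trw: "\<And>x. x \<in> Om ==> \<bar>trace_op (Hw x)\<bar> <= Q"
 obtains B where "B >= 0" "\<And>x. x \<in> Om ==> \<bar>w x\<bar> <= B * u x"
proof -
 define Qu where "Qu = M + \<bar>lam\<bar>"
 \<comment> \<open>\<open>Q + 1\<close> beats the Laplacian of \<open>w\<close>, and
   \<open>2 * Qu + 1\<close> beats \<open>(V - lam) * u\<close> where \<open>u < 2 * a\<close>, with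
   \<open>a\<close> as chosen below.\<close>
 define G where "G = max (2 * Qu + 1) (Q + 1)"
 obtain k where k: "k > 0" "\<And>x. x \<in> Om ==> rho x > - 1 / k ==>
   exp (k * rho x) * (k\<^sup>2 * (gr x \<bullet> gr x) + k * trace_op (Hr x)) >= G \<and>
   exp ((- k) * rho x) * ((- k)\<^sup>2 * (gr x \<bullet> gr x) + (- k) * trace_op (Hr x)) >= G"
  by (rule strip_laplacian_large[of G]) (rule that)
 have hrho: "has_hessian_on Om rho gr Hr" by (rule hessian_subset[OF hess_rho]) (use Om_U in blast)
 note he = hessian_exp[OF hrho]
 have cexp: "continuous_on (closure Om) (\<lambda>x. exp (p * rho x))" for p by (intro continuous_intros cont_rho)
 have "bounded (w ` closure Om)" by (rule compact_imp_bounded[OF compact_continuous_image[OF cw compact_closure]])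
 then obtain Mw where Mw: "Mw > 0" "\<And>x. x \<in> closure Om ==> \<bar>w x\<bar> <= Mw" unfolding bounded_pos by auto
 define K where "K = {x \<in> closure Om. rho x <= - 1 / k}"
 have cK: "compact K" unfolding K_def by (rule closed_sublevel[OF compact_closure cont_rho])
 have KO: "K \<subseteq> Om"
 proof
  fix x assume "x \<in> K"
  then have "x \<in> closure Om" "rho x <= - 1 / k" by (auto simp: K_def)
  moreover have "- 1 / k < 0" using k(1) by simp
  ultimately have "x \<in> closure Om" "rho x < 0" by linarith+
  then show "x \<in> Om" using closure_cases[of x] rho_zero[of x] by auto
 qed
 have "\<exists>m>0. \<forall>x\<in>K. m <= u x"
 proof (cases "K = {}")
  case False
  have "continuous_on K u" by (rule continuous_on_subset[OF cont_u]) (auto simp: K_def)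
  then obtain z where z: "z \<in> K" "\<And>x. x \<in> K ==> u z <= u x" using continuous_attains_inf[OF cK False] by blast
  then show ?thesis using u_pos[of z] KO by blast
 qed (auto intro: exI[of _ 1])
 then obtain m0 where m0: "m0 > 0" "\<And>x. x \<in> K ==> m0 <= u x" by blast
 \<comment> \<open>On the inner boundary of the strip \<open>exp (- 1) <= 1 / 2\<close>, so the
   barrier is at least \<open>A / 2\<close>, which exceeds \<open>Mw\<close>.\<close>
 define A where "A = 2 * (Mw + 1)"
 have A: "A >= 1" using Mw by (simp add: A_def)
 have upper: "w' x <= A * (1 - exp (k * rho x))"
  if h': "has_hessian_on Om w' gw' Hw'" and c': "continuous_on (closure Om) w'"
   and z': "\<And>x. x \<in> frontier Om ==> w' x = 0" and t': "\<And>x. x \<in> Om ==> - Q <= trace_op (Hw' x)"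
   and b': "\<And>x. x \<in> closure Om ==> w' x <= Mw" and x: "x \<in> Om" "rho x >= - 1 / k" for w' gw' Hw' x
 proof -
  define q where "q = (\<lambda>x. w' x + (A * exp (k * rho x) + (- A)))"
  note hq = hessian_add[OF h' hessian_add[OF hessian_cmult[OF he[of k], of A] hessian_const[of Om "- A"]]]
  have "q x <= 0"
  proof (rule strip_maximum_principle[OF hq[folded q_def] _ k(1) _ _ _ x])
   show "continuous_on (closure Om) q" unfolding q_def by (intro continuous_intros c' cexp cont_rho)
   show "q z <= 0" if "z \<in> frontier Om" for z using z'[OF that] rho_zero[OF that] by (simp add: q_def)
   fix z assume z: "z \<in> Om"
   show "q z <= 0" if "rho z = - 1 / k"
   proof -
    have "exp (-1::real) <= 1 / 2"
    proof -
     have "exp (1::real) >= 2" using exp_ge_add_one_self[of 1] by simp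
     then show ?thesis by (simp add: exp_minus field_simps)
    qed
    moreover have "k * rho z = - 1" using that k by simp
    ultimately have "A * exp (k * rho z) <= A * (1 / 2)" using A by (intro mult_left_mono) auto
    then show ?thesis using b'[OF Om_closure[OF z]] by (simp add: q_def A_def)
   qed
   assume r: "rho z > - 1 / k"
   have "G <= 1 * (exp (k * rho z) * (k\<^sup>2 * (gr z \<bullet> gr z) + k * trace_op (Hr z)))" using k(2)[OF z r] by simp
   also have "\<dots> <= A * (exp (k * rho z) * (k\<^sup>2 * (gr z \<bullet> gr z) + k * trace_op (Hr z)))"
   proof (rule mult_right_mono[OF A])
    have "0 <= G" using V_bd[OF z] by (simp add: G_def Qu_def le_max_iff_disj)
    then show "0 <= exp (k * rho z) * (k\<^sup>2 * (gr z \<bullet> gr z) + k * trace_op (Hr z))" using k(2)[OF z r] by linarith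
   qed
   finally have *: "G <= A * (exp (k * rho z) * (k\<^sup>2 * (gr z \<bullet> gr z) + k * trace_op (Hr z)))" .
   show "0 < trace_op (\<lambda>a. Hw' z a + (A *\<^sub>R ((k * exp (k * rho z)) *\<^sub>R Hr z a + (k * k * exp (k * rho z) * (gr z \<bullet> a)) *\<^sub>R gr z) + 0))"
   proof -
    have "trace_op (\<lambda>a. Hw' z a + (A *\<^sub>R ((k * exp (k * rho z)) *\<^sub>R Hr z a + (k * k * exp (k * rho z) * (gr z \<bullet> a)) *\<^sub>R gr z) + 0))
     = trace_op (Hw' z) + A * (exp (k * rho z) * (k\<^sup>2 * (gr z \<bullet> gr z) + k * trace_op (Hr z)))"
     by (subst trace_op_simps(1), subst trace_op_simps(1), subst trace_op_simps(2), subst trace_exp)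
       (simp only: trace_op_simps(5) add_0_right)
    then show ?thesis using * t'[OF z] by (simp add: G_def)
   qed
  qed
  then show ?thesis by (simp add: q_def algebra_simps)
 qed
 have up: "\<bar>w x\<bar> <= A * (1 - exp (k * rho x))" if x: "x \<in> Om" "rho x >= - 1 / k" for x
 proof -
  have 1: "w x <= A * (1 - exp (k * rho x))"
   by (rule upper[OF hw cw zw _ _ x]) (use trw Mw in \<open>force simp: abs_le_iff\<close>)+
  have 2: "(-1) * w x <= A * (1 - exp (k * rho x))"
  proof (rule upper[OF hessian_cmult[OF hw, of "-1"] _ _ _ _ x])
   show "continuous_on (closure Om) (\<lambda>x. (-1) * w x)" by (intro continuous_intros cw)
   show "- Q <= trace_op (\<lambda>a. (-1) *\<^sub>R Hw z a)" if "z \<in> Om" for z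
    unfolding trace_op_simps(2) using trw[OF that] by (simp add: abs_le_iff)
  qed (use zw Mw in \<open>force simp: abs_le_iff\<close>)+
  from 1 2 show ?thesis by simp
 qed
 \<comment> \<open>On the inner boundary the lower barrier is at most \<open>(3 - 1) * a\<close>,
   which is the bound \<open>m0\<close> for \<open>u\<close> there.\<close>
 define a where "a = m0 / 2"
 have a: "a > 0" using m0 by (simp add: a_def)
 have low: "a * (exp ((- k) * rho x) - 1) <= u x" if x: "x \<in> Om" "rho x >= - 1 / k" for x
 proof -
  define q where "q = (\<lambda>x. (a * exp ((- k) * rho x) + (- a)) + (-1) * u x)"
  note hq = hessian_add[OF hessian_add[OF hessian_cmult[OF he[of "- k"], of a] hessian_const[of Om "- a"]] hessian_cmult[OF hu, of "-1"]]
  have e2: "exp ((- k) * rho z) <= 3" if "rho z >= - 1 / k" for z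
  proof -
   have "(- k) * rho z <= 1" using that k(1) by (simp add: field_simps)
   then have "exp ((- k) * rho z) <= exp 1" by simp
   then show ?thesis using exp_le by linarith
  qed
  have "q x <= 0"
  proof (rule strip_maximum_principle[OF hq[folded q_def] _ k(1) _ _ _ x])
   show "continuous_on (closure Om) q" unfolding q_def by (intro continuous_intros cont_u cont_rho)
   show "q z <= 0" if "z \<in> frontier Om" for z using u_zero[OF that] rho_zero[OF that] by (simp add: q_def)
   fix z assume z: "z \<in> Om"
   show "q z <= 0" if r: "rho z = - 1 / k"
   proof -
    have "z \<in> K" using Om_closure[OF z] r by (simp add: K_def)
    then have "m0 <= u z" by (rule m0(2))
    moreover have "a * exp ((- k) * rho z) <= a * 3" using e2[of z] r a by (intro mult_left_mono) auto
    ultimately show ?thesis by (simp add: q_def a_def)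
   qed
   assume r: "rho z > - 1 / k" and qz: "q z > 0"
   have "a * G <= a * (exp ((- k) * rho z) * ((- k)\<^sup>2 * (gr z \<bullet> gr z) + (- k) * trace_op (Hr z)))"
    using k(2)[OF z r] a by (intro mult_left_mono) auto
   moreover have "u z < 2 * a"
   proof -
    have "a * exp ((- k) * rho z) <= a * 3" using e2[of z] r a by (intro mult_left_mono) auto
    then show ?thesis using qz by (simp add: q_def)
   qed
   moreover have "(V z - lam) * u z <= Qu * (2 * a)"
   proof -
    have "(V z - lam) * u z <= \<bar>V z - lam\<bar> * u z" using u_pos[OF z] by (intro mult_right_mono) auto
    also have "\<dots> <= Qu * (2 * a)" using V_bd[OF z] \<open>u z < 2 * a\<close> u_pos[OF z] by (intro mult_mono) (auto simp: Qu_def)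
    finally show ?thesis .
   qed
   moreover have "a * (2 * Qu + 1) <= a * G" using a by (intro mult_left_mono) (auto simp: G_def)
   ultimately have *: "0 < a * (exp ((- k) * rho z) * ((- k)\<^sup>2 * (gr z \<bullet> gr z) + (- k) * trace_op (Hr z))) - (V z - lam) * u z"
    using a by (simp add: algebra_simps)
   have "trace_op (\<lambda>b. (a *\<^sub>R (((- k) * exp ((- k) * rho z)) *\<^sub>R Hr z b + ((- k) * (- k) * exp ((- k) * rho z) * (gr z \<bullet> b)) *\<^sub>R gr z) + 0) + (-1) *\<^sub>R H z b)
    = a * (exp ((- k) * rho z) * ((- k)\<^sup>2 * (gr z \<bullet> gr z) + (- k) * trace_op (Hr z))) + (-1) * trace_op (H z)"
    by (subst trace_op_simps(1), subst trace_op_simps(1), subst trace_op_simps(2), subst trace_exp, subst trace_op_simps(2))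
      (simp only: trace_op_simps(5) add_0_right)
   then show "0 < trace_op (\<lambda>b. (a *\<^sub>R (((- k) * exp ((- k) * rho z)) *\<^sub>R Hr z b + ((- k) * (- k) * exp ((- k) * rho z) * (gr z \<bullet> b)) *\<^sub>R gr z) + 0) + (-1) *\<^sub>R H z b)"
    using * pde[OF z] by simp
  qed
  then show ?thesis by (simp add: q_def algebra_simps)
 qed
 define B where "B = A / a + Mw / m0"
 have B1: "A / a <= B" "Mw / m0 <= B" "0 <= B" using A a Mw m0 by (auto simp: B_def)
 show ?thesis
 proof (rule that[OF B1(3)])
  fix x assume x: "x \<in> Om"
  show "\<bar>w x\<bar> <= B * u x"
  proof (cases "rho x >= - 1 / k")
   case True
   define E where "E = exp (k * rho x)"
   have E: "E > 0" by (simp add: E_def)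
   have e: "exp ((- k) * rho x) = 1 / E" by (simp add: E_def exp_minus inverse_eq_divide)
   \<comment> \<open>Equivalent to \<open>2 <= E + 1 / E\<close>, this links the upper barrier for
     \<open>w\<close> to the lower barrier for \<open>u\<close>.\<close>
   have "1 - E <= 1 / E - 1"
   proof -
    have "0 <= (E - 1)\<^sup>2 / E" using E by simp
    also have "(E - 1)\<^sup>2 / E = E - 2 + 1 / E" using E by (simp add: power2_eq_square field_simps)
    finally show ?thesis by simp
   qed
   moreover have "1 / E - 1 <= u x / a"
    unfolding pos_le_divide_eq[OF a] using low[OF x True] unfolding e by (simp only: mult.commute)
   ultimately have "1 - E <= u x / a" by linarith
   then have "A * (1 - E) <= A * (u x / a)" using A by (intro mult_left_mono) auto
   also have "\<dots> = (A / a) * u x" by simp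
   also have "\<dots> <= B * u x" using B1 u_pos[OF x] by (intro mult_right_mono) auto
   finally show ?thesis using up[OF x True] by (simp add: E_def)
  next
   case False
   then have "x \<in> K" using Om_closure[OF x] by (simp add: K_def)
   then have "Mw * m0 <= Mw * u x" using m0(2) Mw by (intro mult_left_mono) auto
   then have "Mw <= (Mw / m0) * u x" using m0(1) by (simp add: field_simps)
   also have "\<dots> <= B * u x" using B1 u_pos[OF x] by (intro mult_right_mono) auto
   finally show ?thesis using Mw(2)[OF Om_closure[OF x]] by simp
  qed
 qed
qed

text \<open>Ground-state transform: division by \<open>u\<close> produces the drift
  \<open>2 gf\<close>. If \<open>w\<close> solves an eigenvalue equation with the same potential,
  the potential cancels on the right and only the difference of the eigenvalues remains.\<close>

lemma quotient_operator:
 assumes hw: "has_hessian_on Om w gw Hw"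
 obtains gv Hv where "has_hessian_on Om (\<lambda>x. w x * inverse (u x)) gv Hv"
  "\<And>x. x \<in> Om ==> trace_op (Hv x) + 2 * (gf x \<bullet> gv x) = trace_op (Hw x) * inverse (u x) - (V x - lam) * (w x * inverse (u x))"
proof -
 define i where "i = (\<lambda>x. inverse (u x))"
 have hi: "has_hessian_on Om i (\<lambda>x. (- (i x * i x)) *\<^sub>R g x) (\<lambda>x a. (- (i x * i x)) *\<^sub>R H x a + ((2 * i x * i x * i x) * (g x \<bullet> a)) *\<^sub>R g x)"
  unfolding i_def
  by (rule hessian_compose[OF hu, of inverse "\<lambda>s. - (inverse s * inverse s)" "\<lambda>s. 2 * inverse s * inverse s * inverse s"])
    (use u_pos in \<open>auto intro!: derivative_eq_intros simp: less_imp_neq[symmetric]\<close>)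
 note hv = hessian_mult[OF hw hi]
 show ?thesis
 proof (rule that[OF hv[unfolded i_def]])
  fix x assume x: "x \<in> Om"
  have gfx: "gf x = i x *\<^sub>R g x" by (simp add: gf_def i_def)
  have iu: "i x * u x = 1" using u_pos[OF x] by (simp add: i_def)
  have "trace_op (\<lambda>a. w x *\<^sub>R ((- (i x * i x)) *\<^sub>R H x a + ((2 * i x * i x * i x) * (g x \<bullet> a)) *\<^sub>R g x) + (gw x \<bullet> a) *\<^sub>R ((- (i x * i x)) *\<^sub>R g x) +
    (i x *\<^sub>R Hw x a + ((- (i x * i x)) *\<^sub>R g x \<bullet> a) *\<^sub>R gw x))
   + 2 * (gf x \<bullet> (w x *\<^sub>R ((- (i x * i x)) *\<^sub>R g x) + i x *\<^sub>R gw x)) = trace_op (Hw x) * i x - w x * (i x * i x) * trace_op (H x)"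
   unfolding trace_op_simps(1) trace_op_simps(2) trace_op_simps(3) trace_op_simps(4)
   by (simp add: gfx inner_add_right inner_commute[of "gw x"] algebra_simps)
  also have "\<dots> = trace_op (Hw x) * i x - (V x - lam) * (w x * i x)"
  proof -
   have "w x * (i x * i x) * ((V x - lam) * u x) = (V x - lam) * (w x * i x) * (i x * u x)" by (simp add: algebra_simps)
   then show ?thesis unfolding pde[OF x] iu by simp
  qed
  finally show "trace_op (\<lambda>a. w x *\<^sub>R ((- (inverse (u x) * inverse (u x))) *\<^sub>R H x a + ((2 * inverse (u x) * inverse (u x) * inverse (u x)) * (g x \<bullet> a)) *\<^sub>R g x) + (gw x \<bullet> a) *\<^sub>R ((- (inverse (u x) * inverse (u x))) *\<^sub>R g x) +
    (inverse (u x) *\<^sub>R Hw x a + ((- (inverse (u x) * inverse (u x))) *\<^sub>R g x \<bullet> a) *\<^sub>R gw x))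
   + 2 * (gf x \<bullet> (w x *\<^sub>R ((- (inverse (u x) * inverse (u x))) *\<^sub>R g x) + inverse (u x) *\<^sub>R gw x)) = trace_op (Hw x) * inverse (u x) - (V x - lam) * (w x * inverse (u x))"
   by (simp only: i_def)
 qed
qed

text \<open>\<open>- ln u\<close> is a Lyapunov function: it blows up at the boundary, and the drift Laplacian
 with drift \<open>2 \<nabla> ln u\<close> maps it to \<open>\<lambda> - V - |\<nabla> ln u|\<^sup>2\<close>, which is bounded above.\<close>

lemma pair_penalized_max:
 fixes \<psi> :: "'a \<times> 'a \<Rightarrow> real"
 assumes c: "continuous_on (Om \<times> Om) \<psi>" and b: "\<And>x y. x \<in> Om ==> y \<in> Om ==> \<psi> (x, y) <= B" and e: "e > 0"
 obtains x0 y0 where "x0 \<in> Om" "y0 \<in> Om"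
  "\<And>x y. x \<in> Om ==> y \<in> Om ==> \<psi> (x, y) + e * (f x + f y) <= \<psi> (x0, y0) + e * (f x0 + f y0)"
proof -
 obtain p where p: "p \<in> Om" using Om_ne by blast
 define L where "L = \<psi> (p, p) + e * (f p + f p)"
 define d where "d = exp ((L - B) / e - 1)"
 \<comment> \<open>\<open>d\<close> is the level below which the penalty outweighs whatever the
   bound \<open>B\<close> could recover, so such pairs do worse than the reference pair
   \<open>(p, p)\<close>.\<close>
 have low: "\<psi> (x, y) + e * (f x + f y) < L" if x: "x \<in> Om" "y \<in> Om" "u x < d \<or> u y < d" for x y
 proof -
  have *: "f z < (L - B) / e - 1" if "z \<in> Om" "u z < d" for z
   using that u_pos[OF that(1)] unfolding f_def d_def by (metis exp_less_cancel_iff exp_ln)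
  have "f x + f y < (L - B) / e - 1" using x(3) *[OF x(1)] *[OF x(2)] f_le0[OF x(1)] f_le0[OF x(2)] by linarith
  then have "e * (f x + f y) < e * ((L - B) / e - 1)" using e by (intro mult_strict_left_mono) auto
  also have "\<dots> = L - B - e"
  proof -
   have "e * ((L - B) / e) = L - B" using e by simp
   then show ?thesis unfolding right_diff_distrib by simp
  qed
  finally show ?thesis using b[OF x(1,2)] e by linarith
 qed
 define K where "K = {x \<in> closure Om. d <= u x}"
 have cK: "compact K" unfolding K_def by (rule closed_sublevel(2)[OF compact_closure cont_u])
 have d0: "d > 0" by (simp add: d_def)
 have KO: "K \<subseteq> Om"
 proof
  fix x assume "x \<in> K"
  then have "x \<in> closure Om" "u x > 0" using d0 by (auto simp: K_def)
  then show "x \<in> Om" by (rule u_pos_Om)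
 qed
 have pK: "p \<in> K" using low[OF p p] Om_closure[OF p] by (force simp: K_def L_def)
 have KK: "K \<times> K \<subseteq> Om \<times> Om" using KO by blast
 have cf: "continuous_on K f" by (rule continuous_on_subset[OF hessian_continuous_on(1)[OF hf] KO])
 have c1: "continuous_on (K \<times> K) (\<lambda>p. f (fst p))" "continuous_on (K \<times> K) (\<lambda>p. f (snd p))"
  by (rule continuous_on_compose2[OF cf]; auto intro!: continuous_intros)+
 have "continuous_on (K \<times> K) (\<lambda>p. \<psi> p + e * (f (fst p) + f (snd p)))"
  by (rule continuous_on_add[OF continuous_on_subset[OF c KK] continuous_on_mult[OF continuous_on_const continuous_on_add[OF c1]]])
 from continuous_attains_sup[OF compact_Times[OF cK cK] _ this] pK
 obtain q where q: "q \<in> K \<times> K" "\<forall>p\<in>K \<times> K. \<psi> p + e * (f (fst p) + f (snd p)) <= \<psi> q + e * (f (fst q) + f (snd q))" by blast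
 obtain x0 y0 where q0: "q = (x0, y0)" by (cases q) auto
 have qK: "x0 \<in> K" "y0 \<in> K" using q(1) by (auto simp: q0)
 have qm: "\<psi> (x, y) + e * (f x + f y) <= \<psi> (x0, y0) + e * (f x0 + f y0)" if "x \<in> K" "y \<in> K" for x y
  using q(2)[rule_format, of "(x, y)"] that by (simp add: q0)
 show ?thesis
 proof (rule that[of x0 y0])
  show "x0 \<in> Om" "y0 \<in> Om" using qK KO by auto
  fix x y assume x: "x \<in> Om" "y \<in> Om"
  show "\<psi> (x, y) + e * (f x + f y) <= \<psi> (x0, y0) + e * (f x0 + f y0)"
  proof (cases "x \<in> K \<and> y \<in> K")
   case False
   then have "u x < d \<or> u y < d" using Om_closure[OF x(1)] Om_closure[OF x(2)] by (auto simp: K_def)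
   then have "\<psi> (x, y) + e * (f x + f y) < L" by (rule low[OF x])
   then show ?thesis using qm[OF pK pK] by (simp add: L_def)
  qed (use qm in blast)
 qed
qed

lemma penalized_max:
 assumes c: "continuous_on Om \<psi>" and b: "\<And>x. x \<in> Om ==> \<psi> x <= B" and e: "e > 0"
 obtains y where "y \<in> Om" "\<And>x. x \<in> Om ==> \<psi> x + e * f x <= \<psi> y + e * f y"
proof -
 \<comment> \<open>The one-point statement is the two-point statement for a sum of two copies, with
   the second point frozen at its optimal position.\<close>
 have "continuous_on (Om \<times> Om) (\<lambda>p. \<psi> (fst p) + \<psi> (snd p))"
  by (intro continuous_on_add continuous_on_compose2[OF c]) (auto intro!: continuous_intros)
 moreover have "\<psi> (fst (x, y)) + \<psi> (snd (x, y)) <= B + B" if "x \<in> Om" "y \<in> Om" for x y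
  using b[OF that(1)] b[OF that(2)] by simp
 ultimately obtain y z where yz: "y \<in> Om" "z \<in> Om" and m: "\<And>x x'. x \<in> Om ==> x' \<in> Om ==>
   \<psi> (fst (x, x')) + \<psi> (snd (x, x')) + e * (f x + f x') <= \<psi> (fst (y, z)) + \<psi> (snd (y, z)) + e * (f y + f z)"
  using pair_penalized_max[of "\<lambda>p. \<psi> (fst p) + \<psi> (snd p)" "B + B", OF _ _ e] by blast
 show ?thesis
  by (rule that[OF yz(1)]) (use m yz(2) in \<open>force simp: distrib_left\<close>)
qed

text \<open>At a maximum of \<open>v + e f\<close> the gradient of \<open>v\<close> is
  \<open>- e\<close> times that of \<open>f\<close>, so the drift contributes
  \<open>- 2 e |gf|^2\<close>. The unbounded gradient near the boundary thus enters with a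
  favourable sign, and the error is a fixed multiple of \<open>e\<close>.\<close>

lemma penalized_operator:
 assumes hv: "has_hessian_on Om v gv Hv" and bd: "\<And>x. x \<in> Om ==> v x <= B" and e: "e > 0"
 obtains y where "y \<in> Om" "\<And>x. x \<in> Om ==> v x + e * f x <= v y + e * f y"
  "trace_op (Hv y) + 2 * (gf y \<bullet> gv y) <= e * (M + \<bar>lam\<bar>)"
proof -
 obtain y where y: "y \<in> Om" "\<And>x. x \<in> Om ==> v x + e * f x <= v y + e * f y"
  using penalized_max[OF hessian_continuous_on(1)[OF hv] bd e] by blast
 note hs = hessian_add[OF hv hessian_cmult[OF hf, of e]]
 have ev: "\<forall>\<^sub>F z in nhds y. v z + e * f z <= v y + e * f y"
  using eventually_nhds_in_open[OF open_Om y(1)] by (rule eventually_mono) (rule y(2))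
 have g0: "gv y + e *\<^sub>R gf y = 0" using hessian_at_max(1)[OF hs open_Om y(1) ev] .
 have "trace_op (\<lambda>a. Hv y a + e *\<^sub>R Hf y a) <= 0" using hessian_at_max(2)[OF hs open_Om y(1) ev] .
 then have t: "trace_op (Hv y) + e * trace_op (Hf y) <= 0" unfolding trace_op_simps(1) trace_op_simps(2) .
 have gv: "gv y = - (e *\<^sub>R gf y)" using g0 by (simp add: eq_neg_iff_add_eq_0)
 have "trace_op (Hv y) + 2 * (gf y \<bullet> gv y) <= - e * (trace_op (Hf y) + gf y \<bullet> gf y) - e * (gf y \<bullet> gf y)"
  unfolding gv using t by (simp add: algebra_simps)
 also have "\<dots> <= e * (- (V y - lam))" unfolding trf[OF y(1)] using mult_nonneg_nonneg[OF less_imp_le[OF e] inner_ge_zero[of "gf y"]] by (simp add: algebra_simps)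
 also have "\<dots> <= e * (M + \<bar>lam\<bar>)" using V_bd[OF y(1)] e by (intro mult_left_mono) auto
 finally show ?thesis using that[OF y] by blast
qed

text \<open>A maximum principle that asks for boundedness instead of boundary values: the penalty
  forces an interior maximum, where a positive value of \<open>v\<close> would be incompatible with
  the equation.\<close>

lemma one_point_max:
 assumes hv: "has_hessian_on Om v gv Hv" and bd: "\<And>x. x \<in> Om ==> v x <= B"
  and eq: "\<And>x. x \<in> Om ==> trace_op (Hv x) + 2 * (gf x \<bullet> gv x) = a x * v x"
  and a: "a0 > 0" "\<And>x. x \<in> Om ==> a x >= a0" and x: "x \<in> Om"
 shows "v x <= 0"
proof (rule ccontr)
 assume "\<not> v x <= 0"
 then have vx: "v x > 0" by simp
 define K where "K = M + \<bar>lam\<bar>"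
 have K: "K >= 0" using V_bd[OF x] by (simp add: K_def)
 \<comment> \<open>The first entry preserves half of the value \<open>v x\<close> at the maximum;
   the second makes the error at most \<open>a0 * v x / 4\<close>, half of what the equation
   forces.\<close>
 define e where "e = min (v x / (2 * (1 - f x))) (a0 * v x / (4 * (K + 1)))"
 have f0: "f x <= 0" by (rule f_le0[OF x])
 have e: "e > 0" unfolding e_def using vx f0 a(1) K by (intro min_less_iff_conj[THEN iffD2] conjI divide_pos_pos mult_pos_pos) auto
 obtain y where y: "y \<in> Om" "\<And>x. x \<in> Om ==> v x + e * f x <= v y + e * f y"
  "trace_op (Hv y) + 2 * (gf y \<bullet> gv y) <= e * (M + \<bar>lam\<bar>)" using penalized_operator[OF hv bd e] by blast
 have "e * (- f x) <= v x / 2"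
 proof -
  have "e * (1 - f x) <= v x / (2 * (1 - f x)) * (1 - f x)" using f0 by (intro mult_right_mono) (auto simp: e_def)
  also have "\<dots> = v x / 2" using f0 by (simp add: field_simps)
  finally show ?thesis using e by (simp add: algebra_simps)
 qed
 then have "v x / 2 <= v x + e * f x" by simp
 also have "\<dots> <= v y + e * f y" by (rule y(2)[OF x])
 also have "\<dots> <= v y" using f_le0[OF y(1)] e by (simp add: mult_nonneg_nonpos)
 finally have vy: "v x / 2 <= v y" .
 have "a0 * (v x / 2) <= a y * v y" using a(1) a(2)[OF y(1)] vy vx by (intro mult_mono) auto
 also have "\<dots> <= e * K" using y(3) eq[OF y(1)] by (simp add: K_def)
 also have "\<dots> <= a0 * v x / (4 * (K + 1)) * (K + 1)"
  using K e by (intro mult_mono) (auto simp: e_def)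
 also have "\<dots> = a0 * v x / 4" using K by (simp add: field_simps)
 finally show False using a(1) vx by (simp add: field_simps)
qed

text \<open>Applied to a quotient of eigenfunctions and to its negative, this puts zero between
  infimum and supremum and takes the place of orthogonality. A positive lower bound would make the
  operator at a penalised minimum at most \<open>- a0 * c\<close>, where it can be negative only up
  to a multiple of \<open>e\<close>.\<close>

lemma one_point_min:
 assumes hv: "has_hessian_on Om v gv Hv"
  and eq: "\<And>x. x \<in> Om ==> trace_op (Hv x) + 2 * (gf x \<bullet> gv x) = a x * v x"
  and a: "a0 > 0" "\<And>x. x \<in> Om ==> a x <= - a0" and c: "c > 0"
 shows "\<exists>x\<in>Om. v x < c"
proof (rule ccontr)
 assume "\<not> ?thesis"
 then have vc: "\<And>x. x \<in> Om ==> c <= v x" by force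
 have K: "M + \<bar>lam\<bar> >= 0" using V_bd Om_ne by force
 define K1 where "K1 = M + \<bar>lam\<bar> + 1"
 have K1: "K1 > 0" using K by (simp add: K1_def)
 define e where "e = a0 * c / (2 * K1)"
 have e: "e > 0" using a c K1 by (simp add: e_def)
 obtain y where y: "y \<in> Om" "trace_op (\<lambda>b. (-1) *\<^sub>R Hv y b) + 2 * (gf y \<bullet> ((-1) *\<^sub>R gv y)) <= e * (M + \<bar>lam\<bar>)"
 proof -
  have b: "\<And>x. x \<in> Om ==> (-1) * v x <= 0" using vc c by force
  show thesis using penalized_operator[OF hessian_cmult[OF hv, of "-1"] b e] that by blast
 qed
 have "trace_op (\<lambda>b. (-1) *\<^sub>R Hv y b) + 2 * (gf y \<bullet> ((-1) *\<^sub>R gv y)) = - (trace_op (Hv y) + 2 * (gf y \<bullet> gv y))"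
  unfolding trace_op_simps(2) by simp
 then have "- (a y * v y) <= e * (M + \<bar>lam\<bar>)" using y(2) eq[OF y(1)] by simp
 moreover have "a0 * c <= (- a y) * v y" using a(1) a(2)[OF y(1)] vc[OF y(1)] c by (intro mult_mono) auto
 moreover have "e * (M + \<bar>lam\<bar>) <= e * K1" using e by (simp add: K1_def)
 moreover have "e * K1 = a0 * c / 2" using K1 by (simp add: e_def)
 ultimately have "a0 * c <= a0 * c / 2" by simp
 then show False using mult_pos_pos[OF a(1) c] by simp
qed

end

section \<open>The modulus of log-concavity\<close>

lemma eventually_line:
 fixes x v :: "'a::real_normed_vector"
 assumes "\<forall>\<^sub>F z in nhds x. P z" shows "\<forall>\<^sub>F t in nhds (0::real). P (x + t *\<^sub>R v)"
proof -
 have "((\<lambda>t. x + t *\<^sub>R v) \<longlongrightarrow> x + 0 *\<^sub>R v) (nhds (0::real))"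
  by (intro tendsto_intros filterlim_ident)
 then show ?thesis using assms by (auto simp: filterlim_iff)
qed

lemma jet2_shift:
 assumes I: "open I" "s \<in> I" and L: "\<And>t. t \<in> I ==> (L has_real_derivative L1 t) (at t)"
  and L2: "(L1 has_real_derivative c) (at s)"
 shows "jet2 (\<lambda>t. L (s + t)) (L1 s) c"
 unfolding jet2_def
proof (intro exI[of _ "\<lambda>t. L1 (s + t)"] conjI)
 have "((\<lambda>t. s + t) \<longlongrightarrow> s + 0) (nhds (0::real))" by (intro tendsto_intros filterlim_ident)
 then have "\<forall>\<^sub>F t in nhds 0. s + t \<in> I" using I by (simp add: topological_tendstoD)
 then show "\<forall>\<^sub>F t in nhds 0. ((\<lambda>t. L (s + t)) has_real_derivative L1 (s + t)) (at t)"
 proof eventually_elim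
  case (elim t)
  have "(L has_real_derivative L1 (t + s)) (at (t + s))" using L[OF elim] unfolding add.commute[of s] .
  then show ?case unfolding DERIV_shift add.commute[of s] .
 qed
 show "((\<lambda>t. L1 (s + t)) has_real_derivative c) (at 0)"
  using L2 DERIV_shift[of L1 c 0 s] by (simp add: add.commute)
qed simp

section \<open>Strict convexity of the domain\<close>

context smooth_convex_domain
begin

text \<open>If a point of the open segment were outside \<open>Om\<close>, the whole open segment
  would lie in the frontier, because a single point of it in \<open>Om\<close> pulls the rest
  inside. Then \<open>rho\<close> vanishes along a line, so its second derivative in a tangential
  direction is zero, against \<open>curv\<close>.\<close>

lemma strictly_convex:
 assumes p: "p \<in> closure Om" and r: "r \<in> closure Om" and pr: "p \<noteq> r" and x: "x \<in> open_segment p r"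
 shows "x \<in> Om"
proof (rule ccontr)
 assume xn: "x \<notin> Om"
 have int: "interior Om = Om" using open_Om by (rule interior_open)
 have seg: "open_segment p r \<subseteq> closure Om"
  using convex_closure[OF convex_Om] p r by (meson closed_segment_subset order_trans segment_open_subset_closed)
 have none: "w \<notin> Om" if w: "w \<in> open_segment p r" for w
 proof
  assume wO: "w \<in> Om"
  have "open_segment w p \<subseteq> Om" "open_segment w r \<subseteq> Om"
   using in_interior_closure_convex_segment[OF convex_Om, of w p] in_interior_closure_convex_segment[OF convex_Om, of w r]
    wO p r int by auto
  moreover have "x = w \<or> x \<in> open_segment w p \<or> x \<in> open_segment w r"
  proof -
   obtain a where a: "0 < a" "a < 1" "w = (1 - a) *\<^sub>R p + a *\<^sub>R r" using w by (auto simp: in_segment)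
   obtain b where b: "0 < b" "b < 1" "x = (1 - b) *\<^sub>R p + b *\<^sub>R r" using x by (auto simp: in_segment)
   consider "b = a" | "b < a" | "b > a" by linarith
   then show ?thesis
   proof cases
    case 2
    define c where "c = (a - b) / a"
    have c: "0 < c" "c < 1" using 2 a b by (auto simp: c_def field_simps)
    have ca: "(1 - c) * a = b" using a by (simp add: c_def field_simps)
    have "(1 - c) *\<^sub>R w + c *\<^sub>R p = (1 - (1 - c) * a) *\<^sub>R p + ((1 - c) * a) *\<^sub>R r"
     unfolding a(3) by (simp add: algebra_simps)
    then have "x = (1 - c) *\<^sub>R w + c *\<^sub>R p" using b(3) unfolding ca by simp
    moreover have "w \<noteq> p"
    proof
     assume "w = p"
     then have "a *\<^sub>R (r - p) = 0" using a(3) by (simp add: algebra_simps)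
     then show False using a pr by simp
    qed
    ultimately show ?thesis using c by (auto simp: in_segment)
   next
    case 3
    define c where "c = (b - a) / (1 - a)"
    have c: "0 < c" "c < 1" using 3 a b by (auto simp: c_def field_simps)
    have ca: "(1 - c) * a + c = b"
    proof -
     have "(1 - c) * a + c = a + c * (1 - a)" by (simp add: algebra_simps)
     also have "c * (1 - a) = b - a" using a by (simp add: c_def)
     finally show ?thesis by simp
    qed
    have "(1 - c) *\<^sub>R w + c *\<^sub>R r = (1 - ((1 - c) * a + c)) *\<^sub>R p + ((1 - c) * a + c) *\<^sub>R r"
     unfolding a(3) by (simp add: algebra_simps)
    then have "x = (1 - c) *\<^sub>R w + c *\<^sub>R r" using b(3) unfolding ca by simp
    moreover have "w \<noteq> r"
    proof
     assume "w = r"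
     then have "(1 - a) *\<^sub>R (p - r) = 0" using a(3) by (simp add: algebra_simps)
     then show False using a pr by simp
    qed
    ultimately show ?thesis using c by (auto simp: in_segment)
   qed (use a b in simp)
  qed
  ultimately show False using xn wO by blast
 qed
 have xf: "x \<in> frontier Om" using closure_cases[of x] seg x xn by blast
 obtain b where b: "0 < b" "b < 1" "x = (1 - b) *\<^sub>R p + b *\<^sub>R r" using x by (auto simp: in_segment)
 define v where "v = r - p"
 have "((\<lambda>t. b + t) \<longlongrightarrow> b + 0) (nhds (0::real))" by (intro tendsto_intros filterlim_ident)
 then have "\<forall>\<^sub>F t in nhds 0. b + t \<in> {0<..<1}" using b by (intro topological_tendstoD) auto
 then have z: "\<forall>\<^sub>F t in nhds 0. rho (x + t *\<^sub>R v) = 0"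
 proof eventually_elim
  case (elim t)
  have "x + t *\<^sub>R v = (1 - (b + t)) *\<^sub>R p + (b + t) *\<^sub>R r" by (simp add: b(3) v_def algebra_simps)
  then have "x + t *\<^sub>R v \<in> open_segment p r" using elim pr by (auto simp: in_segment)
  then have "x + t *\<^sub>R v \<in> frontier Om" using closure_cases seg none by blast
  then show ?case by (rule rho_zero)
 qed
 have xU: "x \<in> U" using cl_U xf by (auto simp: frontier_def)
 note J = jet2_line[OF hess_rho open_U xU, of v]
 have r0: "rho (x + 0 *\<^sub>R v) = 0" using rho_zero[OF xf] by simp
 have "gr x \<bullet> v = 0" by (rule jet2_max(1)[OF J]) (use z r0 in \<open>auto elim: eventually_mono\<close>)
 then have "Hr x v \<bullet> v > 0" using curv[OF xf, of v] pr by (simp add: v_def)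
 moreover have "Hr x v \<bullet> v <= 0" by (rule jet2_max(2)[OF J]) (use z r0 in \<open>auto elim: eventually_mono\<close>)
 ultimately show False by simp
qed

end

section \<open>Korevaar's log-concavity argument\<close>

context ground_state
begin

text \<open>At the maximum all three gradients coincide, and moving the three points by the same
  vector compares the Hessians. \<open>F\<close> is kept general because it is once the logarithm of
  a comparison function near the boundary and once \<open>f\<close> itself.\<close>

lemma korevaar_test:
 assumes x: "x \<in> Om" and y: "y \<in> Om" and hF: "has_hessian_on N F gF HF" "open N" and m: "m = (1/2) *\<^sub>R (x + y)" "m \<in> N"
  and mx: "\<And>a b. \<forall>\<^sub>F t in nhds 0. f (x + t *\<^sub>R a) + f (y + t *\<^sub>R b) - 2 * F (m + t *\<^sub>R ((1/2) *\<^sub>R (a + b))) <= f x + f y - 2 * F m"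
 shows "V x + V y - 2 * lam <= 2 * (trace_op (HF m) + gF m \<bullet> gF m)"
proof -
 have J: "gf x \<bullet> a + gf y \<bullet> b - 2 * (gF m \<bullet> ((1/2) *\<^sub>R (a + b))) = 0"
  "Hf x a \<bullet> a + Hf y b \<bullet> b - 2 * (HF m ((1/2) *\<^sub>R (a + b)) \<bullet> ((1/2) *\<^sub>R (a + b))) <= 0" for a b
 proof -
  note j = jet2_diff[OF jet2_add[OF jet2_line[OF hf open_Om x, of a] jet2_line[OF hf open_Om y, of b]]
    jet2_cmult[OF jet2_line[OF hF m(2), of "(1/2) *\<^sub>R (a + b)"], of 2]]
  have "\<forall>\<^sub>F t in nhds 0. f (x + t *\<^sub>R a) + f (y + t *\<^sub>R b) - 2 * F (m + t *\<^sub>R ((1/2) *\<^sub>R (a + b)))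
    <= f (x + 0 *\<^sub>R a) + f (y + 0 *\<^sub>R b) - 2 * F (m + 0 *\<^sub>R ((1/2) *\<^sub>R (a + b)))"
   using mx[of a b] by simp
  from jet2_max[OF j this]
  show "gf x \<bullet> a + gf y \<bullet> b - 2 * (gF m \<bullet> ((1/2) *\<^sub>R (a + b))) = 0"
   "Hf x a \<bullet> a + Hf y b \<bullet> b - 2 * (HF m ((1/2) *\<^sub>R (a + b)) \<bullet> ((1/2) *\<^sub>R (a + b))) <= 0" .
 qed
 have "gf x \<bullet> a = gF m \<bullet> a" for a using J(1)[of a 0] by simp
 then have gx: "gf x = gF m" by (metis inner_commute vector_eq_ldot)
 have "gf y \<bullet> a = gF m \<bullet> a" for a using J(1)[of 0 a] by simp
 then have gy: "gf y = gF m" by (metis inner_commute vector_eq_ldot)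
 have "Hf x a \<bullet> a + Hf y a \<bullet> a - 2 * (HF m a \<bullet> a) <= 0" for a
  using J(2)[of a a] by (simp add: scaleR_2[symmetric])
 then have "(\<Sum>a\<in>Basis. Hf x a \<bullet> a + Hf y a \<bullet> a - 2 * (HF m a \<bullet> a)) <= 0" by (intro sum_nonpos)
 then have "trace_op (Hf x) + trace_op (Hf y) - 2 * trace_op (HF m) <= 0"
  unfolding trace_op_def by (simp add: sum.distrib sum_subtractf sum_distrib_left)
 then show ?thesis using trf[OF x] trf[OF y] unfolding gx gy distrib_left by argo
qed

lemma midpoint_closure: "x \<in> closure Om ==> y \<in> closure Om ==> (1/2) *\<^sub>R (x + y) \<in> closure Om"
 using convexD[OF convex_closure[OF convex_Om], of x y "1/2" "1/2"] by (simp add: scaleR_add_right)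

lemma midpoint_Om: "x \<in> Om ==> y \<in> Om ==> (1/2) *\<^sub>R (x + y) \<in> Om"
 using convexD[OF convex_Om, of x y "1/2" "1/2"] by (simp add: scaleR_add_right)

lemma ln_sqrt_prod:
 assumes "a > 0" "b > 0" "sqrt (a * b) <= c" shows "ln a + ln b <= 2 * ln c"
proof -
 have "ln (sqrt (a * b)) <= ln c" using assms by (intro ln_mono) auto
 then show ?thesis using assms by (simp add: ln_sqrt ln_mult)
qed

text \<open>The quotient of the geometric mean \<open>W\<close> by \<open>u\<close> at the midpoint
  takes the form \<open>0 / 0\<close> when both points approach the same boundary point, so its
  supremum is first taken over pairs whose midpoint avoids the boundary strip. A strict
  supersolution carries the bound into the strip. The maximum is then a genuine one, and strict
  convexity of the potential excludes a value above \<open>1\<close>.\<close>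

lemma log_concave_midpoint:
 assumes strict: "\<And>x y. x \<in> Om ==> y \<in> Om ==> x \<noteq> y ==> 2 * V ((1/2) *\<^sub>R (x + y)) < V x + V y"
  and x0: "x0 \<in> Om" and y0: "y0 \<in> Om"
 shows "f x0 + f y0 <= 2 * f ((1/2) *\<^sub>R (x0 + y0))"
proof -
 define Qu where "Qu = M + \<bar>lam\<bar>"
 define G where "G = 2 * Qu + 1"
 obtain k where k: "k > 0" "\<And>x. x \<in> Om ==> rho x > - 1 / k ==>
   exp (k * rho x) * (k\<^sup>2 * (gr x \<bullet> gr x) + k * trace_op (Hr x)) >= G \<and>
   exp ((- k) * rho x) * ((- k)\<^sup>2 * (gr x \<bullet> gr x) + (- k) * trace_op (Hr x)) >= G"
  by (rule strip_laplacian_large[of G]) (rule that)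
 have hrho: "has_hessian_on Om rho gr Hr" by (rule hessian_subset[OF hess_rho]) (use Om_U in blast)
 \<comment> \<open>\<open>h\<close> lies between \<open>1\<close> and \<open>2\<close> on the
   closure. In the strip its Laplacian is at most \<open>- G\<close>, below
   \<open>(V - lam) * h\<close>, so it is a strict supersolution that stays away from zero at the
   boundary.\<close>
 define h where "h = (\<lambda>x. (-1) * exp (k * rho x) + 2)"
 define gh where "gh = (\<lambda>x. (-1) *\<^sub>R ((k * exp (k * rho x)) *\<^sub>R gr x) + 0)"
 define Hh where "Hh = (\<lambda>x a. (-1) *\<^sub>R ((k * exp (k * rho x)) *\<^sub>R Hr x a + (k * k * exp (k * rho x) * (gr x \<bullet> a)) *\<^sub>R gr x) + 0)"
 have hh: "has_hessian_on Om h gh Hh" unfolding h_def gh_def Hh_def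
  by (rule hessian_add[OF hessian_cmult[OF hessian_exp[OF hrho]] hessian_const])
 have trh: "trace_op (Hh x) = - (exp (k * rho x) * (k\<^sup>2 * (gr x \<bullet> gr x) + k * trace_op (Hr x)))" for x
  unfolding Hh_def by (subst trace_op_simps(1), subst trace_op_simps(2), subst trace_exp) (simp only: trace_op_simps(5) add_0_right mult_minus1)
 have rle: "rho x <= 0" if "x \<in> closure Om" for x using closure_cases[OF that] rho_neg[of x] rho_zero[of x] by auto
 have h1: "1 <= h x" "h x <= 2" if "x \<in> closure Om" for x
 proof -
  have "exp (k * rho x) <= 1" using rle[OF that] k(1) by (simp add: mult_nonneg_nonpos)
  then show "1 <= h x" by (simp add: h_def)
  show "h x <= 2" by (simp add: h_def)
 qed
 have ch: "continuous_on (closure Om) h" unfolding h_def by (intro continuous_intros cont_rho)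
 define C2 where "C2 = closure Om \<times> closure Om"
 have cC2: "compact C2" unfolding C2_def by (intro compact_Times compact_closure)
 define md where "md = (\<lambda>z::'a \<times> 'a. (1/2) *\<^sub>R (fst z + snd z))"
 have mdc: "md ` C2 \<subseteq> closure Om" unfolding md_def C2_def by (auto intro: midpoint_closure)
 have cmd: "continuous_on C2 md" unfolding md_def by (intro continuous_intros)
 have comp: "continuous_on C2 (\<lambda>z. q (md z))" if "continuous_on (closure Om) q" for q :: "'a \<Rightarrow> real"
  by (rule continuous_on_compose2[OF that cmd mdc])
 have cfst: "continuous_on C2 (\<lambda>z. u (fst z))" "continuous_on C2 (\<lambda>z. u (snd z))"
  unfolding C2_def by (auto intro!: continuous_on_compose2[OF cont_u] continuous_intros)
 define W where "W = (\<lambda>z. sqrt (u (fst z) * u (snd z)))"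
 have cW: "continuous_on C2 W" unfolding W_def by (intro continuous_intros cfst)
 have Wpos: "fst z \<in> Om \<and> snd z \<in> Om" if "z \<in> C2" "W z > 0" for z
 proof -
  have "u (fst z) >= 0" "u (snd z) >= 0" using that(1) u_nonneg by (auto simp: C2_def)
  moreover have "u (fst z) * u (snd z) > 0" using that(2) by (simp add: W_def)
  ultimately have "u (fst z) > 0" "u (snd z) > 0" by (auto simp: zero_less_mult_iff)
  then show ?thesis using that(1) u_pos_Om by (auto simp: C2_def)
 qed
 have umd: "u (md z) >= 0" if "z \<in> C2" for z using mdc u_nonneg that by blast
 define K where "K = {z \<in> C2. rho (md z) <= - 1 / k}"
 have cK: "compact K" unfolding K_def by (rule closed_sublevel(1)[OF cC2 comp[OF cont_rho]])
 have Kpos: "u (md z) > 0" if "z \<in> K" for z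
 proof -
  have "rho (md z) <= - 1 / k" "- 1 / k < 0" using that k(1) by (simp_all add: K_def)
  then have "rho (md z) < 0" by linarith
  then have "md z \<in> Om" using closure_cases[of "md z"] rho_zero[of "md z"] mdc that by (force simp: K_def)
  then show ?thesis by (rule u_pos)
 qed
 \<comment> \<open>\<open>t\<close> is the supremum of the quotient over \<open>K\<close>, raised to
   \<open>1\<close> if smaller. Attainment is recorded for \<open>t > 1\<close>, the case to be
   refuted.\<close>
 have "\<exists>t\<ge>1. (\<forall>z\<in>K. W z <= t * u (md z)) \<and> (t > 1 --> (\<exists>z\<in>K. W z = t * u (md z)))"
 proof (cases "K = {}")
  case True then show ?thesis by (intro exI[of _ 1]) auto
 next
  case False
  have KC: "K \<subseteq> C2" by (auto simp: K_def)
  have "continuous_on K (\<lambda>z. W z / u (md z))"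
   by (intro continuous_on_divide continuous_on_subset[OF cW KC] continuous_on_subset[OF comp[OF cont_u] KC]) (use Kpos in force)
  then obtain z where z: "z \<in> K" "\<And>y. y \<in> K ==> W y / u (md y) <= W z / u (md z)"
   using continuous_attains_sup[OF cK False] by blast
  define T where "T = W z / u (md z)"
  have T: "W y <= T * u (md y)" if "y \<in> K" for y using z(2)[OF that] Kpos[OF that] by (simp add: T_def pos_divide_le_eq)
  have Tz: "W z = T * u (md z)" using Kpos[OF z(1)] by (simp add: T_def)
  show ?thesis
  proof (intro exI[of _ "max 1 T"] conjI ballI impI)
   fix y assume y: "y \<in> K"
   have "T * u (md y) <= max 1 T * u (md y)" using Kpos[OF y] by (intro mult_right_mono) auto
   then show "W y <= max 1 T * u (md y)" using T[OF y] by linarith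
  next
   assume "1 < max 1 T"
   then have "max 1 T = T" by simp
   then show "\<exists>z\<in>K. W z = max 1 T * u (md z)" using Tz z(1) by auto
  qed simp
 qed
 then obtain t where t: "t >= 1" "\<And>z. z \<in> K ==> W z <= t * u (md z)" "t > 1 ==> \<exists>z\<in>K. W z = t * u (md z)" by blast
 have near: "\<forall>\<^sub>F s in nhds 0. x + s *\<^sub>R a \<in> Om" if "x \<in> Om" for x a
  by (rule eventually_line[OF eventually_nhds_in_open[OF open_Om that]])
 have mdl: "md (x + s *\<^sub>R a, y + s *\<^sub>R b) = md (x, y) + s *\<^sub>R ((1/2) *\<^sub>R (a + b))" for x y a b s
  by (simp add: md_def algebra_simps)
 \<comment> \<open>If the bound failed in the strip, the smallest multiple \<open>a\<close> of
   \<open>h\<close> that restores it would touch at a pair of interior points whose midpoint is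
   strictly inside the strip, against the strict supersolution property.\<close>
 have B: "W z <= t * u (md z)" if z: "z \<in> C2" for z
 proof (rule ccontr)
  assume neg: "\<not> W z <= t * u (md z)"
  define S where "S = {z \<in> C2. - 1 / k <= rho (md z)}"
  have cS: "compact S" unfolding S_def by (rule closed_sublevel(2)[OF cC2 comp[OF cont_rho]])
  have SC: "S \<subseteq> C2" by (auto simp: S_def)
  have zS: "z \<in> S" using z neg t(2)[of z] by (force simp: S_def K_def)
  have hp: "h (md z) >= 1" if "z \<in> C2" for z using h1(1) mdc that by blast
  have "continuous_on S (\<lambda>z. (W z - t * u (md z)) / h (md z))"
   by (intro continuous_on_divide continuous_on_diff continuous_on_mult continuous_on_const continuous_on_subset[OF cW SC]
     continuous_on_subset[OF comp[OF cont_u] SC] continuous_on_subset[OF comp[OF ch] SC]) (use hp SC in force)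
  then obtain p where p: "p \<in> S" "\<And>y. y \<in> S ==> (W y - t * u (md y)) / h (md y) <= (W p - t * u (md p)) / h (md p)"
   using continuous_attains_sup[OF cS, of "\<lambda>z. (W z - t * u (md z)) / h (md z)"] zS by blast
  define a where "a = (W p - t * u (md p)) / h (md p)"
  have "(W z - t * u (md z)) / h (md z) > 0" using neg hp[OF z] by (intro divide_pos_pos) auto
  then have a: "a > 0" using p(2)[OF zS] by (simp add: a_def)
  have pC: "p \<in> C2" using p(1) SC by blast
  have ple: "W y <= t * u (md y) + a * h (md y)" if "y \<in> S" for y
  proof -
   have "0 < h (md y)" using hp[of y] that SC by force
   then show ?thesis using p(2)[OF that] unfolding a_def[symmetric] by (simp add: pos_divide_le_eq)
  qed
  have peq: "W p = t * u (md p) + a * h (md p)" using hp[OF pC] by (simp add: a_def)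
  have "a * h (md p) > 0" using a hp[OF pC] by (intro mult_pos_pos) auto
  moreover have "t * u (md p) >= 0" using t(1) umd[OF pC] by (intro mult_nonneg_nonneg) auto
  ultimately have Wp: "W p > 0" "W p > t * u (md p)" unfolding peq by linarith+
  define x y where "x = fst p" and "y = snd p"
  have xy: "x \<in> Om" "y \<in> Om" using Wpos[OF pC Wp(1)] by (simp_all add: x_def y_def)
  define m where "m = (1/2) *\<^sub>R (x + y)"
  have pm: "md p = m" by (simp add: md_def m_def x_def y_def)
  have pxy: "p = (x, y)" by (simp add: x_def y_def)
  have mO: "m \<in> Om" unfolding m_def by (rule midpoint_Om[OF xy])
  have rm: "rho m > - 1 / k"
  proof (rule ccontr)
   assume "\<not> rho m > - 1 / k"
   then have "p \<in> K" using pC by (simp add: K_def pm)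
   from t(2)[OF this] Wp(2) show False by simp
  qed
  define P where "P = (\<lambda>x. t * u x + a * h x)"
  have hP: "has_hessian_on Om P (\<lambda>x. t *\<^sub>R g x + a *\<^sub>R gh x) (\<lambda>x b. t *\<^sub>R H x b + a *\<^sub>R Hh x b)"
   unfolding P_def by (rule hessian_add[OF hessian_cmult[OF hu] hessian_cmult[OF hh]])
  have Ppos: "P x > 0" if "x \<in> Om" for x
   unfolding P_def using t(1) u_pos[OF that] a h1(1)[OF Om_closure[OF that]] by (intro add_pos_pos mult_pos_pos) auto
  obtain HF where HF: "has_hessian_on Om (\<lambda>x. ln (P x)) (\<lambda>x. inverse (P x) *\<^sub>R (t *\<^sub>R g x + a *\<^sub>R gh x)) HF"
   "\<And>x. x \<in> Om ==> trace_op (HF x) + (inverse (P x) *\<^sub>R (t *\<^sub>R g x + a *\<^sub>R gh x)) \<bullet> (inverse (P x) *\<^sub>R (t *\<^sub>R g x + a *\<^sub>R gh x))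
    = trace_op (\<lambda>b. t *\<^sub>R H x b + a *\<^sub>R Hh x b) / P x"
   using hessian_ln[OF hP Ppos] by blast
  have "V x + V y - 2 * lam <= 2 * (trace_op (HF m) + (inverse (P m) *\<^sub>R (t *\<^sub>R g m + a *\<^sub>R gh m)) \<bullet> (inverse (P m) *\<^sub>R (t *\<^sub>R g m + a *\<^sub>R gh m)))"
  proof (rule korevaar_test[OF xy HF(1) open_Om m_def mO])
   fix b c
   have "isCont rho m" using hessian_continuous_on(1)[OF hess_rho] open_U Om_U[OF mO] by (simp add: continuous_on_eq_continuous_at)
   then have "\<forall>\<^sub>F z in nhds m. rho z > - 1 / k"
    using rm by (metis isCont_def order_tendstoD(1) tendsto_at_iff_tendsto_nhds)
   from eventually_line[OF this, of "(1/2) *\<^sub>R (b + c)"] near[OF xy(1), of b] near[OF xy(2), of c]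
   show "\<forall>\<^sub>F s in nhds 0. f (x + s *\<^sub>R b) + f (y + s *\<^sub>R c) - 2 * ln (P (m + s *\<^sub>R ((1/2) *\<^sub>R (b + c)))) <= f x + f y - 2 * ln (P m)"
   proof eventually_elim
    case (elim s)
    let ?q = "(x + s *\<^sub>R b, y + s *\<^sub>R c)"
    have mq: "md ?q = m + s *\<^sub>R ((1/2) *\<^sub>R (b + c))" using mdl[of x s b y c] pm pxy by simp
    have "?q \<in> S" using elim Om_closure by (simp add: S_def C2_def mq)
    from ple[OF this] have "sqrt (u (x + s *\<^sub>R b) * u (y + s *\<^sub>R c)) <= P (m + s *\<^sub>R ((1/2) *\<^sub>R (b + c)))"
     unfolding mq P_def by (simp add: W_def)
    then have 1: "f (x + s *\<^sub>R b) + f (y + s *\<^sub>R c) <= 2 * ln (P (m + s *\<^sub>R ((1/2) *\<^sub>R (b + c))))"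
     unfolding f_def using elim u_pos by (intro ln_sqrt_prod) auto
    have "sqrt (u x * u y) = P m" using peq unfolding pm P_def by (simp add: W_def pxy)
    then have "ln (sqrt (u x * u y)) = ln (P m)" by simp
    then have "f x + f y = 2 * ln (P m)"
     using u_pos[OF xy(1)] u_pos[OF xy(2)] by (simp add: ln_sqrt ln_mult f_def)
    then show ?case using 1 by simp
   qed
  qed
  also have "\<dots> = 2 * (trace_op (\<lambda>b. t *\<^sub>R H m b + a *\<^sub>R Hh m b) / P m)" unfolding HF(2)[OF mO] ..
  also have "trace_op (\<lambda>b. t *\<^sub>R H m b + a *\<^sub>R Hh m b) = t * ((V m - lam) * u m) + a * trace_op (Hh m)"
   unfolding trace_op_simps(1) trace_op_simps(2) pde[OF mO] ..
  also have "2 * ((t * ((V m - lam) * u m) + a * trace_op (Hh m)) / P m) < 2 * (V m - lam)"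
  proof -
   have "trace_op (Hh m) <= - G" unfolding trh using k(2)[OF mO rm] by simp
   moreover have "(lam - V m) * h m <= Qu * 2"
   proof -
    have "(lam - V m) * h m <= \<bar>lam - V m\<bar> * h m" using h1(1)[OF Om_closure[OF mO]] by (intro mult_right_mono) auto
    also have "\<dots> <= Qu * 2" using V_bd[OF mO] h1[OF Om_closure[OF mO]] by (intro mult_mono) (auto simp: Qu_def)
    finally show ?thesis .
   qed
   ultimately have "trace_op (Hh m) < (V m - lam) * h m" by (simp add: G_def algebra_simps)
   then have "a * trace_op (Hh m) < a * ((V m - lam) * h m)" using a by (intro mult_strict_left_mono)
   then have "t * ((V m - lam) * u m) + a * trace_op (Hh m) < (V m - lam) * P m" by (simp add: P_def algebra_simps)
   then have "(t * ((V m - lam) * u m) + a * trace_op (Hh m)) / P m < V m - lam"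
    unfolding pos_divide_less_eq[OF Ppos[OF mO]] .
   then show ?thesis by (rule mult_strict_left_mono) simp
  qed
  finally have "V x + V y < 2 * V m" by simp
  moreover have "2 * V m <= V x + V y"
  proof (cases "x = y")
   case True
   then have "m = x" by (simp add: m_def scaleR_2[symmetric])
   then show ?thesis using True by simp
  next
   case False then show ?thesis using strict[OF xy False] by (simp add: m_def)
  qed
  ultimately show False by simp
 qed
 \<comment> \<open>With \<open>B\<close> the contact found in \<open>K\<close> is a maximum among
   all nearby pairs. For \<open>t > 1\<close> the two points are distinct, and the test contradicts
   strict convexity.\<close>
 have "t = 1"
 proof (rule ccontr)
  assume "t \<noteq> 1"
  then have t1: "t > 1" using t(1) by simp
  then obtain p where p: "p \<in> K" "W p = t * u (md p)" using t(3) by blast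
  have pC: "p \<in> C2" using p(1) by (simp add: K_def)
  have Wp: "W p > 0" unfolding p(2) using t1 Kpos[OF p(1)] by (intro mult_pos_pos) auto
  define x y where "x = fst p" and "y = snd p"
  have xy: "x \<in> Om" "y \<in> Om" using Wpos[OF pC Wp] by (simp_all add: x_def y_def)
  define m where "m = (1/2) *\<^sub>R (x + y)"
  have pm: "md p = m" by (simp add: md_def m_def x_def y_def)
  have pxy: "p = (x, y)" by (simp add: x_def y_def)
  have mO: "m \<in> Om" unfolding m_def by (rule midpoint_Om[OF xy])
  have eq: "f x + f y = 2 * (ln t + f m)"
  proof -
   have "sqrt (u x * u y) = t * u m" using p(2) unfolding pm by (simp add: W_def pxy)
   then have "ln (sqrt (u x * u y)) = ln (t * u m)" by simp
   then show ?thesis using u_pos[OF xy(1)] u_pos[OF xy(2)] u_pos[OF mO] t1 by (simp add: ln_sqrt ln_mult f_def)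
  qed
  have ne: "x \<noteq> y"
  proof
   assume "x = y"
   then have "m = x" by (simp add: m_def scaleR_2[symmetric])
   then have "ln t = 0" using eq \<open>x = y\<close> by simp
   then show False using t1 by simp
  qed
  have "V x + V y - 2 * lam <= 2 * (trace_op (Hf m) + gf m \<bullet> gf m)"
  proof (rule korevaar_test[OF xy hf open_Om m_def mO])
   fix b c
   from near[OF xy(1), of b] near[OF xy(2), of c]
   show "\<forall>\<^sub>F s in nhds 0. f (x + s *\<^sub>R b) + f (y + s *\<^sub>R c) - 2 * f (m + s *\<^sub>R ((1/2) *\<^sub>R (b + c))) <= f x + f y - 2 * f m"
   proof eventually_elim
    case (elim s)
    let ?q = "(x + s *\<^sub>R b, y + s *\<^sub>R c)"
    have mq: "md ?q = m + s *\<^sub>R ((1/2) *\<^sub>R (b + c))" using mdl[of x s b y c] pm pxy by simp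
    have mqO: "m + s *\<^sub>R ((1/2) *\<^sub>R (b + c)) \<in> Om" unfolding mq[symmetric] md_def using midpoint_Om[OF elim] by simp
    have "?q \<in> C2" using elim Om_closure by (simp add: C2_def)
    from B[OF this] have "sqrt (u (x + s *\<^sub>R b) * u (y + s *\<^sub>R c)) <= t * u (m + s *\<^sub>R ((1/2) *\<^sub>R (b + c)))"
     unfolding mq by (simp add: W_def)
    then have "f (x + s *\<^sub>R b) + f (y + s *\<^sub>R c) <= 2 * ln (t * u (m + s *\<^sub>R ((1/2) *\<^sub>R (b + c))))"
     unfolding f_def using elim u_pos by (intro ln_sqrt_prod) auto
    also have "\<dots> = 2 * (ln t + f (m + s *\<^sub>R ((1/2) *\<^sub>R (b + c))))"
     using u_pos[OF mqO] t1 by (simp add: ln_mult f_def)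
    finally show ?case using eq by simp
   qed
  qed
  then have "V x + V y <= 2 * V m" unfolding trf[OF mO] by simp
  then show False using strict[OF xy ne] by (simp add: m_def)
 qed
 moreover have "(x0, y0) \<in> C2" using x0 y0 Om_closure by (simp add: C2_def)
 ultimately have "sqrt (u x0 * u y0) <= u ((1/2) *\<^sub>R (x0 + y0))" using B[of "(x0, y0)"] by (simp add: W_def md_def)
 then show ?thesis unfolding f_def using x0 y0 u_pos by (intro ln_sqrt_prod) auto
qed

end

section \<open>Four-point comparison\<close>

lemma convex_symmetric_segment:
 assumes "convex S" "m + z \<in> S" "m - z \<in> S" "\<bar>s\<bar> <= 1" shows "m + s *\<^sub>R z \<in> S"
proof -
 have "((1 + s) / 2) *\<^sub>R (m + z) + ((1 - s) / 2) *\<^sub>R (m - z) \<in> S"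
  by (rule convexD[OF assms(1-3)]) (use assms(4) in \<open>auto simp: add_divide_distrib diff_divide_distrib\<close>)
 moreover have "((1 + s) / 2) *\<^sub>R (m + z) + ((1 - s) / 2) *\<^sub>R (m - z) = ((1 + s) / 2 + (1 - s) / 2) *\<^sub>R m + ((1 + s) / 2 - (1 - s) / 2) *\<^sub>R z"
  by (simp only: scaleR_add_left scaleR_diff_left scaleR_add_right scaleR_diff_right) simp
 moreover have "(1 + s) / 2 + (1 - s) / 2 = 1" "(1 + s) / 2 - (1 - s) / 2 = s" by (simp_all add: add_divide_distrib diff_divide_distrib)
 ultimately show ?thesis by simp
qed

lemma norm_line_deriv:
 fixes z a :: "'a::real_inner"
 assumes "z \<noteq> 0"
 shows "((\<lambda>t. norm (z + t *\<^sub>R a)) has_real_derivative (a \<bullet> sgn z)) (at 0)"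
proof -
 have 1: "((\<lambda>t. z + t *\<^sub>R a) has_derivative (\<lambda>t. t *\<^sub>R a)) (at 0)" by (auto intro!: derivative_eq_intros)
 have 2: "(norm has_derivative (\<lambda>v. v \<bullet> sgn z)) (at (z + 0 *\<^sub>R a))" using has_derivative_norm[of z] assms by simp
 from has_derivative_compose[OF 1 2] have "((\<lambda>t. norm (z + t *\<^sub>R a)) has_derivative (\<lambda>t. (t *\<^sub>R a) \<bullet> sgn z)) (at 0)" .
 moreover have "(\<lambda>t. (t *\<^sub>R a) \<bullet> sgn z) = (*) (a \<bullet> sgn z)" by (simp add: fun_eq_iff)
 ultimately show ?thesis by (simp add: has_field_derivative_def)
qed

context ground_state
begin

lemma hessian_nonpos:
 assumes mc: "\<And>x y. x \<in> Om ==> y \<in> Om ==> f x + f y <= 2 * f ((1/2) *\<^sub>R (x + y))" and x: "x \<in> Om"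
 shows "Hf x v \<bullet> v <= 0"
proof -
 note j = jet2_add[OF jet2_line[OF hf open_Om x, of v] jet2_line[OF hf open_Om x, of "- v"]]
 have near: "\<forall>\<^sub>F s in nhds 0. x + s *\<^sub>R a \<in> Om" for a
  by (rule eventually_line[OF eventually_nhds_in_open[OF open_Om x]])
 have "\<forall>\<^sub>F t in nhds 0. f (x + t *\<^sub>R v) + f (x + t *\<^sub>R - v) <= f (x + 0 *\<^sub>R v) + f (x + 0 *\<^sub>R - v)"
  using near[of v] near[of "- v"]
 proof eventually_elim
  case (elim t)
  have "(1/2) *\<^sub>R ((x + t *\<^sub>R v) + (x + t *\<^sub>R - v)) = x" by (simp add: scaleR_2[symmetric])
  then show ?case using mc[OF elim] by simp
 qed
 from jet2_max(2)[OF j this] have "Hf x v \<bullet> v + Hf x (- v) \<bullet> (- v) <= 0" .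
 moreover have "Hf x (- v) = - Hf x v" using hessian_linear[OF hf x] by (rule linear_neg)
 ultimately show ?thesis by simp
qed

lemma pair_deriv:
 assumes "m + s *\<^sub>R z \<in> Om" "m - s *\<^sub>R z \<in> Om"
 shows "((\<lambda>s. f (m + s *\<^sub>R z) + f (m - s *\<^sub>R z)) has_real_derivative (gf (m + s *\<^sub>R z) - gf (m - s *\<^sub>R z)) \<bullet> z) (at s)"
proof -
 have 1: "((\<lambda>s. f (m + s *\<^sub>R z)) has_real_derivative gf (m + s *\<^sub>R z) \<bullet> z) (at s)"
  using hf assms(1) by (intro has_derivative_line) (auto simp: has_hessian_on_def)
 have 2: "((\<lambda>s. f (m + s *\<^sub>R (- z))) has_real_derivative gf (m + s *\<^sub>R (- z)) \<bullet> (- z)) (at s)"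
  using hf assms(2) by (intro has_derivative_line) (auto simp: has_hessian_on_def)
 from DERIV_add[OF 1 2] show ?thesis by (simp add: inner_diff_left)
qed

text \<open>Log-concavity in this form keeps the four-point function bounded above when the outer
  points approach the boundary.\<close>

lemma pair_decreasing:
 assumes mc: "\<And>x y. x \<in> Om ==> y \<in> Om ==> f x + f y <= 2 * f ((1/2) *\<^sub>R (x + y))"
  and z: "m + z \<in> Om" "m - z \<in> Om" and s: "0 <= s" "s <= 1"
 shows "f (m + z) + f (m - z) <= f (m + s *\<^sub>R z) + f (m - s *\<^sub>R z)"
proof -
 have inO: "m + t *\<^sub>R z \<in> Om" "m - t *\<^sub>R z \<in> Om" if "\<bar>t\<bar> <= 1" for t
  using convex_symmetric_segment[OF convex_Om z that] convex_symmetric_segment[OF convex_Om z, of "- t"] that by simp_all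
 define k where "k = (\<lambda>t. (gf (m + t *\<^sub>R z) - gf (m - t *\<^sub>R z)) \<bullet> z)"
 have kd: "(k has_real_derivative Hf (m + t *\<^sub>R z) z \<bullet> z + Hf (m - t *\<^sub>R z) z \<bullet> z) (at t)" if "\<bar>t\<bar> <= 1" for t
 proof -
  have g: "((\<lambda>t. gf (m + t *\<^sub>R a) \<bullet> z) has_real_derivative Hf (m + t *\<^sub>R a) a \<bullet> z) (at t)" if "m + t *\<^sub>R a \<in> Om" for a
  proof -
   have 1: "((\<lambda>t. m + t *\<^sub>R a) has_derivative (\<lambda>s. s *\<^sub>R a)) (at t)" by (auto intro!: derivative_eq_intros)
   have 2: "(gf has_derivative Hf (m + t *\<^sub>R a)) (at (m + t *\<^sub>R a))" using hf that by (simp add: has_hessian_on_def)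
   from has_derivative_compose[OF 1 2] have "((\<lambda>t. gf (m + t *\<^sub>R a)) has_derivative (\<lambda>s. Hf (m + t *\<^sub>R a) (s *\<^sub>R a))) (at t)" .
   from has_derivative_inner_left[OF this, of z]
   have "((\<lambda>t. gf (m + t *\<^sub>R a) \<bullet> z) has_derivative (\<lambda>s. Hf (m + t *\<^sub>R a) (s *\<^sub>R a) \<bullet> z)) (at t)" .
   moreover have "(\<lambda>s. Hf (m + t *\<^sub>R a) (s *\<^sub>R a) \<bullet> z) = (\<lambda>s. (Hf (m + t *\<^sub>R a) a \<bullet> z) * s)"
    using linear_scale[OF hessian_linear[OF hf that]] by (simp add: fun_eq_iff)
   ultimately show ?thesis by (simp add: has_field_derivative_def)
  qed
  have "m + t *\<^sub>R (- z) \<in> Om" using inO(2)[OF that] by simp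
  from DERIV_diff[OF g[OF inO(1)[OF that]] g[OF this]]
  have "((\<lambda>t. gf (m + t *\<^sub>R z) \<bullet> z - gf (m + t *\<^sub>R - z) \<bullet> z) has_real_derivative Hf (m + t *\<^sub>R z) z \<bullet> z - Hf (m + t *\<^sub>R - z) (- z) \<bullet> z) (at t)" .
  moreover have "Hf (m - t *\<^sub>R z) (- z) = - Hf (m - t *\<^sub>R z) z"
   using hessian_linear[OF hf inO(2)[OF that]] by (rule linear_neg)
  ultimately show ?thesis by (simp add: k_def inner_diff_left)
 qed
 have k0: "k t <= 0" if "0 <= t" "t <= 1" for t
 proof -
  have "k t <= k 0"
  proof (rule DERIV_nonpos_imp_nonincreasing[OF that(1)])
   fix x assume "0 <= x" "x <= t"
   then have x: "\<bar>x\<bar> <= 1" using that by simp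
   have "Hf (m + x *\<^sub>R z) z \<bullet> z + Hf (m - x *\<^sub>R z) z \<bullet> z <= 0"
    using hessian_nonpos[OF mc inO(1)[OF x], of z] hessian_nonpos[OF mc inO(2)[OF x], of z] by simp
   then show "\<exists>y. DERIV k x :> y \<and> y <= 0" using kd[OF x] by blast
  qed
  then show ?thesis by (simp add: k_def)
 qed
 have "f (m + 1 *\<^sub>R z) + f (m - 1 *\<^sub>R z) <= f (m + s *\<^sub>R z) + f (m - s *\<^sub>R z)"
 proof (rule DERIV_nonpos_imp_nonincreasing[OF s(2), of "\<lambda>t. f (m + t *\<^sub>R z) + f (m - t *\<^sub>R z)"])
  fix t assume t: "s <= t" "t <= 1"
  then have t1: "\<bar>t\<bar> <= 1" using s by simp
  show "\<exists>y. ((\<lambda>t. f (m + t *\<^sub>R z) + f (m - t *\<^sub>R z)) has_real_derivative y) (at t) \<and> y <= 0"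
   using pair_deriv[OF inO[OF t1]] k0[of t] t s unfolding k_def by auto
 qed
 then show ?thesis by simp
qed

text \<open>\<open>L\<close> is to be the logarithm of a one-dimensional solution, so
  \<open>L2 + L1^2\<close> is the one-dimensional potential minus its energy. The energy cancels in
  \<open>strict\<close>, which is the integrated modulus condition on the potentials, made strict by
  the quadratic perturbation.\<close>

context
 fixes L L1 L2 :: "real \<Rightarrow> real" and D :: real
 assumes mc: "\<And>x y. x \<in> Om ==> y \<in> Om ==> f x + f y <= 2 * f ((1/2) *\<^sub>R (x + y))"
  and L: "\<And>s. \<bar>s\<bar> <= D ==> (L has_real_derivative L1 s) (at s)" "\<And>s. \<bar>s\<bar> <= D ==> (L1 has_real_derivative L2 s) (at s)"
  and even: "\<And>s. L (- s) = L s"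
  and diam: "\<And>x y. x \<in> Om ==> y \<in> Om ==> norm (y - x) < 2 * D"
  and strict: "\<And>m z s. m + z \<in> Om ==> m - z \<in> Om ==> z \<noteq> 0 ==> 0 <= s ==> s < 1 ==>
    2 * ((L2 (norm z) + (L1 (norm z))\<^sup>2) - (L2 (s * norm z) + (L1 (s * norm z))\<^sup>2))
     < V (m + z) + V (m - z) - V (m + s *\<^sub>R z) - V (m - s *\<^sub>R z)"
begin

text \<open>The sharp modulus of log-concavity in integrated form. Compared with the two-point function
 built from \<open>\<nabla> ln u\<close>, the four-point function involves no third derivatives, and plain
 log-concavity controls it near the boundary.\<close>

lemma four_point:
 assumes z0: "m0 + z0 \<in> Om" "m0 - z0 \<in> Om" and s0: "0 <= s0" "s0 <= 1"
 shows "f (m0 + z0) + f (m0 - z0) - f (m0 + s0 *\<^sub>R z0) - f (m0 - s0 *\<^sub>R z0) <= 2 * L (norm z0) - 2 * L (s0 * norm z0)"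
proof (rule ccontr)
 assume neg: "\<not> ?thesis"
 define Q where "Q = (\<lambda>m z s. f (m + z) + f (m - z) - f (m + s *\<^sub>R z) - f (m - s *\<^sub>R z) - 2 * L (norm z) + 2 * L (s * norm z))"
 define Q0 where "Q0 = Q m0 z0 s0"
 have Q0: "Q0 > 0" using neg by (simp add: Q0_def Q_def)
 have nz: "norm z < D" if "m + z \<in> Om" "m - z \<in> Om" for m z
 proof -
  have "(m + z) - (m - z) = 2 *\<^sub>R z" by (simp add: scaleR_2)
  then have "norm (2 *\<^sub>R z) < 2 * D" using diam[OF that(2,1)] by simp
  then show ?thesis by simp
 qed
 have D0: "D > 0" using nz[OF z0] norm_ge_zero[of z0] by linarith
 have contL: "continuous_on {-D..D} L"
 proof (rule continuous_at_imp_continuous_on, rule ballI)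
  fix s assume "s \<in> {-D..D}"
  then have "\<bar>s\<bar> <= D" by auto
  then show "isCont L s" by (rule DERIV_isCont[OF L(1)])
 qed
 define Cf where "Cf = {(m, z, s). m + z \<in> Om \<and> m - z \<in> Om \<and> 0 <= s \<and> s <= (1::real)}"
 \<comment> \<open>Log-concavity removes all four values of \<open>f\<close> from the upper bound,
   although each of them may tend to minus infinity at the boundary.\<close>
 have Qub: "Q m z s <= - 2 * L (norm z) + 2 * L (s * norm z)" if "(m, z, s) \<in> Cf" for m z s
  using pair_decreasing[OF mc, of m z s] that by (simp add: Cf_def Q_def)
 obtain BL where "\<And>s. s \<in> {-D..D} ==> norm (L s) <= BL" by (rule compact_bound[OF compact_Icc contL]) (rule that)
 then have BL: "\<bar>L s\<bar> <= BL" if "\<bar>s\<bar> <= D" for s using that by (simp add: abs_le_iff)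
 have srange: "\<bar>norm z\<bar> <= D" "\<bar>s * norm z\<bar> <= D" if "(m, z, s) \<in> Cf" for m z s
 proof -
  have n: "norm z < D" using nz that by (auto simp: Cf_def)
  then show "\<bar>norm z\<bar> <= D" by simp
  have "s * norm z <= 1 * norm z" using that by (intro mult_right_mono) (auto simp: Cf_def)
  then show "\<bar>s * norm z\<bar> <= D" using n that by (simp add: Cf_def abs_mult)
 qed
 define Qs where "Qs = {Q m z s | m z s. (m, z, s) \<in> Cf}"
 have Qbdd: "bdd_above Qs"
 proof (rule bdd_aboveI[of _ "4 * BL"])
  fix q assume "q \<in> Qs"
  then obtain m z s where q: "q = Q m z s" "(m, z, s) \<in> Cf" by (auto simp: Qs_def)
  show "q <= 4 * BL" using Qub[OF q(2)] BL[OF srange(1)[OF q(2)]] BL[OF srange(2)[OF q(2)]] q(1) by (auto simp: abs_le_iff)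
 qed
 have Q0Qs: "Q0 \<in> Qs" using z0 s0 by (auto simp: Qs_def Q0_def Cf_def)
 define S where "S = Sup Qs"
 have SQ: "Q m z s <= S" if "(m, z, s) \<in> Cf" for m z s
  unfolding S_def by (rule cSup_upper[OF _ Qbdd]) (use that in \<open>auto simp: Qs_def\<close>)
 have S0: "S >= Q0" unfolding S_def by (rule cSup_upper[OF Q0Qs Qbdd])
 have "\<exists>c. c \<in> Cf \<and> (case c of (m, z, s) \<Rightarrow> S - inverse (real (Suc n)) < Q m z s)" for n
 proof -
  have "S - inverse (real (Suc n)) < Sup Qs" by (simp add: S_def)
  then obtain q where "q \<in> Qs" "S - inverse (real (Suc n)) < q" using less_cSup_iff[OF _ Qbdd] Q0Qs by blast
  then show ?thesis by (auto simp: Qs_def)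
 qed
 then have "\<forall>n. \<exists>c. c \<in> Cf \<and> (case c of (m, z, s) \<Rightarrow> S - inverse (real (Suc n)) < Q m z s)" by blast
 from choice[OF this] obtain c where c: "\<forall>n. c n \<in> Cf \<and> (case c n of (m, z, s) \<Rightarrow> S - inverse (real (Suc n)) < Q m z s)" ..
 define mm zz ss where "mm = (\<lambda>n. fst (c n))" and "zz = (\<lambda>n. fst (snd (c n)))" and "ss = (\<lambda>n. snd (snd (c n)))"
 have cC: "(mm n, zz n, ss n) \<in> Cf" and cQ: "S - inverse (real (Suc n)) < Q (mm n) (zz n) (ss n)" for n
  using c[rule_format, of n] by (auto simp: mm_def zz_def ss_def split_beta)
 define T where "T = closure Om \<times> closure Om \<times> {0..1::real}"
 have "compact T" unfolding T_def by (intro compact_Times compact_closure compact_Icc)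
 moreover have "\<forall>n. (mm n + zz n, mm n - zz n, ss n) \<in> T" using cC Om_closure by (auto simp: T_def Cf_def)
 ultimately obtain l r where lr: "l \<in> T" "strict_mono (r::nat\<Rightarrow>nat)" "((\<lambda>n. (mm n + zz n, mm n - zz n, ss n)) \<circ> r) \<longlonglongrightarrow> l"
  unfolding compact_def by meson
 obtain p q s where l: "l = (p, q, s)" by (cases l) auto
 have pq: "p \<in> closure Om" "q \<in> closure Om" "0 <= s" "s <= 1" using lr(1) by (auto simp: l T_def)
 have lp: "(\<lambda>n. mm (r n) + zz (r n)) \<longlonglongrightarrow> p" and lq: "(\<lambda>n. mm (r n) - zz (r n)) \<longlonglongrightarrow> q" and ls: "(\<lambda>n. ss (r n)) \<longlonglongrightarrow> s"
  using tendsto_fst[OF lr(3)] tendsto_fst[OF tendsto_snd[OF lr(3)]] tendsto_snd[OF tendsto_snd[OF lr(3)]] by (simp_all add: l o_def)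
 define m z where "m = (1/2) *\<^sub>R (p + q)" and "z = (1/2) *\<^sub>R (p - q)"
 have pmz: "p = m + z" "q = m - z"
 proof -
  have "m + z = (1/2 + 1/2) *\<^sub>R p" unfolding m_def z_def by (simp only: scaleR_add_left scaleR_add_right scaleR_diff_right) simp
  then show "p = m + z" by simp
  have "m - z = (1/2 + 1/2) *\<^sub>R q" unfolding m_def z_def by (simp only: scaleR_add_left scaleR_add_right scaleR_diff_right) simp
  then show "q = m - z" by simp
 qed
 have lm: "(\<lambda>n. mm (r n)) \<longlonglongrightarrow> m"
 proof -
  have "(\<lambda>n. (1/2) *\<^sub>R ((mm (r n) + zz (r n)) + (mm (r n) - zz (r n)))) \<longlonglongrightarrow> m"
   unfolding m_def by (intro tendsto_intros lp lq)
  then show ?thesis by (simp add: scaleR_2[symmetric])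
 qed
 have lz: "(\<lambda>n. zz (r n)) \<longlonglongrightarrow> z"
 proof -
  have "(\<lambda>n. (1/2) *\<^sub>R ((mm (r n) + zz (r n)) - (mm (r n) - zz (r n)))) \<longlonglongrightarrow> z"
   unfolding z_def by (intro tendsto_intros lp lq)
  then show ?thesis by (simp add: scaleR_2[symmetric])
 qed
 have lQ: "\<forall>\<^sub>F n in sequentially. Q (mm (r n)) (zz (r n)) (ss (r n)) > S / 2"
 proof -
  have "(\<lambda>n. S - inverse (real (Suc (r n)))) \<longlonglongrightarrow> S - 0"
   using LIMSEQ_subseq_LIMSEQ[OF LIMSEQ_inverse_real_of_nat lr(2)] by (intro tendsto_intros) (simp add: o_def)
  then have "\<forall>\<^sub>F n in sequentially. S - inverse (real (Suc (r n))) > S / 2"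
   using S0 Q0 by (intro order_tendstoD(1)) auto
  then show ?thesis by (rule eventually_mono) (rule less_trans[OF _ cQ])
 qed
 have nzl: "(\<lambda>n. norm (zz (r n))) \<longlonglongrightarrow> norm z" "(\<lambda>n. ss (r n) * norm (zz (r n))) \<longlonglongrightarrow> s * norm z"
  by (intro tendsto_intros lz ls)+
 have nzD: "norm z <= D"
  by (rule LIMSEQ_le_const2[OF nzl(1)]) (use srange(1)[OF cC] in \<open>auto intro: order_trans\<close>)
 have snD: "\<bar>s * norm z\<bar> <= D"
 proof -
  have "s * norm z <= 1 * norm z" using pq by (intro mult_right_mono) auto
  then show ?thesis using nzD pq by (simp add: abs_mult)
 qed
 have isL: "isCont L t" if "\<bar>t\<bar> <= D" for t using L(1)[OF that] by (rule DERIV_isCont)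
 have lL: "(\<lambda>n. L (norm (zz (r n)))) \<longlonglongrightarrow> L (norm z)" "(\<lambda>n. L (ss (r n) * norm (zz (r n)))) \<longlonglongrightarrow> L (s * norm z)"
  using isCont_tendsto_compose[OF isL nzl(1)] isCont_tendsto_compose[OF isL nzl(2)] nzD snD by simp_all
 have ub: "S / 2 <= - 2 * L (norm z) + 2 * L (s * norm z)"
 proof (rule tendsto_lowerbound)
  show "(\<lambda>n. - 2 * L (norm (zz (r n))) + 2 * L (ss (r n) * norm (zz (r n)))) \<longlonglongrightarrow> - 2 * L (norm z) + 2 * L (s * norm z)"
   by (intro tendsto_intros lL)
  show "\<forall>\<^sub>F n in sequentially. S / 2 <= - 2 * L (norm (zz (r n))) + 2 * L (ss (r n) * norm (zz (r n)))"
   using lQ by (rule eventually_mono) (rule less_imp_le, rule less_le_trans[OF _ Qub[OF cC]])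
 qed simp
 \<comment> \<open>For \<open>s = 1\<close>, and likewise for \<open>z = 0\<close>, the bound
   \<open>ub\<close> reduces to \<open>S / 2 <= 0\<close>.\<close>
 have s1: "s < 1" using ub S0 Q0 pq(4) by (cases "s = 1") auto
 have zn: "z \<noteq> 0" using ub S0 Q0 by auto
 have pnq: "p \<noteq> q" using zn by (auto simp: z_def)
 \<comment> \<open>Even if \<open>p\<close> and \<open>q\<close> were on the boundary, the inner
   points are proper points of the open segment because \<open>s < 1\<close>, so strict convexity of
   the domain places them in \<open>Om\<close>.\<close>
 have xO: "m + s *\<^sub>R z \<in> Om" "m - s *\<^sub>R z \<in> Om"
 proof -
  have gen: "(1 - a) *\<^sub>R (m + z) + a *\<^sub>R (m - z) = m + (1 - a - a) *\<^sub>R z" for a by (simp add: algebra_simps scaleR_2[symmetric] mult.commute)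
  have e1: "m + s *\<^sub>R z = (1 - (1 - s) / 2) *\<^sub>R p + ((1 - s) / 2) *\<^sub>R q"
   unfolding pmz gen by (simp add: diff_divide_distrib)
  have e2: "m - s *\<^sub>R z = (1 - (1 + s) / 2) *\<^sub>R p + ((1 + s) / 2) *\<^sub>R q"
   unfolding pmz gen by (simp add: add_divide_distrib)
  show "m + s *\<^sub>R z \<in> Om" by (rule strictly_convex[OF pq(1,2) pnq]) (unfold in_segment e1, use s1 pq pnq in \<open>auto intro!: exI[of _ "(1 - s) / 2"]\<close>)
  show "m - s *\<^sub>R z \<in> Om" by (rule strictly_convex[OF pq(1,2) pnq]) (unfold in_segment e2, use s1 pq pnq in \<open>auto intro!: exI[of _ "(1 + s) / 2"]\<close>)
 qed
 have isf: "isCont f x" if "x \<in> Om" for x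
  using hessian_continuous_on(1)[OF hf] open_Om that by (simp add: continuous_on_eq_continuous_at)
 have lx: "(\<lambda>n. f (mm (r n) + ss (r n) *\<^sub>R zz (r n))) \<longlonglongrightarrow> f (m + s *\<^sub>R z)"
  "(\<lambda>n. f (mm (r n) - ss (r n) *\<^sub>R zz (r n))) \<longlonglongrightarrow> f (m - s *\<^sub>R z)"
  by (rule isCont_tendsto_compose[OF isf[OF xO(1)]], intro tendsto_intros lm lz ls)
    (rule isCont_tendsto_compose[OF isf[OF xO(2)]], intro tendsto_intros lm lz ls)
 \<comment> \<open>If an outer point reached the boundary, its logarithm would tend to minus
   infinity while the remaining terms stay bounded above. The hypothesis \<open>dom\<close> discards
   the other outer value, which is nonpositive.\<close>
 have endp: "w \<in> Om" if w: "w \<in> closure Om" and lw: "(\<lambda>n. wn n) \<longlonglongrightarrow> w" and wO: "\<And>n. wn n \<in> Om"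
   and dom: "\<And>n. Q (mm (r n)) (zz (r n)) (ss (r n)) <= f (wn n) - f (mm (r n) + ss (r n) *\<^sub>R zz (r n)) - f (mm (r n) - ss (r n) *\<^sub>R zz (r n))
      - 2 * L (norm (zz (r n))) + 2 * L (ss (r n) * norm (zz (r n)))" for w wn
 proof (rule ccontr)
  assume "w \<notin> Om"
  then have "u w = 0" using closure_cases[OF w] u_zero by blast
  have "(\<lambda>n. u (wn n)) \<longlonglongrightarrow> u w"
   using cont_u w lw wO Om_closure unfolding continuous_on_sequentially by (simp add: o_def)
  then have lu: "(\<lambda>n. u (wn n)) \<longlonglongrightarrow> 0" using \<open>u w = 0\<close> by simp
  define c where "c = - f (m + s *\<^sub>R z) - f (m - s *\<^sub>R z) - 2 * L (norm z) + 2 * L (s * norm z)"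
  have lc: "(\<lambda>n. - f (mm (r n) + ss (r n) *\<^sub>R zz (r n)) - f (mm (r n) - ss (r n) *\<^sub>R zz (r n))
      - 2 * L (norm (zz (r n))) + 2 * L (ss (r n) * norm (zz (r n)))) \<longlonglongrightarrow> c"
   unfolding c_def by (intro tendsto_intros lx lL)
  have 1: "\<forall>\<^sub>F n in sequentially. - f (mm (r n) + ss (r n) *\<^sub>R zz (r n)) - f (mm (r n) - ss (r n) *\<^sub>R zz (r n))
      - 2 * L (norm (zz (r n))) + 2 * L (ss (r n) * norm (zz (r n))) < c + 1"
   by (rule order_tendstoD(2)[OF lc]) simp
  have 2: "\<forall>\<^sub>F n in sequentially. u (wn n) < exp (- c - 1)" by (rule order_tendstoD(2)[OF lu]) simp
  have "\<forall>\<^sub>F n in sequentially. False"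
   using 1 2 lQ
  proof eventually_elim
   case (elim n)
   have "f (wn n) < - c - 1" unfolding f_def using elim(2) u_pos[OF wO[of n]] by (metis exp_less_cancel_iff exp_ln)
   then show False using elim(1,3) dom[of n] S0 Q0 by linarith
  qed
  then show False by simp
 qed
 have rO: "mm n + zz n \<in> Om" "mm n - zz n \<in> Om" for n using cC[of n] by (auto simp: Cf_def)
 have pO: "p \<in> Om" by (rule endp[OF pq(1) lp rO(1)]) (use f_le0[OF rO(2)] in \<open>simp add: Q_def\<close>)
 have qO: "q \<in> Om" by (rule endp[OF pq(2) lq rO(2)]) (use f_le0[OF rO(1)] in \<open>simp add: Q_def\<close>)
 have Qmax: "Q m z s = S"
 proof (rule LIMSEQ_unique)
  have "(\<lambda>n. f (mm (r n) + zz (r n))) \<longlonglongrightarrow> f (m + z)" "(\<lambda>n. f (mm (r n) - zz (r n))) \<longlonglongrightarrow> f (m - z)"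
   using isCont_tendsto_compose[OF isf[OF pO] lp] isCont_tendsto_compose[OF isf[OF qO] lq] by (simp_all add: pmz)
  then show "(\<lambda>n. Q (mm (r n)) (zz (r n)) (ss (r n))) \<longlonglongrightarrow> Q m z s" unfolding Q_def by (intro tendsto_intros lx lL)
  show "(\<lambda>n. Q (mm (r n)) (zz (r n)) (ss (r n))) \<longlonglongrightarrow> S"
  proof (rule tendsto_sandwich)
   show "\<forall>\<^sub>F n in sequentially. S - inverse (real (Suc (r n))) <= Q (mm (r n)) (zz (r n)) (ss (r n))" using cQ by (simp add: less_imp_le)
   show "\<forall>\<^sub>F n in sequentially. Q (mm (r n)) (zz (r n)) (ss (r n)) <= S" using SQ[OF cC] by simp
   have "(\<lambda>n. S - inverse (real (Suc (r n)))) \<longlonglongrightarrow> S - 0"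
    using LIMSEQ_subseq_LIMSEQ[OF LIMSEQ_inverse_real_of_nat lr(2)] by (intro tendsto_intros) (simp add: o_def)
   then show "(\<lambda>n. S - inverse (real (Suc (r n)))) \<longlonglongrightarrow> S" by simp
  qed simp
 qed
 have zO: "m + z \<in> Om" "m - z \<in> Om" using pO qO by (simp_all add: pmz)
 \<comment> \<open>Evenness of \<open>L\<close> admits negative \<open>s\<close>; variations of the
   inner distance are then two-sided also when \<open>s = 0\<close>.\<close>
 have max: "Q m' z' s' <= Q m z s" if "m' + z' \<in> Om" "m' - z' \<in> Om" "\<bar>s'\<bar> <= 1" for m' z' s'
 proof (cases "s' >= 0")
  case True then show ?thesis using SQ[of m' z' s'] that Qmax by (simp add: Cf_def)
 next
  case False
  have "Q m' z' s' = Q m' z' (- s')" by (simp add: Q_def even)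
  then show ?thesis using SQ[of m' z' "- s'"] that False Qmax by (simp add: Cf_def)
 qed
 define N where "N = norm z"
 have N: "N > 0" "N < D" using zn nz[OF zO] by (simp_all add: N_def)
 define e where "e = (1 / N) *\<^sub>R z"
 have ze: "z = N *\<^sub>R e" using N by (simp add: e_def)
 have ne: "norm e = 1" using N by (simp add: e_def N_def)
 define k where "k = s * N"
 have k: "0 <= k" "k < N" using pq(3) s1 N by (simp_all add: k_def)
 have szk: "s *\<^sub>R z = k *\<^sub>R e" by (simp add: ze k_def)
 have p4: "m + N *\<^sub>R e \<in> Om" "m + N *\<^sub>R (- e) \<in> Om" "m + k *\<^sub>R e \<in> Om" "m + k *\<^sub>R (- e) \<in> Om"
  using zO xO by (simp_all add: szk ze[symmetric])
 have QN: "Q m' (a *\<^sub>R e) (b / a) = f (m' + a *\<^sub>R e) + f (m' - a *\<^sub>R e) - f (m' + b *\<^sub>R e) - f (m' - b *\<^sub>R e) - 2 * L a + 2 * L b"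
  if "a > 0" for m' a b
 proof -
  have "(b / a) *\<^sub>R (a *\<^sub>R e) = b *\<^sub>R e" "b / a * norm (a *\<^sub>R e) = b" "norm (a *\<^sub>R e) = a" using that ne by simp_all
  then show ?thesis unfolding Q_def by simp
 qed
 have Qz: "Q m z s = f (m + N *\<^sub>R e) + f (m - N *\<^sub>R e) - f (m + k *\<^sub>R e) - f (m - k *\<^sub>R e) - 2 * L N + 2 * L k"
  using QN[OF N(1), of m k] N by (simp add: ze[symmetric] k_def)
 define A1 A2 B1 B2 where "A1 = m + N *\<^sub>R e" and "A2 = m - N *\<^sub>R e" and "B1 = m + k *\<^sub>R e" and "B2 = m - k *\<^sub>R e"
 have ABO: "A1 \<in> Om" "A2 \<in> Om" "B1 \<in> Om" "B2 \<in> Om" using p4 by (simp_all add: A1_def A2_def B1_def B2_def)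
 note jl = jet2_line[OF hf open_Om]
 have near: "\<forall>\<^sub>F t in nhds 0. x + t *\<^sub>R a \<in> Om" if "x \<in> Om" for x a
  by (rule eventually_line[OF eventually_nhds_in_open[OF open_Om that]])
 \<comment> \<open>Rigid translation of all four points leaves both distances, and with them the
   terms in \<open>L\<close>, unchanged.\<close>
 have T: "gf A1 \<bullet> a + gf A2 \<bullet> a - gf B1 \<bullet> a - gf B2 \<bullet> a = 0"
  "Hf A1 a \<bullet> a + Hf A2 a \<bullet> a - Hf B1 a \<bullet> a - Hf B2 a \<bullet> a <= 0" for a
 proof -
  note j = jet2_diff[OF jet2_diff[OF jet2_add[OF jl[OF ABO(1), of a] jl[OF ABO(2), of a]] jl[OF ABO(3), of a]] jl[OF ABO(4), of a]]
  have "\<forall>\<^sub>F t in nhds 0. f (A1 + t *\<^sub>R a) + f (A2 + t *\<^sub>R a) - f (B1 + t *\<^sub>R a) - f (B2 + t *\<^sub>R a)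
    <= f (A1 + 0 *\<^sub>R a) + f (A2 + 0 *\<^sub>R a) - f (B1 + 0 *\<^sub>R a) - f (B2 + 0 *\<^sub>R a)"
   using near[OF ABO(1), of a] near[OF ABO(2), of a]
  proof eventually_elim
   case (elim t)
   have "Q (m + t *\<^sub>R a) (N *\<^sub>R e) (k / N) <= Q m z s"
    by (rule max) (use elim k N in \<open>simp_all add: A1_def A2_def algebra_simps\<close>)
   then show ?case unfolding QN[OF N(1)] Qz by (simp add: A1_def A2_def B1_def B2_def algebra_simps)
  qed
  from jet2_max[OF j this]
  show "gf A1 \<bullet> a + gf A2 \<bullet> a - gf B1 \<bullet> a - gf B2 \<bullet> a = 0"
   "Hf A1 a \<bullet> a + Hf A2 a \<bullet> a - Hf B1 a \<bullet> a - Hf B2 a \<bullet> a <= 0" .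
 qed
 have LI: "open {-D<..<D}" by simp
 have NI: "N \<in> {-D<..<D}" "k \<in> {-D<..<D}" using N k D0 by auto
 have jN: "jet2 (\<lambda>t. L (N + t)) (L1 N) (L2 N)" and jk: "jet2 (\<lambda>t. L (k + t)) (L1 k) (L2 k)"
  by (rule jet2_shift[OF LI NI(1)], use L N in auto) (rule jet2_shift[OF LI NI(2)], use L k N in auto)
 \<comment> \<open>Both pairs separate along \<open>e\<close> at the same rate; this is the
   variation that brings in \<open>L2\<close>.\<close>
 have E: "gf A1 \<bullet> e + gf A2 \<bullet> (- e) - gf B1 \<bullet> e - gf B2 \<bullet> (- e) - 2 * L1 N + 2 * L1 k = 0"
  "Hf A1 e \<bullet> e + Hf A2 (- e) \<bullet> (- e) - Hf B1 e \<bullet> e - Hf B2 (- e) \<bullet> (- e) - 2 * L2 N + 2 * L2 k <= 0"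
 proof -
  note j = jet2_add[OF jet2_diff[OF jet2_diff[OF jet2_diff[OF jet2_add[OF jl[OF ABO(1), of e] jl[OF ABO(2), of "- e"]] jl[OF ABO(3), of e]] jl[OF ABO(4), of "- e"]]
    jet2_cmult[OF jN, of 2]] jet2_cmult[OF jk, of 2]]
  have ev: "\<forall>\<^sub>F t in nhds 0. \<bar>t\<bar> < (N - k) / 2" unfolding eventually_nhds_metric using k by (intro exI[of _ "(N - k) / 2"]) auto
  have "\<forall>\<^sub>F t in nhds 0. f (A1 + t *\<^sub>R e) + f (A2 + t *\<^sub>R - e) - f (B1 + t *\<^sub>R e) - f (B2 + t *\<^sub>R - e) - 2 * L (N + t) + 2 * L (k + t)
    <= f (A1 + 0 *\<^sub>R e) + f (A2 + 0 *\<^sub>R - e) - f (B1 + 0 *\<^sub>R e) - f (B2 + 0 *\<^sub>R - e) - 2 * L (N + 0) + 2 * L (k + 0)"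
   using near[OF ABO(1), of e] near[OF ABO(2), of "- e"] ev
  proof eventually_elim
   case (elim t)
   have Nt: "N + t > 0" "\<bar>k + t\<bar> <= N + t" using elim(3) k by auto
   have "Q m ((N + t) *\<^sub>R e) ((k + t) / (N + t)) <= Q m z s"
    by (rule max) (use elim Nt in \<open>simp_all add: A1_def A2_def algebra_simps abs_divide\<close>)
   then show ?case unfolding QN[OF Nt(1)] Qz by (simp add: A1_def A2_def B1_def B2_def algebra_simps)
  qed
  from jet2_max[OF j this]
  show "gf A1 \<bullet> e + gf A2 \<bullet> (- e) - gf B1 \<bullet> e - gf B2 \<bullet> (- e) - 2 * L1 N + 2 * L1 k = 0"
   "Hf A1 e \<bullet> e + Hf A2 (- e) \<bullet> (- e) - Hf B1 e \<bullet> e - Hf B2 (- e) \<bullet> (- e) - 2 * L2 N + 2 * L2 k <= 0" .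
 qed
 \<comment> \<open>Only the inner pair moves. Together with the first line of \<open>E\<close> this
   fixes both axial gradient differences.\<close>
 have Sg: "gf B1 \<bullet> e + gf B2 \<bullet> (- e) - 2 * L1 k = 0"
 proof -
  note j = jet2_add[OF jet2_diff[OF jet2_minus[OF jl[OF ABO(3), of e]] jl[OF ABO(4), of "- e"]] jet2_cmult[OF jk, of 2]]
  have ev: "\<forall>\<^sub>F t in nhds 0. \<bar>t\<bar> < N - k" unfolding eventually_nhds_metric using k by (intro exI[of _ "N - k"]) auto
  have "\<forall>\<^sub>F t in nhds 0. - f (B1 + t *\<^sub>R e) - f (B2 + t *\<^sub>R - e) + 2 * L (k + t) <= - f (B1 + 0 *\<^sub>R e) - f (B2 + 0 *\<^sub>R - e) + 2 * L (k + 0)"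
   using ev
  proof eventually_elim
   case (elim t)
   have kt: "\<bar>k + t\<bar> <= N" using elim k by auto
   have "Q m (N *\<^sub>R e) ((k + t) / N) <= Q m z s"
    by (rule max) (use ABO kt N in \<open>simp_all add: A1_def A2_def abs_divide\<close>)
   then show ?case unfolding QN[OF N(1)] Qz by (simp add: B1_def B2_def algebra_simps)
  qed
  from jet2_max(1)[OF j this] show ?thesis by simp
 qed
 \<comment> \<open>The segment is tilted about its midpoint by a vector orthogonal to
   \<open>e\<close>. The first variation ties the orthogonal parts of the outer and inner gradient
   differences by the factor \<open>s\<close>, so the outer one is no longer than the inner
   one.\<close>
 have X: "(gf A1 - gf A2) \<bullet> x = s * ((gf B1 - gf B2) \<bullet> x)" if x: "e \<bullet> x = 0" for x
 proof -
  define F where "F = (\<lambda>t. f (A1 + t *\<^sub>R x) + f (A2 + t *\<^sub>R - x) - f (B1 + t *\<^sub>R (s *\<^sub>R x)) - f (B2 + t *\<^sub>R - (s *\<^sub>R x))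
    - 2 * L (norm (z + t *\<^sub>R x)) + 2 * L (s * norm (z + t *\<^sub>R x)))"
  have dn: "((\<lambda>t. norm (z + t *\<^sub>R x)) has_real_derivative 0) (at 0)"
   using norm_line_deriv[OF zn, of x] x N by (simp add: sgn_div_norm ze inner_commute[of x])
  have dline: "((\<lambda>t. f (w + t *\<^sub>R a)) has_real_derivative gf w \<bullet> a) (at 0)" if "w \<in> Om" for w a
   using hf that has_derivative_line[of f "gf w" w 0 a] by (simp add: has_hessian_on_def)
  have dL1: "((\<lambda>t. L (norm (z + t *\<^sub>R x))) has_real_derivative L1 N * 0) (at 0)"
   by (rule DERIV_chain2[OF _ dn]) (use L(1)[of N] N in \<open>simp add: N_def[symmetric]\<close>)
  have dL2: "((\<lambda>t. L (s * norm (z + t *\<^sub>R x))) has_real_derivative L1 k * (s * 0)) (at 0)"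
   by (rule DERIV_chain2[OF _ DERIV_cmult[OF dn]]) (use L(1)[of k] k N in \<open>simp add: N_def[symmetric] k_def[symmetric]\<close>)
  have dF: "(F has_real_derivative (gf A1 \<bullet> x + gf A2 \<bullet> - x - gf B1 \<bullet> (s *\<^sub>R x) - gf B2 \<bullet> - (s *\<^sub>R x) - 2 * (L1 N * 0) + 2 * (L1 k * (s * 0)))) (at 0)"
   unfolding F_def by (intro DERIV_add DERIV_diff DERIV_cmult dline ABO dL1 dL2)
  have "\<forall>\<^sub>F t in nhds 0. F t <= F 0"
   using near[OF ABO(1), of x] near[OF ABO(2), of "- x"]
  proof eventually_elim
   case (elim t)
   have "Q m (z + t *\<^sub>R x) s <= Q m z s"
    by (rule max) (use elim pq in \<open>simp_all add: A1_def A2_def ze[symmetric] algebra_simps\<close>)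
   then show ?case unfolding F_def Q_def by (simp add: A1_def A2_def B1_def B2_def szk[symmetric] ze[symmetric] algebra_simps)
  qed
  then obtain d where d: "d > 0" "\<And>t. \<bar>0 - t\<bar> < d ==> F t <= F 0" unfolding eventually_nhds_metric by (auto simp: dist_real_def)
  from DERIV_local_max[OF dF d(1)] d(2) show ?thesis by (simp add: inner_diff_left algebra_simps)
 qed
 define Dp Dq where "Dp = gf A1 - gf A2" and "Dq = gf B1 - gf B2"
 have Dqe: "Dq \<bullet> e = 2 * L1 k" using Sg by (simp add: Dq_def inner_diff_left)
 have Dpe: "Dp \<bullet> e = 2 * L1 N" using E(1) Sg by (simp add: Dp_def inner_diff_left)
 have ee: "e \<bullet> e = 1" using ne by (simp add: norm_eq_1)
 define Pp Pq where "Pp = Dp - (Dp \<bullet> e) *\<^sub>R e" and "Pq = Dq - (Dq \<bullet> e) *\<^sub>R e"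
 have orth: "e \<bullet> Pp = 0" "e \<bullet> Pq = 0" by (simp_all add: Pp_def Pq_def inner_diff_right ee inner_commute[of e Dp] inner_commute[of e Dq])
 have Xp: "Pp \<bullet> x = s * (Pq \<bullet> x)" if "e \<bullet> x = 0" for x
  using X[OF that] that by (simp add: Pp_def Pq_def Dp_def[symmetric] Dq_def[symmetric] inner_diff_left)
 have n2: "Pp \<bullet> Pp <= Pq \<bullet> Pq"
 proof -
  have "Pp \<bullet> Pp = s * (Pq \<bullet> Pp)" using Xp[OF orth(1)] .
  also have "Pq \<bullet> Pp = s * (Pq \<bullet> Pq)" using Xp[OF orth(2)] by (simp add: inner_commute)
  also have "s * (s * (Pq \<bullet> Pq)) <= 1 * (1 * (Pq \<bullet> Pq))" using pq(3,4) by (intro mult_mono) auto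
  finally show ?thesis by simp
 qed
 have split: "w \<bullet> w = (w \<bullet> e)\<^sup>2 + (w - (w \<bullet> e) *\<^sub>R e) \<bullet> (w - (w \<bullet> e) *\<^sub>R e)" for w
  by (simp add: inner_diff_left inner_diff_right ee inner_commute[of e w] power2_eq_square)
 have DD: "Dp \<bullet> Dp - Dq \<bullet> Dq <= 4 * ((L1 N)\<^sup>2 - (L1 k)\<^sup>2)"
  using split[of Dp] split[of Dq] n2 unfolding Pp_def Pq_def Dpe Dqe by (simp add: power_mult_distrib)
 have sums: "gf A1 + gf A2 = gf B1 + gf B2"
 proof -
  have "(gf A1 + gf A2) \<bullet> a = (gf B1 + gf B2) \<bullet> a" for a using T(1)[of a] by (simp add: inner_add_left)
  then show ?thesis by (metis inner_commute vector_eq_ldot)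
 qed
 \<comment> \<open>The sums of the two outer and of the two inner gradients agree, so by the
   parallelogram law the squared gradients are compared through the gradient differences
   alone.\<close>
 have par: "2 * (a \<bullet> a + b \<bullet> b) = (a + b) \<bullet> (a + b) + (a - b) \<bullet> (a - b)" for a b :: 'a
  by (simp add: inner_add_left inner_add_right inner_diff_left inner_diff_right)
 have gg: "2 * (gf A1 \<bullet> gf A1 + gf A2 \<bullet> gf A2 - gf B1 \<bullet> gf B1 - gf B2 \<bullet> gf B2) <= 4 * ((L1 N)\<^sup>2 - (L1 k)\<^sup>2)"
 proof -
  have 1: "2 * (gf A1 \<bullet> gf A1 + gf A2 \<bullet> gf A2) = (gf B1 + gf B2) \<bullet> (gf B1 + gf B2) + Dp \<bullet> Dp"
   using par[of "gf A1" "gf A2"] by (simp only: sums Dp_def)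
  have 2: "2 * (gf B1 \<bullet> gf B1 + gf B2 \<bullet> gf B2) = (gf B1 + gf B2) \<bullet> (gf B1 + gf B2) + Dq \<bullet> Dq"
   using par[of "gf B1" "gf B2"] by (simp only: Dq_def)
  have "2 * (gf A1 \<bullet> gf A1 + gf A2 \<bullet> gf A2 - gf B1 \<bullet> gf B1 - gf B2 \<bullet> gf B2) = Dp \<bullet> Dp - Dq \<bullet> Dq"
   using 1 2 by argo
  then show ?thesis using DD by simp
 qed
 obtain B where B: "finite B" "e \<in> B" "\<And>A. linear A ==> trace_op A = (\<Sum>b\<in>B. A b \<bullet> b)"
  by (rule trace_op_orthonormal[OF ne]) (rule that; assumption)
 have lin: "linear (Hf w)" if "w \<in> Om" for w by (rule hessian_linear[OF hf that])
 have neg2: "Hf w (- e) \<bullet> (- e) = Hf w e \<bullet> e" if "w \<in> Om" for w using linear_neg[OF lin[OF that], of e] by simp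
 have "trace_op (Hf A1) + trace_op (Hf A2) - trace_op (Hf B1) - trace_op (Hf B2) =
   (\<Sum>b\<in>B. Hf A1 b \<bullet> b + Hf A2 b \<bullet> b - Hf B1 b \<bullet> b - Hf B2 b \<bullet> b)"
  by (simp add: B(3)[OF lin[OF ABO(1)]] B(3)[OF lin[OF ABO(2)]] B(3)[OF lin[OF ABO(3)]] B(3)[OF lin[OF ABO(4)]] sum.distrib sum_subtractf)
 also have "\<dots> = (Hf A1 e \<bullet> e + Hf A2 e \<bullet> e - Hf B1 e \<bullet> e - Hf B2 e \<bullet> e) + (\<Sum>b\<in>B - {e}. Hf A1 b \<bullet> b + Hf A2 b \<bullet> b - Hf B1 b \<bullet> b - Hf B2 b \<bullet> b)"
  by (rule sum.remove[OF B(1,2)])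
 also have "\<dots> <= (2 * L2 N - 2 * L2 k) + 0"
 proof (rule add_mono)
  show "Hf A1 e \<bullet> e + Hf A2 e \<bullet> e - Hf B1 e \<bullet> e - Hf B2 e \<bullet> e <= 2 * L2 N - 2 * L2 k"
   using E(2) unfolding neg2[OF ABO(2)] neg2[OF ABO(4)] by linarith
  show "(\<Sum>b\<in>B - {e}. Hf A1 b \<bullet> b + Hf A2 b \<bullet> b - Hf B1 b \<bullet> b - Hf B2 b \<bullet> b) <= 0" by (intro sum_nonpos T(2))
 qed
 finally have "V A1 + V A2 - V B1 - V B2 <= 2 * ((L2 N + (L1 N)\<^sup>2) - (L2 k + (L1 k)\<^sup>2))"
  using trf[OF ABO(1)] trf[OF ABO(2)] trf[OF ABO(3)] trf[OF ABO(4)] gg by (simp add: algebra_simps)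
 moreover have "A1 = m + z" "A2 = m - z" "B1 = m + s *\<^sub>R z" "B2 = m - s *\<^sub>R z"
  by (simp_all add: A1_def A2_def B1_def B2_def szk ze[symmetric])
 ultimately show False using strict[OF zO zn pq(3) s1] by (simp add: N_def k_def)
qed

text \<open>The four-point inequality is an equality at \<open>s = 1\<close>, so its one-sided
  derivative there has a sign; this turns the integrated estimate into one for gradients.\<close>

lemma grad_modulus:
 assumes xy: "x \<in> Om" "y \<in> Om"
 shows "(gf y - gf x) \<bullet> (y - x) <= 2 * L1 (norm (y - x) / 2) * norm (y - x)"
proof -
 define m z where "m = (1/2) *\<^sub>R (x + y)" and "z = (1/2) *\<^sub>R (y - x)"
 have mz: "m + z = y" "m - z = x"
  unfolding m_def z_def by (simp_all add: algebra_simps flip: scaleR_add_left)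
 have n: "norm z = norm (y - x) / 2" by (simp add: z_def)
 have nD: "norm z <= D" using diam[OF xy] by (simp add: n)
 define k where "k = (\<lambda>s. (f (m + s *\<^sub>R z) + f (m - s *\<^sub>R z)) - 2 * L (s * norm z))"
 have kd: "(k has_real_derivative (gf y - gf x) \<bullet> z - 2 * (L1 (norm z) * norm z)) (at 1)"
 proof -
  have 1: "((\<lambda>s. L (s * norm z)) has_real_derivative L1 (norm z) * norm z) (at 1)"
   by (rule DERIV_chain2[of L]) (use L(1)[of "norm z"] nD in \<open>auto intro!: derivative_eq_intros\<close>)
  have 2: "((\<lambda>s. f (m + s *\<^sub>R z) + f (m - s *\<^sub>R z)) has_real_derivative (gf y - gf x) \<bullet> z) (at 1)"
   using pair_deriv[of m 1 z] xy by (simp add: mz)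
  show ?thesis unfolding k_def by (rule DERIV_diff[OF 2 DERIV_cmult[OF 1]])
 qed
 have "(gf y - gf x) \<bullet> z - 2 * (L1 (norm z) * norm z) <= 0"
 proof (rule ccontr)
  assume "\<not> ?thesis"
  then obtain r where r: "r > 0" "\<And>h. 0 < h ==> h < r ==> k (1 - h) < k 1"
   using DERIV_pos_inc_left[OF kd] by auto
  define h where "h = min (r / 2) 1"
  have h: "0 < h" "h < r" "h <= 1" using r(1) by (auto simp: h_def)
  have "k 1 <= k (1 - h)"
   using four_point[of m z "1 - h"] xy h by (simp add: k_def mz)
  then show False using r(2)[OF h(1,2)] by simp
 qed
 moreover have "(gf y - gf x) \<bullet> z = ((gf y - gf x) \<bullet> (y - x)) / 2" by (simp add: z_def)
 ultimately show ?thesis unfolding n by simp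
qed

end

end

section \<open>Two-point comparison of oscillations\<close>

context ground_state
begin

text \<open>\<open>w\<close> and \<open>gh\<close> are to come from the one-dimensional problem.
  \<open>v\<close> is to be an eigenfunction divided by the perturbed ground state,
  \<open>ga\<close> the corresponding difference of eigenvalues, and \<open>c\<close> what the
  perturbation leaves in the equation of \<open>v\<close>.\<close>

context
 fixes L1 w w1 w2 :: "real \<Rightarrow> real" and v :: "'a \<Rightarrow> real" and gv Hv and c :: "'a \<Rightarrow> real" and D gh ga dl B :: real
 assumes mod: "\<And>x y. x \<in> Om ==> y \<in> Om ==> (gf y - gf x) \<bullet> (y - x) <= 2 * L1 (norm (y - x) / 2) * norm (y - x)"
  and diam: "\<And>x y. x \<in> Om ==> y \<in> Om ==> norm (y - x) < 2 * D"
  and w: "\<And>s. \<bar>s\<bar> <= D ==> (w has_real_derivative w1 s) (at s)" "\<And>s. \<bar>s\<bar> <= D ==> (w1 has_real_derivative w2 s) (at s)"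
  and w1: "\<And>s. 0 <= s ==> s < D ==> w1 s >= 0"
  and w2: "\<And>s. 0 <= s ==> s < D ==> w2 s + 2 * L1 s * w1 s <= - gh * w s"
  and hv: "has_hessian_on Om v gv Hv"
  and bd: "\<And>x. x \<in> Om ==> \<bar>v x\<bar> <= B"
  and eq: "\<And>x. x \<in> Om ==> trace_op (Hv x) + 2 * (gf x \<bullet> gv x) = - (ga + c x) * v x"
  and c: "\<And>x. x \<in> Om ==> \<bar>c x\<bar> <= dl"
begin

text \<open>Penalised maximum of \<open>v y - v x - C w(|y - x| / 2)\<close>. First variations give
  both gradients of \<open>v\<close> up to the penalty; \<open>mod\<close> bounds the drift along
  the line through the points and is multiplied by \<open>w1 >= 0\<close>; the differential
  inequality for \<open>w\<close> closes the estimate. The squared gradients from the penalty have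
  the right sign.\<close>

lemma two_point_estimate:
 assumes C: "C > 0" and xy0: "x0 \<in> Om" "y0 \<in> Om" "v y0 - v x0 > C * w (norm (y0 - x0) / 2)" and w_pos: "w 0 > 0" and k: "k > 0"
 obtains x y where "x \<in> Om" "y \<in> Om"
  "C * gh * w (norm (y - x) / 2) <= ga * (v y - v x) + dl * (\<bar>v x\<bar> + \<bar>v y\<bar>) + k"
proof -
 define K where "K = M + \<bar>lam\<bar>"
 have K: "K >= 0" using V_bd[OF xy0(1)] by (simp add: K_def)
 define m0 where "m0 = v y0 - v x0 - C * w (norm (y0 - x0) / 2)"
 have m0: "m0 > 0" using xy0 by (simp add: m0_def)
 define F0 where "F0 = f x0 + f y0"
 have F0: "F0 <= 0" using f_le0 xy0 by (simp add: F0_def add_nonpos_nonpos)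
 \<comment> \<open>The first entry keeps the value at the maximum positive despite the penalty; the
   second makes the contribution of the potential at most \<open>k\<close>.\<close>
 define ep where "ep = min (m0 / (2 * (1 - F0))) (k / (2 * (K + 1)))"
 have ep: "ep > 0" unfolding ep_def using m0 F0 K k by (intro min_less_iff_conj[THEN iffD2] conjI divide_pos_pos mult_pos_pos) auto
 define \<psi> where "\<psi> = (\<lambda>(x, y). v y - v x - C * w (norm (y - x) / 2))"
 have rng: "\<bar>norm (y - x) / 2\<bar> < D" if "x \<in> Om" "y \<in> Om" for x y using diam[OF that] by simp
 have isw: "isCont w s" if "\<bar>s\<bar> <= D" for s using w(1)[OF that] by (rule DERIV_isCont)
 have D0: "D > 0" using rng[OF xy0(1,1)] by simp
 have cw: "continuous_on {-D..D} w"
  by (rule continuous_at_imp_continuous_on) (auto intro!: isw)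
 obtain BW where "\<And>s. s \<in> {-D..D} ==> norm (w s) <= BW" by (rule compact_bound[OF compact_Icc cw]) (rule that)
 then have BW: "\<bar>w s\<bar> <= BW" if "\<bar>s\<bar> <= D" for s using that by (simp add: abs_le_iff)
 have c\<psi>: "continuous_on (Om \<times> Om) \<psi>"
 proof -
  note cv = hessian_continuous_on(1)[OF hv]
  have 1: "continuous_on (Om \<times> Om) (\<lambda>p. v (snd p))" "continuous_on (Om \<times> Om) (\<lambda>p. v (fst p))"
   by (rule continuous_on_compose2[OF cv]; auto intro!: continuous_intros)+
  have 2: "continuous_on (Om \<times> Om) (\<lambda>p. norm (snd p - fst p) / 2)" by (intro continuous_intros) auto
  have "(\<lambda>p. norm (snd p - fst p) / 2) ` (Om \<times> Om) \<subseteq> {-D..D}" 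
  proof (rule image_subsetI)
   fix p assume "p \<in> Om \<times> Om"
   then have "\<bar>norm (snd p - fst p) / 2\<bar> < D" by (intro rng) auto
   then show "norm (snd p - fst p) / 2 \<in> {-D..D}" unfolding abs_less_iff atLeastAtMost_iff by linarith
  qed
  from continuous_on_compose2[OF cw 2 this]
  have 3: "continuous_on (Om \<times> Om) (\<lambda>p. w (norm (snd p - fst p) / 2))" .
  have "continuous_on (Om \<times> Om) (\<lambda>p. v (snd p) - v (fst p) - C * w (norm (snd p - fst p) / 2))"
   by (rule continuous_on_diff[OF continuous_on_diff[OF 1] continuous_on_mult[OF continuous_on_const 3]])
  then show ?thesis by (simp add: \<psi>_def split_beta)
 qed
 have b\<psi>: "\<psi> (x, y) <= 2 * B + C * BW" if "x \<in> Om" "y \<in> Om" for x y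
 proof -
  have "- (C * w (norm (y - x) / 2)) <= C * BW"
   using BW[of "norm (y - x) / 2"] rng[OF that] C mult_left_mono[of "- w (norm (y - x) / 2)" BW C] by simp
  then show ?thesis using bd[OF that(1)] bd[OF that(2)] unfolding \<psi>_def by (simp add: abs_le_iff)
 qed
 obtain x y where xy: "x \<in> Om" "y \<in> Om"
  and mx: "\<And>a b. a \<in> Om ==> b \<in> Om ==> \<psi> (a, b) + ep * (f a + f b) <= \<psi> (x, y) + ep * (f x + f y)"
  using pair_penalized_max[OF c\<psi> b\<psi> ep] by blast
 define z where "z = y - x"
 have mx': "v b - v a - C * w (norm (b - a) / 2) + ep * (f a + f b) <= v y - v x - C * w (norm z / 2) + ep * (f x + f y)" if "a \<in> Om" "b \<in> Om" for a b
  using mx[OF that] by (simp add: \<psi>_def z_def)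
 have pos: "v y - v x - C * w (norm z / 2) > 0"
 proof -
  have "ep * (- F0) <= m0 / 2"
  proof -
   have "ep * (1 - F0) <= m0 / (2 * (1 - F0)) * (1 - F0)" using F0 by (intro mult_right_mono) (auto simp: ep_def)
   also have "\<dots> = m0 / 2" using F0 by (simp add: field_simps)
   finally show ?thesis using ep by (simp add: algebra_simps)
  qed
  moreover have "m0 + ep * F0 <= v y - v x - C * w (norm z / 2) + ep * (f x + f y)"
   using mx'[OF xy0(1,2)] by (simp add: m0_def F0_def)
  moreover have "ep * (f x + f y) <= 0" using f_le0[OF xy(1)] f_le0[OF xy(2)] ep by (simp add: mult_nonneg_nonpos)
  ultimately show ?thesis using m0 by simp
 qed
 \<comment> \<open>Here \<open>w 0 > 0\<close> matters: on the diagonal the test function is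
   negative, so the maximum is attained where the distance is differentiable.\<close>
 have zn: "z \<noteq> 0"
 proof
  assume "z = 0"
  then have "x = y" by (simp add: z_def)
  then show False using pos \<open>z = 0\<close> C w_pos mult_pos_pos[OF C w_pos] by simp
 qed
 define s where "s = norm z / 2"
 have s: "0 < s" "s < D" using zn rng[OF xy] by (simp_all add: s_def z_def)
 define e where "e = sgn z"
 have ne: "norm e = 1" using zn by (simp add: e_def norm_sgn)
 have ze: "z = (2 * s) *\<^sub>R e" using zn by (simp add: e_def s_def sgn_div_norm)
 have near: "\<forall>\<^sub>F t in nhds 0. p + t *\<^sub>R a \<in> Om" if "p \<in> Om" for p a
  by (rule eventually_line[OF eventually_nhds_in_open[OF open_Om that]])
 have dline: "((\<lambda>t. f (p + t *\<^sub>R a)) has_real_derivative gf p \<bullet> a) (at 0)" if "p \<in> Om" for p a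
  using hf that has_derivative_line[of f "gf p" p 0 a] by (simp add: has_hessian_on_def)
 have vline: "((\<lambda>t. v (p + t *\<^sub>R a)) has_real_derivative gv p \<bullet> a) (at 0)" if "p \<in> Om" for p a
  using hv that has_derivative_line[of v "gv p" p 0 a] by (simp add: has_hessian_on_def)
 have wline: "((\<lambda>t. w (norm (z + t *\<^sub>R a) / 2)) has_real_derivative w1 s * ((a \<bullet> e) / 2)) (at 0)" for a
  by (rule DERIV_chain2[of w]) (use w(1)[of s] s norm_line_deriv[OF zn, of a] in \<open>auto simp: s_def e_def intro!: derivative_eq_intros\<close>)
 have loc: "d = 0" if dF: "(F has_real_derivative d) (at 0)" and ev: "\<forall>\<^sub>F t in nhds 0. F t <= F 0" for F :: "real \<Rightarrow> real" and d
 proof -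
  from ev obtain r where r: "r > 0" "\<And>t. \<bar>0 - t\<bar> < r ==> F t <= F 0" unfolding eventually_nhds_metric by (auto simp: dist_real_def)
  show ?thesis by (rule DERIV_local_max[OF dF r(1)]) (use r(2) in blast)
 qed
 have gy: "gv y = (C * w1 s / 2) *\<^sub>R e - ep *\<^sub>R gf y"
 proof -
  have H: "gv y \<bullet> a - C * (w1 s * ((a \<bullet> e) / 2)) + ep * (gf y \<bullet> a) = 0" for a
  proof (rule loc)
   show "((\<lambda>t. v (y + t *\<^sub>R a) - C * w (norm (z + t *\<^sub>R a) / 2) + ep * f (y + t *\<^sub>R a)) has_real_derivative
     gv y \<bullet> a - C * (w1 s * ((a \<bullet> e) / 2)) + ep * (gf y \<bullet> a)) (at 0)"
    by (intro DERIV_add DERIV_diff DERIV_cmult dline vline wline xy)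
   show "\<forall>\<^sub>F t in nhds 0. v (y + t *\<^sub>R a) - C * w (norm (z + t *\<^sub>R a) / 2) + ep * f (y + t *\<^sub>R a)
     <= v (y + 0 *\<^sub>R a) - C * w (norm (z + 0 *\<^sub>R a) / 2) + ep * f (y + 0 *\<^sub>R a)"
    using near[OF xy(2), of a]
   proof eventually_elim
    case (elim t)
    have e1: "y + t *\<^sub>R a - x = z + t *\<^sub>R a" by (simp add: z_def)
    show ?case using mx'[OF xy(1) elim] unfolding e1 by (simp add: distrib_left)
   qed
  qed
  have "(gv y - ((C * w1 s / 2) *\<^sub>R e - ep *\<^sub>R gf y)) \<bullet> a = 0" for a
   using H[of a] by (simp add: inner_diff_left inner_add_left inner_commute[of e a] algebra_simps)
  from this[of "gv y - ((C * w1 s / 2) *\<^sub>R e - ep *\<^sub>R gf y)"] show ?thesis by simp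
 qed
 have gx: "gv x = (C * w1 s / 2) *\<^sub>R e + ep *\<^sub>R gf x"
 proof -
  have H: "- (gv x \<bullet> a) - C * (w1 s * ((- a \<bullet> e) / 2)) + ep * (gf x \<bullet> a) = 0" for a
  proof (rule loc)
   show "((\<lambda>t. - v (x + t *\<^sub>R a) - C * w (norm (z + t *\<^sub>R (- a)) / 2) + ep * f (x + t *\<^sub>R a)) has_real_derivative
     - (gv x \<bullet> a) - C * (w1 s * ((- a \<bullet> e) / 2)) + ep * (gf x \<bullet> a)) (at 0)"
    by (intro DERIV_add DERIV_diff DERIV_cmult DERIV_minus dline vline wline xy)
   show "\<forall>\<^sub>F t in nhds 0. - v (x + t *\<^sub>R a) - C * w (norm (z + t *\<^sub>R (- a)) / 2) + ep * f (x + t *\<^sub>R a)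
     <= - v (x + 0 *\<^sub>R a) - C * w (norm (z + 0 *\<^sub>R (- a)) / 2) + ep * f (x + 0 *\<^sub>R a)"
    using near[OF xy(1), of a]
   proof eventually_elim
    case (elim t)
    have e1: "y - (x + t *\<^sub>R a) = z + t *\<^sub>R (- a)" by (simp add: z_def)
    show ?case using mx'[OF elim xy(2)] unfolding e1 by (simp add: distrib_left)
   qed
  qed
  have "(gv x - ((C * w1 s / 2) *\<^sub>R e + ep *\<^sub>R gf x)) \<bullet> a = 0" for a
   using H[of a] by (simp add: inner_diff_left inner_add_left inner_commute[of e a] algebra_simps)
  from this[of "gv x - ((C * w1 s / 2) *\<^sub>R e + ep *\<^sub>R gf x)"] show ?thesis by simp
 qed
 note jf = jet2_line[OF hf open_Om] and jv = jet2_line[OF hv open_Om]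
 \<comment> \<open>Equal displacement of both points keeps \<open>y - x\<close> fixed, so
   \<open>w\<close> does not contribute.\<close>
 have T: "Hv y a \<bullet> a - Hv x a \<bullet> a + ep * (Hf x a \<bullet> a + Hf y a \<bullet> a) <= 0" for a
 proof -
  note j = jet2_add[OF jet2_diff[OF jv[OF xy(2), of a] jv[OF xy(1), of a]] jet2_cmult[OF jet2_add[OF jf[OF xy(1), of a] jf[OF xy(2), of a]], of ep]]
  have "\<forall>\<^sub>F t in nhds 0. v (y + t *\<^sub>R a) - v (x + t *\<^sub>R a) + ep * (f (x + t *\<^sub>R a) + f (y + t *\<^sub>R a))
    <= v (y + 0 *\<^sub>R a) - v (x + 0 *\<^sub>R a) + ep * (f (x + 0 *\<^sub>R a) + f (y + 0 *\<^sub>R a))"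
   using near[OF xy(1), of a] near[OF xy(2), of a]
  proof eventually_elim
   case (elim t)
   have "y + t *\<^sub>R a - (x + t *\<^sub>R a) = z" by (simp add: z_def)
   then show ?case using mx'[OF elim] by simp
  qed
  from jet2_max(2)[OF j this] show ?thesis .
 qed
 have sI: "open {-D<..<D}" "s \<in> {-D<..<D}" using s D0 by auto
 have jw: "jet2 (\<lambda>t. w (s + t)) (w1 s) (w2 s)" by (rule jet2_shift[OF sI]) (use w s in auto)
 \<comment> \<open>Opposite displacements along \<open>e\<close> change the argument of
   \<open>w\<close> at unit speed.\<close>
 have E: "Hv y e \<bullet> e - Hv x (- e) \<bullet> (- e) - C * w2 s + ep * (Hf x (- e) \<bullet> (- e) + Hf y e \<bullet> e) <= 0"
 proof -
  note j = jet2_add[OF jet2_diff[OF jet2_diff[OF jv[OF xy(2), of e] jv[OF xy(1), of "- e"]] jet2_cmult[OF jw, of C]]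
    jet2_cmult[OF jet2_add[OF jf[OF xy(1), of "- e"] jf[OF xy(2), of e]], of ep]]
  have ev: "\<forall>\<^sub>F t in nhds 0. \<bar>t\<bar> < s" unfolding eventually_nhds_metric using s by (intro exI[of _ s]) auto
  have "\<forall>\<^sub>F t in nhds 0. v (y + t *\<^sub>R e) - v (x + t *\<^sub>R - e) - C * w (s + t) + ep * (f (x + t *\<^sub>R - e) + f (y + t *\<^sub>R e))
    <= v (y + 0 *\<^sub>R e) - v (x + 0 *\<^sub>R - e) - C * w (s + 0) + ep * (f (x + 0 *\<^sub>R - e) + f (y + 0 *\<^sub>R e))"
   using near[OF xy(1), of "- e"] near[OF xy(2), of e] ev
  proof eventually_elim
   case (elim t)
   have "(2 * t) *\<^sub>R e = t *\<^sub>R e + t *\<^sub>R e" by (simp only: mult_2 scaleR_add_left)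
   then have "y + t *\<^sub>R e - (x + t *\<^sub>R - e) = z + (2 * t) *\<^sub>R e" by (simp add: z_def)
   also have "\<dots> = (2 * (s + t)) *\<^sub>R e" by (simp add: ze distrib_left scaleR_add_left)
   finally have N: "norm (y + t *\<^sub>R e - (x + t *\<^sub>R - e)) / 2 = s + t" using elim(3) ne by simp
   show ?case using mx'[OF elim(1,2)] unfolding N by (simp add: s_def[symmetric])
  qed
  from jet2_max(2)[OF j this] show ?thesis .
 qed
 obtain Bs where Bs: "finite Bs" "e \<in> Bs" "\<And>A. linear A ==> trace_op A = (\<Sum>b\<in>Bs. A b \<bullet> b)"
  by (rule trace_op_orthonormal[OF ne]) (rule that; assumption)
 have linf: "linear (Hf p)" and linv: "linear (Hv p)" if "p \<in> Om" for p by (rule hessian_linear[OF hf that], rule hessian_linear[OF hv that])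
 have negx: "Hf x (- e) \<bullet> (- e) = Hf x e \<bullet> e" "Hv x (- e) \<bullet> (- e) = Hv x e \<bullet> e"
  using linear_neg[OF linf[OF xy(1)], of e] linear_neg[OF linv[OF xy(1)], of e] by simp_all
 have "trace_op (Hv y) - trace_op (Hv x) + ep * (trace_op (Hf x) + trace_op (Hf y))
   = (\<Sum>b\<in>Bs. Hv y b \<bullet> b - Hv x b \<bullet> b + ep * (Hf x b \<bullet> b + Hf y b \<bullet> b))"
  by (simp add: Bs(3)[OF linv[OF xy(1)]] Bs(3)[OF linv[OF xy(2)]] Bs(3)[OF linf[OF xy(1)]] Bs(3)[OF linf[OF xy(2)]] sum.distrib sum_subtractf sum_distrib_left[symmetric])
 also have "\<dots> = (Hv y e \<bullet> e - Hv x e \<bullet> e + ep * (Hf x e \<bullet> e + Hf y e \<bullet> e)) + (\<Sum>b\<in>Bs - {e}. Hv y b \<bullet> b - Hv x b \<bullet> b + ep * (Hf x b \<bullet> b + Hf y b \<bullet> b))"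
  by (rule sum.remove[OF Bs(1,2)])
 also have "\<dots> <= C * w2 s + 0"
 proof (rule add_mono)
  show "Hv y e \<bullet> e - Hv x e \<bullet> e + ep * (Hf x e \<bullet> e + Hf y e \<bullet> e) <= C * w2 s" using E unfolding negx by linarith
  show "(\<Sum>b\<in>Bs - {e}. Hv y b \<bullet> b - Hv x b \<bullet> b + ep * (Hf x b \<bullet> b + Hf y b \<bullet> b)) <= 0" by (intro sum_nonpos T)
 qed
 finally have tr: "trace_op (Hv y) - trace_op (Hv x) + ep * (trace_op (Hf x) + trace_op (Hf y)) <= C * w2 s" by simp
 define P where "P = (gf y - gf x) \<bullet> e"
 have P: "P <= 2 * L1 s"
 proof -
  have "P * (2 * s) = (gf y - gf x) \<bullet> z" by (simp add: P_def ze)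
  also have "\<dots> <= 2 * L1 s * (2 * s)" using mod[OF xy] by (simp add: z_def[symmetric] s_def)
  finally show ?thesis using s by simp
 qed
 have Cw: "C * w1 s >= 0" using C w1[of s] s by simp
 have gvs: "2 * (gf y \<bullet> gv y) - 2 * (gf x \<bullet> gv x) = C * w1 s * P - 2 * ep * (gf y \<bullet> gf y + gf x \<bullet> gf x)"
  unfolding gx gy P_def by (simp add: inner_diff_left inner_diff_right inner_add_right algebra_simps)
 define G where "G = gf y \<bullet> gf y + gf x \<bullet> gf x"
 have G: "ep * G >= 0" using ep by (simp add: G_def)
 have tf: "ep * (trace_op (Hf x) + trace_op (Hf y)) = ep * (V x + V y - 2 * lam) - ep * G"
 proof -
  have "trace_op (Hf x) + trace_op (Hf y) = V x + V y - 2 * lam - G" using trf[OF xy(1)] trf[OF xy(2)] by (simp add: G_def)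
  then show ?thesis by (simp add: right_diff_distrib)
 qed
 have eV: "ep * (V x + V y - 2 * lam) >= - k"
 proof -
  have "V x + V y - 2 * lam >= - (2 * K)" using abs_le_D2[OF V_bd[OF xy(1)]] abs_le_D2[OF V_bd[OF xy(2)]] abs_ge_self[of lam] unfolding K_def distrib_left by linarith
  then have "ep * (V x + V y - 2 * lam) >= ep * (- (2 * K))" using ep by (intro mult_left_mono) auto
  moreover have "ep * (2 * K) <= k"
  proof -
   have "ep * (2 * K) <= ep * (2 * (K + 1))" using ep by (intro mult_left_mono) auto
   also have "\<dots> <= k / (2 * (K + 1)) * (2 * (K + 1))" using K by (intro mult_right_mono) (auto simp: ep_def)
   also have "\<dots> = k" using K by simp
   finally show ?thesis .
  qed
  ultimately show ?thesis by simp
 qed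
 have CP: "C * w1 s * P <= C * (2 * L1 s * w1 s)"
  using mult_left_mono[OF P Cw] by (simp add: algebra_simps)
 have cw2: "C * w2 s <= - (C * gh * w s) - C * (2 * L1 s * w1 s)"
 proof -
  have "w2 s <= - gh * w s - 2 * L1 s * w1 s" using w2[of s] s by simp
  from mult_left_mono[OF this, of C] show ?thesis using C by (simp add: algebra_simps)
 qed
 have cv: "- (c y * v y) + c x * v x >= - (dl * (\<bar>v x\<bar> + \<bar>v y\<bar>))"
 proof -
  have "c p * v p <= dl * \<bar>v p\<bar>" "- (c p * v p) <= dl * \<bar>v p\<bar>" if "p \<in> Om" for p
   using mult_right_mono[OF c[OF that], of "\<bar>v p\<bar>"] abs_ge_self[of "c p * v p"] abs_ge_minus_self[of "c p * v p"] by (simp_all add: abs_mult)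
  from this(1)[OF xy(2)] this(2)[OF xy(1)] show ?thesis by (simp add: distrib_left)
 qed
 have "trace_op (Hv y) - trace_op (Hv x) = - (C * w1 s * P) + 2 * (ep * G) - ga * (v y - v x) + (- (c y * v y) + c x * v x)"
  using eq[OF xy(1)] eq[OF xy(2)] gvs unfolding G_def[symmetric] by (simp add: algebra_simps)
 then have "C * gh * w s <= ga * (v y - v x) + dl * (\<bar>v x\<bar> + \<bar>v y\<bar>) + k"
  using tr tf eV CP cw2 cv G by linarith
 then show ?thesis using that[OF xy] by (simp add: s_def z_def)
qed

text \<open>\<open>S\<close> is the best constant in \<open>v y - v x <= S w(|y - x| / 2)\<close>.
  The two-point estimate just below \<open>S\<close>, divided by \<open>w\<close>, gives
  \<open>gh <= ga\<close> up to the error from \<open>c\<close>, which is at most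
  \<open>2 dl wM / w0\<close> because \<open>|v| <= S wM\<close>.\<close>

lemma gap_comparison:
 assumes wb: "\<And>s. 0 <= s ==> s < D ==> w0 <= w s" "\<And>s. 0 <= s ==> s < D ==> w s <= wM" "w0 > 0" and ga: "ga >= 0"
  and low: "\<And>r. r > 0 ==> \<exists>x\<in>Om. v x < r" and up: "\<And>r. r > 0 ==> \<exists>x\<in>Om. v x > - r"
  and nz: "p \<in> Om" "v p \<noteq> 0"
 shows "gh <= ga + 2 * dl * wM / w0"
proof -
 have rng: "0 <= norm (y - x) / 2" "norm (y - x) / 2 < D" if "x \<in> Om" "y \<in> Om" for x y using diam[OF that] by simp_all
 have D0: "D > 0" using rng[OF nz(1,1)] by simp
 have wpos: "w s > 0" if "0 <= s" "s < D" for s using wb(1)[OF that] wb(3) by linarith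
 define A where "A = {(v y - v x) / w (norm (y - x) / 2) | x y. x \<in> Om \<and> y \<in> Om}"
 have bA: "bdd_above A"
 proof (rule bdd_aboveI[of _ "2 * B / w0"])
  fix q assume "q \<in> A"
  then obtain x y where q: "q = (v y - v x) / w (norm (y - x) / 2)" "x \<in> Om" "y \<in> Om" by (auto simp: A_def)
  have B0: "B >= 0" using bd[OF nz(1)] by linarith
  have "v y - v x <= 2 * B" using bd[OF q(2)] bd[OF q(3)] by (simp add: abs_le_iff)
  then have "q <= 2 * B / w (norm (y - x) / 2)" unfolding q(1) using wpos[OF rng[OF q(2,3)]] by (intro divide_right_mono) auto
  also have "\<dots> <= 2 * B / w0" using wb(1)[OF rng[OF q(2,3)]] wb(3) B0 by (intro divide_left_mono) auto
  finally show "q <= 2 * B / w0" .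
 qed
 define S where "S = Sup A"
 have SA: "v y - v x <= S * w (norm (y - x) / 2)" if "x \<in> Om" "y \<in> Om" for x y
 proof -
  have "(v y - v x) / w (norm (y - x) / 2) <= S" unfolding S_def by (rule cSup_upper[OF _ bA]) (use that in \<open>auto simp: A_def\<close>)
  then show ?thesis using wpos[OF rng[OF that]] by (simp add: pos_divide_le_eq)
 qed
 have S0: "S > 0"
 proof -
  have "\<exists>x y. x \<in> Om \<and> y \<in> Om \<and> v y - v x > 0"
  proof (cases "v p > 0")
   case True from low[OF this] obtain q where "q \<in> Om" "v q < v p" by blast
   then show ?thesis using nz(1) by (metis diff_gt_0_iff_gt)
  next
   case False then have "- v p > 0" using nz by simp
   from up[OF this] obtain q where "q \<in> Om" "v q > v p" by auto
   then show ?thesis using nz(1) by (metis diff_gt_0_iff_gt)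
  qed
  then obtain x y where q: "x \<in> Om" "y \<in> Om" "v y - v x > 0" by blast
  then have "S * w (norm (y - x) / 2) > 0" using SA[OF q(1,2)] by linarith
  then show ?thesis using wpos[OF rng[OF q(1,2)]] by (simp add: zero_less_mult_iff)
 qed
 have SM: "v y - v x <= S * wM" if "x \<in> Om" "y \<in> Om" for x y
  using SA[OF that] mult_left_mono[OF wb(2)[OF rng[OF that]] less_imp_le[OF S0]] by linarith
 \<comment> \<open>An oscillation bound controls \<open>v\<close> itself because \<open>low\<close>
   and \<open>up\<close> put zero between its infimum and its supremum.\<close>
 have vb: "\<bar>v x\<bar> <= S * wM" if x: "x \<in> Om" for x
 proof -
  have "v x <= S * wM"
  proof (rule field_le_epsilon)
   fix r :: real assume "r > 0"
   from low[OF this] obtain q where "q \<in> Om" "v q < r" by blast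
   then show "v x <= S * wM + r" using SM[OF _ x, of q] by simp
  qed
  moreover have "- v x <= S * wM"
  proof (rule field_le_epsilon)
   fix r :: real assume "r > 0"
   from up[OF this] obtain q where "q \<in> Om" "v q > - r" by blast
   then show "- v x <= S * wM + r" using SM[OF x, of q] by simp
  qed
  ultimately show ?thesis by (simp add: abs_le_iff)
 qed
 have dl0: "dl >= 0" using c[OF nz(1)] by linarith
 have wM0: "wM > 0" using wb(2)[of 0] wpos[of 0] D0 by simp
 have "S * gh <= S * (ga + 2 * dl * wM / w0)"
 proof (rule field_le_mult_one_interval)
  fix r :: real assume r: "0 < r" "r < 1"
  \<comment> \<open>The supremum \<open>S\<close> may fail to be attained, so the estimate is
    applied with constants just below it, and then \<open>r\<close> tends to
    \<open>1\<close>.\<close>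
  define C where "C = r * S"
  have C: "0 < C" "C < S" using r S0 by (simp_all add: C_def)
  have Ane: "A \<noteq> {}" using nz(1) by (auto simp: A_def)
  obtain q where "q \<in> A" "C < q" using less_cSup_iff[OF Ane bA, of C] C(2) by (auto simp: S_def)
  then obtain x0 y0 where xy0: "x0 \<in> Om" "y0 \<in> Om" "C < (v y0 - v x0) / w (norm (y0 - x0) / 2)" by (auto simp: A_def)
  have gt: "v y0 - v x0 > C * w (norm (y0 - x0) / 2)" using xy0(3) wpos[OF rng[OF xy0(1,2)]] by (simp add: pos_less_divide_eq)
  have "C * gh <= S * (ga + 2 * dl * wM / w0)"
  proof (rule field_le_epsilon)
   fix k :: real assume k: "k > 0"
   have kw: "k * w0 > 0" using k wb(3) by simp
   have w0p: "w 0 > 0" using wpos[of 0] D0 by simp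
   obtain x y where xy: "x \<in> Om" "y \<in> Om" "C * gh * w (norm (y - x) / 2) <= ga * (v y - v x) + dl * (\<bar>v x\<bar> + \<bar>v y\<bar>) + k * w0"
    using two_point_estimate[OF C(1) xy0(1,2) gt w0p kw] by blast
   define W where "W = w (norm (y - x) / 2)"
   have W: "W > 0" "w0 <= W" using wpos[OF rng[OF xy(1,2)]] wb(1)[OF rng[OF xy(1,2)]] by (simp_all add: W_def)
   have 1: "ga * (v y - v x) <= ga * (S * W)" unfolding W_def by (rule mult_left_mono[OF SA[OF xy(1,2)] ga])
   have 2: "dl * (\<bar>v x\<bar> + \<bar>v y\<bar>) <= dl * (S * wM + S * wM)" by (intro mult_left_mono add_mono vb xy dl0)
   have 3: "dl * (S * wM + S * wM) <= (2 * dl * wM / w0 * S) * W"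
   proof -
    have "(2 * dl * wM / w0 * S) * w0 <= (2 * dl * wM / w0 * S) * W" using W dl0 wM0 S0 wb(3) by (intro mult_left_mono) auto
    then show ?thesis using wb(3) by (simp add: algebra_simps)
   qed
   have 4: "k * w0 <= k * W" using W k by simp
   have "(C * gh) * W <= (S * (ga + 2 * dl * wM / w0) + k) * W"
   proof -
    have "(S * (ga + 2 * dl * wM / w0) + k) * W = ga * (S * W) + (2 * dl * wM / w0 * S) * W + k * W" by (simp add: algebra_simps)
    then show ?thesis using xy(3) 1 2 3 4 unfolding W_def[symmetric] by linarith
   qed
   then show "C * gh <= S * (ga + 2 * dl * wM / w0) + k" using W(1) by simp
  qed
  then show "r * (S * gh) <= S * (ga + 2 * dl * wM / w0)" by (simp add: C_def mult.assoc)
 qed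
 then show ?thesis using S0 by simp
qed

end

end

section \<open>The one-dimensional problem\<close>

lemma antiderivative_exists:
 fixes h :: "real \<Rightarrow> real" assumes "continuous_on UNIV h"
 obtains F where "\<And>x. (F has_real_derivative h x) (at x)" "F 0 = 0"
proof -
 have c: "isCont h x" for x using assms by (simp add: continuous_on_eq_continuous_at)
 obtain F where F: "\<And>x. (F has_vector_derivative h x) (at x)"
  using einterval_antiderivative[of "-\<infinity>" \<infinity> h] c by auto
 show ?thesis
 proof (rule that[of "\<lambda>x. F x - F 0"])
  fix x
  have "(F has_real_derivative h x) (at x)" using F[of x] by (simp add: has_real_derivative_iff_has_vector_derivative)
  then show "((\<lambda>x. F x - F 0) has_real_derivative h x) (at x)" by (auto intro!: derivative_eq_intros)
 qed simp
qed

lemma power_bound_integrate: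
 fixes F h :: "real \<Rightarrow> real"
 assumes F: "\<And>x. (F has_real_derivative h x) (at x)" "F 0 = 0"
  and h: "\<And>x. \<bar>x\<bar> <= R ==> \<bar>h x\<bar> <= C * \<bar>x\<bar> ^ n" and x: "\<bar>x\<bar> <= R"
 shows "\<bar>F x\<bar> <= C * \<bar>x\<bar> ^ Suc n / real (Suc n)"
proof -
 have pos: "G y <= C * y ^ Suc n / real (Suc n)"
  if G: "\<And>x. (G has_real_derivative k x) (at x)" "G 0 = 0" "\<And>x. \<bar>x\<bar> <= R ==> \<bar>k x\<bar> <= C * \<bar>x\<bar> ^ n" and y: "0 <= y" "y <= R" for G k y
 proof -
  have "C * 0 ^ Suc n / real (Suc n) - G 0 <= C * y ^ Suc n / real (Suc n) - G y"
  proof (rule DERIV_nonneg_imp_nondecreasing[OF y(1)])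
   fix t assume t: "0 <= t" "t <= y"
   have "((\<lambda>t. C * t ^ Suc n / real (Suc n) - G t) has_real_derivative C * (real (Suc n) * t ^ n) / real (Suc n) - k t) (at t)"
    using G(1)[of t] by (auto intro!: derivative_eq_intros simp del: power_Suc of_nat_Suc)
   moreover have "C * (real (Suc n) * t ^ n) / real (Suc n) = C * t ^ n" by simp
   moreover have "k t <= C * t ^ n" using G(3)[of t] t y by simp
   ultimately show "\<exists>z. ((\<lambda>t. C * t ^ Suc n / real (Suc n) - G t) has_real_derivative z) (at t) \<and> 0 <= z"
    by (intro exI conjI) auto
  qed
  then show ?thesis using G(2) by simp
 qed
 have both: "\<bar>G y\<bar> <= C * y ^ Suc n / real (Suc n)"
  if G: "\<And>x. (G has_real_derivative k x) (at x)" "G 0 = 0" "\<And>x. \<bar>x\<bar> <= R ==> \<bar>k x\<bar> <= C * \<bar>x\<bar> ^ n" and y: "0 <= y" "y <= R" for G k y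
 proof -
  have "- G y <= C * y ^ Suc n / real (Suc n)"
   by (rule pos[of "\<lambda>x. - G x" "\<lambda>x. - k x"]) (use G y in \<open>auto intro!: derivative_eq_intros\<close>)
  with pos[of G k y] G y show ?thesis by (simp add: abs_le_iff)
 qed
 show ?thesis
 proof (cases "x >= 0")
  case True then show ?thesis using both[of F h x] F h x by simp
 next
  case False
  have "((\<lambda>x. F (- x)) has_real_derivative - h (- x)) (at x)" for x
  proof -
   have "(uminus has_real_derivative - 1) (at x)" by (auto intro!: derivative_eq_intros)
   from DERIV_chain2[OF F(1) this] show ?thesis by simp
  qed
  moreover have h': "\<bar>- h (- x)\<bar> <= C * \<bar>x\<bar> ^ n" if "\<bar>x\<bar> <= R" for x using h[of "- x"] that by simp
  ultimately have "\<bar>F (- (- x))\<bar> <= C * (- x) ^ Suc n / real (Suc n)"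
   using F(2) h' x False by (intro both[of "\<lambda>x. F (- x)" "\<lambda>x. - h (- x)"]) auto
  then show ?thesis using False by simp
 qed
qed

text \<open>Picard series: \<open>a n\<close> and \<open>b n\<close> are the corrections of order
  \<open>n\<close> to the solution and its derivative. Factorial bounds on compact intervals make
  the series of derivatives converge uniformly, so the sum may be differentiated twice.\<close>

lemma linear_ode_exists:
 fixes p :: "real \<Rightarrow> real" and c0 c1 :: real
 assumes p: "continuous_on UNIV p"
 obtains y y1 where "\<And>s. (y has_real_derivative y1 s) (at s)" "\<And>s. (y1 has_real_derivative p s * y s) (at s)"
  "y 0 = c0" "y1 0 = c1"
proof -
 have ex: "\<exists>a b. (\<forall>s. (a has_real_derivative b s) (at s)) \<and> (\<forall>s. (b has_real_derivative p s * c s) (at s)) \<and> a 0 = 0 \<and> b 0 = 0"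
  if c: "continuous_on UNIV c" for c
 proof -
  obtain b where b: "\<And>x. (b has_real_derivative p x * c x) (at x)" "b 0 = 0"
   using antiderivative_exists[of "\<lambda>x. p x * c x"] p c by (auto intro: continuous_on_mult)
  have "continuous_on UNIV b" using b(1) by (auto simp: continuous_on_eq_continuous_at intro: DERIV_isCont)
  then obtain a where "\<And>x. (a has_real_derivative b x) (at x)" "a 0 = 0" using antiderivative_exists[of b] by blast
  then show ?thesis using b by blast
 qed
 \<comment> \<open>One Picard step: the double antiderivative of \<open>p * c\<close> with zero
   initial data, together with its derivative.\<close>
 define nxt where "nxt = (\<lambda>c. SOME ab. (\<forall>s. (fst ab has_real_derivative snd ab s) (at s)) \<and> (\<forall>s. (snd ab has_real_derivative p s * c s) (at s)) \<and> fst ab 0 = 0 \<and> snd ab 0 = 0)"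
 have nxt: "(\<forall>s. (fst (nxt c) has_real_derivative snd (nxt c) s) (at s)) \<and> (\<forall>s. (snd (nxt c) has_real_derivative p s * c s) (at s)) \<and> fst (nxt c) 0 = 0 \<and> snd (nxt c) 0 = 0"
  if cc: "continuous_on UNIV c" for c
 proof -
  obtain a b where "(\<forall>s. (a has_real_derivative b s) (at s)) \<and> (\<forall>s. (b has_real_derivative p s * c s) (at s)) \<and> a 0 = 0 \<and> b 0 = 0"
   using ex[OF cc] by blast
  then have "(\<forall>s. (fst (a, b) has_real_derivative snd (a, b) s) (at s)) \<and> (\<forall>s. (snd (a, b) has_real_derivative p s * c s) (at s)) \<and> fst (a, b) 0 = 0 \<and> snd (a, b) 0 = 0" by simp
  then show ?thesis unfolding nxt_def by (rule someI)
 qed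
 define ab where "ab = rec_nat (\<lambda>s. c0 + c1 * s, \<lambda>s. c1) (\<lambda>n r. nxt (fst r))"
 define a b where "a = (\<lambda>n. fst (ab n))" and "b = (\<lambda>n. snd (ab n))"
 have ab0: "a 0 = (\<lambda>s. c0 + c1 * s)" "b 0 = (\<lambda>s. c1)" by (simp_all add: a_def b_def ab_def)
 have abS: "a (Suc n) = fst (nxt (a n))" "b (Suc n) = snd (nxt (a n))" for n by (simp_all add: a_def b_def ab_def)
 have ca: "continuous_on UNIV (a n)" for n
 proof (induction n)
  case 0 show ?case unfolding ab0 by (intro continuous_intros)
 next
  case (Suc n)
  then show ?case unfolding abS using nxt[OF Suc] by (auto simp: continuous_on_eq_continuous_at intro: DERIV_isCont)
 qed
 \<comment> \<open>Second derivative of the term of order \<open>n\<close>. The shift by one index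
   turns the sum of the \<open>dd\<close> into \<open>p\<close> times the sum of the
   \<open>a\<close>.\<close>
 define dd where "dd = (\<lambda>n s. case n of 0 \<Rightarrow> 0 | Suc m \<Rightarrow> p s * a m s)"
 have da: "(a n has_real_derivative b n s) (at s)" and db: "(b n has_real_derivative dd n s) (at s)" for n s
  using nxt[OF ca] by (cases n; auto simp: ab0 abS dd_def intro!: derivative_eq_intros)+
 have zero: "a (Suc n) 0 = 0" "b (Suc n) 0 = 0" for n using nxt[OF ca] by (simp_all add: abS)
 have main: "summable (\<lambda>n. a n x) \<and> summable (\<lambda>n. b n x) \<and> ((\<lambda>x. \<Sum>n. a n x) has_real_derivative (\<Sum>n. b n x)) (at x) \<and>
   ((\<lambda>x. \<Sum>n. b n x) has_real_derivative (\<Sum>n. dd n x)) (at x)" for x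
 proof -
  define R where "R = \<bar>x\<bar> + 1"
  have R: "R >= 1" by (simp add: R_def)
  have "bounded (p ` {-R..R})"
   by (rule compact_imp_bounded[OF compact_continuous_image[OF continuous_on_subset[OF p] compact_Icc]]) simp
  then obtain K where K: "K > 0" "\<And>s. \<bar>s\<bar> <= R ==> \<bar>p s\<bar> <= K" unfolding bounded_pos by (auto simp: abs_le_iff)
  define C where "C = \<bar>c0\<bar> + \<bar>c1\<bar> * R + \<bar>c1\<bar>"
  have C: "C >= 0" using R by (simp add: C_def)
  \<comment> \<open>Two integrations would produce the factorial of \<open>2 n\<close>. One of them
    is replaced by the factor \<open>R\<close>, which leaves a single factorial and a power
    \<open>n\<close> that closes the induction.\<close>
  have bd: "\<bar>s\<bar> <= R ==> \<bar>a n s\<bar> <= C * (R * K) ^ n / fact n * \<bar>s\<bar> ^ n" for n s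
  proof (induction n arbitrary: s)
   case 0
   have "\<bar>c1 * s\<bar> <= \<bar>c1\<bar> * R" unfolding abs_mult using 0 by (intro mult_left_mono) auto
   then show ?case unfolding ab0 C_def power_0 fact_0 div_by_1 mult_1_right using abs_ge_zero[of c1] abs_triangle_ineq[of c0 "c1 * s"] by linarith
  next
   case (Suc n)
   define E where "E = C * (R * K) ^ n / fact n"
   have E: "E >= 0" using C R K by (simp add: E_def)
   have 1: "\<bar>dd (Suc n) t\<bar> <= (K * E) * \<bar>t\<bar> ^ n" if "\<bar>t\<bar> <= R" for t
   proof -
    have "\<bar>p t\<bar> * \<bar>a n t\<bar> <= K * (E * \<bar>t\<bar> ^ n)"
     using K(2)[OF that] Suc.IH[OF that] K(1) unfolding E_def by (intro mult_mono) auto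
    then show ?thesis by (simp add: dd_def abs_mult)
   qed
   have 2: "\<bar>b (Suc n) t\<bar> <= (R * (K * E)) * \<bar>t\<bar> ^ n" if "\<bar>t\<bar> <= R" for t
   proof -
    have "\<bar>b (Suc n) t\<bar> <= (K * E) * \<bar>t\<bar> ^ Suc n / real (Suc n)"
     by (rule power_bound_integrate[OF db zero(2) 1 that])
    also have "\<dots> <= (K * E) * \<bar>t\<bar> ^ Suc n / 1" using K E by (intro divide_left_mono) auto
    also have "\<dots> = (K * E * \<bar>t\<bar> ^ n) * \<bar>t\<bar>" by simp
    also have "\<dots> <= (K * E * \<bar>t\<bar> ^ n) * R" using that K E by (intro mult_left_mono) auto
    finally show ?thesis by (simp add: algebra_simps)
   qed
   have "\<bar>a (Suc n) s\<bar> <= (R * (K * E)) * \<bar>s\<bar> ^ Suc n / real (Suc n)"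
    by (rule power_bound_integrate[OF da zero(1) 2 Suc.prems])
   also have "\<dots> = C * (R * K) ^ Suc n / fact (Suc n) * \<bar>s\<bar> ^ Suc n"
    unfolding E_def by (simp add: field_simps del: of_nat_Suc)
   finally show ?case .
  qed
  define e where "e = (\<lambda>n. C * ((R * K * R) ^ n / fact n))"
  have se: "summable e" unfolding e_def
   using summable_mult[OF summable_exp[of "R * K * R"], of C] by (simp add: divide_inverse mult.commute)
  have be: "\<bar>a n s\<bar> <= e n" if "\<bar>s\<bar> <= R" for n s
  proof -
   have "\<bar>a n s\<bar> <= C * (R * K) ^ n / fact n * \<bar>s\<bar> ^ n" by (rule bd[OF that])
   also have "\<dots> <= C * (R * K) ^ n / fact n * R ^ n" using C R K that by (intro mult_left_mono power_mono) auto
   finally show ?thesis by (simp add: e_def power_mult_distrib)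
  qed
  have dde: "\<bar>dd (Suc n) s\<bar> <= K * e n" if "\<bar>s\<bar> <= R" for n s
   unfolding dd_def using K(2)[OF that] be[OF that, of n] K(1) by (simp add: abs_mult mult_mono)
  have bbe: "\<bar>b (Suc n) s\<bar> <= R * (K * e n)" if s: "\<bar>s\<bar> <= R" for n s
  proof -
   have "\<bar>b (Suc n) s\<bar> <= (K * e n) * \<bar>s\<bar> ^ Suc 0 / real (Suc 0)"
    by (rule power_bound_integrate[OF db zero(2) _ s]) (use dde in simp)
   also have "\<dots> = (K * e n) * \<bar>s\<bar>" by simp
   also have "\<dots> <= (K * e n) * R"
   proof (rule mult_left_mono[OF s])
    have "0 <= e n" using be[OF s, of n] abs_ge_zero[of "a n s"] by linarith
    then show "0 <= K * e n" using K(1) by simp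
   qed
   finally show ?thesis by (simp add: mult.commute)
  qed
  define S where "S = {-R..R}"
  have xS: "x \<in> interior S" by (auto simp: S_def R_def)
  have inS: "\<bar>s\<bar> <= R" if "s \<in> S" for s using that by (auto simp: S_def)
  define eb where "eb = (\<lambda>n. case n of 0 \<Rightarrow> \<bar>c1\<bar> | Suc m \<Rightarrow> R * (K * e m))"
  define ed where "ed = (\<lambda>n. case n of 0 \<Rightarrow> 0 | Suc m \<Rightarrow> K * e m)"
  have seb: "summable eb" and sed: "summable ed"
   by (subst summable_Suc_iff[symmetric], simp add: eb_def ed_def se summable_mult)+
  have ueb: "uniformly_convergent_on S (\<lambda>n s. \<Sum>i<n. b i s)"
  proof (rule Weierstrass_m_test'[OF _ seb])
   fix n s assume "s \<in> S"
   then show "norm (b n s) <= eb n" using bbe[OF inS] by (cases n) (auto simp: eb_def ab0)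
  qed
  have ued: "uniformly_convergent_on S (\<lambda>n s. \<Sum>i<n. dd i s)"
  proof (rule Weierstrass_m_test'[OF _ sed])
   fix n s assume "s \<in> S"
   then show "norm (dd n s) <= ed n" using dde[OF inS] by (cases n) (auto simp: ed_def, simp add: dd_def)
  qed
  have s0: "0 \<in> S" using R by (auto simp: S_def)
  have sa: "summable (\<lambda>n. a n 0)" by (rule summable_comparison_test'[OF se, of 0]) (use be[of 0] R in simp)
  have sb: "summable (\<lambda>n. b n 0)" by (rule summable_comparison_test'[OF seb, of 0])
   (use bbe[of 0] R in \<open>simp add: eb_def ab0 split: nat.split\<close>)
  have cS: "convex S" by (simp add: S_def)
  note D1 = has_field_derivative_series'[OF cS has_field_derivative_at_within[OF da] ueb s0 sa xS]
  note D2 = has_field_derivative_series'[OF cS has_field_derivative_at_within[OF db] ued s0 sb xS]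
  show ?thesis using D1 D2 by blast
 qed
 define y y1 where "y = (\<lambda>x. \<Sum>n. a n x)" and "y1 = (\<lambda>x. \<Sum>n. b n x)"
 show ?thesis
 proof (rule that[of y y1])
  fix s
  show "(y has_real_derivative y1 s) (at s)" using main[of s] by (simp add: y_def y1_def)
  have "(\<Sum>n. dd n s) = p s * y s"
  proof -
   have "(\<lambda>n. p s * a n s) sums (p s * y s)" unfolding y_def by (rule sums_mult[OF summable_sums]) (use main[of s] in blast)
   then have "(\<lambda>n. dd (Suc n) s) sums (p s * y s)" by (simp add: dd_def)
   then have "(\<lambda>n. dd n s) sums (p s * y s + dd 0 s)" by (rule sums_Suc)
   then show ?thesis by (simp add: dd_def sums_unique[symmetric])
  qed
  then show "(y1 has_real_derivative p s * y s) (at s)" using main[of s] by (simp add: y1_def)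
 next
  have z: "(\<lambda>n. a (Suc n) 0) sums 0" "(\<lambda>n. b (Suc n) 0) sums 0" by (simp_all add: zero)
  have "(\<lambda>n. a n 0) sums (0 + a 0 0)" "(\<lambda>n. b n 0) sums (0 + b 0 0)" by (rule sums_Suc[OF z(1)], rule sums_Suc[OF z(2)])
  then show "y 0 = c0" "y1 0 = c1" by (auto simp: y_def y1_def ab0 sums_unique[symmetric])
 qed
qed

text \<open>Gronwall for \<open>y^2 + y1^2 + e^2\<close>; including \<open>e^2\<close> absorbs the
  forcing into the same differential inequality. With \<open>e = 0\<close> it gives uniqueness, with
  \<open>e\<close> proportional to a change of parameter the Lipschitz dependence on the
  energy.\<close>

lemma energy_estimate:
 fixes y y1 :: "real \<Rightarrow> real"
 assumes y: "\<And>s. 0 <= s ==> s < R ==> (y has_real_derivative y1 s) (at s)"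
   "\<And>s. 0 <= s ==> s < R ==> (y1 has_real_derivative p s * y s + r s) (at s)"
  and p: "\<And>s. 0 <= s ==> s < R ==> \<bar>p s\<bar> <= K" and r: "\<And>s. 0 <= s ==> s < R ==> \<bar>r s\<bar> <= e" and s: "0 <= s" "s < R"
 shows "(y s)\<^sup>2 + (y1 s)\<^sup>2 <= ((y 0)\<^sup>2 + (y1 0)\<^sup>2 + e\<^sup>2) * exp ((2 + K) * s)"
proof -
 define c where "c = 2 + K"
 have K: "K >= 0" using p[OF s] by linarith
 define F where "F = (\<lambda>s. ((y s)\<^sup>2 + (y1 s)\<^sup>2 + e\<^sup>2) * exp (- c * s))"
 have "F s <= F 0"
 proof (rule DERIV_nonpos_imp_nonincreasing[OF s(1)])
  fix t assume "0 <= t" "t <= s"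
  then have t: "0 <= t" "t < R" using s by auto
  define Y Z P q where "Y = y t" and "Z = y1 t" and "P = p t" and "q = r t"
  have D: "(F has_real_derivative (2 * Y * Z + 2 * Z * (P * Y + q)) * exp (- c * t) + (Y\<^sup>2 + Z\<^sup>2 + e\<^sup>2) * (- c * exp (- c * t))) (at t)"
   unfolding F_def Y_def Z_def P_def q_def using y(1)[OF t] y(2)[OF t]
   by (auto intro!: derivative_eq_intros simp: algebra_simps)
  have "2 * Y * Z + 2 * Z * (P * Y + q) <= c * (Y\<^sup>2 + Z\<^sup>2 + e\<^sup>2)"
  proof -
   have 1: "2 * Y * Z <= Y\<^sup>2 + Z\<^sup>2" using sum_squares_bound[of Y Z] by simp
   have "2 * Z * Y * P <= \<bar>2 * Z * Y\<bar> * \<bar>P\<bar>" by (metis abs_ge_self abs_mult)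
   also have "\<dots> <= (Y\<^sup>2 + Z\<^sup>2) * K"
   proof (rule mult_mono)
    show "\<bar>2 * Z * Y\<bar> <= Y\<^sup>2 + Z\<^sup>2" using sum_squares_bound[of Z Y] sum_squares_bound[of "- Z" Y] by (simp add: abs_le_iff)
    show "\<bar>P\<bar> <= K" unfolding P_def by (rule p[OF t])
   qed auto
   finally have 2: "2 * Z * Y * P <= (Y\<^sup>2 + Z\<^sup>2) * K" .
   have 3: "2 * Z * q <= Z\<^sup>2 + e\<^sup>2"
   proof -
    have "q\<^sup>2 <= e\<^sup>2" using r[OF t] unfolding q_def by (metis abs_ge_zero power2_abs power_mono)
    then show ?thesis using sum_squares_bound[of Z q] by simp
   qed
   have "0 <= K * e\<^sup>2" "0 <= Y\<^sup>2" "0 <= e\<^sup>2" using K by auto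
   moreover have "2 * Y * Z + 2 * Z * (P * Y + q) = 2 * Y * Z + 2 * Z * Y * P + 2 * Z * q" by (simp add: algebra_simps)
   moreover have "c * (Y\<^sup>2 + Z\<^sup>2 + e\<^sup>2) = 2 * Y\<^sup>2 + 2 * Z\<^sup>2 + 2 * e\<^sup>2 + (Y\<^sup>2 + Z\<^sup>2) * K + K * e\<^sup>2" by (simp add: c_def algebra_simps)
   ultimately show ?thesis using 1 2 3 by linarith
  qed
  then have "(2 * Y * Z + 2 * Z * (P * Y + q)) * exp (- c * t) <= c * (Y\<^sup>2 + Z\<^sup>2 + e\<^sup>2) * exp (- c * t)" by (intro mult_right_mono) auto
  then show "\<exists>z. (F has_real_derivative z) (at t) \<and> z <= 0" using D by (intro exI conjI) (auto simp: algebra_simps)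
 qed
 then have "((y s)\<^sup>2 + (y1 s)\<^sup>2 + e\<^sup>2) * exp (- c * s) <= (y 0)\<^sup>2 + (y1 0)\<^sup>2 + e\<^sup>2" by (simp add: F_def)
 then have "((y s)\<^sup>2 + (y1 s)\<^sup>2 + e\<^sup>2) * exp (- c * s) * exp (c * s) <= ((y 0)\<^sup>2 + (y1 0)\<^sup>2 + e\<^sup>2) * exp (c * s)" by (intro mult_right_mono) auto
 moreover have "exp (- c * s) * exp (c * s) = 1" by (simp flip: exp_add)
 ultimately have "(y s)\<^sup>2 + (y1 s)\<^sup>2 + e\<^sup>2 <= ((y 0)\<^sup>2 + (y1 0)\<^sup>2 + e\<^sup>2) * exp (c * s)" by (simp only: mult.assoc mult_1_right)
 then show ?thesis using zero_le_power2[of e] unfolding c_def by linarith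
qed

lemma ode_unique:
 fixes y y1 :: "real \<Rightarrow> real"
 assumes y: "\<And>s. 0 <= s ==> s < R ==> (y has_real_derivative y1 s) (at s)"
   "\<And>s. 0 <= s ==> s < R ==> (y1 has_real_derivative p s * y s) (at s)"
  and p: "\<And>s. 0 <= s ==> s < R ==> \<bar>p s\<bar> <= K" and z: "y 0 = 0" "y1 0 = 0" and s: "0 <= s" "s < R"
 shows "y s = 0"
proof -
 have "(y s)\<^sup>2 + (y1 s)\<^sup>2 <= ((y 0)\<^sup>2 + (y1 0)\<^sup>2 + 0\<^sup>2) * exp ((2 + K) * s)"
  by (rule energy_estimate[where r = "\<lambda>s. 0", OF y(1) _ p _ s]) (use y(2) in auto)
 then have "(y s)\<^sup>2 + (y1 s)\<^sup>2 <= 0" using z by simp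
 then show ?thesis by (metis add_nonneg_eq_0_iff order_antisym sum_power2_ge_zero zero_le_power2 power2_eq_iff_nonneg zero_eq_power2)
qed

lemma ode_unique_sym:
 fixes y y1 :: "real \<Rightarrow> real"
 assumes y: "\<And>s. \<bar>s\<bar> < R ==> (y has_real_derivative y1 s) (at s)"
   "\<And>s. \<bar>s\<bar> < R ==> (y1 has_real_derivative p s * y s) (at s)"
  and p: "\<And>s. \<bar>s\<bar> < R ==> \<bar>p s\<bar> <= K" and z: "y 0 = 0" "y1 0 = 0" and s: "\<bar>s\<bar> < R"
 shows "y s = 0"
proof (cases "s >= 0")
 case True
 show ?thesis by (rule ode_unique[of R y y1 p K]) (use y p z s True in auto)
next
 case False
 have m: "(uminus has_real_derivative - 1) (at t)" for t :: real by (auto intro!: derivative_eq_intros)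
 have "y (- (- s)) = 0"
 proof (rule ode_unique[of R "\<lambda>t. y (- t)" "\<lambda>t. - y1 (- t)" "\<lambda>t. p (- t)" K])
  fix t :: real assume t: "0 <= t" "t < R"
  have t': "\<bar>- t\<bar> < R" using t by simp
  show "((\<lambda>t. y (- t)) has_real_derivative - y1 (- t)) (at t)" using DERIV_chain2[OF y(1)[OF t'] m] by simp
  show "((\<lambda>t. - y1 (- t)) has_real_derivative p (- t) * y (- t)) (at t)" using DERIV_minus[OF DERIV_chain2[OF y(2)[OF t'] m]] by simp
  show "\<bar>p (- t)\<bar> <= K" by (rule p[OF t'])
 qed (use z s False in auto)
 then show ?thesis by simp
qed

section \<open>Zeros of solutions as the energy varies\<close>

lemma nonneg_of_positive_below:
 fixes F :: "real \<Rightarrow> real"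
 assumes C: "C >= 0" "\<And>n. \<bar>n - m\<bar> <= 1 ==> \<bar>F n - F m\<bar> <= C * \<bar>n - m\<bar>" and pos: "\<And>n. n < m ==> F n > 0"
 shows "F m >= 0"
proof (rule field_le_epsilon)
 fix e :: real assume e: "e > 0"
 define t where "t = min 1 (e / (C + 1))"
 have t: "t > 0" "t <= 1" using e C by (auto simp: t_def)
 have "C * t <= (C + 1) * (e / (C + 1))" using C e t by (intro mult_mono) (auto simp: t_def)
 also have "\<dots> = e" using C by simp
 finally have "C * t <= e" .
 moreover have "\<bar>F (m - t) - F m\<bar> <= C * t" using C(2)[of "m - t"] t by simp
 ultimately show "0 <= F m + e" using pos[of "m - t"] t by linarith
qed

text \<open>\<open>m\<close> is the infimum of the parameters with a nonpositive value in
  \<open>(0, D]\<close>. Zeros cannot enter at \<open>0\<close> by \<open>near0\<close>, and at the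
  critical parameter a zero inside the interval would be a minimum with vanishing derivative,
  against \<open>nz\<close>. So the first zero enters at \<open>D\<close>.\<close>

lemma first_zero_parameter:
 fixes Y Y1 :: "real \<Rightarrow> real \<Rightarrow> real"
 assumes D: "D > 0"
  and d: "\<And>m s. (Y m has_real_derivative Y1 m s) (at s)"
  and nz: "\<And>m s. Y m s = 0 ==> Y1 m s \<noteq> 0"
  and lip: "\<And>n. \<exists>C\<ge>0. \<forall>m s. \<bar>m - n\<bar> <= 1 --> 0 <= s --> s <= D --> \<bar>Y m s - Y n s\<bar> <= C * \<bar>m - n\<bar>"
  and near0: "\<And>n. \<exists>r>0. \<exists>e>0. \<forall>m s. \<bar>m - n\<bar> < e --> 0 < s --> s <= r --> Y m s > 0"
  and low: "\<And>m s. m <= b ==> 0 < s ==> s <= D ==> Y m s > 0"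
  and bad: "0 < s1" "s1 <= D" "Y m1 s1 <= 0"
 obtains m where "m <= m1" "Y m D = 0" "\<And>s. 0 < s ==> s < D ==> Y m s > 0"
proof -
 define Z where "Z = {m. \<exists>s. 0 < s \<and> s <= D \<and> Y m s <= 0}"
 have m1: "m1 \<in> Z" using bad by (auto simp: Z_def)
 have bdd: "bdd_below Z"
 proof (rule bdd_belowI[of _ b])
  fix m assume "m \<in> Z"
  then obtain s where "0 < s" "s <= D" "Y m s <= 0" by (auto simp: Z_def)
  then show "b <= m" using low[of m s] by linarith
 qed
 define m where "m = Inf Z"
 have mm1: "m <= m1" unfolding m_def by (rule cInf_lower[OF m1 bdd])
 have below: "Y n s > 0" if "n < m" "0 < s" "s <= D" for n s
 proof (rule ccontr)
  assume "\<not> Y n s > 0"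
  then have "n \<in> Z" using that by (auto simp: Z_def intro!: exI[of _ s])
  then have "m <= n" unfolding m_def by (rule cInf_lower[OF _ bdd])
  then show False using that by simp
 qed
 obtain C where C: "C >= 0" "\<And>n s. \<bar>n - m\<bar> <= 1 ==> 0 <= s ==> s <= D ==> \<bar>Y n s - Y m s\<bar> <= C * \<bar>n - m\<bar>"
  using lip[of m] by blast
 have cY: "continuous_on S (Y m)" for S by (rule continuous_at_imp_continuous_on) (use d in \<open>auto intro: DERIV_isCont\<close>)
 have mZ: "m \<in> Z"
 proof (rule ccontr)
  assume "m \<notin> Z"
  then have pos: "Y m s > 0" if "0 < s" "s <= D" for s using that by (force simp: Z_def)
  obtain r e where r: "r > 0" and e: "e > 0" and re: "\<And>n s. \<bar>n - m\<bar> < e ==> 0 < s ==> s <= r ==> Y n s > 0"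
   using near0[of m] by blast
  define r' where "r' = min r D"
  have r': "r' > 0" "r' <= D" "r' <= r" using r D by (auto simp: r'_def)
  obtain t where t: "t \<in> {r'..D}" "\<forall>s\<in>{r'..D}. Y m t <= Y m s"
   using continuous_attains_inf[OF compact_Icc _ cY, of r' D] r' by auto
  define c where "c = Y m t"
  have c: "c > 0" unfolding c_def by (rule pos) (use t r' in auto)
  define k where "k = min e (min 1 (c / (C + 1)))"
  have k: "k > 0" "k <= e" "k <= 1" using e c C by (auto simp: k_def)
  have kC: "C * k < c"
  proof -
   have "C * k <= C * (c / (C + 1))" using C by (intro mult_left_mono) (auto simp: k_def)
   also have "\<dots> < (C + 1) * (c / (C + 1))" using c C by (intro mult_strict_right_mono) auto
   also have "\<dots> = c" using C by simp
   finally show ?thesis .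
  qed
  have ok: "n \<notin> Z" if n: "\<bar>n - m\<bar> < k" for n
  proof
   assume "n \<in> Z"
   then obtain s where s: "0 < s" "s <= D" "Y n s <= 0" by (auto simp: Z_def)
   show False
   proof (cases "s <= r'")
    case True then show False using re[of n s] s n k r' by auto
   next
    case False
    then have "c <= Y m s" using t s by (auto simp: c_def)
    moreover have "\<bar>Y n s - Y m s\<bar> <= C * \<bar>n - m\<bar>" using n k s by (intro C(2)) auto
    moreover have "C * \<bar>n - m\<bar> <= C * k" using n C(1) by (intro mult_left_mono) auto
    ultimately show False using s kC by linarith
   qed
  qed
  have "Inf Z < m + k" using k by (simp add: m_def)
  then obtain n where n: "n \<in> Z" "n < m + k" using cInf_less_iff[OF _ bdd, of "m + k"] m1 by blast
  have "m <= n" unfolding m_def by (rule cInf_lower[OF n(1) bdd])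
  then show False using ok[of n] n by auto
 qed
 have ge0: "Y m s >= 0" if s: "0 < s" "s <= D" for s
  by (rule nonneg_of_positive_below[OF C(1), where F = "\<lambda>n. Y n s"]) (use C(2) below s in auto)
 have int: "Y m s > 0" if s: "0 < s" "s < D" for s
 proof (rule ccontr)
  assume "\<not> Y m s > 0"
  then have z: "Y m s = 0" using ge0[of s] s by simp
  have "Y1 m s = 0"
  proof (rule DERIV_local_min[OF d])
   show "0 < min s (D - s)" using s by simp
   show "\<forall>y. \<bar>s - y\<bar> < min s (D - s) --> Y m s <= Y m y" using ge0 z by auto
  qed
  then show False using nz[OF z] by simp
 qed
 obtain s where s: "0 < s" "s <= D" "Y m s <= 0" using mZ by (auto simp: Z_def)
 then have "s = D" using int[of s] by fastforce
 then have "Y m D = 0" using s ge0[of D] by simp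
 then show ?thesis using that[OF mm1 _ int] by blast
qed

text \<open>\<open>q\<close> is continuous on the whole line, so \<open>D\<close> and
  \<open>- D\<close> are interior points for the initial value problems and one-sided derivatives do
  not occur.\<close>

locale even_potential =
 fixes q :: "real \<Rightarrow> real" and D :: real
 assumes q_cont: "continuous_on UNIV q" and q_even: "\<And>s. q (- s) = q s" and D_pos: "D > 0"
begin

definition ivp :: "real \<Rightarrow> real \<Rightarrow> real \<Rightarrow> (real \<Rightarrow> real) \<times> (real \<Rightarrow> real)" where
 "ivp c0 c1 m = (SOME yz. (\<forall>s. (fst yz has_real_derivative snd yz s) (at s)) \<and>
   (\<forall>s. (snd yz has_real_derivative (q s - m) * fst yz s) (at s)) \<and> fst yz 0 = c0 \<and> snd yz 0 = c1)"

text \<open>\<open>sol 1 0 m\<close> is the even and \<open>sol 0 1 m\<close> the odd solution at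
  energy \<open>m\<close>. Their values at \<open>D\<close>, as functions of \<open>m\<close>,
  encode the Dirichlet spectrum.\<close>

definition sol :: "real \<Rightarrow> real \<Rightarrow> real \<Rightarrow> real \<Rightarrow> real" where "sol c0 c1 m = fst (ivp c0 c1 m)"
definition sol1 :: "real \<Rightarrow> real \<Rightarrow> real \<Rightarrow> real \<Rightarrow> real" where "sol1 c0 c1 m = snd (ivp c0 c1 m)"

lemma sol: "(sol c0 c1 m has_real_derivative sol1 c0 c1 m s) (at s)"
  "(sol1 c0 c1 m has_real_derivative (q s - m) * sol c0 c1 m s) (at s)"
  "sol c0 c1 m 0 = c0" "sol1 c0 c1 m 0 = c1"
proof -
 have "continuous_on UNIV (\<lambda>s. q s - m)" by (intro continuous_intros q_cont)
 then obtain y y1 where y: "\<And>s. (y has_real_derivative y1 s) (at s)" "\<And>s. (y1 has_real_derivative (q s - m) * y s) (at s)"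
  "y 0 = c0" "y1 0 = c1" by (rule linear_ode_exists) (rule that; assumption)
 let ?P = "\<lambda>yz. (\<forall>s. (fst yz has_real_derivative snd yz s) (at s)) \<and>
   (\<forall>s. (snd yz has_real_derivative (q s - m) * fst yz s) (at s)) \<and> fst yz 0 = c0 \<and> snd yz 0 = c1"
 have "?P (y, y1)" using y by simp
 then have "?P (ivp c0 c1 m)" unfolding ivp_def by (rule someI[of ?P])
 then show "(sol c0 c1 m has_real_derivative sol1 c0 c1 m s) (at s)"
  "(sol1 c0 c1 m has_real_derivative (q s - m) * sol c0 c1 m s) (at s)"
  "sol c0 c1 m 0 = c0" "sol1 c0 c1 m 0 = c1" by (simp_all add: sol_def sol1_def)
qed

lemma cont_bound:
 fixes h :: "real \<Rightarrow> real"
 assumes "continuous_on UNIV h" obtains K where "K >= 0" "\<And>s. \<bar>s\<bar> <= R ==> \<bar>h s\<bar> <= K"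
proof -
 obtain K where "K >= 0" "\<And>s. s \<in> {-R..R} ==> norm (h s) <= K"
  by (rule compact_bound[OF compact_Icc continuous_on_subset[OF assms subset_UNIV]]) (rule that)
 then show ?thesis using that[of K] by (simp add: abs_le_iff)
qed

lemma sol_cont: "continuous_on S (sol c0 c1 m)" "continuous_on S (sol1 c0 c1 m)"
 by (auto intro!: continuous_at_imp_continuous_on DERIV_isCont[OF sol(1)] DERIV_isCont[OF sol(2)])

lemma sol_unique:
 assumes y: "\<And>s. \<bar>s\<bar> < R ==> (y has_real_derivative y1 s) (at s)"
   "\<And>s. \<bar>s\<bar> < R ==> (y1 has_real_derivative (q s - m) * y s) (at s)"
  and s: "\<bar>s\<bar> < R"
 shows "y s = sol (y 0) (y1 0) m s"
proof -
 have c: "continuous_on UNIV (\<lambda>s. q s - m)" by (intro continuous_intros q_cont)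
 obtain K where K: "K >= 0" "\<And>s. \<bar>s\<bar> <= R ==> \<bar>q s - m\<bar> <= K"
  by (rule cont_bound[OF c, of R]) (rule that; assumption)
 have "y s - sol (y 0) (y1 0) m s = 0"
 proof (rule ode_unique_sym[of R "\<lambda>s. y s - sol (y 0) (y1 0) m s" "\<lambda>s. y1 s - sol1 (y 0) (y1 0) m s" "\<lambda>s. q s - m" K])
  fix t assume t: "\<bar>t\<bar> < R"
  show "((\<lambda>s. y s - sol (y 0) (y1 0) m s) has_real_derivative y1 t - sol1 (y 0) (y1 0) m t) (at t)"
   by (rule DERIV_diff[OF y(1)[OF t] sol(1)])
  show "((\<lambda>s. y1 s - sol1 (y 0) (y1 0) m s) has_real_derivative (q t - m) * (y t - sol (y 0) (y1 0) m t)) (at t)"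
   using DERIV_diff[OF y(2)[OF t] sol(2)] by (simp add: right_diff_distrib)
  show "\<bar>q t - m\<bar> <= K" using K(2)[of t] t by simp
 qed (use s sol in auto)
 then show ?thesis by simp
qed

lemma sol_combine: "sol a b m s = a * sol 1 0 m s + b * sol 0 1 m s"
proof -
 have "a * sol 1 0 m s + b * sol 0 1 m s = sol (a * sol 1 0 m 0 + b * sol 0 1 m 0) (a * sol1 1 0 m 0 + b * sol1 0 1 m 0) m s"
 proof (rule sol_unique[of "\<bar>s\<bar> + 1" "\<lambda>s. a * sol 1 0 m s + b * sol 0 1 m s" "\<lambda>s. a * sol1 1 0 m s + b * sol1 0 1 m s"])
  fix t
  show "((\<lambda>s. a * sol 1 0 m s + b * sol 0 1 m s) has_real_derivative a * sol1 1 0 m t + b * sol1 0 1 m t) (at t)"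
   by (intro DERIV_add DERIV_cmult sol)
  have "((\<lambda>s. a * sol1 1 0 m s + b * sol1 0 1 m s) has_real_derivative a * ((q t - m) * sol 1 0 m t) + b * ((q t - m) * sol 0 1 m t)) (at t)"
   by (intro DERIV_add DERIV_cmult sol)
  then show "((\<lambda>s. a * sol1 1 0 m s + b * sol1 0 1 m s) has_real_derivative (q t - m) * (a * sol 1 0 m t + b * sol 0 1 m t)) (at t)"
   by (simp add: algebra_simps)
 qed simp
 then show ?thesis by (simp add: sol)
qed

lemma sol_parity: "sol 1 0 m (- s) = sol 1 0 m s" "sol 0 1 m (- s) = - sol 0 1 m s"
proof -
 have mi: "(uminus has_real_derivative - 1) (at t)" for t :: real by (auto intro!: derivative_eq_intros)
 have d: "((\<lambda>s. sol a b m (- s)) has_real_derivative - sol1 a b m (- t)) (at t)"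
  "((\<lambda>s. sol1 a b m (- s)) has_real_derivative - ((q t - m) * sol a b m (- t))) (at t)" for a b t
  using DERIV_chain2[OF sol(1)[of a b m "- t"] mi] DERIV_chain2[OF sol(2)[of a b m "- t"] mi] by (simp_all add: q_even)
 have "sol 1 0 m (- s) = sol (sol 1 0 m (- 0)) (- sol1 1 0 m (- 0)) m s"
  by (rule sol_unique[of "\<bar>s\<bar> + 1" "\<lambda>s. sol 1 0 m (- s)" "\<lambda>s. - sol1 1 0 m (- s)"]) (use d DERIV_minus[OF d(2)] in auto)
 then show "sol 1 0 m (- s) = sol 1 0 m s" by (simp add: sol)
 have "- sol 0 1 m (- s) = sol (- sol 0 1 m (- 0)) (sol1 0 1 m (- 0)) m s"
 proof (rule sol_unique[of "\<bar>s\<bar> + 1" "\<lambda>s. - sol 0 1 m (- s)" "\<lambda>s. sol1 0 1 m (- s)"])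
  fix t
  show "((\<lambda>s. - sol 0 1 m (- s)) has_real_derivative sol1 0 1 m (- t)) (at t)" using DERIV_minus[OF d(1)] by simp
  show "((\<lambda>s. sol1 0 1 m (- s)) has_real_derivative (q t - m) * - sol 0 1 m (- t)) (at t)" using d(2)[of 0 1 t] by simp
 qed simp
 then show "sol 0 1 m (- s) = - sol 0 1 m s" by (simp add: sol)
qed

lemma wronskian: "sol 1 0 m s * sol1 0 1 m s - sol1 1 0 m s * sol 0 1 m s = 1"
proof -
 define W where "W = (\<lambda>s. sol 1 0 m s * sol1 0 1 m s - sol1 1 0 m s * sol 0 1 m s)"
 have d: "(W has_real_derivative 0) (at t)" for t
  unfolding W_def by (rule DERIV_cong[OF DERIV_diff[OF DERIV_mult[OF sol(1) sol(2)] DERIV_mult[OF sol(2) sol(1)]]]) simp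
 have "W s = W 0" by (rule DERIV_isconst_all[of W]) (simp add: d)
 then show ?thesis by (simp add: W_def sol)
qed

text \<open>The difference of two solutions solves the equation with forcing
  \<open>(n - m) * sol c0 c1 n\<close>, so the energy estimate applies.\<close>

lemma sol_lipschitz:
 "\<exists>C\<ge>0. \<forall>m s. \<bar>m - n\<bar> <= 1 --> 0 <= s --> s <= D -->
   \<bar>sol c0 c1 m s - sol c0 c1 n s\<bar> <= C * \<bar>m - n\<bar> \<and> \<bar>sol1 c0 c1 m s - sol1 c0 c1 n s\<bar> <= C * \<bar>m - n\<bar>"
proof -
 obtain K where K: "K >= 0" "\<And>s. \<bar>s\<bar> <= D + 1 ==> \<bar>q s\<bar> <= K" by (rule cont_bound[OF q_cont, of "D + 1"]) (rule that; assumption)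
 obtain B where B: "B >= 0" "\<And>s. \<bar>s\<bar> <= D + 1 ==> \<bar>sol c0 c1 n s\<bar> <= B" by (rule cont_bound[OF sol_cont(1), of "D + 1" c0 c1 n]) (rule that; assumption)
 define K' where "K' = K + \<bar>n\<bar> + 1"
 have K': "K' >= 0" using K by (simp add: K'_def)
 define E where "E = exp ((2 + K') * D)"
 have E: "E >= 1" using K' D_pos by (simp add: E_def)
 show ?thesis
 proof (intro exI[of _ "B * E"] conjI allI impI)
  show "B * E >= 0" using B E by simp
  fix m s assume m: "\<bar>m - n\<bar> <= 1" and s: "0 <= s" "s <= D"
  define e where "e = \<bar>m - n\<bar> * B"
  have e: "e >= 0" using B by (simp add: e_def)
  have "(sol c0 c1 m s - sol c0 c1 n s)\<^sup>2 + (sol1 c0 c1 m s - sol1 c0 c1 n s)\<^sup>2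
    <= ((sol c0 c1 m 0 - sol c0 c1 n 0)\<^sup>2 + (sol1 c0 c1 m 0 - sol1 c0 c1 n 0)\<^sup>2 + e\<^sup>2) * exp ((2 + K') * s)"
  proof (rule energy_estimate[where R = "D + 1" and p = "\<lambda>s. q s - m" and r = "\<lambda>s. (n - m) * sol c0 c1 n s"])
   fix t :: real assume t: "0 <= t" "t < D + 1"
   show "((\<lambda>a. sol c0 c1 m a - sol c0 c1 n a) has_real_derivative sol1 c0 c1 m t - sol1 c0 c1 n t) (at t)" by (intro DERIV_diff sol)
   show "((\<lambda>a. sol1 c0 c1 m a - sol1 c0 c1 n a) has_real_derivative (q t - m) * (sol c0 c1 m t - sol c0 c1 n t) + (n - m) * sol c0 c1 n t) (at t)"
    using DERIV_diff[OF sol(2)[of c0 c1 m t] sol(2)[of c0 c1 n t]] by (simp add: algebra_simps)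
   show "\<bar>q t - m\<bar> <= K'" using K(2)[of t] t m unfolding K'_def by simp
   show "\<bar>(n - m) * sol c0 c1 n t\<bar> <= e"
    unfolding e_def abs_mult abs_minus_commute[of n m] using B(2)[of t] t by (intro mult_left_mono) auto
  qed (use s in auto)
  then have 1: "(sol c0 c1 m s - sol c0 c1 n s)\<^sup>2 + (sol1 c0 c1 m s - sol1 c0 c1 n s)\<^sup>2 <= e\<^sup>2 * exp ((2 + K') * s)" by (simp add: sol)
  have "e\<^sup>2 * exp ((2 + K') * s) <= e\<^sup>2 * E" unfolding E_def using s K' by (intro mult_left_mono) auto
  also have "\<dots> <= e\<^sup>2 * E\<^sup>2" using E by (intro mult_left_mono) (auto simp: power2_eq_square)
  also have "\<dots> = (B * E * \<bar>m - n\<bar>)\<^sup>2" by (simp add: e_def power_mult_distrib)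
  finally have 2: "e\<^sup>2 * exp ((2 + K') * s) <= (B * E * \<bar>m - n\<bar>)\<^sup>2" .
  have nn: "B * E * \<bar>m - n\<bar> >= 0" using B E by simp
  have "\<bar>x\<bar> <= B * E * \<bar>m - n\<bar>" if "x\<^sup>2 <= (B * E * \<bar>m - n\<bar>)\<^sup>2" for x
   using that nn by (metis abs_le_square_iff abs_of_nonneg)
  moreover have "(sol c0 c1 m s - sol c0 c1 n s)\<^sup>2 <= (B * E * \<bar>m - n\<bar>)\<^sup>2" "(sol1 c0 c1 m s - sol1 c0 c1 n s)\<^sup>2 <= (B * E * \<bar>m - n\<bar>)\<^sup>2"
   using 1 2 zero_le_power2[of "sol c0 c1 m s - sol c0 c1 n s"] zero_le_power2[of "sol1 c0 c1 m s - sol1 c0 c1 n s"] by linarith+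
  ultimately show "\<bar>sol c0 c1 m s - sol c0 c1 n s\<bar> <= B * E * \<bar>m - n\<bar>" "\<bar>sol1 c0 c1 m s - sol1 c0 c1 n s\<bar> <= B * E * \<bar>m - n\<bar>" by blast+
 qed
qed

lemma positive_near:
 fixes F :: "real \<Rightarrow> real \<Rightarrow> real"
 assumes lip: "\<exists>C\<ge>0. \<forall>m s. \<bar>m - n\<bar> <= 1 --> 0 <= s --> s <= D --> \<bar>F m s - F n s\<bar> <= C * \<bar>m - n\<bar>"
  and one: "F n 0 = 1" and cont: "isCont (F n) 0"
 shows "\<exists>r>0. \<exists>e>0. \<forall>m s. \<bar>m - n\<bar> < e --> 0 <= s --> s <= r --> F m s > 0"
proof -
 obtain C where C: "C >= 0" "\<And>m s. \<bar>m - n\<bar> <= 1 ==> 0 <= s ==> s <= D ==> \<bar>F m s - F n s\<bar> <= C * \<bar>m - n\<bar>" using lip by blast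
 obtain d where d: "d > 0" "\<And>s. dist s 0 < d ==> dist (F n s) (F n 0) < 1 / 2"
  using cont unfolding continuous_at_eps_delta by (metis half_gt_zero zero_less_one)
 define r e where "r = min (d / 2) D" and "e = min 1 (1 / (2 * (C + 1)))"
 have r: "r > 0" "r < d" "r <= D" using d D_pos by (auto simp: r_def)
 have e: "e > 0" "e <= 1" using C by (auto simp: e_def)
 have eC: "C * e <= 1 / 2"
 proof -
  have "C * e <= (C + 1) * (1 / (2 * (C + 1)))" using C e by (intro mult_mono) (auto simp: e_def)
  also have "\<dots> = 1 / 2" using C by simp
  finally show ?thesis .
 qed
 have "F m s > 0" if m: "\<bar>m - n\<bar> < e" and s: "0 <= s" "s <= r" for m s
 proof -
  have "\<bar>F m s - F n s\<bar> <= C * \<bar>m - n\<bar>" using m e s r by (intro C(2)) auto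
  moreover have "C * \<bar>m - n\<bar> <= C * e" using m C(1) by (intro mult_left_mono) auto
  moreover have "\<bar>F n s - 1\<bar> < 1 / 2" using d(2)[of s] s r one by (simp add: dist_real_def)
  ultimately show ?thesis using eC by linarith
 qed
 then show ?thesis using r(1) e(1) by blast
qed

lemma sol_lip: "\<exists>C\<ge>0. \<forall>m s. \<bar>m - n\<bar> <= 1 --> 0 <= s --> s <= D --> \<bar>sol c0 c1 m s - sol c0 c1 n s\<bar> <= C * \<bar>m - n\<bar>"
 and sol1_lip: "\<exists>C\<ge>0. \<forall>m s. \<bar>m - n\<bar> <= 1 --> 0 <= s --> s <= D --> \<bar>sol1 c0 c1 m s - sol1 c0 c1 n s\<bar> <= C * \<bar>m - n\<bar>"
 using sol_lipschitz[of n c0 c1] by blast+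

lemma sol_near0:
 "\<exists>r>0. \<exists>e>0. \<forall>m s. \<bar>m - n\<bar> < e --> 0 < s --> s <= r --> sol 1 0 m s > 0"
 "\<exists>r>0. \<exists>e>0. \<forall>m s. \<bar>m - n\<bar> < e --> 0 < s --> s <= r --> sol 0 1 m s > 0"
proof -
 obtain r e where re: "r > 0" "e > 0" "\<And>m s. \<bar>m - n\<bar> < e ==> 0 <= s ==> s <= r ==> sol 1 0 m s > 0"
  using positive_near[OF sol_lip sol(3) DERIV_isCont[OF sol(1)]] by blast
 have "sol 1 0 m s > 0" if "\<bar>m - n\<bar> < e" "0 < s" "s <= r" for m s using re(3)[of m s] that by simp
 then show "\<exists>r>0. \<exists>e>0. \<forall>m s. \<bar>m - n\<bar> < e --> 0 < s --> s <= r --> sol 1 0 m s > 0" using re(1,2) by blast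
 obtain r e where re: "r > 0" "e > 0" "\<And>m s. \<bar>m - n\<bar> < e ==> 0 <= s ==> s <= r ==> sol1 0 1 m s > 0"
  using positive_near[OF sol1_lip sol(4) DERIV_isCont[OF sol(2)]] by blast
 have "sol 0 1 m s > 0" if "\<bar>m - n\<bar> < e" "0 < s" "s <= r" for m s
 proof -
  have "sol 0 1 m 0 < sol 0 1 m s"
  proof (rule DERIV_pos_imp_increasing[OF that(2)])
   fix t :: real assume "0 <= t" "t <= s"
   then show "\<exists>y. (sol 0 1 m has_real_derivative y) (at t) \<and> 0 < y" using sol(1)[of 0 1 m t] re(3)[of m t] that by auto
  qed
  then show ?thesis by (simp add: sol)
 qed
 then show "\<exists>r>0. \<exists>e>0. \<forall>m s. \<bar>m - n\<bar> < e --> 0 < s --> s <= r --> sol 0 1 m s > 0" using re(1,2) by blast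
qed

text \<open>At energies not above the potential the product of the solution and its derivative is
  nondecreasing and starts at zero, so the square of the solution is nondecreasing and cannot return
  to zero.\<close>

lemma sol_positive_low:
 assumes c: "c0 * c1 = 0" and near: "\<exists>r>0. \<forall>s. 0 < s --> s <= r --> sol c0 c1 m s > 0"
  and m: "\<And>t. 0 <= t ==> t <= D ==> q t >= m" and s: "0 < s" "s <= D"
 shows "sol c0 c1 m s > 0"
proof (rule ccontr)
 assume neg: "\<not> ?thesis"
 have P: "0 <= sol c0 c1 m t * sol1 c0 c1 m t" if t: "0 <= t" "t <= D" for t
 proof -
  have "sol c0 c1 m 0 * sol1 c0 c1 m 0 <= sol c0 c1 m t * sol1 c0 c1 m t"
  proof (rule DERIV_nonneg_imp_nondecreasing[OF t(1)])
   fix x assume x: "0 <= x" "x <= t"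
   have "((\<lambda>t. sol c0 c1 m t * sol1 c0 c1 m t) has_real_derivative sol1 c0 c1 m x * sol1 c0 c1 m x + (q x - m) * sol c0 c1 m x * sol c0 c1 m x) (at x)"
    by (rule DERIV_mult[OF sol(1) sol(2)])
   moreover have "0 <= sol1 c0 c1 m x * sol1 c0 c1 m x + (q x - m) * sol c0 c1 m x * sol c0 c1 m x"
    using m[of x] x t unfolding mult.assoc by (intro add_nonneg_nonneg mult_nonneg_nonneg[of "q x - m"]) auto
   ultimately show "\<exists>y. ((\<lambda>t. sol c0 c1 m t * sol1 c0 c1 m t) has_real_derivative y) (at x) \<and> 0 <= y" by blast
  qed
  then show ?thesis using c by (simp add: sol)
 qed
 obtain r where r: "r > 0" "\<And>s. 0 < s ==> s <= r ==> sol c0 c1 m s > 0" using near by blast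
 define a where "a = min r s"
 have a: "0 < a" "a <= s" "sol c0 c1 m a > 0" using r s by (auto simp: a_def)
 obtain t where t: "a <= t" "t <= s" "sol c0 c1 m t = 0"
  using IVT2'[of "sol c0 c1 m" s 0 a, OF _ _ a(2) sol_cont(1)] a neg by auto
 have "sol c0 c1 m a * sol c0 c1 m a <= sol c0 c1 m t * sol c0 c1 m t"
 proof (rule DERIV_nonneg_imp_nondecreasing[OF t(1)])
  fix x assume x: "a <= x" "x <= t"
  have "((\<lambda>t. sol c0 c1 m t * sol c0 c1 m t) has_real_derivative sol1 c0 c1 m x * sol c0 c1 m x + sol1 c0 c1 m x * sol c0 c1 m x) (at x)"
   by (rule DERIV_mult[OF sol(1) sol(1)])
  moreover have "0 <= sol1 c0 c1 m x * sol c0 c1 m x + sol1 c0 c1 m x * sol c0 c1 m x"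
   using P[of x] x a t s by (simp add: mult.commute)
  ultimately show "\<exists>y. ((\<lambda>t. sol c0 c1 m t * sol c0 c1 m t) has_real_derivative y) (at x) \<and> 0 <= y" by blast
 qed
 then show False using a(3) t(3) mult_pos_pos[OF a(3) a(3)] by simp
qed

lemma first_zero_sol:
 assumes "(c0, c1) = (1, 0) \<or> (c0, c1) = (0, 1)" and bad: "0 < s1" "s1 <= D" "sol c0 c1 m1 s1 <= 0"
 obtains m where "m <= m1" "sol c0 c1 m D = 0" "\<And>s. 0 < s ==> s < D ==> sol c0 c1 m s > 0"
proof -
 obtain K where K: "K >= 0" "\<And>s. \<bar>s\<bar> <= D ==> \<bar>q s\<bar> <= K" by (rule cont_bound[OF q_cont, of D]) (rule that; assumption)
 have near: "\<exists>r>0. \<exists>e>0. \<forall>m s. \<bar>m - n\<bar> < e --> 0 < s --> s <= r --> sol c0 c1 m s > 0" for n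
  using assms(1) sol_near0[of n] by auto
 show ?thesis
 proof (rule first_zero_parameter[of D "sol c0 c1" "sol1 c0 c1" "- K" s1 m1])
  show "sol1 c0 c1 m s \<noteq> 0" if "sol c0 c1 m s = 0" for m s
   using wronskian[of m s] assms(1) that by auto
  show "sol c0 c1 m s > 0" if m: "m <= - K" "0 < s" "s <= D" for m s
  proof (rule sol_positive_low[OF _ _ _ m(2,3)])
   show "c0 * c1 = 0" using assms(1) by auto
   obtain r e where re: "r > 0" "e > 0" "\<forall>m' s. \<bar>m' - m\<bar> < e --> 0 < s --> s <= r --> sol c0 c1 m' s > 0" using near[of m] by blast
   show "\<exists>r>0. \<forall>s. 0 < s --> s <= r --> sol c0 c1 m s > 0" using re(1,2) re(3)[rule_format, of m] by (intro exI[of _ r]) auto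
   fix t :: real assume "0 <= t" "t <= D"
   then show "m <= q t" using K(2)[of t] m(1) by (simp add: abs_le_iff)
  qed
 qed (use D_pos sol(1) sol_lip near bad that in auto)
qed

lemma eigenvalue_of_sol:
 assumes z: "sol c0 c1 m D = 0" "sol c0 c1 m (- D) = 0" and c: "c0 \<noteq> 0 \<or> c1 \<noteq> 0"
  and V: "\<And>s. \<bar>s\<bar> < D ==> W s = q s"
 shows "dirichlet_eigenvalue {-D<..<D} W m"
proof -
 define S where "S = {-D<..<D}"
 define y where "y = sol c0 c1 m"
 have h: "has_hessian_on S y (sol1 c0 c1 m) (\<lambda>x a. ((q x - m) * y x) * a)"
  unfolding has_hessian_on_def y_def using sol(1,2)[of c0 c1 m] by (auto simp: has_field_derivative_def)
 have cH: "continuous_on S (\<lambda>x. ((q x - m) * y x * b) \<bullet> c)" for b c :: real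
  unfolding y_def inner_real_def by (intro continuous_intros continuous_on_subset[OF q_cont] sol_cont) auto
 have oS: "open S" by (simp add: S_def)
 note C = Ck2_of_hessian[OF oS h cH]
 have fr: "frontier S = {-D, D}" "closure S = {-D..D}" using D_pos
  by (auto simp: S_def frontier_def)
 show ?thesis unfolding dirichlet_eigenvalue_def S_def[symmetric]
 proof (intro exI[of _ y] conjI ballI)
  show "Ck_on 2 S y" by (rule C(1))
  show "continuous_on (closure S) y" unfolding y_def by (rule sol_cont)
  show "y x = 0" if "x \<in> frontier S" for x using that z by (auto simp: fr y_def)
  show "- laplacian y x + W x * y x = m * y x" if x: "x \<in> S" for x
  proof -
   have "W x = q x" using x by (intro V) (auto simp: S_def)
   then show ?thesis using C(2)[OF x] by (simp add: trace_op_def algebra_simps)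
  qed
  show "\<exists>x\<in>S. y x \<noteq> 0"
  proof (rule ccontr)
   assume "\<not> ?thesis"
   then have z: "y x = 0" if "x \<in> S" for x using that by blast
   have 0: "0 \<in> S" using D_pos by (simp add: S_def)
   have "((\<lambda>x. 0) has_real_derivative sol1 c0 c1 m 0) (at 0)"
    by (rule has_field_derivative_transform_within_open[OF sol(1)[of c0 c1 m 0] oS 0]) (use z y_def in simp)
   then have "sol1 c0 c1 m 0 = 0" using DERIV_unique[OF _ DERIV_const] by blast
   then show False using c z[OF 0] by (simp add: y_def sol)
  qed
 qed
qed

lemma eigenvalue_of_zero:
 assumes "sol 1 0 m D = 0 \<or> sol 0 1 m D = 0" and V: "\<And>s. \<bar>s\<bar> < D ==> W s = q s"
 shows "dirichlet_eigenvalue {-D<..<D} W m"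
 using assms(1)
proof
 assume "sol 1 0 m D = 0" then show ?thesis by (intro eigenvalue_of_sol[of 1 0] V) (simp_all add: sol_parity)
next
 assume "sol 0 1 m D = 0" then show ?thesis by (intro eigenvalue_of_sol[of 0 1] V) (simp_all add: sol_parity)
qed

text \<open>Inside the interval an eigenfunction is a combination of the even and the odd solution.
  By continuity this persists at both ends, and adding and subtracting the two boundary conditions
  separates the parts.\<close>

lemma zero_of_eigenvalue:
 assumes e: "dirichlet_eigenvalue {-D<..<D} W m" and V: "\<And>s. \<bar>s\<bar> < D ==> W s = q s"
 shows "sol 1 0 m D = 0 \<or> sol 0 1 m D = 0"
proof -
 define S where "S = {-D<..<D}"
 have fr: "frontier S = {-D, D}" "closure S = {-D..D}" using D_pos by (auto simp: S_def frontier_def)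
 obtain u where u: "Ck_on 2 S u" "continuous_on (closure S) u" "\<forall>x\<in>frontier S. u x = 0" "\<exists>x\<in>S. u x \<noteq> 0"
   "\<forall>x\<in>S. - laplacian u x + W x * u x = m * u x"
  using e unfolding dirichlet_eigenvalue_def S_def[symmetric] by blast
 obtain g H where gH: "has_hessian_on S u g H" "\<And>x. x \<in> S ==> laplacian u x = trace_op (H x)"
  by (rule Ck2_has_hessian[OF u(1)]) (rule that; assumption)
 have inS: "s \<in> S \<longleftrightarrow> \<bar>s\<bar> < D" for s by (auto simp: S_def)
 have d1: "(u has_real_derivative g s) (at s)" if "\<bar>s\<bar> < D" for s
 proof -
  have "(u has_derivative (\<lambda>v. g s \<bullet> v)) (at s)" using gH(1) that by (simp add: has_hessian_on_def inS)
  then show ?thesis by (simp add: has_field_derivative_def inner_real_def)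
 qed
 have d2: "(g has_real_derivative (q s - m) * u s) (at s)" if s: "\<bar>s\<bar> < D" for s
 proof -
  have d: "(g has_derivative H s) (at s)" using gH(1) s by (simp add: has_hessian_on_def inS)
  have "linear (H s)" by (rule hessian_linear[OF gH(1)]) (simp add: inS s)
  then have "H s v = H s 1 * v" for v using linear_scale[of "H s" v 1] by (simp add: mult.commute)
  then have "H s = (*) (H s 1)" by blast
  moreover have "H s 1 = (q s - m) * u s"
  proof -
   have "laplacian u s = H s 1" using gH(2)[of s] s by (simp add: inS trace_op_def)
   then show ?thesis using u(5)[rule_format, of s] s V[OF s] by (simp add: inS algebra_simps)
  qed
  ultimately show ?thesis using d by (simp add: has_field_derivative_def)
 qed
 have eq: "u s = u 0 * sol 1 0 m s + g 0 * sol 0 1 m s" if "s \<in> S" for s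
  using sol_unique[of D u g m s, OF d1 d2] that sol_combine[of "u 0" "g 0" m s] by (simp add: inS)
 have eqc: "u s = u 0 * sol 1 0 m s + g 0 * sol 0 1 m s" if "s \<in> closure S" for s
 proof -
  have "u s - (u 0 * sol 1 0 m s + g 0 * sol 0 1 m s) = 0"
   by (rule continuous_constant_on_closure[OF _ _ that, of "\<lambda>s. u s - (u 0 * sol 1 0 m s + g 0 * sol 0 1 m s)"])
     (intro continuous_intros u(2) sol_cont, use eq in auto)
  then show ?thesis by simp
 qed
 have "u 0 * sol 1 0 m D + g 0 * sol 0 1 m D = 0" "u 0 * sol 1 0 m D - g 0 * sol 0 1 m D = 0"
  using eqc[of D] eqc[of "- D"] u(3) D_pos by (simp_all add: fr sol_parity)
 then have z: "u 0 * sol 1 0 m D = 0" "g 0 * sol 0 1 m D = 0" by linarith+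
 have "u 0 \<noteq> 0 \<or> g 0 \<noteq> 0" using u(4) eq by auto
 then show ?thesis using z by auto
qed

text \<open>\<open>L\<close> is the logarithm of the even solution \<open>p\<close> at an energy
  \<open>m < l1\<close>, and \<open>w = Y / p\<close>, where \<open>Y\<close> is the odd solution at
  an energy \<open>n < l2\<close> plus a multiple of the even one. Below the eigenvalues the
  denominators stay positive up to \<open>D\<close>, and the loss in the gap is at most
  \<open>e\<close>.\<close>

lemma comparison_functions:
 assumes eig: "first_two_dirichlet_eigenvalues {-D<..<D} W l1 l2" and V: "\<And>s. \<bar>s\<bar> < D ==> W s = q s" and e: "e > 0"
 obtains m n L L1 L2 w w1 w2 w0 wM where "n - m >= l2 - l1 - e"
  "\<And>s. \<bar>s\<bar> <= D ==> (L has_real_derivative L1 s) (at s)" "\<And>s. \<bar>s\<bar> <= D ==> (L1 has_real_derivative L2 s) (at s)"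
  "\<And>s. L (- s) = L s" "\<And>s. L2 s + (L1 s)\<^sup>2 = q s - m"
  "\<And>s. \<bar>s\<bar> <= D ==> (w has_real_derivative w1 s) (at s)" "\<And>s. \<bar>s\<bar> <= D ==> (w1 has_real_derivative w2 s) (at s)"
  "\<And>s. 0 <= s ==> s < D ==> w1 s >= 0" "\<And>s. 0 <= s ==> s < D ==> w2 s + 2 * L1 s * w1 s <= - (n - m) * w s"
  "\<And>s. 0 <= s ==> s < D ==> w0 <= w s" "\<And>s. 0 <= s ==> s < D ==> w s <= wM" "w0 > 0"
proof -
 have E: "dirichlet_eigenvalue {-D<..<D} W l1" "\<And>m. dirichlet_eigenvalue {-D<..<D} W m ==> l1 <= m" "l1 < l2"
   "\<And>m. dirichlet_eigenvalue {-D<..<D} W m ==> l1 < m ==> l2 <= m"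
  using eig unfolding first_two_dirichlet_eigenvalues_def by blast+
 have phi_pos: "sol 1 0 m s > 0" if m: "m < l1" and s: "0 <= s" "s <= D" for m s
 proof (rule ccontr)
  assume neg: "\<not> ?thesis"
  then have "s \<noteq> 0" using sol(3)[of 1 0 m] by auto
  then have s0: "0 < s" using s by simp
  obtain k where k: "k <= m" "sol 1 0 k D = 0"
   by (rule first_zero_sol[of 1 0 s m]) (use neg s0 s in auto)
  have "l1 <= k" using k by (intro E(2) eigenvalue_of_zero V) auto
  then show False using k m by simp
 qed
 have phi_D: "sol 1 0 l1 D >= 0"
 proof -
  obtain C where C: "C >= 0" "\<And>m s. \<bar>m - l1\<bar> <= 1 ==> 0 <= s ==> s <= D ==> \<bar>sol 1 0 m s - sol 1 0 l1 s\<bar> <= C * \<bar>m - l1\<bar>"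
   using sol_lip[of l1 1 0] by blast
  show ?thesis by (rule nonneg_of_positive_below[OF C(1), where F = "\<lambda>n. sol 1 0 n D"]) (use C(2) phi_pos D_pos in auto)
 qed
 \<comment> \<open>The parameter at which a zero first enters is an eigenvalue below
   \<open>l2\<close>, hence \<open>l1\<close>. There the even solution is still nonnegative at
   \<open>D\<close>, but its Wronskian with the odd solution, which reaches zero from above, would
   make it negative.\<close>
 have psi_pos: "sol 0 1 n s > 0" if n: "n < l2" and s: "0 < s" "s <= D" for n s
 proof (rule ccontr)
  assume neg: "\<not> ?thesis"
  obtain k where k: "k <= n" "sol 0 1 k D = 0" "\<And>s. 0 < s ==> s < D ==> sol 0 1 k s > 0"
  proof (rule first_zero_sol[of 0 1 s n])
  qed (use neg s that in auto)
  have ek: "dirichlet_eigenvalue {-D<..<D} W k" using k by (intro eigenvalue_of_zero V) auto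
  have "k = l1" using E(2)[OF ek] E(4)[OF ek] k n by linarith
  have "sol1 0 1 k D <= 0"
  proof (rule ccontr)
   assume "\<not> ?thesis"
   then obtain d where d: "d > 0" "\<And>h. 0 < h ==> h < d ==> sol 0 1 k (D - h) < sol 0 1 k D"
    using DERIV_pos_inc_left[OF sol(1)[of 0 1 k D]] by auto
   define h where "h = min (d / 2) (D / 2)"
   have "0 < h" "h < d" "h < D" using d D_pos by (auto simp: h_def)
   then show False using d(2)[of h] k(3)[of "D - h"] k(2) by auto
  qed
  moreover have "sol 1 0 k D * sol1 0 1 k D = 1" using wronskian[of k D] k(2) by simp
  ultimately show False using phi_D \<open>k = l1\<close> mult_nonneg_nonpos[of "sol 1 0 k D" "sol1 0 1 k D"] by simp
 qed
 have phi0: "sol 1 0 l1 D = 0" using zero_of_eigenvalue[OF E(1) V] psi_pos[of l1 D] E(3) D_pos by auto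
 have phi1: "sol1 1 0 l1 D < 0"
 proof -
  have "sol1 1 0 l1 D * sol 0 1 l1 D = - 1" using wronskian[of l1 D] phi0 by simp
  moreover have "sol 0 1 l1 D > 0" using psi_pos[of l1 D] E(3) D_pos by simp
  ultimately show ?thesis by (metis less_minus_one_simps(1) mult_less_0_iff not_less_iff_gr_or_eq)
 qed
 \<comment> \<open>Within \<open>e\<close> of \<open>l2\<close> to control the loss, and above
   \<open>l1\<close>, so that \<open>m < n\<close> makes the Wronskian \<open>W'\<close>
   nonincreasing.\<close>
 define n where "n = max ((l1 + l2) / 2) (l2 - e / 2)"
 have n: "l1 < n" "n < l2" "n >= l2 - e"
 proof -
  have "l1 < (l1 + l2) / 2" "(l1 + l2) / 2 < l2" using E(3) by simp_all
  then show "l1 < n" "n < l2" "n >= l2 - e" using e by (auto simp: n_def less_max_iff_disj le_max_iff_disj)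
 qed
 \<comment> \<open>The odd solution vanishes at \<open>0\<close>. A small multiple of the even one
   gives \<open>Y 0 = h > 0\<close>, hence a positive lower bound for \<open>w\<close>, without
   destroying positivity further out.\<close>
 obtain h where h: "h > 0" "\<And>s. 0 <= s ==> s <= D ==> sol 0 1 n s + h * sol 1 0 n s > 0"
 proof -
  obtain d where d: "d > 0" "\<And>s. dist s 0 < d ==> dist (sol 1 0 n s) (sol 1 0 n 0) < 1"
   using DERIV_isCont[OF sol(1)[of 1 0 n 0]] unfolding continuous_at_eps_delta by (metis zero_less_one)
  define r where "r = min (d / 2) D"
  have r: "r > 0" "r < d" "r <= D" using d D_pos by (auto simp: r_def)
  have p1: "sol 1 0 n s > 0" if "0 <= s" "s <= r" for s using d(2)[of s] that r by (simp add: sol dist_real_def)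
  obtain t where t: "t \<in> {r..D}" "\<forall>s\<in>{r..D}. sol 0 1 n t <= sol 0 1 n s"
   using continuous_attains_inf[OF compact_Icc _ sol_cont(1)[of _ 0 1 n], of r D] r by auto
  define c where "c = sol 0 1 n t"
  have c: "c > 0" unfolding c_def by (rule psi_pos) (use t r n in auto)
  obtain B where B: "B >= 0" "\<And>s. \<bar>s\<bar> <= D ==> \<bar>sol 1 0 n s\<bar> <= B" by (rule cont_bound[OF sol_cont(1), of D 1 0 n]) (rule that; assumption)
  define h where "h = c / (B + 1)"
  have h: "h > 0" using c B by (simp add: h_def)
  show ?thesis
  proof (rule that[OF h])
   fix s :: real assume s: "0 <= s" "s <= D"
   show "sol 0 1 n s + h * sol 1 0 n s > 0"
   proof (cases "s <= r")
    case True
    have "sol 0 1 n s >= 0" using psi_pos[of n s] s n sol(3)[of 0 1 n] by (cases "s = 0") auto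
    then show ?thesis using mult_pos_pos[OF h p1[OF s(1) True]] by linarith
   next
    case False
    then have "c <= sol 0 1 n s" using t s by (auto simp: c_def)
    moreover have "- (h * sol 1 0 n s) < c"
    proof -
     have "- (h * sol 1 0 n s) <= h * \<bar>sol 1 0 n s\<bar>" using abs_ge_minus_self[of "sol 1 0 n s"] h mult_left_mono[of "- sol 1 0 n s" "\<bar>sol 1 0 n s\<bar>" h] by simp
     also have "\<dots> <= h * B" using B(2)[of s] s h by (intro mult_left_mono) auto
     also have "\<dots> < h * (B + 1)" using h by simp
     also have "\<dots> = c" using B by (simp add: h_def)
     finally show ?thesis .
    qed
    ultimately show ?thesis by linarith
   qed
  qed
 qed
 define Y Y1 where "Y = (\<lambda>s. sol 0 1 n s + h * sol 1 0 n s)" and "Y1 = (\<lambda>s. sol1 0 1 n s + h * sol1 1 0 n s)"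
 have Y: "(Y has_real_derivative Y1 s) (at s)" "(Y1 has_real_derivative (q s - n) * Y s) (at s)" for s
 proof -
  show "(Y has_real_derivative Y1 s) (at s)" unfolding Y_def Y1_def by (intro DERIV_add DERIV_cmult sol)
  have "(Y1 has_real_derivative (q s - n) * sol 0 1 n s + h * ((q s - n) * sol 1 0 n s)) (at s)" unfolding Y1_def by (intro DERIV_add DERIV_cmult sol)
  then show "(Y1 has_real_derivative (q s - n) * Y s) (at s)" by (simp add: Y_def algebra_simps)
 qed
 have Ypos: "Y s > 0" if "0 <= s" "s <= D" for s using h(2)[OF that] by (simp add: Y_def)
 \<comment> \<open>At \<open>m = l1\<close> the expression equals
   \<open>- Y D * sol1 1 0 l1 D\<close>, which is positive because the even solution reaches zero at
   \<open>D\<close> with negative slope; by continuity it stays positive slightly below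
   \<open>l1\<close>.\<close>
 obtain m where m: "m < l1" "m > l1 - 1" and WD: "Y1 D * sol 1 0 m D - Y D * sol1 1 0 m D > 0"
 proof -
  obtain C where C: "C >= 0" "\<And>m s. \<bar>m - l1\<bar> <= 1 ==> 0 <= s ==> s <= D ==>
    \<bar>sol 1 0 m s - sol 1 0 l1 s\<bar> <= C * \<bar>m - l1\<bar> \<and> \<bar>sol1 1 0 m s - sol1 1 0 l1 s\<bar> <= C * \<bar>m - l1\<bar>"
   using sol_lipschitz[of l1 1 0] by blast
  define G where "G = - (Y D * sol1 1 0 l1 D)"
  have YD: "Y D > 0" using Ypos[of D] D_pos by simp
  have G: "G > 0" using mult_pos_neg[OF YD phi1] by (simp add: G_def)
  define A where "A = \<bar>Y1 D\<bar> * C + Y D * C + 1"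
  have A: "A > 0" unfolding A_def using C(1) YD by (intro add_nonneg_pos add_nonneg_nonneg mult_nonneg_nonneg) auto
  define t where "t = min (1/2) (G / (2 * A))"
  have t: "t > 0" "t <= 1 / 2" "t <= G / (2 * A)" using G A by (auto simp: t_def)
  define m where "m = l1 - t"
  have mt: "\<bar>m - l1\<bar> = t" using t by (simp add: m_def)
  have a1: "\<bar>sol 1 0 m D\<bar> <= C * t" "\<bar>sol1 1 0 m D - sol1 1 0 l1 D\<bar> <= C * t"
   using C(2)[of m D] D_pos phi0 t unfolding mt by auto
  have b1: "\<bar>Y1 D * sol 1 0 m D\<bar> <= \<bar>Y1 D\<bar> * (C * t)" unfolding abs_mult by (rule mult_left_mono[OF a1(1)]) simp
  have b2: "\<bar>Y D * (sol1 1 0 m D - sol1 1 0 l1 D)\<bar> <= Y D * (C * t)" unfolding abs_mult using a1(2) YD by (simp add: mult_left_mono)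
  have "t * (\<bar>Y1 D\<bar> * C + Y D * C) <= t * A" using t by (intro mult_left_mono) (auto simp: A_def)
  also have "\<dots> <= G / (2 * A) * A" using t A by (intro mult_right_mono) auto
  also have "\<dots> = G / 2" using A by simp
  finally have "\<bar>Y1 D\<bar> * (C * t) + Y D * (C * t) <= G / 2" by (simp add: algebra_simps)
  moreover have "Y1 D * sol 1 0 m D - Y D * sol1 1 0 m D = G + Y1 D * sol 1 0 m D - Y D * (sol1 1 0 m D - sol1 1 0 l1 D)" by (simp add: G_def algebra_simps)
  ultimately have "Y1 D * sol 1 0 m D - Y D * sol1 1 0 m D > 0" using b1 b2 G by linarith
  then show ?thesis using that[of m] t by (simp add: m_def)
 qed
 define p p1 where "p = sol 1 0 m" and "p1 = sol1 1 0 m"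
 have p: "(p has_real_derivative p1 s) (at s)" "(p1 has_real_derivative (q s - m) * p s) (at s)" for s
  unfolding p_def p1_def by (rule sol)+
 have even: "p (- s) = p s" for s by (simp add: p_def sol_parity)
 have ppos: "p s > 0" if "\<bar>s\<bar> <= D" for s
 proof (cases "s >= 0")
  case True then show ?thesis using phi_pos[OF m(1), of s] that by (simp add: p_def)
 next
  case False then show ?thesis using phi_pos[OF m(1), of "- s"] that by (simp add: p_def sol_parity)
 qed
 define W' where "W' = (\<lambda>s. Y1 s * p s - Y s * p1 s)"
 have W': "(W' has_real_derivative (m - n) * (Y s * p s)) (at s)" for s
  unfolding W'_def by (rule DERIV_cong[OF DERIV_diff[OF DERIV_mult[OF Y(2) p(1)] DERIV_mult[OF Y(1) p(2)]]]) (simp add: algebra_simps)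
 \<comment> \<open>\<open>W'\<close> is the numerator of the derivative of \<open>w\<close>. It is
   nonincreasing on \<open>[0, D]\<close> and positive at \<open>D\<close> by the choice of
   \<open>m\<close>.\<close>
 have W'pos: "W' s >= 0" if s: "0 <= s" "s <= D" for s
 proof -
  have "W' D <= W' s"
  proof (rule DERIV_nonpos_imp_nonincreasing[OF s(2)])
   fix t assume t: "s <= t" "t <= D"
   have "Y t * p t > 0" using t s by (intro mult_pos_pos Ypos ppos) auto
   then have "(m - n) * (Y t * p t) <= 0" using m n by (intro mult_nonpos_nonneg) auto
   then show "\<exists>y. (W' has_real_derivative y) (at t) \<and> y <= 0" using W'[of t] by blast
  qed
  then show ?thesis using WD by (simp add: W'_def p_def p1_def)
 qed
 define L L1 L2 where "L = (\<lambda>s. ln (p s))" and "L1 = (\<lambda>s. p1 s / p s)" and "L2 = (\<lambda>s. (q s - m) - (p1 s / p s)\<^sup>2)"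
 define w w1 w2 where "w = (\<lambda>s. Y s / p s)" and "w1 = (\<lambda>s. W' s / (p s)\<^sup>2)" and "w2 = (\<lambda>s. - (n - m) * (Y s / p s) - 2 * (p1 s / p s) * (W' s / (p s)\<^sup>2))"
 have wd: "(w has_real_derivative w1 s) (at s)" if s: "\<bar>s\<bar> <= D" for s
  unfolding w_def w1_def W'_def
  by (rule DERIV_cong[OF DERIV_divide[OF Y(1) p(1)]]) (use ppos[OF s] in \<open>auto simp: power2_eq_square\<close>)
 have wc: "continuous_on {0..D} w"
 proof (rule continuous_at_imp_continuous_on, rule ballI)
  fix s assume "s \<in> {0..D}" then show "isCont w s" by (intro DERIV_isCont[OF wd]) auto
 qed
 obtain t1 where t1: "t1 \<in> {0..D}" "\<forall>s\<in>{0..D}. w t1 <= w s" using continuous_attains_inf[OF compact_Icc _ wc] D_pos by auto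
 obtain t2 where t2: "t2 \<in> {0..D}" "\<forall>s\<in>{0..D}. w s <= w t2" using continuous_attains_sup[OF compact_Icc _ wc] D_pos by auto
 show ?thesis
 proof (rule that[of n m L L1 L2 w w1 w2 "w t1" "w t2"])
  show "n - m >= l2 - l1 - e" using n m by simp
  fix s :: real
  show "L (- s) = L s" by (simp add: L_def even)
  show "L2 s + (L1 s)\<^sup>2 = q s - m" by (simp add: L1_def L2_def)
  {
   assume s: "\<bar>s\<bar> <= D"
   show "(L has_real_derivative L1 s) (at s)"
    unfolding L_def L1_def using DERIV_chain2[OF DERIV_ln[OF ppos[OF s]] p(1)] by (simp add: field_simps)
   show "(L1 has_real_derivative L2 s) (at s)"
    unfolding L1_def L2_def
    by (rule DERIV_cong[OF DERIV_divide[OF p(2) p(1)]]) (use ppos[OF s] in \<open>auto simp: power2_eq_square field_simps\<close>)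
   show "(w has_real_derivative w1 s) (at s)" by (rule wd[OF s])
   show "(w1 has_real_derivative w2 s) (at s)"
   proof -
    have p2: "((\<lambda>s. (p s)\<^sup>2) has_real_derivative 2 * p s * p1 s) (at s)"
     using DERIV_power[OF p(1), of 2 s] by (simp add: mult_ac)
    have pn: "(p s)\<^sup>2 \<noteq> 0" using ppos[OF s] by simp
    show ?thesis unfolding w1_def w2_def
     by (rule DERIV_cong[OF DERIV_divide[OF W' p2 pn]]) (use ppos[OF s] in \<open>simp add: power2_eq_square field_simps\<close>)
   qed
  }
  {
   assume s: "0 <= s" "s < D"
   show "w1 s >= 0" using W'pos[of s] s by (simp add: w1_def)
   show "w2 s + 2 * L1 s * w1 s <= - (n - m) * w s" by (simp add: w2_def L1_def w1_def w_def)
   show "w t1 <= w s" "w s <= w t2" using t1 t2 s by auto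
  }
  show "w t1 > 0" unfolding w_def using t1(1) by (intro divide_pos_pos Ypos ppos) auto
 qed
qed

end

section \<open>The fundamental gap\<close>

lemma operator_norm_bound_of_entries:
 fixes A :: "'a::euclidean_space \<Rightarrow> 'a"
 assumes A: "linear A" and K: "\<And>b c. b \<in> Basis ==> c \<in> Basis ==> \<bar>A b \<bullet> c\<bar> <= K"
 shows "norm (A v) <= (real DIM('a) * (real DIM('a) * K)) * norm v"
proof -
 have e: "\<bar>A v \<bullet> c\<bar> <= real DIM('a) * K * norm v" if c: "c \<in> Basis" for c
 proof -
  have "A v = A (\<Sum>b\<in>Basis. (v \<bullet> b) *\<^sub>R b)" by (simp add: euclidean_representation)
  also have "\<dots> = (\<Sum>b\<in>Basis. (v \<bullet> b) *\<^sub>R A b)" by (simp add: linear_sum[OF A] linear_scale[OF A])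
  finally have "A v \<bullet> c = (\<Sum>b\<in>Basis. (v \<bullet> b) * (A b \<bullet> c))" by (simp add: inner_sum_left)
  also have "\<bar>\<dots>\<bar> <= (\<Sum>b\<in>Basis. \<bar>(v \<bullet> b) * (A b \<bullet> c)\<bar>)" by (rule sum_abs)
  also have "\<dots> <= (\<Sum>b\<in>(Basis::'a set). norm v * K)"
   unfolding abs_mult using c by (intro sum_mono mult_mono Basis_le_norm K) auto
  finally show ?thesis by (simp add: mult_ac)
 qed
 have "norm (A v) <= (\<Sum>c\<in>Basis. \<bar>A v \<bullet> c\<bar>)" by (rule norm_le_l1)
 also have "\<dots> <= (\<Sum>c\<in>(Basis::'a set). real DIM('a) * K * norm v)" by (intro sum_mono e)
 finally show ?thesis by (simp add: mult_ac)
qed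

lemma schroedinger_domain_of_smooth:
 fixes Om :: "'a::euclidean_space set"
 assumes Om: "open Om" "convex Om" "bounded Om" "Om \<noteq> {}" and V: "smooth_on_closed (closure Om) V"
 obtains M where "schroedinger_domain Om V (grad V) M" "continuous_on (closure Om) V"
proof -
 obtain U where U: "open U" "closure Om \<subseteq> U" "C_inf_on U V" using V unfolding smooth_on_closed_def by blast
 have C2: "Ck_on 2 U V" using U(3) by (simp add: C_inf_on_def)
 obtain g H where h: "has_hessian_on U V g H" and cH: "\<And>b c. continuous_on U (\<lambda>x. H x b \<bullet> c)" and gr: "\<And>x. grad V x = g x"
  by (rule Ck2_has_hessian[OF C2]) (rule that)
 have cl: "compact (closure Om)" using Om(3) by simp
 have sub: "Om \<subseteq> closure Om" by (rule closure_subset)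
 note cont = continuous_on_subset[OF _ U(2)]
 obtain K1 where K1: "K1 >= 0" "\<And>x. x \<in> closure Om ==> norm (V x) <= K1"
  by (rule compact_bound[OF cl cont[OF hessian_continuous_on(1)[OF h]]]) (rule that)
 obtain K2 where K2: "K2 >= 0" "\<And>x. x \<in> closure Om ==> norm (g x) <= K2"
  by (rule compact_bound[OF cl cont[OF hessian_continuous_on(2)[OF h]]]) (rule that)
 have "\<exists>K. \<forall>x\<in>closure Om. \<bar>H x b \<bullet> c\<bar> <= K" for b c
  using compact_bound[OF cl cont[OF cH[of b c]]] by (metis real_norm_def)
 then obtain k where k: "\<And>b c x. x \<in> closure Om ==> \<bar>H x b \<bullet> c\<bar> <= k b c" by metis
 define K3 where "K3 = (\<Sum>b\<in>(Basis::'a set). \<Sum>c\<in>(Basis::'a set). \<bar>k b c\<bar>)"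
 have K3: "\<bar>H x b \<bullet> c\<bar> <= K3" if "x \<in> closure Om" "b \<in> Basis" "c \<in> Basis" for x b c
 proof -
  have "\<bar>H x b \<bullet> c\<bar> <= \<bar>k b c\<bar>" using k[OF that(1), of b c] by linarith
  also have "\<dots> <= (\<Sum>c\<in>(Basis::'a set). \<bar>k b c\<bar>)" by (rule member_le_sum[OF that(3)]) auto
  also have "\<dots> <= K3" unfolding K3_def by (rule member_le_sum[OF that(2), of "\<lambda>b. \<Sum>c\<in>(Basis::'a set). \<bar>k b c\<bar>"]) (auto intro: sum_nonneg)
  finally show ?thesis .
 qed
 define B where "B = real DIM('a) * (real DIM('a) * K3)"
 have B: "norm (H x v) <= B * norm v" if "x \<in> Om" for x v
 proof -
  have x: "x \<in> closure Om" by (rule subsetD[OF sub that])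
  show ?thesis unfolding B_def by (rule operator_norm_bound_of_entries[OF hessian_linear[OF h subsetD[OF U(2) x]] K3[OF x]])
 qed
 have lip: "norm (g x - g y) <= B * norm (x - y)" if "x \<in> Om" "y \<in> Om" for x y
 proof (rule differentiable_bound[OF Om(2) _ _ that])
  fix x assume x: "x \<in> Om"
  show "(g has_derivative H x) (at x within Om)" using h x sub U(2) by (auto simp: has_hessian_on_def has_derivative_at_withinI)
  show "onorm (H x) <= B" by (rule onorm_le[OF B[OF x]])
 qed
 define M where "M = K1 + K2 + \<bar>B\<bar>"
 have "schroedinger_domain Om V (grad V) M"
 proof
  fix x assume x: "x \<in> Om"
  show "(V has_derivative (\<bullet>) (grad V x)) (at x)" using h x sub U(2) by (auto simp: has_hessian_on_def gr)
  show "\<bar>V x\<bar> <= M" using K1(2)[of x] K2(1) x sub by (auto simp: M_def)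
  show "norm (grad V x) <= M" using K2(2)[of x] K1(1) x sub by (auto simp: M_def gr)
  fix y assume y: "y \<in> Om"
  have "B * norm (x - y) <= M * norm (x - y)" using K1(1) K2(1) by (intro mult_right_mono) (auto simp: M_def)
  then show "norm (grad V x - grad V y) <= M * norm (x - y)" using lip[OF x y] by (simp add: gr)
 qed (use Om in auto)
 then show ?thesis using that cont[OF hessian_continuous_on(1)[OF h]] by blast
qed

lemma schroedinger_domain_perturb:
 assumes s: "schroedinger_domain Om V gV M" and R: "\<And>x. x \<in> Om ==> norm x <= R" and dl: "dl >= 0"
 obtains M' where "schroedinger_domain Om (\<lambda>x. V x + dl * (x \<bullet> x)) (\<lambda>x. gV x + (2 * dl) *\<^sub>R x) M'"
proof -
 interpret schroedinger_domain Om V gV M by (rule s)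
 have R0: "R >= 0" using R Om_ne norm_ge_zero by (metis ex_in_conv order_trans)
 define M' where "M' = M + dl * R\<^sup>2 + 2 * dl * R + 2 * dl"
 have n: "dl * R\<^sup>2 >= 0" "2 * dl * R >= 0" using dl R0 by auto
 have "schroedinger_domain Om (\<lambda>x. V x + dl * (x \<bullet> x)) (\<lambda>x. gV x + (2 * dl) *\<^sub>R x) M'"
 proof
  fix x assume x: "x \<in> Om"
  have "((\<lambda>x. V x + dl * (x \<bullet> x)) has_derivative (\<lambda>v. gV x \<bullet> v + dl * (x \<bullet> v + v \<bullet> x))) (at x)"
   by (intro has_derivative_add V_deriv[OF x] has_derivative_mult_right has_derivative_inner has_derivative_ident)
  then show "((\<lambda>x. V x + dl * (x \<bullet> x)) has_derivative (\<bullet>) (gV x + (2 * dl) *\<^sub>R x)) (at x)"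
   by (rule has_derivative_eq_rhs) (auto simp: fun_eq_iff inner_add_left inner_commute algebra_simps)
  have nx: "x \<bullet> x <= R\<^sup>2" using power_mono[OF R[OF x] norm_ge_zero, of 2] by (simp add: power2_norm_eq_inner)
  have "dl * (x \<bullet> x) <= dl * R\<^sup>2" by (rule mult_left_mono[OF nx dl])
  moreover have "0 <= dl * (x \<bullet> x)" using dl by simp
  ultimately show "\<bar>V x + dl * (x \<bullet> x)\<bar> <= M'" using V_bound[OF x] n dl unfolding M'_def by linarith
  have "norm (gV x + (2 * dl) *\<^sub>R x) <= norm (gV x) + 2 * dl * norm x" using norm_triangle_ineq[of "gV x" "(2 * dl) *\<^sub>R x"] dl by simp
  moreover have "2 * dl * norm x <= 2 * dl * R" using R[OF x] dl by (intro mult_left_mono) auto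
  ultimately show "norm (gV x + (2 * dl) *\<^sub>R x) <= M'" using gV_bound[OF x] n dl unfolding M'_def by linarith
  fix y assume y: "y \<in> Om"
  have eq: "gV x + (2 * dl) *\<^sub>R x - (gV y + (2 * dl) *\<^sub>R y) = (gV x - gV y) + (2 * dl) *\<^sub>R (x - y)" by (simp add: algebra_simps)
  have "norm (gV x + (2 * dl) *\<^sub>R x - (gV y + (2 * dl) *\<^sub>R y)) <= norm (gV x - gV y) + 2 * dl * norm (x - y)"
   unfolding eq using norm_triangle_ineq[of "gV x - gV y" "(2 * dl) *\<^sub>R (x - y)"] dl by simp
  also have "\<dots> <= (M + 2 * dl) * norm (x - y)" using gV_lip[OF x y] by (simp add: distrib_right)
  also have "\<dots> <= M' * norm (x - y)" using n by (intro mult_right_mono) (auto simp: M'_def)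
  finally show "norm (gV x + (2 * dl) *\<^sub>R x - (gV y + (2 * dl) *\<^sub>R y)) <= M' * norm (x - y)" .
 qed (rule open_Om convex_Om bounded_Om Om_ne)+
 then show ?thesis using that by blast
qed

text \<open>The constructed limit is nonnegative, attains \<open>1\<close>, and is a supersolution
  for the constant \<open>M + |lam|\<close>; the strong maximum principle makes it positive.\<close>

lemma ground_state_of_potential:
 assumes sc: "smooth_convex_domain Om rho gr Hr U" and sd: "schroedinger_domain Om V gV M"
 obtains u g H lam where "ground_state Om rho gr Hr U V M u g H lam" "\<And>b c. continuous_on Om (\<lambda>x. H x b \<bullet> c)"
proof -
 interpret D: smooth_convex_domain Om rho gr Hr U by (rule sc)
 interpret S: schroedinger_domain Om V gV M by (rule sd)
 obtain u g H lam where u: "has_hessian_on Om u g H" "\<And>b c. continuous_on Om (\<lambda>x. H x b \<bullet> c)"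
  "\<And>x. x \<in> Om ==> trace_op (H x) = (V x - lam) * u x"
  "\<And>x. x \<in> Om ==> 0 <= u x" "\<And>x. x \<in> Om ==> u x <= 1" "\<exists>x\<in>Om. u x = 1"
  "continuous_on (closure Om) u" "\<And>x. x \<in> frontier Om ==> u x = 0"
  by (rule S.ground_state_exists) (rule that)
 have pos: "u x > 0" if x: "x \<in> Om" for x
 proof (rule positive_of_nonneg_supersolution[OF D.open_Om convex_connected[OF D.convex_Om] u(1) _ _ u(4) _ x])
  show "0 <= M + \<bar>lam\<bar>" using S.M_nonneg by simp
  show "trace_op (H y) <= (M + \<bar>lam\<bar>) * u y" if "y \<in> Om" for y
   unfolding u(3)[OF that] using S.V_bound[OF that] u(4)[OF that] by (intro mult_right_mono) (auto simp: abs_le_iff)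
  show "\<exists>x\<in>Om. 0 < u x" using u(6) by force
 qed
 have "ground_state Om rho gr Hr U V M u g H lam"
  by (intro ground_state.intro sc ground_state_axioms.intro) (use S.V_bound u pos in auto)
 then show ?thesis using that u(2) by blast
qed

lemma eigenfunction_data:
 assumes "dirichlet_eigenvalue Om V mu"
 obtains w gw Hw where "has_hessian_on Om w gw Hw" "continuous_on (closure Om) w" "\<And>x. x \<in> frontier Om ==> w x = 0"
  "\<exists>x\<in>Om. w x \<noteq> 0" "\<And>x. x \<in> Om ==> trace_op (Hw x) = (V x - mu) * w x"
proof -
 obtain w where w: "Ck_on 2 Om w" "continuous_on (closure Om) w" "\<forall>x\<in>frontier Om. w x = 0" "\<exists>x\<in>Om. w x \<noteq> 0"
   "\<forall>x\<in>Om. - laplacian w x + V x * w x = mu * w x"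
  using assms unfolding dirichlet_eigenvalue_def by blast
 obtain g H where h: "has_hessian_on Om w g H" and tr: "\<And>x. x \<in> Om ==> laplacian w x = trace_op (H x)"
  by (rule Ck2_has_hessian[OF w(1)]) (rule that)
 show ?thesis
 proof (rule that[OF h w(2) _ w(4)])
  show "w x = 0" if "x \<in> frontier Om" for x using w(3) that by blast
  show "trace_op (H x) = (V x - mu) * w x" if "x \<in> Om" for x
   using w(5) tr[OF that] that by (simp add: algebra_simps)
 qed
qed

context ground_state
begin

text \<open>The eigenfunction may belong to a potential \<open>V'\<close> different from that of the
  ground state; the discrepancy stays in the zero-order coefficient. Thus eigenfunctions of the
  unperturbed operator can be divided by the perturbed ground state, and conversely.\<close>

lemma eigenfunction_quotient:
 assumes hw: "has_hessian_on Om w gw Hw" and cw: "continuous_on (closure Om) w" and zw: "\<And>x. x \<in> frontier Om ==> w x = 0"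
  and tr: "\<And>x. x \<in> Om ==> trace_op (Hw x) = (V' x - mu) * w x" and V': "\<And>x. x \<in> Om ==> \<bar>V' x\<bar> <= M'"
 obtains gv Hv B where "has_hessian_on Om (\<lambda>x. w x * inverse (u x)) gv Hv" "\<And>x. x \<in> Om ==> \<bar>w x * inverse (u x)\<bar> <= B"
  "\<And>x. x \<in> Om ==> trace_op (Hv x) + 2 * (gf x \<bullet> gv x) = (V' x - V x + lam - mu) * (w x * inverse (u x))"
proof -
 obtain K where K: "K >= 0" "\<And>x. x \<in> closure Om ==> norm (w x) <= K"
  by (rule compact_bound[OF compact_closure cw]) (rule that)
 have "\<bar>trace_op (Hw x)\<bar> <= (M' + \<bar>mu\<bar>) * K" if x: "x \<in> Om" for x
 proof -
  have "\<bar>V' x - mu\<bar> <= M' + \<bar>mu\<bar>" using V'[OF x] by linarith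
  then show ?thesis unfolding tr[OF x] abs_mult using K(2)[OF Om_closure[OF x]] by (intro mult_mono) auto
 qed
 then obtain B where B: "B >= 0" "\<And>x. x \<in> Om ==> \<bar>w x\<bar> <= B * u x" using quotient_bounded[OF hw cw zw] by blast
 obtain gv Hv where v: "has_hessian_on Om (\<lambda>x. w x * inverse (u x)) gv Hv"
  "\<And>x. x \<in> Om ==> trace_op (Hv x) + 2 * (gf x \<bullet> gv x) = trace_op (Hw x) * inverse (u x) - (V x - lam) * (w x * inverse (u x))"
  by (rule quotient_operator[OF hw]) (rule that)
 show ?thesis
 proof (rule that[OF v(1)])
  fix x assume x: "x \<in> Om"
  show "\<bar>w x * inverse (u x)\<bar> <= B" using B(2)[OF x] u_pos[OF x] by (simp add: abs_mult divide_inverse[symmetric] pos_divide_le_eq)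
  show "trace_op (Hv x) + 2 * (gf x \<bullet> gv x) = (V' x - V x + lam - mu) * (w x * inverse (u x))"
   unfolding v(2)[OF x] tr[OF x] by (simp add: algebra_simps)
 qed
qed

end

section \<open>The perturbed problem and the removal of the perturbation\<close>

lemma convex_pair_strict:
 fixes x y :: "'a::real_inner"
 shows "x \<noteq> y ==> 2 * (((1/2) *\<^sub>R (x + y)) \<bullet> ((1/2) *\<^sub>R (x + y))) < x \<bullet> x + y \<bullet> y"
proof -
 assume "x \<noteq> y"
 then have "(x - y) \<bullet> (x - y) > 0" by simp
 then show ?thesis by (simp add: inner_add_left inner_add_right inner_diff_left inner_diff_right inner_commute[of y x] field_simps)
qed

text \<open>The chain \<open>l1 <= lam0 <= lam <= l1 + dl R^2\<close> links the given lowest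
  eigenvalue to the perturbed ground state. The smallness of \<open>dl\<close> keeps
  \<open>l2 - lam\<close> positive, so that \<open>one_point_min\<close> applies to the
  quotient.\<close>

lemma gap_perturbed:
 fixes Om :: "'a::euclidean_space set" and L L1 L2 w w1 w2 q :: "real \<Rightarrow> real"
 assumes sc: "smooth_convex_domain Om rho gr Hr U" and sd: "schroedinger_domain Om V gV M"
  and convV: "convex_on Om V" and R: "\<And>x. x \<in> Om ==> norm x <= R"
  and eig: "first_two_dirichlet_eigenvalues Om V l1 l2"
  and L: "\<And>s. \<bar>s\<bar> <= D ==> (L has_real_derivative L1 s) (at s)" "\<And>s. \<bar>s\<bar> <= D ==> (L1 has_real_derivative L2 s) (at s)"
   "\<And>s. L (- s) = L s" "\<And>s. L2 s + (L1 s)\<^sup>2 = q s - m"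
  and w: "\<And>s. \<bar>s\<bar> <= D ==> (w has_real_derivative w1 s) (at s)" "\<And>s. \<bar>s\<bar> <= D ==> (w1 has_real_derivative w2 s) (at s)"
   "\<And>s. 0 <= s ==> s < D ==> w1 s >= 0" "\<And>s. 0 <= s ==> s < D ==> w2 s + 2 * L1 s * w1 s <= - gh * w s"
   "\<And>s. 0 <= s ==> s < D ==> w0 <= w s" "\<And>s. 0 <= s ==> s < D ==> w s <= wM" "w0 > 0"
  and diam: "\<And>x y. x \<in> Om ==> y \<in> Om ==> norm (y - x) < 2 * D"
  and modV: "\<And>m z s. m + z \<in> Om ==> m - z \<in> Om ==> z \<noteq> 0 ==> 0 <= s ==> s < 1 ==>
    2 * (q (norm z) - q (s * norm z)) <= V (m + z) + V (m - z) - V (m + s *\<^sub>R z) - V (m - s *\<^sub>R z)"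
  and dl: "dl > 0" "dl * R\<^sup>2 < l2 - l1"
 shows "gh <= l2 - l1 + 2 * (dl * R\<^sup>2) * wM / w0"
proof -
 interpret D: smooth_convex_domain Om rho gr Hr U by (rule sc)
 interpret S: schroedinger_domain Om V gV M by (rule sd)
 define Vd where "Vd = (\<lambda>x. V x + dl * (x \<bullet> x))"
 obtain Md where sdd: "schroedinger_domain Om Vd (\<lambda>x. gV x + (2 * dl) *\<^sub>R x) Md"
  unfolding Vd_def by (rule schroedinger_domain_perturb[OF sd R less_imp_le[OF dl(1)]]) (assumption | rule that)+
 interpret Sd: schroedinger_domain Om Vd "\<lambda>x. gV x + (2 * dl) *\<^sub>R x" Md by (rule sdd)
 obtain u0 g0 H0 lam0 where gs0: "ground_state Om rho gr Hr U V M u0 g0 H0 lam0" and cH0: "\<And>b c. continuous_on Om (\<lambda>x. H0 x b \<bullet> c)"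
  by (rule ground_state_of_potential[OF sc sd]) (rule that)
 obtain u1 g1 H1 lam where gs1: "ground_state Om rho gr Hr U Vd Md u1 g1 H1 lam"
  by (rule ground_state_of_potential[OF sc sdd]) (rule that)
 interpret G0: ground_state Om rho gr Hr U V M u0 g0 H0 lam0 by (rule gs0)
 interpret G1: ground_state Om rho gr Hr U Vd Md u1 g1 H1 lam by (rule gs1)
 obtain p0 where p0: "p0 \<in> Om" using D.Om_ne by blast
 have xx: "0 <= dl * (x \<bullet> x)" "dl * (x \<bullet> x) <= dl * R\<^sup>2" if "x \<in> Om" for x
  using dl(1) power_mono[OF R[OF that] norm_ge_zero, of 2] by (auto simp: power2_norm_eq_inner)
 have E: "dirichlet_eigenvalue Om V l1" "\<And>mu. dirichlet_eigenvalue Om V mu ==> l1 <= mu" "dirichlet_eigenvalue Om V l2" "l1 < l2"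
  using eig unfolding first_two_dirichlet_eigenvalues_def by blast+
 \<comment> \<open>The unperturbed ground state relates \<open>l1\<close> to \<open>lam\<close>:
   being an eigenvalue, \<open>lam0\<close> is at least \<open>l1\<close>.\<close>
 have "dirichlet_eigenvalue Om V lam0"
  unfolding dirichlet_eigenvalue_def
 proof (intro exI[of _ u0] conjI ballI)
  show "Ck_on 2 Om u0" by (rule Ck2_of_hessian(1)[OF D.open_Om G0.hu cH0])
  show "\<exists>x\<in>Om. u0 x \<noteq> 0" using p0 G0.u_pos[OF p0] by (intro bexI[of _ p0]) auto
  fix x assume x: "x \<in> Om"
  show "- laplacian u0 x + V x * u0 x = lam0 * u0 x"
   unfolding Ck2_of_hessian(2)[OF D.open_Om G0.hu cH0 x] G0.pde[OF x] by (simp add: algebra_simps)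
 qed (use G0.cont_u G0.u_zero in auto)
 then have l1_lam0: "l1 <= lam0" by (rule E(2))
 \<comment> \<open>Otherwise the quotient \<open>u1 / u0\<close> satisfies an equation with positive
   zero-order coefficient, and the maximum principle makes it nonpositive.\<close>
 have lam0_lam: "lam0 <= lam"
 proof (rule ccontr)
  assume "\<not> lam0 <= lam"
  then have a0: "lam0 - lam > 0" by simp
  obtain gv Hv B where v: "has_hessian_on Om (\<lambda>x. u1 x * inverse (u0 x)) gv Hv" "\<And>x. x \<in> Om ==> \<bar>u1 x * inverse (u0 x)\<bar> <= B"
   "\<And>x. x \<in> Om ==> trace_op (Hv x) + 2 * (G0.gf x \<bullet> gv x) = (Vd x - V x + lam0 - lam) * (u1 x * inverse (u0 x))"
   by (rule G0.eigenfunction_quotient[OF G1.hu G1.cont_u G1.u_zero G1.pde G1.V_bd]) (assumption | rule that)+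
  have "u1 p0 * inverse (u0 p0) <= 0"
   by (rule G0.one_point_max[OF v(1) _ v(3) a0 _ p0, of B]) (use v(2) xx in \<open>auto simp: abs_le_iff Vd_def\<close>)
  moreover have "u1 p0 * inverse (u0 p0) > 0" using G1.u_pos[OF p0] G0.u_pos[OF p0] by simp
  ultimately show False by simp
 qed
 \<comment> \<open>Otherwise the quotient of an eigenfunction for \<open>l1\<close> by
   \<open>u1\<close> and its negative are both nonpositive, so that eigenfunction vanishes.\<close>
 have lam_l1: "lam <= l1 + dl * R\<^sup>2"
 proof (rule ccontr)
  assume "\<not> ?thesis"
  then have a0: "lam - l1 - dl * R\<^sup>2 > 0" by simp
  obtain y gy Hy where y: "has_hessian_on Om y gy Hy" "continuous_on (closure Om) y" "\<And>x. x \<in> frontier Om ==> y x = 0"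
   "\<exists>x\<in>Om. y x \<noteq> 0" "\<And>x. x \<in> Om ==> trace_op (Hy x) = (V x - l1) * y x"
   by (rule eigenfunction_data[OF E(1)]) (rule that)
  obtain gv Hv B where v: "has_hessian_on Om (\<lambda>x. y x * inverse (u1 x)) gv Hv" "\<And>x. x \<in> Om ==> \<bar>y x * inverse (u1 x)\<bar> <= B"
   "\<And>x. x \<in> Om ==> trace_op (Hv x) + 2 * (G1.gf x \<bullet> gv x) = (V x - Vd x + lam - l1) * (y x * inverse (u1 x))"
   by (rule G1.eigenfunction_quotient[OF y(1,2,3,5) S.V_bound]) (assumption | rule that)+
  have a: "lam - l1 - dl * R\<^sup>2 <= V x - Vd x + lam - l1" if "x \<in> Om" for x using xx[OF that] by (simp add: Vd_def)
  have le: "y x * inverse (u1 x) <= 0" if "x \<in> Om" for x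
   by (rule G1.one_point_max[OF v(1) _ v(3) a0 a that, of B]) (use v(2) in \<open>auto simp: abs_le_iff\<close>)
  have eq': "trace_op (\<lambda>b. (- 1) *\<^sub>R Hv x b) + 2 * (G1.gf x \<bullet> ((- 1) *\<^sub>R gv x)) = (V x - Vd x + lam - l1) * ((- 1) * (y x * inverse (u1 x)))" if "x \<in> Om" for x
   using v(3)[OF that] unfolding trace_op_simps(2) by (simp add: algebra_simps)
  have ge: "(- 1) * (y x * inverse (u1 x)) <= 0" if "x \<in> Om" for x
   by (rule G1.one_point_max[OF hessian_cmult[OF v(1), of "- 1"] _ eq' a0 a that, of B]) (use v(2) in \<open>auto simp: abs_le_iff\<close>)
  obtain x where x: "x \<in> Om" "y x \<noteq> 0" using y(4) by blast
  have "y x * inverse (u1 x) = 0" using le[OF x(1)] ge[OF x(1)] by linarith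
  then show False using x G1.u_pos[OF x(1)] by simp
 qed
 define ga where "ga = l2 - lam"
 have ga: "ga > 0" using lam_l1 dl by (simp add: ga_def)
 obtain y gy Hy where y: "has_hessian_on Om y gy Hy" "continuous_on (closure Om) y" "\<And>x. x \<in> frontier Om ==> y x = 0"
  "\<exists>x\<in>Om. y x \<noteq> 0" "\<And>x. x \<in> Om ==> trace_op (Hy x) = (V x - l2) * y x"
  by (rule eigenfunction_data[OF E(3)]) (rule that)
 define v where "v = (\<lambda>x. y x * inverse (u1 x))"
 obtain gv Hv B where v0: "has_hessian_on Om (\<lambda>x. y x * inverse (u1 x)) gv Hv" "\<And>x. x \<in> Om ==> \<bar>y x * inverse (u1 x)\<bar> <= B"
  "\<And>x. x \<in> Om ==> trace_op (Hv x) + 2 * (G1.gf x \<bullet> gv x) = (V x - Vd x + lam - l2) * (y x * inverse (u1 x))"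
  by (rule G1.eigenfunction_quotient[OF y(1,2,3,5) S.V_bound]) (assumption | rule that)+
 have hv: "has_hessian_on Om v gv Hv" and bv: "\<And>x. x \<in> Om ==> \<bar>v x\<bar> <= B" using v0(1,2) by (simp_all add: v_def)
 have eqv: "trace_op (Hv x) + 2 * (G1.gf x \<bullet> gv x) = - (ga + dl * (x \<bullet> x)) * v x" if "x \<in> Om" for x
  unfolding v0(3)[OF that] by (simp add: v_def ga_def Vd_def algebra_simps)
 have eqv': "trace_op (\<lambda>b. (- 1) *\<^sub>R Hv x b) + 2 * (G1.gf x \<bullet> ((- 1) *\<^sub>R gv x)) = - (ga + dl * (x \<bullet> x)) * ((- 1) * v x)" if "x \<in> Om" for x
  using eqv[OF that] unfolding trace_op_simps(2) by (simp add: algebra_simps)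
 have aneg: "- (ga + dl * (x \<bullet> x)) <= - ga" if "x \<in> Om" for x using xx(1)[OF that] by simp
 have low: "\<exists>x\<in>Om. v x < r" if "r > 0" for r by (rule G1.one_point_min[OF hv eqv ga aneg that])
 have up: "\<exists>x\<in>Om. v x > - r" if r: "r > 0" for r
 proof -
  have "\<exists>x\<in>Om. (- 1) * v x < r" by (rule G1.one_point_min[OF hessian_cmult[OF hv, of "- 1"] eqv' ga aneg r])
  then show ?thesis by force
 qed
 obtain p where p: "p \<in> Om" "v p \<noteq> 0"
 proof -
  obtain x where "x \<in> Om" "y x \<noteq> 0" using y(4) by blast
  then show ?thesis using that[of x] G1.u_pos[of x] by (simp add: v_def)
 qed
 have mc: "G1.f x + G1.f y <= 2 * G1.f ((1/2) *\<^sub>R (x + y))" if "x \<in> Om" "y \<in> Om" for x y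
 proof (rule G1.log_concave_midpoint[OF _ that])
  fix x y assume xy: "x \<in> Om" "y \<in> Om" "x \<noteq> y"
  have "V ((1 - 1/2) *\<^sub>R x + (1/2) *\<^sub>R y) <= (1 - 1/2) * V x + (1/2) * V y" by (rule convex_onD[OF convV]) (use xy in auto)
  moreover have "(1 - 1/2) *\<^sub>R x + (1/2) *\<^sub>R y = (1/2) *\<^sub>R (x + y)" by (simp add: scaleR_add_right)
  ultimately have "2 * V ((1/2) *\<^sub>R (x + y)) <= V x + V y" by simp
  moreover have "dl * (2 * (((1/2) *\<^sub>R (x + y)) \<bullet> ((1/2) *\<^sub>R (x + y)))) < dl * (x \<bullet> x + y \<bullet> y)"
   by (rule mult_strict_left_mono[OF convex_pair_strict[OF xy(3)] dl(1)])
  ultimately show "2 * Vd ((1/2) *\<^sub>R (x + y)) < Vd x + Vd y" unfolding Vd_def distrib_left by linarith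
 qed
 \<comment> \<open>The perturbation contributes exactly \<open>2 dl (1 - s^2) |z|^2\<close>, which
   turns the weak modulus condition into a strict one.\<close>
 have strict: "2 * ((L2 (norm z) + (L1 (norm z))\<^sup>2) - (L2 (s * norm z) + (L1 (s * norm z))\<^sup>2))
     < Vd (a + z) + Vd (a - z) - Vd (a + s *\<^sub>R z) - Vd (a - s *\<^sub>R z)"
  if z: "a + z \<in> Om" "a - z \<in> Om" "z \<noteq> 0" "0 <= s" "s < 1" for a z s
 proof -
  have "s\<^sup>2 < 1" using z(4,5) by (simp add: abs_square_less_1)
  then have "0 < 2 * ((1 - s\<^sup>2) * (z \<bullet> z))" using z(3) by simp
  moreover have "(a + z) \<bullet> (a + z) + (a - z) \<bullet> (a - z) - (a + s *\<^sub>R z) \<bullet> (a + s *\<^sub>R z) - (a - s *\<^sub>R z) \<bullet> (a - s *\<^sub>R z) = 2 * ((1 - s\<^sup>2) * (z \<bullet> z))"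
   by (simp add: inner_add_left inner_add_right inner_diff_left inner_diff_right algebra_simps power2_eq_square)
  ultimately have "0 < dl * ((a + z) \<bullet> (a + z) + (a - z) \<bullet> (a - z) - (a + s *\<^sub>R z) \<bullet> (a + s *\<^sub>R z) - (a - s *\<^sub>R z) \<bullet> (a - s *\<^sub>R z))"
   using dl(1) by simp
  then show ?thesis using modV[OF z] unfolding L(4) Vd_def right_diff_distrib distrib_left by linarith
 qed
 have mod: "(G1.gf y - G1.gf x) \<bullet> (y - x) <= 2 * L1 (norm (y - x) / 2) * norm (y - x)" if "x \<in> Om" "y \<in> Om" for x y
  by (rule G1.grad_modulus[OF mc L(1,2,3) diam strict that])
 have c: "\<bar>dl * (x \<bullet> x)\<bar> <= dl * R\<^sup>2" if "x \<in> Om" for x using xx[OF that] by simp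
 have "gh <= ga + 2 * (dl * R\<^sup>2) * wM / w0"
  by (rule G1.gap_comparison[OF mod diam w(1-4) hv bv eqv c w(5-7) less_imp_le[OF ga] low up p])
 then show ?thesis using l1_lam0 lam0_lam by (simp add: ga_def)
qed

text \<open>An open set contains a slightly longer segment. Half distances therefore stay strictly
  below \<open>D\<close>, where the one-dimensional functions are controlled.\<close>

lemma open_norm_less_diameter:
 fixes S :: "'a::euclidean_space set"
 assumes S: "open S" "bounded S" and xy: "x \<in> S" "y \<in> S"
 shows "norm (y - x) < diameter S"
proof -
 obtain b :: 'a where b: "b \<in> Basis" using nonempty_Basis by blast
 define e where "e = (if x = y then b else sgn (y - x))"
 have e: "norm (y - x + t *\<^sub>R e) = norm (y - x) + t" if "t > 0" for t
 proof (cases "x = y")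
  case True then show ?thesis using b that by (simp add: e_def)
 next
  case False
  then have n: "norm (y - x) > 0" by simp
  have "norm (y - x) *\<^sub>R sgn (y - x) = y - x" using False by (simp add: sgn_div_norm)
  then have "y - x + t *\<^sub>R e = (norm (y - x) + t) *\<^sub>R sgn (y - x)" using False by (simp add: e_def scaleR_add_left)
  then show ?thesis using n that False by (simp add: norm_sgn)
 qed
 have ne: "norm e = 1" using b by (simp add: e_def norm_sgn)
 obtain r where r: "r > 0" "ball y r \<subseteq> S" using S(1) xy(2) open_contains_ball by blast
 have "y + (r / 2) *\<^sub>R e \<in> S" using r ne by (intro subsetD[OF r(2)]) (simp add: dist_norm)
 from diameter_bounded_bound[OF S(2) this xy(1)] have "norm (y + (r / 2) *\<^sub>R e - x) <= diameter S" by (simp add: dist_norm)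
 moreover have "y + (r / 2) *\<^sub>R e - x = y - x + (r / 2) *\<^sub>R e" by simp
 ultimately show ?thesis using e[of "r / 2"] r by simp
qed

text \<open>Integrates the modulus condition for the pairs \<open>m + t z\<close>,
  \<open>m - t z\<close> over \<open>t\<close> from \<open>s\<close> to \<open>1\<close>.
  Derivatives of \<open>q\<close> at interior points and continuity suffice, by the mean value
  theorem.\<close>

lemma potential_modulus_integrated:
 fixes Om :: "'a::euclidean_space set" and V :: "'a \<Rightarrow> real" and q q' :: "real \<Rightarrow> real"
 assumes conv: "convex Om" and dV: "\<And>x. x \<in> Om ==> (V has_derivative (\<lambda>v. gV x \<bullet> v)) (at x)"
  and q: "continuous_on UNIV q" "\<And>s. 0 < s ==> s < D ==> (q has_real_derivative q' s) (at s)"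
  and diam: "\<And>x y. x \<in> Om ==> y \<in> Om ==> norm (y - x) < 2 * D"
  and mod: "\<And>x y. x \<in> Om ==> y \<in> Om ==> x \<noteq> y ==> (gV y - gV x) \<bullet> ((1 / norm (y - x)) *\<^sub>R (y - x)) >= 2 * q' (norm (y - x) / 2)"
  and z: "m + z \<in> Om" "m - z \<in> Om" "z \<noteq> 0" "0 <= s" "s < 1"
 shows "2 * (q (norm z) - q (s * norm z)) <= V (m + z) + V (m - z) - V (m + s *\<^sub>R z) - V (m - s *\<^sub>R z)"
proof -
 note inO = convex_symmetric_segment[OF conv z(1,2)]
 have inO': "m + t *\<^sub>R (- z) \<in> Om" if "\<bar>t\<bar> <= 1" for t using inO[of "- t"] that by simp
 define k where "k = (\<lambda>t. V (m + t *\<^sub>R z) + V (m + t *\<^sub>R (- z)) - 2 * q (t * norm z))"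
 have dk0: "((\<lambda>t. V (m + t *\<^sub>R z) + V (m + t *\<^sub>R (- z))) has_real_derivative gV (m + t *\<^sub>R z) \<bullet> z + gV (m + t *\<^sub>R (- z)) \<bullet> (- z)) (at t)" if "\<bar>t\<bar> <= 1" for t
  by (intro DERIV_add has_derivative_line dV inO[OF that] inO'[OF that])
 have nz: "norm z < D"
 proof -
  have "(m + z) - (m - z) = 2 *\<^sub>R z" by (simp add: scaleR_2)
  then have "norm (2 *\<^sub>R z) < 2 * D" using diam[OF z(2,1)] by simp
  then show ?thesis by simp
 qed
 have "k s <= k 1"
 proof (rule DERIV_nonneg_imp_increasing_open[OF less_imp_le[OF z(5)]])
  fix t assume t: "s < t" "t < 1"
  then have t0: "0 < t" "\<bar>t\<bar> <= 1" using z(4) by auto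
  define T where "T = t * norm z"
  have T: "0 < T" "T < D"
  proof -
   show "0 < T" using t0 z(3) by (simp add: T_def)
   have "T <= 1 * norm z" unfolding T_def using t0 by (intro mult_right_mono) auto
   then show "T < D" using nz by simp
  qed
  have dq: "((\<lambda>t. q (t * norm z)) has_real_derivative q' T * norm z) (at t)"
   by (rule DERIV_chain2[of q]) (use q(2)[OF T] in \<open>auto simp: T_def intro!: derivative_eq_intros\<close>)
  define x y where "x = m + t *\<^sub>R (- z)" and "y = m + t *\<^sub>R z"
  have yx: "y - x = (2 * t) *\<^sub>R z" by (simp add: x_def y_def scaleR_2[symmetric])
  have nyx: "norm (y - x) = 2 * T" using t0 by (simp add: yx T_def)
  have "x \<noteq> y" using nyx T(1) by auto
  then have xy: "x \<in> Om" "y \<in> Om" "x \<noteq> y" using inO[OF t0(2)] inO'[OF t0(2)] unfolding x_def y_def by blast+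
  have "2 * q' T <= (gV y - gV x) \<bullet> ((1 / (2 * T)) *\<^sub>R ((2 * t) *\<^sub>R z))" using mod[OF xy] unfolding nyx unfolding yx by simp
  also have "\<dots> = ((gV y - gV x) \<bullet> z) / norm z" using t0 z(3) by (simp add: T_def)
  finally have "2 * q' T * norm z <= (gV y - gV x) \<bullet> z" using z(3) by (simp add: pos_le_divide_eq)
  then have "0 <= (gV y \<bullet> z + gV x \<bullet> (- z)) - 2 * (q' T * norm z)" by (simp add: inner_diff_left)
  moreover have "(k has_real_derivative (gV y \<bullet> z + gV x \<bullet> (- z)) - 2 * (q' T * norm z)) (at t)"
   unfolding k_def x_def y_def by (rule DERIV_diff[OF dk0[OF t0(2)] DERIV_cmult[OF dq]])
  ultimately show "\<exists>d. (k has_real_derivative d) (at t) \<and> d >= 0" by blast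
 next
  have "continuous_on {s..1} (\<lambda>t. V (m + t *\<^sub>R z) + V (m + t *\<^sub>R (- z)))"
  proof (rule continuous_at_imp_continuous_on, rule ballI)
   fix t assume "t \<in> {s..1}"
   then have "\<bar>t\<bar> <= 1" using z(4) by auto
   then show "isCont (\<lambda>t. V (m + t *\<^sub>R z) + V (m + t *\<^sub>R (- z))) t" by (rule DERIV_isCont[OF dk0])
  qed
  moreover have "continuous_on {s..1} (\<lambda>t. q (t * norm z))"
   by (rule continuous_on_compose2[OF q(1)]) (auto intro!: continuous_intros)
  ultimately show "continuous_on {s..1} k" unfolding k_def by (intro continuous_on_diff continuous_on_mult continuous_on_const)
 qed
 then show ?thesis by (simp add: k_def)
qed

theorem mainTheorem2:
  fixes \<Omega> :: "'a::euclidean_space set"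
    and V :: "'a \<Rightarrow> real"
    and Vt Vt' :: "real \<Rightarrow> real"
    and d l1 l2 lt1 lt2 :: real
  assumes dom: "smooth_uniformly_convex_domain \<Omega>"
    and d_def: "d = diameter \<Omega>"
    and V_smooth: "smooth_on_closed (closure \<Omega>) V"
    and V_convex: "convex_on (closure \<Omega>) V"
    and Vt_deriv: "\<forall>t\<in>{-d/2..d/2}. (Vt has_real_derivative Vt' t) (at t within {-d/2..d/2})"
    and Vt'_cont: "continuous_on {-d/2..d/2} Vt'"
    and Vt_even: "\<forall>t\<in>{-d/2..d/2}. Vt (-t) = Vt t"
    and modulus: "\<forall>x\<in>\<Omega>. \<forall>y\<in>\<Omega>. x \<noteq> y \<longrightarrow>
        (grad V y - grad V x) \<bullet> ((1 / norm (y - x)) *\<^sub>R (y - x)) \<ge> 2 * Vt' (norm (y - x) / 2)"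
    and eig: "first_two_dirichlet_eigenvalues \<Omega> V l1 l2"
    and eig1d: "first_two_dirichlet_eigenvalues {-d/2<..<d/2} Vt lt1 lt2"
  shows "l2 - l1 \<ge> lt2 - lt1"
proof -
 obtain rho gr Hr U where sc: "smooth_convex_domain \<Omega> rho gr Hr U" by (rule smooth_convex_domain_of_def[OF dom]) (rule that)
 interpret smooth_convex_domain \<Omega> rho gr Hr U by (rule sc)
 obtain M where sd: "schroedinger_domain \<Omega> V (grad V) M"
  by (rule schroedinger_domain_of_smooth[OF open_Om convex_Om bounded_Om Om_ne V_smooth]) (rule that)
 interpret S: schroedinger_domain \<Omega> V "grad V" M by (rule sd)
 define D where "D = d / 2"
 have dD: "- d / 2 = - D" "d / 2 = D" by (simp_all add: D_def)
 have diam: "norm (y - x) < 2 * D" if "x \<in> \<Omega>" "y \<in> \<Omega>" for x y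
  using open_norm_less_diameter[OF open_Om bounded_Om that] by (simp add: D_def d_def)
 obtain p where "p \<in> \<Omega>" using Om_ne by blast
 then have D0: "D > 0" using diam[of p p] by simp
 have Vt_cont: "continuous_on {-D..D} Vt"
  using Vt_deriv unfolding dD by (auto intro!: DERIV_continuous_on)
 \<comment> \<open>Constant continuation beyond the ends keeps \<open>q\<close> continuous and even
   on the whole line, as the initial value problems require.\<close>
 define q where "q = (\<lambda>s. Vt (max (- D) (min D s)))"
 have q_in: "q s = Vt s" if "\<bar>s\<bar> <= D" for s
 proof -
  have "s <= D" "- D <= s" using that by auto
  then show ?thesis by (simp add: q_def)
 qed
 have q_cont: "continuous_on UNIV q"
  unfolding q_def by (rule continuous_on_compose2[OF Vt_cont]) (use D0 in \<open>auto intro!: continuous_intros\<close>)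
 have q_even: "q (- s) = q s" for s
 proof -
  have "max (- D) (min D (- s)) = - max (- D) (min D s)" using D0 by (simp add: max_def min_def)
  moreover have "max (- D) (min D s) \<in> {- D..D}" using D0 by simp
  ultimately show ?thesis using Vt_even unfolding dD q_def by simp
 qed
 interpret E: even_potential q D by unfold_locales (rule q_cont q_even D0)+
 have q_deriv: "(q has_real_derivative Vt' s) (at s)" if s: "0 < s" "s < D" for s
 proof -
  have "(Vt has_real_derivative Vt' s) (at s within {- D..D})" using Vt_deriv s unfolding dD by auto
  moreover have "at s within {- D..D} = at s" by (rule at_within_interior) (use s in \<open>simp add: interior_atLeastAtMost_real\<close>)
  ultimately have "(Vt has_real_derivative Vt' s) (at s)" by simp
  then show ?thesis
   by (rule has_field_derivative_transform_within_open[of _ _ _ "{- D<..<D}"]) (use s in \<open>auto simp: q_in\<close>)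
 qed
 have modV: "2 * (q (norm z) - q (s * norm z)) <= V (m + z) + V (m - z) - V (m + s *\<^sub>R z) - V (m - s *\<^sub>R z)"
  if "m + z \<in> \<Omega>" "m - z \<in> \<Omega>" "z \<noteq> 0" "0 <= s" "s < 1" for m z s
  by (rule potential_modulus_integrated[OF convex_Om S.V_deriv q_cont q_deriv diam _ that]) (use modulus in auto)
 have convV: "convex_on \<Omega> V" by (rule convex_on_subset[OF V_convex closure_subset convex_Om])
 obtain R where R: "\<And>x. x \<in> \<Omega> ==> norm x <= R" using bounded_Om unfolding bounded_iff by blast
 have l12: "l1 < l2" using eig by (simp add: first_two_dirichlet_eigenvalues_def)
 show ?thesis
 proof (rule field_le_epsilon)
  fix e :: real assume e: "e > 0"
  have eig1: "first_two_dirichlet_eigenvalues {- D<..<D} Vt lt1 lt2" using eig1d unfolding dD .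
  have Vq: "Vt s = q s" if "\<bar>s\<bar> < D" for s using q_in[of s] that by simp
  obtain m n L L1 L2 w w1 w2 w0 wM where c: "n - m >= lt2 - lt1 - e / 2"
   "\<And>s. \<bar>s\<bar> <= D ==> (L has_real_derivative L1 s) (at s)" "\<And>s. \<bar>s\<bar> <= D ==> (L1 has_real_derivative L2 s) (at s)"
   "\<And>s. L (- s) = L s" "\<And>s. L2 s + (L1 s)\<^sup>2 = q s - m"
   "\<And>s. \<bar>s\<bar> <= D ==> (w has_real_derivative w1 s) (at s)" "\<And>s. \<bar>s\<bar> <= D ==> (w1 has_real_derivative w2 s) (at s)"
   "\<And>s. 0 <= s ==> s < D ==> w1 s >= 0" "\<And>s. 0 <= s ==> s < D ==> w2 s + 2 * L1 s * w1 s <= - (n - m) * w s"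
   "\<And>s. 0 <= s ==> s < D ==> w0 <= w s" "\<And>s. 0 <= s ==> s < D ==> w s <= wM" "w0 > 0"
   by (rule E.comparison_functions[OF eig1 Vq half_gt_zero[OF e]]) (assumption | rule that)+
  define A where "A = 2 * R\<^sup>2 * \<bar>wM\<bar> / w0"
  have A: "A >= 0" using c(12) by (simp add: A_def)
  \<comment> \<open>The first entry keeps \<open>dl * R^2\<close> below \<open>l2 - l1\<close>; the
    second makes the perturbation error at most \<open>e / 2\<close>, the other half of
    \<open>e\<close> being spent in the one-dimensional problem.\<close>
  define dl where "dl = min ((l2 - l1) / (2 * (R\<^sup>2 + 1))) (e / (2 * (A + 1)))"
  have half: "a / (2 * b) * b = a / 2" if "b > 0" for a b :: real using that by simp
  have R1: "R\<^sup>2 + 1 > 0" using zero_le_power2[of R] by linarith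
  have dl0: "dl > 0" using l12 e A R1 by (simp add: dl_def)
  have "dl * R\<^sup>2 < dl * (R\<^sup>2 + 1)" using dl0 by simp
  also have "\<dots> <= (l2 - l1) / (2 * (R\<^sup>2 + 1)) * (R\<^sup>2 + 1)" using R1 by (intro mult_right_mono) (auto simp: dl_def)
  also have "\<dots> = (l2 - l1) / 2" by (rule half[OF R1])
  finally have dl1: "dl * R\<^sup>2 < l2 - l1" using l12 by simp
  have "dl * A <= dl * (A + 1)" using dl0 by simp
  also have "\<dots> <= e / (2 * (A + 1)) * (A + 1)" using A by (intro mult_right_mono) (auto simp: dl_def)
  also have "\<dots> = e / 2" by (rule half) (use A in simp)
  finally have dl2: "dl * A <= e / 2" .
  have "n - m <= l2 - l1 + 2 * (dl * R\<^sup>2) * wM / w0"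
   by (rule gap_perturbed[OF sc sd convV R eig c(2-12) diam modV dl0 dl1])
  moreover have "2 * (dl * R\<^sup>2) * wM / w0 <= dl * A"
  proof -
   have "2 * (dl * R\<^sup>2) * wM / w0 <= 2 * (dl * R\<^sup>2) * \<bar>wM\<bar> / w0" using dl0 c(12) by (intro divide_right_mono mult_left_mono) auto
   then show ?thesis by (simp add: A_def mult_ac)
  qed
  ultimately show "lt2 - lt1 <= l2 - l1 + e" using c(1) dl2 by linarith
 qed
qed

end
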